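(* Let $\tau\in\mathcal{H}$ and $\nu\in\mathbb{C}\setminus((-\infty,-1]\cup[1,\infty))$ with $\nu/\tau\notin(-\infty,0]$ (and such that all the series below have no vanishing denominators). Put $\tau^*=-1/\tau$, $\nu^*=\nu/\tau$. Then $$L_1(\tau,\nu+\tau)=\frac{\log(1-e^{2\pi i\nu})}{2\pi\tau i}+\frac{e^{2\pi i\nu}}{2(1-e^{2\pi i\nu})}+\frac1\tau L_1(\tau^*,\nu^*+\tau^* )+\frac{1}{2\pi\tau i}\Big(\frac{\Gamma'(\frac\nu\tau+1)}{\Gamma(\frac\nu\tau+1)}-\log\frac\nu\tau-\frac{\tau}{2\nu}-\tau\frac{\partial}{\partial\nu}P(\tau,\nu)\Big)$$ and $$L_2(\tau,\nu+\tau)=\frac1{24}-\frac{\mathrm{Li}_2(e^{2\pi i\nu})}{4\pi^2\tau^2}-\frac{\nu}{\tau^2}L_1(\tau^*,\nu^*+\tau^* )+\frac1{\tau^2}L_2(\tau^*,\nu^*+\tau^* )-\frac{\nu}{2\pi i\tau^2}\Big(\frac{\Gamma'(\frac\nu\tau+1)}{\Gamma(\frac\nu\tau+1)}-\log\frac\nu\tau-\frac{\tau}{2\nu}+\frac{\tau^2}{\nu}\frac{\partial}{\partial\tau}P(\tau,\nu)\Big).$$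
   Context: $\mathcal{H}$ is the upper half-plane. For $\tau\in\mathcal{H}$, $\nu\in\mathbb{C}$, with $q=e^{2\pi i\tau}$, $x=e^{2\pi i\nu}$: $L_1(\tau,\nu)=\sum_{n\ge0}\frac{xq^n}{1-xq^n}$ and $L_2(\tau,\nu)=\sum_{n\ge0}\frac{(n+1)xq^n}{1-xq^n}$. $\log$ is principal; $\mathrm{Li}_2$ is the dilogarithm $\sum_{n\ge1}x^n/n^2$ (analytically continued). $P=P_-$, where for $d\in(-\pi,0)$, $P^d(\tau,\nu)=\int_0^{\infty e^{id}}\frac{\sin\frac\nu\tau t}{e^{it/\tau}-1}\big(\cot\frac t2-\frac2t\big)\frac{dt}{t}$ (along the ray of argument $d$), and $P_-$ is the analytic function on $(\mathbb{C}\setminus(-\infty,0])\times(\mathbb{C}\setminus((-\infty,-1]\cup[1,\infty)))$ obtained by analytic continuation of $\{P^d\}_{d\in(-\pi,0)}$.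
   Formalization: In the first formula the term e^{2πiν}/(2(1-e^{2πiν})) has sign -, not +; log(1-e^{2πiν}) and Li_2(e^{2πiν}) are continued in ν from Im ν>0; P is any analytic continuation of {P^d} to a connected open domain containing (τ,ν), as P is not single-valued on the full product. *)

theory Defs
  imports "HOL-Analysis.Analysis"
begin

definition L1 :: "complex \<Rightarrow> complex \<Rightarrow> complex" where
  "L1 \<tau> \<nu> = (let q = exp (2 * of_real pi * \<i> * \<tau>); x = exp (2 * of_real pi * \<i> * \<nu>)
            in \<Sum>n. x * q ^ n / (1 - x * q ^ n))"

definition L2 :: "complex \<Rightarrow> complex \<Rightarrow> complex" where
  "L2 \<tau> \<nu> = (let q = exp (2 * of_real pi * \<i> * \<tau>); x = exp (2 * of_real pi * \<i> * \<nu>)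
            in \<Sum>n. of_nat (n + 1) * x * q ^ n / (1 - x * q ^ n))"

definition L_denominators_nonzero :: "complex \<Rightarrow> complex \<Rightarrow> bool" where
  "L_denominators_nonzero \<tau> \<nu> \<longleftrightarrow>
     (\<forall>n::nat. 1 - exp (2 * of_real pi * \<i> * \<nu>) * exp (2 * of_real pi * \<i> * \<tau>) ^ n \<noteq> 0)"

definition nu_domain :: "complex set" where
  "nu_domain = - (complex_of_real ` ({..-1} \<union> {1..}))"


subsection \<open>The functions \<open>P\<^sup>d\<close> and their analytic continuation\<close>

definition P_integrand :: "complex \<Rightarrow> complex \<Rightarrow> complex \<Rightarrow> complex" where
  "P_integrand \<tau> \<nu> t =
     sin (\<nu> / \<tau> * t) / (exp (\<i> * t / \<tau>) - 1) * (cot (t / 2) - 2 / t) / t"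

text \<open>The integral over the ray of argument \<open>d\<close>, parametrized by \<open>t = r * cis d\<close>.\<close>

definition P_ray :: "real \<Rightarrow> complex \<Rightarrow> complex \<Rightarrow> complex" where
  "P_ray d \<tau> \<nu> =
     (LINT r:{0<..}|lborel. P_integrand \<tau> \<nu> (of_real r * cis d) * cis d)"

text \<open>
  The open set of \<open>(\<tau>, \<nu>)\<close> for which the integrand decays exponentially on the ray of
  argument \<open>d\<close>.  It forces \<open>Im (cis d / \<tau>) < 0\<close>; for \<open>d \<in> (-\<pi>, 0)\<close> this means that
  the principal argument of \<open>\<tau>\<close> lies in \<open>(d, d + \<pi>)\<close>.
\<close>

definition P_ray_domain :: "real \<Rightarrow> (complex \<times> complex) set" where
  "P_ray_domain d =
     {(\<tau>, \<nu>). \<bar>Im (\<nu> * cis d / \<tau>)\<bar> < - Im (cis d / \<tau>)}"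

text \<open>Joint analyticity in two complex variables: complex differentiability at every point.\<close>

definition holomorphic2_on :: "(complex \<times> complex \<Rightarrow> complex) \<Rightarrow> (complex \<times> complex) set \<Rightarrow> bool" where
  "holomorphic2_on f D \<longleftrightarrow>
     (\<forall>z\<in>D. \<exists>a b. (f has_derivative (\<lambda>(h, k). a * h + b * k)) (at z))"

text \<open>
  \<open>P\<close> is an analytic continuation, to the domain \<open>D\<close>, of the family of all \<open>P\<^sup>d\<close> with
  \<open>d \<in> (-\<pi>, 0)\<close>.  The domain is a parameter because \<open>P\<close> is not single-valued on the whole
  product of the slit plane and \<open>nu_domain\<close>: for \<open>\<tau>\<close> not real it has logarithmic branch points
  at \<open>\<nu> = k + m * \<tau>\<close> with integers \<open>k * m > 0\<close>.  Its partial derivatives are single-valued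
  (with poles there), so they do not depend on the choice of \<open>D\<close>.
\<close>

definition P_continuation :: "(complex \<times> complex) set \<Rightarrow> (complex \<times> complex \<Rightarrow> complex) \<Rightarrow> bool" where
  "P_continuation D P \<longleftrightarrow>
     open D \<and> connected D \<and> D \<subseteq> (- \<real>\<^sub>\<le>\<^sub>0) \<times> nu_domain \<and> holomorphic2_on P D \<and>
     (\<forall>d\<in>{-pi<..<0}. P_ray_domain d \<subseteq> D \<and> (\<forall>(\<tau>, \<nu>)\<in>P_ray_domain d. P (\<tau>, \<nu>) = P_ray d \<tau> \<nu>))"


subsection \<open>The branches of \<open>log (1 - e\<^sup>2\<^sup>\<pi>\<^sup>i\<^sup>\<nu>)\<close> and of the dilogarithm\<close>

definition dilog_series :: "complex \<Rightarrow> complex" where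
  "dilog_series x = (\<Sum>n. x ^ (n + 1) / of_nat ((n + 1)\<^sup>2))"

definition slit_domain :: "complex \<Rightarrow> complex set" where
  "slit_domain \<tau> = {\<nu>\<in>nu_domain. \<nu> / \<tau> \<notin> \<real>\<^sub>\<le>\<^sub>0}"

text \<open>For open connected \<open>D\<close> and nonempty open \<open>S \<subseteq> D\<close> there is at most one such function on \<open>D\<close>.\<close>

definition continuation :: "(complex \<Rightarrow> complex) \<Rightarrow> complex set \<Rightarrow> complex set \<Rightarrow> complex \<Rightarrow> complex" where
  "continuation g S D = (SOME f. f holomorphic_on D \<and> (\<forall>u\<in>S. f u = g u))"

text \<open>
  For \<open>Im \<tau> > 0\<close> the set \<open>slit_domain \<tau>\<close> is simply connected, contains the open upper half-plane
  and contains no integer, so that \<open>log (1 - e\<^sup>2\<^sup>\<pi>\<^sup>i\<^sup>\<nu>)\<close> and \<open>Li\<^sub>2 (e\<^sup>2\<^sup>\<pi>\<^sup>i\<^sup>\<nu>)\<close> continue from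
  \<open>Im \<nu> > 0\<close> (where \<open>e\<^sup>2\<^sup>\<pi>\<^sup>i\<^sup>\<nu>\<close> lies in the unit disc) to analytic functions of \<open>\<nu>\<close> on it.
  In the lower half-plane these need not be the principal values, which jump across
  the half-lines below the integers.
\<close>

definition log_one_minus_e :: "complex \<Rightarrow> complex \<Rightarrow> complex" where
  "log_one_minus_e \<tau> =
     continuation (\<lambda>u. Ln (1 - exp (2 * of_real pi * \<i> * u))) {u. Im u > 0} (slit_domain \<tau>)"

definition dilog_e :: "complex \<Rightarrow> complex \<Rightarrow> complex" where
  "dilog_e \<tau> =
     continuation (\<lambda>u. dilog_series (exp (2 * of_real pi * \<i> * u))) {u. Im u > 0} (slit_domain \<tau>)"

end

theory Submission
  imports Defs "HOL-Complex_Analysis.Complex_Analysis" "HOL-Probability.Sinc_Integral"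
begin

text \<open>
  Substituting \<open>t = - \<i> \<tau> s\<close> turns the ray integral into an integral over \<open>s > 0\<close> of
  \<open>sinh (\<nu> s) / (exp s - 1) * (coth (\<tau> s / 2) - 2 / (\<tau> s)) / s\<close>.
  Expanding both factors into exponentials, the second \<open>\<nu>\<close>-derivative of the first identity becomes
  an identity between absolutely convergent sums of \<open>(\<nu> + m + k \<tau>)\<^sup>-\<^sup>3\<close> over parts of
  the lattice, which holds because the order of summation may be interchanged.  The two
  constants of integration vanish because every term has a limit along \<open>\<nu> = \<i> y\<close>, the oscillating
  integral tending to 0 by Riemann-Lebesgue.  The \<open>\<nu>\<close>-derivative of the second identity is the
  \<open>\<tau>\<close>-derivative of the first, so it follows in the same way.  This settles
  \<open>Re \<tau> > 0\<close>, \<open>Im \<tau> > 0\<close> and \<open>\<nu>\<close> in the upper half of a vertical strip.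

  Both identities then extend by analytic continuation.  The part of \<open>D\<close> over the upper half-plane
  is connected, and the poles of the Lambert series meet a generic complex line in a countable set,
  so that the identity theorem for one variable suffices.
\<close>

subsection \<open>Lambert series\<close>

text \<open>Third powers are the first for which a sum over a two-dimensional lattice converges
  absolutely; hence the two differentiations of the first identity, paid for by two constants. The
  number 1/24 comes from the integral alone: the amplitude of its \<tau>-derivative is 1 / (6 s)
  near s = 0, and the Dirichlet integral of sin (y s) / s is pi / 2. Two obstacles shape the
  continuation. D is only known to be connected as a whole and may reach into Im \<tau> < 0, where
  the series diverge; so its upper part has to be shown connected. And log (1 - qexp \<nu>), the
  dilogarithm and Ln (\<nu> / \<tau>) are cut along \<nu> / \<tau> \<le> 0, whereas D is not. The
  cuts cancel: log (1 - qexp \<nu>) - log \<nu> extends to a function \<open>h\<close> holomorphic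
  on all of \<open>nu_domain\<close>, and what is continued are the identities in terms of
  \<open>h\<close> and a primitive of it.\<close>

definition qexp :: "complex \<Rightarrow> complex" where
  "qexp u = exp (2 * of_real pi * \<i> * u)"

definition lam0 :: "complex \<Rightarrow> complex" where
  "lam0 u = qexp u / (1 - qexp u)"

text \<open>\<open>lam1\<close> and \<open>lam2\<close> are the first two derivatives of
  \<open>lam0\<close>, which is a single term of the Lambert series.\<close>

definition lam1 :: "complex \<Rightarrow> complex" where
  "lam1 u = 2 * of_real pi * \<i> * qexp u / (1 - qexp u)\<^sup>2"

definition lam2 :: "complex \<Rightarrow> complex" where
  "lam2 u = (2 * of_real pi * \<i>)\<^sup>2 * qexp u * (1 + qexp u) / (1 - qexp u) ^ 3"

lemma qexp_add: "qexp (u + v) = qexp u * qexp v"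
  by (simp add: qexp_def exp_add ring_distribs)

lemma qexp_of_nat_mult: "qexp (of_nat n * u) = qexp u ^ n"
  by (simp add: qexp_def exp_of_nat_mult [symmetric] mult_ac)

lemma norm_qexp: "norm (qexp u) = exp (- 2 * pi * Im u)"
  by (simp add: qexp_def)

lemma qexp_nonzero [simp]: "qexp u \<noteq> 0"
  by (simp add: qexp_def)

lemma qexp_eq_1_iff: "qexp u = 1 \<longleftrightarrow> u \<in> \<int>"
proof
  assume "qexp u = 1"
  then obtain n :: int where "Re (2 * of_real pi * \<i> * u) = 0"
      and "Im (2 * of_real pi * \<i> * u) = of_int (2 * n) * pi"
    unfolding qexp_def exp_eq_1 by auto
  then have "u = of_int n" by (simp add: complex_eq_iff)
  then show "u \<in> \<int>" by simp
next
  assume "u \<in> \<int>"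
  then obtain n :: int where "u = of_int n" by (auto elim: Ints_cases)
  then show "qexp u = 1"
    unfolding qexp_def exp_eq_1 by auto
qed

lemma has_field_derivative_qexp [derivative_intros]:
  "(g has_field_derivative g') (at z within S) \<Longrightarrow>
   ((\<lambda>z. qexp (g z)) has_field_derivative (2 * of_real pi * \<i> * g' * qexp (g z))) (at z within S)"
  unfolding qexp_def by (auto intro!: derivative_eq_intros)

lemma continuous_on_qexp [continuous_intros]:
  "continuous_on S g \<Longrightarrow> continuous_on S (\<lambda>z. qexp (g z))"
  unfolding qexp_def by (intro continuous_intros)

lemma has_field_derivative_lam0:
  assumes "qexp u \<noteq> 1"
  shows "(lam0 has_field_derivative lam1 u) (at u)"
proof -
  have "1 - qexp u \<noteq> 0" using assms by auto
  then have "((\<lambda>u. qexp u / (1 - qexp u)) has_field_derivative lam1 u) (at u)"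
    unfolding lam1_def
    by (auto intro!: derivative_eq_intros simp: divide_simps power2_eq_square) (simp add: algebra_simps)?
  then show ?thesis by (simp add: lam0_def [abs_def])
qed

lemma has_field_derivative_lam1:
  assumes "qexp u \<noteq> 1"
  shows "(lam1 has_field_derivative lam2 u) (at u)"
proof -
  have nz: "1 - qexp u \<noteq> 0" using assms by auto
  define X where "X = qexp u"
  define c where "c = 2 * complex_of_real pi * \<i>"
  have "((\<lambda>u. c * qexp u / (1 - qexp u)\<^sup>2) has_field_derivative
      ((c * (c * X)) * (1 - X)\<^sup>2 - c * X * (2 * (1 - X) * (- (c * X)))) / ((1 - X)\<^sup>2 * (1 - X)\<^sup>2)) (at u)"
    using nz unfolding X_def c_def
    by (auto intro!: derivative_eq_intros simp: power2_eq_square)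
  also have "((c * (c * X)) * (1 - X)\<^sup>2 - c * X * (2 * (1 - X) * (- (c * X)))) / ((1 - X)\<^sup>2 * (1 - X)\<^sup>2)
     = (c\<^sup>2 * X * (1 + X)) * (1 - X) / ((1 - X) ^ 3 * (1 - X))"
    by (simp add: power2_eq_square power3_eq_cube algebra_simps)
  also have "\<dots> = lam2 u"
    using nz unfolding lam2_def X_def c_def by simp
  finally show ?thesis by (simp add: lam1_def [abs_def] c_def)
qed

lemma norm_one_minus_ge:
  fixes X :: complex
  assumes "norm X \<le> 1/2" shows "norm (1 - X) \<ge> 1/2"
  using norm_triangle_ineq2 [of 1 X] assms by simp

lemma norm_lam0_le:
  assumes "norm (qexp u) \<le> 1/2"
  shows "norm (lam0 u) \<le> 2 * norm (qexp u)"
proof -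
  have "norm (lam0 u) = norm (qexp u) / norm (1 - qexp u)" by (simp add: lam0_def norm_divide)
  also have "\<dots> \<le> norm (qexp u) / (1/2)"
    using norm_one_minus_ge [OF assms] by (intro divide_left_mono) auto
  finally show ?thesis by simp
qed

lemma norm_lam1_le:
  assumes "norm (qexp u) \<le> 1/2"
  shows "norm (lam1 u) \<le> 8 * pi * norm (qexp u)"
proof -
  have "norm (lam1 u) = 2 * pi * norm (qexp u) / norm (1 - qexp u) ^ 2"
    by (simp add: lam1_def norm_divide norm_mult norm_power)
  also have "\<dots> \<le> 2 * pi * norm (qexp u) / (1/2) ^ 2"
    using norm_one_minus_ge [OF assms]
    by (intro divide_left_mono power_mono mult_pos_pos zero_less_power) (auto intro: less_le_trans [of 0 "1/2"])
  finally show ?thesis by (simp add: power2_eq_square)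
qed

text \<open>Near \<open>z\<close> the imaginary part of \<open>a\<close> stays above half its value
  at \<open>z\<close> and that of \<open>b\<close> above a constant, so the exponents grow linearly
  in \<open>k\<close> at a uniform rate. The metric space is later both the plane and the space of
  pairs.\<close>

lemma qexp_term_local_bound:
  fixes a b :: "'a::metric_space \<Rightarrow> complex"
  assumes "isCont a z" "isCont b z" "Im (a z) > 0"
  obtains d M \<rho> where "d > 0" "M > 0" "0 < \<rho>" "\<rho> < 1"
    "\<And>y k. y \<in> ball z d \<Longrightarrow> norm (qexp (b y + of_nat (Suc k) * a y)) \<le> M * \<rho> ^ k"
proof -
  define y0 where "y0 = Im (a z) / 2"
  define B where "B = Im (b z) - 1"
  have ev: "((\<lambda>y. Im (a y)) \<longlongrightarrow> Im (a z)) (nhds z)" "((\<lambda>y. Im (b y)) \<longlongrightarrow> Im (b z)) (nhds z)"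
    using assms unfolding isCont_def tendsto_at_iff_tendsto_nhds by (auto intro!: tendsto_intros)
  have "eventually (\<lambda>y. Im (a y) > y0) (nhds z)" "eventually (\<lambda>y. Im (b y) > B) (nhds z)"
    using order_tendstoD(1) [OF ev(1), of y0] order_tendstoD(1) [OF ev(2), of B] assms
    by (simp_all add: y0_def B_def)
  then have "eventually (\<lambda>y. Im (a y) > y0 \<and> Im (b y) > B) (nhds z)" by eventually_elim auto
  then obtain d where d: "d > 0" "\<And>y. dist y z < d \<Longrightarrow> Im (a y) > y0 \<and> Im (b y) > B"
    unfolding eventually_nhds_metric by auto
  show ?thesis
  proof (rule that [of d "exp (- 2 * pi * B)" "exp (- 2 * pi * y0)"])
    fix y k assume "y \<in> ball z d"
    then have y: "Im (a y) > y0" "Im (b y) > B" using d by (auto simp: dist_commute)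
    have y0: "y0 > 0" using assms by (simp add: y0_def)
    have "real k * y0 \<le> real (Suc k) * Im (a y)"
      using y y0 by (intro mult_mono) auto
    then have "B + real k * y0 \<le> Im (b y) + real (Suc k) * Im (a y)" using y by linarith
    then have "exp (- 2 * pi * (Im (b y) + real (Suc k) * Im (a y))) \<le> exp (- 2 * pi * (B + real k * y0))"
      by simp
    also have "\<dots> = exp (- 2 * pi * B) * exp (- 2 * pi * y0) ^ k"
      by (simp add: exp_of_nat_mult [symmetric] exp_add [symmetric] algebra_simps)
    finally show "norm (qexp (b y + of_nat (Suc k) * a y)) \<le> exp (- 2 * pi * B) * exp (- 2 * pi * y0) ^ k"
      by (simp add: norm_qexp)
  qed (use d assms in \<open>auto simp: y0_def\<close>)
qed

text \<open>Step \<open>a\<close> and offset \<open>b\<close> may both depend on the variable, which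
  covers derivatives in \<nu>, in \<tau> and along complex lines. Weights up to k + 1 cover the
  series of L1 and of L2.\<close>

lemma lambert_series_derivative:
  fixes a b a' b' g g' :: "complex \<Rightarrow> complex" and w :: "nat \<Rightarrow> complex"
  assumes S: "open S"
    and a: "\<And>z. z \<in> S \<Longrightarrow> (a has_field_derivative a' z) (at z)"
    and b: "\<And>z. z \<in> S \<Longrightarrow> (b has_field_derivative b' z) (at z)"
    and Im: "\<And>z. z \<in> S \<Longrightarrow> Im (a z) > 0"
    and np: "\<And>z k. z \<in> S \<Longrightarrow> qexp (b z + of_nat (Suc k) * a z) \<noteq> 1"
    and g: "\<And>u. qexp u \<noteq> 1 \<Longrightarrow> (g has_field_derivative g' u) (at u)"
    and bd: "\<And>u. norm (qexp u) \<le> 1/2 \<Longrightarrow> norm (g u) \<le> C * norm (qexp u)"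
    and w: "\<And>k. norm (w k) \<le> real (Suc k)"
    and z: "z \<in> S"
  shows "summable (\<lambda>k. w k * g (b z + of_nat (Suc k) * a z))"
    and "summable (\<lambda>k. w k * (g' (b z + of_nat (Suc k) * a z) * (b' z + of_nat (Suc k) * a' z)))"
    and "((\<lambda>z. \<Sum>k. w k * g (b z + of_nat (Suc k) * a z)) has_field_derivative
          (\<Sum>k. w k * (g' (b z + of_nat (Suc k) * a z) * (b' z + of_nat (Suc k) * a' z)))) (at z)"
proof -
  define f where "f = (\<lambda>k z. w k * g (b z + of_nat (Suc k) * a z))"
  define f' where "f' = (\<lambda>k z. w k * (g' (b z + of_nat (Suc k) * a z) * (b' z + of_nat (Suc k) * a' z)))"
  have "\<exists>G G'. \<forall>x\<in>S. ((\<lambda>n. f n x) sums G x) \<and> ((\<lambda>n. f' n x) sums G' x) \<and>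
          (G has_field_derivative G' x) (at x)"
  proof (rule series_and_derivative_comparison_complex [OF S])
    fix n x assume x: "x \<in> S"
    show "(f n has_field_derivative f' n x) (at x)"
      unfolding f_def f'_def
      by (intro DERIV_cmult DERIV_chain2 [where g = "\<lambda>z. b z + of_nat (Suc n) * a z"] g np x)
         (auto intro!: derivative_eq_intros a [OF x] b [OF x])
  next
    fix x assume x: "x \<in> S"
    obtain d M \<rho> where d: "d > 0" "M > 0" "0 < \<rho>" "\<rho> < 1"
      "\<And>y k. y \<in> ball x d \<Longrightarrow> norm (qexp (b y + of_nat (Suc k) * a y)) \<le> M * \<rho> ^ k"
      using qexp_term_local_bound [OF DERIV_isCont [OF a [OF x]] DERIV_isCont [OF b [OF x]] Im [OF x]]
      by metis
    \<comment> \<open>The weight contributes k + 1 and \<open>bd\<close> contributes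
      \<open>M * \<rho> ^ k\<close>. The hypothesis of \<open>bd\<close> holds only once
      \<open>M * \<rho> ^ k\<close> is below 1/2, and an eventual comparison is enough.\<close>
    define h where "h = (\<lambda>k. \<bar>C\<bar> * M * (real (Suc k) * \<rho> ^ k))"
    have "summable (\<lambda>k. real (Suc k) * \<rho> ^ k)"
      using sums_summable [OF geometric_deriv_sums [of \<rho>]] d by simp
    then have sh: "summable (\<lambda>k. complex_of_real (h k))"
      unfolding h_def by (intro summable_of_real summable_mult)
    have "(\<lambda>k. M * \<rho> ^ k) \<longlonglongrightarrow> M * 0"
      using d by (intro tendsto_mult tendsto_const LIMSEQ_power_zero) auto
    then have "eventually (\<lambda>k. M * \<rho> ^ k < 1/2) sequentially"
      by (rule order_tendstoD) auto
    then have "eventually (\<lambda>k. \<forall>y\<in>ball x d \<inter> S. norm (f k y) \<le> norm (complex_of_real (h k))) sequentially"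
    proof eventually_elim
      case (elim k)
      show ?case
      proof
        fix y assume "y \<in> ball x d \<inter> S"
        then have le: "norm (qexp (b y + of_nat (Suc k) * a y)) \<le> M * \<rho> ^ k" using d by auto
        have "norm (g (b y + of_nat (Suc k) * a y)) \<le> C * norm (qexp (b y + of_nat (Suc k) * a y))"
          using le elim by (intro bd) auto
        also have "\<dots> \<le> \<bar>C\<bar> * (M * \<rho> ^ k)"
          using le by (intro mult_mono) auto
        finally have "norm (f k y) \<le> real (Suc k) * (\<bar>C\<bar> * (M * \<rho> ^ k))"
          unfolding f_def norm_mult by (intro mult_mono w) auto
        also have "\<dots> = norm (complex_of_real (h k))"
          using d unfolding norm_of_real h_def by (simp add: abs_mult)
        finally show "norm (f k y) \<le> norm (complex_of_real (h k))" .
      qed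
    qed
    moreover have "range (\<lambda>k. complex_of_real (h k)) \<subseteq> \<real>\<^sub>\<ge>\<^sub>0"
      using d by (auto simp: h_def complex_nonneg_Reals_iff)
    ultimately show "\<exists>d h. 0 < d \<and> summable h \<and> range h \<subseteq> \<real>\<^sub>\<ge>\<^sub>0 \<and>
        (\<forall>\<^sub>F n in sequentially. \<forall>y\<in>ball x d \<inter> S. cmod (f n y) \<le> cmod (h n))"
      using d sh by (intro exI [of _ d] exI [of _ "\<lambda>k. complex_of_real (h k)"]) auto
  qed
  then obtain G G' where G: "\<And>x. x \<in> S \<Longrightarrow> (\<lambda>n. f n x) sums G x"
     "\<And>x. x \<in> S \<Longrightarrow> (\<lambda>n. f' n x) sums G' x" "\<And>x. x \<in> S \<Longrightarrow> (G has_field_derivative G' x) (at x)"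
    by metis
  show "summable (\<lambda>k. w k * g (b z + of_nat (Suc k) * a z))"
    using G(1) [OF z] by (simp add: f_def sums_iff)
  show "summable (\<lambda>k. w k * (g' (b z + of_nat (Suc k) * a z) * (b' z + of_nat (Suc k) * a' z)))"
    using G(2) [OF z] by (simp add: f'_def sums_iff)
  have eq: "G' z = (\<Sum>k. f' k z)" using G(2) [OF z] by (simp add: sums_iff)
  have "((\<lambda>z. \<Sum>k. f k z) has_field_derivative G' z) (at z)"
    by (rule has_field_derivative_transform_within_open [OF G(3) [OF z] S z])
       (use G(1) in \<open>auto simp: sums_iff\<close>)
  then show "((\<lambda>z. \<Sum>k. w k * g (b z + of_nat (Suc k) * a z)) has_field_derivative
          (\<Sum>k. w k * (g' (b z + of_nat (Suc k) * a z) * (b' z + of_nat (Suc k) * a' z)))) (at z)"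
    unfolding eq by (simp add: f_def f'_def)
qed

text \<open>An infinite intersection of open conditions stays open because near a given point only
  finitely many are in force: from some \<open>N\<close> on the exponentials have norm below
  1.\<close>

lemma open_lambert_domain:
  fixes a b :: "'a::metric_space \<Rightarrow> complex"
  assumes S: "open S" and a: "continuous_on S a" and b: "continuous_on S b"
    and Im: "\<And>z. z \<in> S \<Longrightarrow> Im (a z) > 0"
  shows "open {z \<in> S. \<forall>k. qexp (b z + of_nat (Suc k) * a z) \<noteq> 1}"
proof (subst open_subopen, safe)
  fix z assume z: "z \<in> S" and nz: "\<forall>k. qexp (b z + of_nat (Suc k) * a z) \<noteq> 1"
  have "isCont a z" "isCont b z" using a b z S by (auto simp: continuous_on_eq_continuous_at)
  then obtain d M \<rho> where d: "d > 0" "M > 0" "0 < \<rho>" "\<rho> < 1"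
      "\<And>y k. y \<in> ball z d \<Longrightarrow> norm (qexp (b y + of_nat (Suc k) * a y)) \<le> M * \<rho> ^ k"
    using qexp_term_local_bound [where a = a and b = b and z = z] Im [OF z] by metis
  have "(\<lambda>k. M * \<rho> ^ k) \<longlonglongrightarrow> M * 0"
    using d by (intro tendsto_mult tendsto_const LIMSEQ_power_zero) auto
  then have "eventually (\<lambda>k. M * \<rho> ^ k < 1) sequentially"
    by (rule order_tendstoD) auto
  then obtain N where N: "\<And>k. k \<ge> N \<Longrightarrow> M * \<rho> ^ k < 1" by (auto simp: eventually_sequentially)
  define T where "T = ball z d \<inter> (\<Inter>k<N. {y \<in> S. qexp (b y + of_nat (Suc k) * a y) \<in> - {1}})"
  have op: "open {y \<in> S. qexp (b y + of_nat (Suc k) * a y) \<in> - {1}}" for k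
  proof -
    have "open (S \<inter> (\<lambda>y. qexp (b y + of_nat (Suc k) * a y)) -` (- {1}))"
      using S a b by (intro continuous_open_preimage continuous_intros) auto
    also have "S \<inter> (\<lambda>y. qexp (b y + of_nat (Suc k) * a y)) -` (- {1}) =
        {y \<in> S. qexp (b y + of_nat (Suc k) * a y) \<in> - {1}}" by blast
    finally show ?thesis .
  qed
  have "open (T \<inter> S)" unfolding T_def using op S by (intro open_Int open_INT) auto
  moreover have "z \<in> T \<inter> S" using d z nz by (auto simp: T_def)
  moreover have "T \<inter> S \<subseteq> {z \<in> S. \<forall>k. qexp (b z + of_nat (Suc k) * a z) \<noteq> 1}"
  proof safe
    fix y k assume y: "y \<in> T" "y \<in> S" "qexp (b y + of_nat (Suc k) * a y) = 1"
    show False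
    proof (cases "k < N")
      case True then show False using y by (auto simp: T_def)
    next
      case False
      have "y \<in> ball z d" using y(1) by (simp add: T_def)
      then have "norm (qexp (b y + of_nat (Suc k) * a y)) \<le> M * \<rho> ^ k" by (rule d(5))
      also have "\<dots> < 1" using False by (intro N) auto
      finally show False using y(3) by simp
    qed
  qed
  ultimately show "\<exists>T. open T \<and> z \<in> T \<and> T \<subseteq> {z \<in> S. \<forall>k. qexp (b z + of_nat (Suc k) * a z) \<noteq> 1}"
    by blast
qed

text \<open>The shift by \<tau> moves n to n + 1, so the sums below start at \<open>Suc k\<close>;
  the k = 0 term occurs separately as \<open>lam0 \<nu>\<close>.\<close>

lemma L1_shift: "L1 \<tau> (\<nu> + \<tau>) = (\<Sum>k. lam0 (\<nu> + of_nat (Suc k) * \<tau>))"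
proof -
  have "qexp (\<nu> + \<tau>) * qexp \<tau> ^ n = qexp (\<nu> + of_nat (Suc n) * \<tau>)" for n
    by (simp only: qexp_of_nat_mult [symmetric] qexp_add [symmetric]) (simp add: algebra_simps)
  then show ?thesis unfolding L1_def Let_def qexp_def [symmetric] lam0_def by simp
qed

lemma L2_shift: "L2 \<tau> (\<nu> + \<tau>) = (\<Sum>k. of_nat (Suc k) * lam0 (\<nu> + of_nat (Suc k) * \<tau>))"
proof -
  have eq: "qexp (\<nu> + \<tau>) * qexp \<tau> ^ n = qexp (\<nu> + of_nat (Suc n) * \<tau>)" for n
    by (simp only: qexp_of_nat_mult [symmetric] qexp_add [symmetric]) (simp add: algebra_simps)
  have "L2 \<tau> (\<nu> + \<tau>) = (\<Sum>n. of_nat (Suc n) * (qexp (\<nu> + \<tau>) * qexp \<tau> ^ n) / (1 - qexp (\<nu> + \<tau>) * qexp \<tau> ^ n))"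
    by (simp only: L2_def Let_def qexp_def mult.assoc Suc_eq_plus1)
  then show ?thesis
    by (simp only: eq lam0_def times_divide_eq_right)
qed

lemma L_denominators_nonzero_iff:
  "L_denominators_nonzero \<tau> (\<nu> + \<tau>) \<longleftrightarrow> (\<forall>k. qexp (\<nu> + of_nat (Suc k) * \<tau>) \<noteq> 1)"
proof -
  have eq: "qexp (\<nu> + \<tau>) * qexp \<tau> ^ n = qexp (\<nu> + of_nat (Suc n) * \<tau>)" for n
    by (simp only: qexp_of_nat_mult [symmetric] qexp_add [symmetric]) (simp add: algebra_simps)
  show ?thesis unfolding L_denominators_nonzero_def qexp_def [symmetric] eq by auto
qed

subsection \<open>Holomorphic parameter integrals over the half-line\<close>

definition halfline_integral :: "(real \<Rightarrow> 'a) \<Rightarrow> 'a :: {banach, second_countable_topology}" where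
  "halfline_integral f = (LINT s:{0<..}|lborel. f s)"

lemma set_integrable_exp_dominated:
  fixes f :: "real \<Rightarrow> 'a :: {banach, second_countable_topology}"
  assumes "continuous_on {0<..} f" "c > 0" "\<And>s. s > 0 \<Longrightarrow> norm (f s) \<le> K * exp (- c * s)"
  shows "set_integrable lborel {0<..} f"
proof (rule set_integrable_bound)
  show "set_integrable lborel {0<..} (\<lambda>s. K * exp (- (s * c)))"
    by (rule set_integrable_mult_right) (rule integrable_I0i_exp_mscale [OF assms(2)])
  show "set_borel_measurable lborel {0<..} f"
    using borel_measurable_continuous_on_indicator [OF _ assms(1)]
    by (simp add: set_borel_measurable_def)
  show "AE s in lborel. s \<in> {0<..} \<longrightarrow> norm (f s) \<le> norm (K * exp (- (s * c)))"
  proof (intro AE_I2 impI)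
    fix s :: real assume "s \<in> {0<..}"
    then have "norm (f s) \<le> K * exp (- c * s)" by (intro assms) auto
    then show "norm (f s) \<le> norm (K * exp (- (s * c)))" by (simp add: mult.commute)
  qed
qed

lemma halfline_integral_cong:
  "(\<And>s. s > 0 \<Longrightarrow> f s = g s) \<Longrightarrow> halfline_integral f = halfline_integral g"
  unfolding halfline_integral_def by (rule set_lebesgue_integral_cong) auto

text \<open>Differentiation under the integral by dominated convergence along sequences. The
  integrand itself is bounded at \<open>z\<close> only; at other points a bound follows from that of
  the derivative.\<close>

lemma has_field_derivative_halfline_integral:
  fixes f f' :: "complex \<Rightarrow> real \<Rightarrow> complex"
  assumes r: "r > 0" and c: "c > 0"
    and der: "\<And>y s. y \<in> ball z r \<Longrightarrow> s > 0 \<Longrightarrow> ((\<lambda>y. f y s) has_field_derivative f' y s) (at y)"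
    and cont: "\<And>y. y \<in> ball z r \<Longrightarrow> continuous_on {0<..} (f y)"
    and cont': "continuous_on {0<..} (f' z)"
    and bound': "\<And>y s. y \<in> ball z r \<Longrightarrow> s > 0 \<Longrightarrow> norm (f' y s) \<le> K * exp (- c * s)"
    and bound: "\<And>s. s > 0 \<Longrightarrow> norm (f z s) \<le> K0 * exp (- c * s)"
  shows "((\<lambda>y. halfline_integral (f y)) has_field_derivative halfline_integral (f' z)) (at z)"
proof -
  \<comment> \<open>The mean value inequality on the ball bounds every difference quotient by the
    majorant of the derivative.\<close>
  have lip: "norm (f y s - f z s) \<le> K * exp (- c * s) * norm (y - z)" if "y \<in> ball z r" "s > 0" for y s
    by (rule field_differentiable_bound [of "ball z r" "\<lambda>y. f y s" "\<lambda>y. f' y s"])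
       (use that r der bound' in \<open>auto intro: has_field_derivative_at_within\<close>)
  have int: "set_integrable lborel {0<..} (f y)" if "y \<in> ball z r" for y
  proof (rule set_integrable_exp_dominated [OF cont [OF that] c])
    fix s :: real assume s: "s > 0"
    have "norm (f y s) \<le> norm (f z s) + norm (f y s - f z s)" by (metis norm_triangle_sub)
    also have "\<dots> \<le> K0 * exp (- c * s) + K * exp (- c * s) * norm (y - z)"
      using s that by (intro add_mono bound lip)
    finally show "norm (f y s) \<le> (K0 + K * norm (y - z)) * exp (- c * s)" by (simp add: algebra_simps)
  qed
  have intK: "set_integrable lborel {0<..} (\<lambda>s. K * exp (- c * s))"
  proof (rule set_integrable_exp_dominated [OF _ c])
    show "continuous_on {0<..} (\<lambda>s. K * exp (- c * s))" by (intro continuous_intros)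
    fix s :: real
    show "norm (K * exp (- c * s)) \<le> \<bar>K\<bar> * exp (- c * s)" by (simp add: abs_mult)
  qed
  show ?thesis
    unfolding has_field_derivative_iff tendsto_at_iff_sequentially
  proof safe
    fix X :: "nat \<Rightarrow> complex"
    assume X: "\<forall>i. X i \<in> UNIV - {z}" "X \<longlonglongrightarrow> z"
    have "eventually (\<lambda>i. X i \<in> ball z r) sequentially"
      using X(2) r by (metis centre_in_ball open_ball topological_tendstoD)
    then obtain N where N: "\<And>i. i \<ge> N \<Longrightarrow> X i \<in> ball z r" by (auto simp: eventually_sequentially)
    \<comment> \<open>The sequence may start outside the ball; dropping \<open>N\<close> terms makes
      the bounds available for every index.\<close>
    define Y where "Y = (\<lambda>i. X (i + N))"
    have Y: "\<And>i. Y i \<in> ball z r" "\<And>i. Y i \<noteq> z" "Y \<longlonglongrightarrow> z"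
      using N X LIMSEQ_ignore_initial_segment [OF X(2), of N] by (auto simp: Y_def)
    have zb: "z \<in> ball z r" using r by simp
    have "(\<lambda>i. LINT s:{0<..}|lborel. (f (Y i) s - f z s) / (Y i - z)) \<longlonglongrightarrow> (LINT s:{0<..}|lborel. f' z s)"
      unfolding set_lebesgue_integral_def
    proof (rule integral_dominated_convergence [where w = "\<lambda>s. indicat_real {0<..} s *\<^sub>R (K * exp (- c * s))"])
      show "(\<lambda>s. indicat_real {0<..} s *\<^sub>R f' z s) \<in> borel_measurable lborel"
        using borel_measurable_continuous_on_indicator [OF _ cont'] by simp
      show "(\<lambda>s. indicat_real {0<..} s *\<^sub>R ((f (Y i) s - f z s) / (Y i - z))) \<in> borel_measurable lborel" for i
      proof -
        have "continuous_on {0<..} (\<lambda>s. (f (Y i) s - f z s) / (Y i - z))"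
          using Y(2) [of i] by (intro continuous_intros cont Y(1) zb) auto
        from borel_measurable_continuous_on_indicator [OF _ this]
        show "(\<lambda>s. indicat_real {0<..} s *\<^sub>R ((f (Y i) s - f z s) / (Y i - z))) \<in> borel_measurable lborel"
          by simp
      qed
      show "integrable lborel (\<lambda>s. indicat_real {0<..} s *\<^sub>R (K * exp (- c * s)))"
        using intK by (simp add: set_integrable_def)
      show "AE s in lborel. (\<lambda>i. indicat_real {0<..} s *\<^sub>R ((f (Y i) s - f z s) / (Y i - z)))
              \<longlonglongrightarrow> indicat_real {0<..} s *\<^sub>R f' z s"
      proof (intro AE_I2)
        fix s :: real
        show "(\<lambda>i. indicat_real {0<..} s *\<^sub>R ((f (Y i) s - f z s) / (Y i - z)))
              \<longlonglongrightarrow> indicat_real {0<..} s *\<^sub>R f' z s"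
        proof (cases "s > 0")
          case True
          have "((\<lambda>y. (f y s - f z s) / (y - z)) \<longlongrightarrow> f' z s) (at z)"
            using der [OF zb True] by (simp add: has_field_derivative_iff)
          then have "((\<lambda>y. (f y s - f z s) / (y - z)) \<circ> Y) \<longlonglongrightarrow> f' z s"
            unfolding tendsto_at_iff_sequentially using Y by blast
          then show ?thesis using True by (simp add: o_def)
        qed simp
      qed
      show "AE s in lborel. norm (indicat_real {0<..} s *\<^sub>R ((f (Y i) s - f z s) / (Y i - z)))
              \<le> indicat_real {0<..} s *\<^sub>R (K * exp (- c * s))" for i
      proof (intro AE_I2)
        fix s :: real
        show "norm (indicat_real {0<..} s *\<^sub>R ((f (Y i) s - f z s) / (Y i - z)))
              \<le> indicat_real {0<..} s *\<^sub>R (K * exp (- c * s))"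
          using lip [OF Y(1) [of i], of s] Y(2) [of i]
          by (cases "s > 0") (auto simp: norm_divide divide_simps)
      qed
    qed
    also have "(\<lambda>i. LINT s:{0<..}|lborel. (f (Y i) s - f z s) / (Y i - z)) =
        (\<lambda>i. (halfline_integral (f (Y i)) - halfline_integral (f z)) / (Y i - z))"
      unfolding halfline_integral_def using int [OF Y(1)] int [OF zb] by (simp add: set_integral_diff)
    finally have "(\<lambda>i. (halfline_integral (f (X (i + N))) - halfline_integral (f z)) / (X (i + N) - z)) \<longlonglongrightarrow> halfline_integral (f' z)"
      by (simp add: Y_def halfline_integral_def)
    then show "((\<lambda>y. (halfline_integral (f y) - halfline_integral (f z)) / (y - z)) \<circ> X)
        \<longlonglongrightarrow> halfline_integral (f' z)"
      unfolding o_def by (rule LIMSEQ_offset)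
  qed
qed

lemma poly_exp_bound:
  assumes "c' < (c :: real)"
  obtains K where "K > 0" "\<And>s. s \<ge> 0 \<Longrightarrow> (1 + s) ^ n * exp (- c * s) \<le> K * exp (- c' * s)"
proof -
  \<comment> \<open>\<open>a \<le> 1\<close> gives \<open>a * (1 + s) \<le> exp (a * s)\<close>, and
    \<open>n * a \<le> c - c'\<close> keeps the n-th power of this within the available
    margin.\<close>
  define a where "a = min 1 ((c - c') / (real n + 1))"
  have a: "0 < a" "a \<le> 1" using assms by (auto simp: a_def)
  have "real n * a \<le> real n * ((c - c') / (real n + 1))"
    by (intro mult_left_mono) (auto simp: a_def)
  also have "\<dots> = (c - c') * (real n / (real n + 1))" by simp
  also have "\<dots> \<le> (c - c') * 1" using assms by (intro mult_left_mono) auto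
  finally have na: "real n * a \<le> c - c'" by simp
  show ?thesis
  proof (rule that [of "1 / a ^ n"])
    show "1 / a ^ n > 0" using a by simp
    fix s :: real assume s: "s \<ge> 0"
    have "a * (1 + s) \<le> 1 + a * s" using a by (simp add: algebra_simps)
    also have "\<dots> \<le> exp (a * s)" by (rule exp_ge_add_one_self)
    finally have "(a * (1 + s)) ^ n \<le> exp (a * s) ^ n" using a s by (intro power_mono) auto
    also have "\<dots> = exp (real n * a * s)" by (simp add: exp_of_nat_mult [symmetric] mult_ac)
    also have "\<dots> \<le> exp ((c - c') * s)" using na s by (simp add: mult_right_mono)
    finally have "a ^ n * (1 + s) ^ n * exp (- c * s) \<le> exp ((c - c') * s) * exp (- c * s)"
      by (simp add: power_mult_distrib)
    also have "\<dots> = exp (- c' * s)" by (simp add: exp_add [symmetric] algebra_simps)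
    finally show "(1 + s) ^ n * exp (- c * s) \<le> 1 / a ^ n * exp (- c' * s)"
      using a by (simp add: field_simps)
  qed
qed

section \<open>Bounds for the factors of the kernel\<close>

lemma inverse_exp_minus_one_le:
  assumes "s > (0::real)"
  shows "1 / (exp s - 1) \<le> (1 + 1 / s) * exp (- s)"
proof -
  have "exp s \<ge> 1 + s" by (rule exp_ge_add_one_self)
  then have "exp (- s) * (1 + s) \<le> 1" using assms by (simp add: exp_minus field_simps)
  moreover have "exp s * exp (- s) = 1" by (simp add: exp_minus)
  ultimately have "s \<le> (s + 1) * exp (- s) * (exp s - 1)" using assms
    by (simp add: algebra_simps)
  moreover have "exp s - 1 > 0" using assms by simp
  ultimately show ?thesis using assms by (simp add: field_simps)
qed

text \<open>This is coth (u / 2) - 2 / u, an odd function with expansion u / 6 + O(u^3) at 0. The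
  coefficient 1/6 is the source of the constant 1/24.\<close>

definition kap :: "complex \<Rightarrow> complex" where
  "kap u = (exp u + 1) / (exp u - 1) - 2 / u"

definition kap' :: "complex \<Rightarrow> complex" where
  "kap' u = 2 / u\<^sup>2 - 2 * exp u / (exp u - 1)\<^sup>2"

lemma norm_exp_minus_one_ge:
  fixes u :: complex
  assumes "Re u > 0"
  shows "norm (exp u - 1) \<ge> Re u"
proof -
  have "Re u \<le> exp (Re u) - 1" using exp_ge_add_one_self [of "Re u"] by linarith
  also have "\<dots> = norm (exp u) - norm (1::complex)" by simp
  also have "\<dots> \<le> norm (exp u - 1)" by (rule norm_triangle_ineq2)
  finally show ?thesis .
qed

lemma exp_neq_one_Re_pos:
  fixes u :: complex
  assumes "Re u > 0"
  shows "exp u - 1 \<noteq> 0"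
  using norm_exp_minus_one_ge [OF assms] assms by auto

lemma has_field_derivative_kap:
  assumes "Re u > 0"
  shows "(kap has_field_derivative kap' u) (at u)"
proof -
  have nz: "exp u - 1 \<noteq> 0" "u \<noteq> 0" using exp_neq_one_Re_pos [OF assms] assms by auto
  have "((\<lambda>u. (exp u + 1) / (exp u - 1) - 2 / u) has_field_derivative
      (exp u * (exp u - 1) - (exp u + 1) * exp u) / ((exp u - 1) * (exp u - 1)) - (0 * u - 2 * 1) / (u * u)) (at u)"
    by (intro DERIV_diff DERIV_divide) (use nz in \<open>auto intro!: derivative_eq_intros\<close>)
  also have "(exp u * (exp u - 1) - (exp u + 1) * exp u) / ((exp u - 1) * (exp u - 1)) - (0 * u - 2 * 1) / (u * u) = kap' u"
    by (simp add: kap'_def power2_eq_square algebra_simps)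
  finally show ?thesis by (simp add: kap_def [abs_def])
qed

text \<open>In the sector norm (exp u - 1) \<ge> Re u \<ge> norm u / A. For norm u \<le> 1 this is
  combined with Taylor's formula; for larger u every summand of \<open>kap\<close> is bounded. A
  single constant serves for all three bounds.\<close>

lemma kap_sector_bounds:
  assumes A: "A \<ge> 1" and u: "Re u > 0" "norm u \<le> A * Re u"
  shows "norm (kap u) \<le> 4 + 3 * A" "norm (kap u) \<le> (4 + 3 * A) * norm u"
    "norm (kap u - u / 6) \<le> (4 + 3 * A) * norm u ^ 2"
proof -
  define n where "n = norm u"
  have n: "n > 0" using u by (auto simp: n_def)
  have nz: "exp u - 1 \<noteq> 0" "u \<noteq> 0" using exp_neq_one_Re_pos [OF u(1)] u by auto
  have "n / A \<le> Re u" using u A by (simp add: n_def field_simps)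
  also have "\<dots> \<le> norm (exp u - 1)" by (rule norm_exp_minus_one_ge [OF u(1)])
  finally have ge: "norm (exp u - 1) \<ge> n / A" .
  have "norm (kap u) \<le> 4 + 3 * A \<and> norm (kap u) \<le> (4 + 3 * A) * n \<and> norm (kap u - u / 6) \<le> (4 + 3 * A) * n ^ 2"
  proof (cases "n \<le> 1")
    case True
    have Re: "\<bar>Re u\<bar> \<le> 1" using True abs_Re_le_cmod [of u] by (simp add: n_def)
    have "exp \<bar>Re u\<bar> \<le> exp 1" using Re by simp
    also have "\<dots> \<le> (3::real)" by (rule exp_le)
    finally have e3: "exp \<bar>Re u\<bar> \<le> 3" .
    define r1 where "r1 = exp u - 1 - u"
    define r3 where "r3 = exp u - 1 - u - u\<^sup>2 / 2 - u ^ 3 / 6"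
    have "norm r1 \<le> exp \<bar>Re u\<bar> * n ^ 2"
      using Taylor_exp [of u 1] by (simp add: r1_def n_def power2_eq_square algebra_simps)
    also have "\<dots> \<le> 3 * n ^ 2" using e3 by (intro mult_right_mono) auto
    finally have r1: "norm r1 \<le> 3 * n ^ 2" .
    have "norm r3 \<le> exp \<bar>Re u\<bar> * n ^ 4 / 6"
      using Taylor_exp [of u 3]
      by (simp add: r3_def n_def eval_nat_numeral fact_reduce algebra_simps)
    also have "\<dots> \<le> 3 * n ^ 4 / 6" using e3 by (intro divide_right_mono mult_right_mono) auto
    finally have r3: "norm r3 \<le> n ^ 4 / 2" by simp
    \<comment> \<open>The numerator has order 4, because all lower terms in the expansion of exp
      cancel. Against a denominator of order 2 this leaves order 2.\<close>
    have "kap u - u / 6 = (u * (exp u + 1) - 2 * (exp u - 1) - u\<^sup>2 / 6 * (exp u - 1)) / (u * (exp u - 1))"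
      using nz by (simp add: kap_def field_simps power2_eq_square)
    also have "u * (exp u + 1) - 2 * (exp u - 1) - u\<^sup>2 / 6 * (exp u - 1) =
        u ^ 4 / 6 + (u - 2) * r3 - u\<^sup>2 / 6 * r1"
      by (simp add: r1_def r3_def field_simps power2_eq_square power3_eq_cube power4_eq_xxxx)
    finally have "norm (kap u - u / 6) = norm (u ^ 4 / 6 + (u - 2) * r3 - u\<^sup>2 / 6 * r1) / (n * norm (exp u - 1))"
      by (simp add: norm_divide norm_mult n_def)
    also have "\<dots> \<le> (3 * n ^ 4) / (n * (n / A))"
    proof (rule frac_le)
      have "norm (u ^ 4 / 6 + (u - 2) * r3 - u\<^sup>2 / 6 * r1) \<le> norm (u ^ 4 / 6) + norm ((u - 2) * r3) + norm (u\<^sup>2 / 6 * r1)"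
        using norm_triangle_ineq4 [of "u ^ 4 / 6 + (u - 2) * r3" "u\<^sup>2 / 6 * r1"]
          norm_triangle_ineq [of "u ^ 4 / 6" "(u - 2) * r3"] by linarith
      also have "\<dots> \<le> n ^ 4 / 6 + 3 * (n ^ 4 / 2) + n ^ 2 / 6 * (3 * n ^ 2)"
      proof (intro add_mono)
        show "norm (u ^ 4 / 6) \<le> n ^ 4 / 6" by (simp add: norm_divide norm_power n_def)
        have "norm (u - 2) \<le> 3" using norm_triangle_ineq4 [of u 2] True by (simp add: n_def)
        then show "norm ((u - 2) * r3) \<le> 3 * (n ^ 4 / 2)"
          unfolding norm_mult using r3 by (intro mult_mono) auto
        show "norm (u\<^sup>2 / 6 * r1) \<le> n ^ 2 / 6 * (3 * n ^ 2)"
          unfolding norm_mult using r1 by (intro mult_mono) (auto simp: norm_divide norm_power n_def)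
      qed
      also have "\<dots> \<le> 3 * n ^ 4" using n by (simp add: power4_eq_xxxx power2_eq_square)
      finally show "norm (u ^ 4 / 6 + (u - 2) * r3 - u\<^sup>2 / 6 * r1) \<le> 3 * n ^ 4" .
      show "n * (n / A) \<le> n * norm (exp u - 1)" using ge n by (intro mult_left_mono) auto
    qed (use n A in auto)
    also have "\<dots> = 3 * A * n ^ 2" using n A by (simp add: field_simps power2_eq_square power4_eq_xxxx)
    finally have 1: "norm (kap u - u / 6) \<le> 3 * A * n ^ 2" .
    also have "3 * A * n ^ 2 \<le> (4 + 3 * A) * n ^ 2" by (simp add: algebra_simps)
    finally have 2: "norm (kap u - u / 6) \<le> (4 + 3 * A) * n ^ 2" .
    have "norm (kap u) \<le> norm (u / 6) + norm (kap u - u / 6)" by (metis norm_triangle_sub)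
    also have "\<dots> \<le> n / 6 + 3 * A * n ^ 2" using 1 by (simp add: norm_divide n_def)
    also have "\<dots> \<le> n + 3 * A * (n * 1)"
      using n True A by (intro add_mono mult_left_mono) (auto simp: power2_eq_square)
    also have "\<dots> \<le> (4 + 3 * A) * n" using n by (simp add: algebra_simps)
    finally have 3: "norm (kap u) \<le> (4 + 3 * A) * n" .
    also have "\<dots> \<le> (4 + 3 * A) * 1" using True A by (intro mult_left_mono) auto
    finally show ?thesis using 2 3 by simp
  next
    case False
    have eq: "kap u = 1 + 2 / (exp u - 1) - 2 / u" using nz by (simp add: kap_def field_simps)
    have "norm (kap u) \<le> norm (1::complex) + norm (2 / (exp u - 1)) + norm (2 / u)"
      unfolding eq
      using norm_triangle_ineq4 [of "1 + 2 / (exp u - 1)" "2 / u"] norm_triangle_ineq [of 1 "2 / (exp u - 1)"]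
      by linarith
    also have "\<dots> \<le> 1 + 2 * A + 2"
    proof (intro add_mono)
      have "1 / A \<le> n / A" using False A by (intro divide_right_mono) auto
      then have le: "1 / A \<le> norm (exp u - 1)" using ge by linarith
      have "0 < norm (exp u - 1)" using nz by simp
      then have "2 / norm (exp u - 1) \<le> 2 / (1 / A)"
        using le A by (intro divide_left_mono mult_pos_pos) auto
      then show "norm (2 / (exp u - 1)) \<le> 2 * A" by (simp add: norm_divide)
      have "2 / n \<le> 2 / 1" using False by (intro divide_left_mono) auto
      then show "norm (2 / u) \<le> 2" by (simp add: norm_divide n_def)
    qed simp
    finally have 1: "norm (kap u) \<le> 3 + 2 * A" by simp
    have 2: "norm (kap u) \<le> 4 + 3 * A" using 1 A by simp
    have "4 + 3 * A \<le> (4 + 3 * A) * n" using A False by simp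
    then have 3: "norm (kap u) \<le> (4 + 3 * A) * n" using 2 by linarith
    have n2: "1 \<le> n ^ 2" "n \<le> n ^ 2"
      using False power_increasing [of 1 2 n] one_le_power [of n 2] by auto
    have "norm (kap u - u / 6) \<le> norm (kap u) + n / 6"
      using norm_triangle_ineq4 [of "kap u" "u / 6"] by (simp add: norm_divide n_def)
    also have "\<dots> \<le> (3 + 2 * A) * n ^ 2 + n ^ 2"
    proof (intro add_mono)
      have "(3 + 2 * A) * 1 \<le> (3 + 2 * A) * n ^ 2" using n2 A by (intro mult_left_mono) auto
      then show "norm (kap u) \<le> (3 + 2 * A) * n ^ 2" using 1 by simp
      show "n / 6 \<le> n ^ 2" using n2 n by simp
    qed
    also have "\<dots> \<le> (4 + 3 * A) * n ^ 2" using A by (simp add: algebra_simps)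
    finally show ?thesis using 2 3 by simp
  qed
  then show "norm (kap u) \<le> 4 + 3 * A" "norm (kap u) \<le> (4 + 3 * A) * norm u"
    "norm (kap u - u / 6) \<le> (4 + 3 * A) * norm u ^ 2" by (auto simp: n_def)
qed

text \<open>Cauchy's inequality on a disc of radius proportional to \<open>norm u\<close>, which stays in a larger sector.\<close>

lemma kap'_sector_bounds:
  assumes A: "A \<ge> 1" and u: "Re u > 0" "norm u \<le> A * Re u"
  shows "norm (kap' u) \<le> 4 * A * (4 + 12 * A)" "norm (kap' u - 1 / 6) \<le> 8 * A * (4 + 12 * A) * norm u"
proof -
  define r where "r = norm u / (2 * A)"
  have "norm u > 0" using u by auto
  then have r: "r > 0" using A by (simp add: r_def)
  \<comment> \<open>Moving by at most r costs half of the lower bound norm u / A for the real part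
    and at most doubles the norm; so the sector constant grows from A to 4 A.\<close>
  have disc: "Re v > 0 \<and> norm v \<le> (4 * A) * Re v \<and> norm v \<le> 2 * norm u" if "v \<in> cball u r" for v
  proof -
    have d: "norm (v - u) \<le> r" using that by (simp add: dist_norm norm_minus_commute)
    have "Re u - Re v \<le> r" using abs_Re_le_cmod [of "v - u"] d by simp
    moreover have "norm u / A \<le> Re u" using u A by (simp add: field_simps)
    ultimately have Re: "norm u / (2 * A) \<le> Re v" by (simp add: r_def field_simps)
    have "norm v \<le> norm u + norm (v - u)" by (metis norm_triangle_sub)
    also have "\<dots> \<le> norm u + norm u / (2 * A)" using d by (simp add: r_def)
    also have "norm u / (2 * A) \<le> norm u / 1" using A by (intro divide_left_mono) auto
    finally have v: "norm v \<le> 2 * norm u" by simp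
    have "2 * norm u = 4 * A * (norm u / (2 * A))" using A by simp
    also have "\<dots> \<le> 4 * A * Re v" using Re A by (intro mult_left_mono) auto
    finally have "norm v \<le> 4 * A * Re v" using v by simp
    moreover have "0 < Re v" using Re r by (simp add: r_def)
    ultimately show ?thesis using v by simp
  qed
  have hol: "kap holomorphic_on cball u r"
    unfolding holomorphic_on_def field_differentiable_def
    using has_field_derivative_kap disc by (blast intro: has_field_derivative_at_within)
  have hol2: "(\<lambda>v. kap v - v / 6) holomorphic_on cball u r"
    by (intro holomorphic_intros hol) auto
  have "norm ((deriv ^^ 1) kap u) \<le> fact 1 * ((4 + 3 * (4 * A)) * (2 * norm u)) / r ^ 1"
  proof (rule Cauchy_inequality)
    fix x assume "norm (u - x) = r"
    then have x: "x \<in> cball u r" by (simp add: dist_norm)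
    have "norm (kap x) \<le> (4 + 3 * (4 * A)) * norm x" using disc [OF x] A by (intro kap_sector_bounds) auto
    also have "\<dots> \<le> (4 + 3 * (4 * A)) * (2 * norm u)" using disc [OF x] A by (intro mult_left_mono) auto
    finally show "norm (kap x) \<le> (4 + 3 * (4 * A)) * (2 * norm u)" .
  qed (use hol r in \<open>auto intro: holomorphic_on_subset holomorphic_on_imp_continuous_on\<close>)
  moreover have "deriv kap u = kap' u" by (rule DERIV_imp_deriv [OF has_field_derivative_kap [OF u(1)]])
  moreover have "((4 + 3 * (4 * A)) * (2 * norm u)) / r = 4 * A * (4 + 12 * A)"
    using A u r by (auto simp: r_def field_simps)
  ultimately show "norm (kap' u) \<le> 4 * A * (4 + 12 * A)" by simp
  have "norm ((deriv ^^ 1) (\<lambda>v. kap v - v / 6) u) \<le> fact 1 * ((4 + 3 * (4 * A)) * (2 * norm u) ^ 2) / r ^ 1"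
  proof (rule Cauchy_inequality)
    fix x assume "norm (u - x) = r"
    then have x: "x \<in> cball u r" by (simp add: dist_norm)
    have "norm (kap x - x / 6) \<le> (4 + 3 * (4 * A)) * norm x ^ 2" using disc [OF x] A by (intro kap_sector_bounds) auto
    also have "\<dots> \<le> (4 + 3 * (4 * A)) * (2 * norm u) ^ 2" using disc [OF x] A by (intro mult_left_mono power_mono) auto
    finally show "norm (kap x - x / 6) \<le> (4 + 3 * (4 * A)) * (2 * norm u) ^ 2" .
  qed (use hol2 r in \<open>auto intro: holomorphic_on_subset holomorphic_on_imp_continuous_on\<close>)
  moreover have "deriv (\<lambda>v. kap v - v / 6) u = kap' u - 1 / 6"
    by (rule DERIV_imp_deriv) (auto intro!: derivative_eq_intros has_field_derivative_kap u)
  moreover have "((4 + 3 * (4 * A)) * (2 * norm u) ^ 2) / r = 8 * A * (4 + 12 * A) * norm u"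
    using A u r by (auto simp: r_def field_simps power2_eq_square)
  ultimately show "norm (kap' u - 1 / 6) \<le> 8 * A * (4 + 12 * A) * norm u" by simp
qed

subsection \<open>The rotated kernel\<close>

definition kerP :: "complex \<Rightarrow> complex \<Rightarrow> real \<Rightarrow> complex" where
  "kerP \<tau> \<nu> s = sinh (\<nu> * of_real s) / (exp (of_real s) - 1) * kap (\<tau> * of_real s) / of_real s"

text \<open>\<open>kerPn n\<close> is the \<nu>-derivative of order n + 1 of \<open>kerP\<close>:
  the first differentiation absorbs the factor 1 / s. \<open>kerPt\<close> is the \<tau>-derivative
  and \<open>kerPtn\<close> the mixed one.\<close>

definition kerPn :: "nat \<Rightarrow> complex \<Rightarrow> complex \<Rightarrow> real \<Rightarrow> complex" where
  "kerPn n \<tau> \<nu> s = of_real s ^ n * (if even n then cosh (\<nu> * of_real s) else sinh (\<nu> * of_real s))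
      / (exp (of_real s) - 1) * kap (\<tau> * of_real s)"

definition kerPt :: "complex \<Rightarrow> complex \<Rightarrow> real \<Rightarrow> complex" where
  "kerPt \<tau> \<nu> s = sinh (\<nu> * of_real s) / (exp (of_real s) - 1) * kap' (\<tau> * of_real s)"

definition kerPtn :: "complex \<Rightarrow> complex \<Rightarrow> real \<Rightarrow> complex" where
  "kerPtn \<tau> \<nu> s = of_real s * cosh (\<nu> * of_real s) / (exp (of_real s) - 1) * kap' (\<tau> * of_real s)"

lemma norm_exp_of_real_minus_one:
  "s > 0 \<Longrightarrow> norm (exp (complex_of_real s) - 1) = exp s - 1"
proof -
  assume "s > 0"
  have "exp (complex_of_real s) - 1 = of_real (exp s - 1)" by (simp add: exp_of_real)
  then show ?thesis using \<open>s > 0\<close> by (simp only: norm_of_real) simp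
qed

lemma norm_cosh_le: "norm (cosh (\<nu> :: complex)) \<le> exp \<bar>Re \<nu>\<bar>"
proof -
  have "norm (cosh \<nu>) \<le> (norm (exp \<nu>) + norm (exp (- \<nu>))) / 2"
    unfolding cosh_def using norm_triangle_ineq [of "exp \<nu>" "exp (- \<nu>)"] by simp
  also have "\<dots> = (exp (Re \<nu>) + exp (- Re \<nu>)) / 2" by simp
  also have "\<dots> \<le> exp \<bar>Re \<nu>\<bar>" by (cases "Re \<nu> \<ge> 0") (auto intro: order_trans [of _ 1])
  finally show ?thesis .
qed

lemma norm_sinh_le1: "norm (sinh (\<nu> :: complex)) \<le> exp \<bar>Re \<nu>\<bar>"
proof -
  have "norm (sinh \<nu>) \<le> (norm (exp \<nu>) + norm (exp (- \<nu>))) / 2"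
    unfolding sinh_def using norm_triangle_ineq4 [of "exp \<nu>" "exp (- \<nu>)"] by simp
  also have "\<dots> = (exp (Re \<nu>) + exp (- Re \<nu>)) / 2" by simp
  also have "\<dots> \<le> exp \<bar>Re \<nu>\<bar>" by (cases "Re \<nu> \<ge> 0") (auto intro: order_trans [of _ 1])
  finally show ?thesis .
qed

text \<open>The factor \<open>norm \<nu>\<close> records the zero of sinh at 0, which compensates
  the pole of 1 / (exp s - 1).\<close>

lemma norm_sinh_le: "norm (sinh (\<nu> :: complex)) \<le> norm \<nu> * exp \<bar>Re \<nu>\<bar>"
proof -
  have "norm (sinh \<nu> - sinh 0) \<le> exp \<bar>Re \<nu>\<bar> * norm (\<nu> - 0)"
  proof (rule field_differentiable_bound [of "closed_segment 0 \<nu>" _ cosh])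
    fix z assume "z \<in> closed_segment 0 \<nu>"
    then obtain t where t: "0 \<le> t" "t \<le> 1" "z = of_real t * \<nu>"
      by (auto simp: in_segment scaleR_conv_of_real)
    have "\<bar>Re z\<bar> = t * \<bar>Re \<nu>\<bar>" using t by (simp add: abs_mult)
    also have "\<dots> \<le> 1 * \<bar>Re \<nu>\<bar>" using t by (intro mult_right_mono) auto
    finally have "exp \<bar>Re z\<bar> \<le> exp \<bar>Re \<nu>\<bar>" by simp
    then show "norm (cosh z) \<le> exp \<bar>Re \<nu>\<bar>" using norm_cosh_le [of z] by linarith
    show "(sinh has_field_derivative cosh z) (at z within closed_segment 0 \<nu>)"
      by (auto intro!: derivative_eq_intros)
  qed auto
  then show ?thesis by (simp add: mult.commute)
qed

text \<open>A whole ball around \<tau> fits into one sector, so the bounds on \<open>kap\<close> are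
  uniform there, as differentiation in \<tau> demands.\<close>

lemma sector_neighbourhood:
  fixes \<tau> :: complex
  assumes "Re \<tau> > 0"
  obtains A r where "A \<ge> 1" "r > 0" "\<And>t. t \<in> ball \<tau> r \<Longrightarrow> Re t > 0 \<and> norm t \<le> A * Re t \<and> norm t \<le> 2 * norm \<tau>"
proof (rule that [of "4 * norm \<tau> / Re \<tau>" "Re \<tau> / 2"])
  have n: "Re \<tau> \<le> norm \<tau>" by (rule complex_Re_le_cmod)
  then show "1 \<le> 4 * norm \<tau> / Re \<tau>" using assms by (simp add: field_simps)
  fix t assume "t \<in> ball \<tau> (Re \<tau> / 2)"
  then have d: "norm (\<tau> - t) < Re \<tau> / 2" by (simp add: dist_norm)
  have 1: "Re t > Re \<tau> / 2" using complex_Re_le_cmod [of "\<tau> - t"] d by simp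
  have 2: "norm t \<le> 2 * norm \<tau>"
    using norm_triangle_ineq2 [of t \<tau>] d n norm_minus_commute [of t \<tau>] norm_ge_zero [of \<tau>] by linarith
  have "2 * norm \<tau> = 4 * norm \<tau> / Re \<tau> * (Re \<tau> / 2)" using assms by simp
  also have "\<dots> \<le> 4 * norm \<tau> / Re \<tau> * Re t" using 1 assms by (intro mult_left_mono) auto
  finally show "Re t > 0 \<and> norm t \<le> 4 * norm \<tau> / Re \<tau> * Re t \<and> norm t \<le> 2 * norm \<tau>"
    using 1 2 assms by simp
qed (use assms in auto)

text \<open>At infinity exp (|Re \<nu>| s) loses against exp s because |Re \<nu>| < 1. At 0 the
  simple pole of 1 / (exp s - 1) is cancelled by a zero of sinh, by a zero of \<open>kap\<close>, or
  by a factor s.\<close>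

lemma kernel_bounds:
  assumes \<tau>: "Re \<tau> > 0" and \<nu>: "\<bar>Re \<nu>\<bar> < 1"
  obtains r c K where "r > 0" "c > 0"
    "\<And>t v. t \<in> ball \<tau> r \<Longrightarrow> v \<in> ball \<nu> r \<Longrightarrow> Re t > 0 \<and> \<bar>Re v\<bar> < 1"
    "\<And>t v s. t \<in> ball \<tau> r \<Longrightarrow> v \<in> ball \<nu> r \<Longrightarrow> s > 0 \<Longrightarrow> norm (kerP t v s) \<le> K * exp (- c * s)"
    "\<And>t v s n. t \<in> ball \<tau> r \<Longrightarrow> v \<in> ball \<nu> r \<Longrightarrow> s > 0 \<Longrightarrow> n \<le> 2 \<Longrightarrow> norm (kerPn n t v s) \<le> K * exp (- c * s)"
    "\<And>t v s. t \<in> ball \<tau> r \<Longrightarrow> v \<in> ball \<nu> r \<Longrightarrow> s > 0 \<Longrightarrow> norm (kerPt t v s) \<le> K * exp (- c * s)"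
    "\<And>t v s. t \<in> ball \<tau> r \<Longrightarrow> v \<in> ball \<nu> r \<Longrightarrow> s > 0 \<Longrightarrow> norm (kerPtn t v s) \<le> K * exp (- c * s)"
proof -
  obtain A r1 where A: "A \<ge> 1" "r1 > 0"
    "\<And>t. t \<in> ball \<tau> r1 \<Longrightarrow> Re t > 0 \<and> norm t \<le> A * Re t \<and> norm t \<le> 2 * norm \<tau>"
    by (rule sector_neighbourhood [OF \<tau>]) (rule that)
  \<comment> \<open>Halfway between |Re \<nu>| and 1: a ball of radius (1 - |Re \<nu>|) / 2 keeps
    |Re v| below \<rho>.\<close>
  define \<rho> where "\<rho> = (1 + \<bar>Re \<nu>\<bar>) / 2"
  define r where "r = min r1 ((1 - \<bar>Re \<nu>\<bar>) / 2)"
  have \<rho>: "0 < \<rho>" "\<rho> < 1" using \<nu> by (auto simp: \<rho>_def)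
  have r: "r > 0" using A \<nu> by (auto simp: r_def)
  define N where "N = norm \<nu> + 1"
  define C where "C = 4 * A * (4 + 12 * A) + (4 + 3 * A) * (2 * norm \<tau>)"
  have C: "C \<ge> 0" "N \<ge> 1" using A by (auto simp: C_def N_def)
  \<comment> \<open>Half of the remaining decay rate 1 - \<rho> pays for the polynomial factor (1 +
    s)^3.\<close>
  obtain K1 where K1: "K1 > 0" "\<And>s. s \<ge> 0 \<Longrightarrow> (1 + s) ^ 3 * exp (- (1 - \<rho>) * s) \<le> K1 * exp (- ((1 - \<rho>) / 2) * s)"
    using poly_exp_bound [of "(1 - \<rho>) / 2" "1 - \<rho>" 3] \<rho> by auto
  have Re_v: "\<bar>Re v\<bar> < \<rho> \<and> norm v \<le> N" if "v \<in> ball \<nu> r" for v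
  proof -
    have d: "norm (v - \<nu>) < (1 - \<bar>Re \<nu>\<bar>) / 2" using that by (simp add: r_def dist_norm norm_minus_commute)
    then have "norm (v - \<nu>) < 1" by simp
    then have "norm v \<le> N" using norm_triangle_ineq2 [of v \<nu>] by (simp add: N_def)
    moreover have "\<bar>Re v\<bar> < \<rho>" using abs_Re_le_cmod [of "v - \<nu>"] d by (simp add: \<rho>_def)
    ultimately show ?thesis by simp
  qed
  have est: "norm (kerP t v s) \<le> N * C * K1 * exp (- ((1 - \<rho>) / 2) * s)"
    "n \<le> 2 \<Longrightarrow> norm (kerPn n t v s) \<le> N * C * K1 * exp (- ((1 - \<rho>) / 2) * s)"
    "norm (kerPt t v s) \<le> N * C * K1 * exp (- ((1 - \<rho>) / 2) * s)"
    "norm (kerPtn t v s) \<le> N * C * K1 * exp (- ((1 - \<rho>) / 2) * s)"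
    if t: "t \<in> ball \<tau> r" and v: "v \<in> ball \<nu> r" and s: "s > 0" for t v s n
  proof -
    have tt: "Re t > 0" "norm t \<le> A * Re t" "norm t \<le> 2 * norm \<tau>" using A t by (auto simp: r_def)
    have us: "Re (t * of_real s) > 0" "norm (t * of_real s) \<le> A * Re (t * of_real s)"
      using tt s by (auto simp: norm_mult)
    have "norm (kap (t * of_real s)) \<le> (4 + 3 * A) * norm (t * of_real s)"
      by (rule kap_sector_bounds [OF A(1) us])
    also have "\<dots> \<le> (4 + 3 * A) * (2 * norm \<tau> * s)"
      using tt s A by (intro mult_left_mono) (auto simp: norm_mult)
    also have "\<dots> \<le> C * s" using A s by (simp add: C_def algebra_simps)
    finally have k1: "norm (kap (t * of_real s)) \<le> C * s" .
    have "norm (kap' (t * of_real s)) \<le> 4 * A * (4 + 12 * A)"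
      by (rule kap'_sector_bounds [OF A(1) us])
    also have "\<dots> \<le> C" using A by (simp add: C_def)
    finally have k2: "norm (kap' (t * of_real s)) \<le> C" .
    have "\<bar>Re (v * of_real s)\<bar> \<le> \<rho> * s" using Re_v [OF v] s by (simp add: abs_mult)
    then have e: "exp \<bar>Re (v * of_real s)\<bar> \<le> exp (\<rho> * s)" by simp
    have ch: "norm (cosh (v * of_real s)) \<le> exp (\<rho> * s)" "norm (sinh (v * of_real s)) \<le> exp (\<rho> * s)"
      using norm_cosh_le [of "v * of_real s"] norm_sinh_le1 [of "v * of_real s"] e by linarith+
    have "norm (sinh (v * of_real s)) \<le> norm (v * of_real s) * exp \<bar>Re (v * of_real s)\<bar>" by (rule norm_sinh_le)
    also have "\<dots> \<le> N * s * exp (\<rho> * s)"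
      using Re_v [OF v] s C(2) e by (intro mult_mono) (auto simp: norm_mult)
    finally have sh: "norm (sinh (v * of_real s)) \<le> N * s * exp (\<rho> * s)" .
    have E: "1 / norm (exp (complex_of_real s) - 1) \<le> (1 + 1 / s) * exp (- s)"
      using inverse_exp_minus_one_le [OF s] norm_exp_of_real_minus_one [OF s] by simp
    \<comment> \<open>Every kernel is a product of a hyperbolic factor of size
      \<open>p * exp (\<rho> * s)\<close>, of 1 / (exp s - 1), and of a factor of size
      \<open>q\<close> from \<open>kap\<close> or \<open>kap'\<close>. Only the sizes differ from
      kernel to kernel.\<close>
    have gen: "a * b * c \<le> N * C * K1 * exp (- ((1 - \<rho>) / 2) * s)"
      if "a \<le> p * exp (\<rho> * s)" "b \<le> (1 + 1 / s) * exp (- s)" "c \<le> q" "p * (1 + 1 / s) * q \<le> N * C * (1 + s) ^ 3"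
        "0 \<le> a" "0 \<le> b" "0 \<le> c" "0 \<le> p" for a b c p q
    proof -
      have "a * b * c \<le> (p * exp (\<rho> * s)) * ((1 + 1 / s) * exp (- s)) * q"
        using that s by (intro mult_mono mult_nonneg_nonneg) auto
      also have "\<dots> = (p * (1 + 1 / s) * q) * exp (- (1 - \<rho>) * s)"
        by (simp add: exp_add [symmetric] algebra_simps)
      also have "\<dots> \<le> N * C * (1 + s) ^ 3 * exp (- (1 - \<rho>) * s)"
        using that by (intro mult_right_mono) auto
      also have "\<dots> \<le> N * C * (K1 * exp (- ((1 - \<rho>) / 2) * s))"
        unfolding mult.assoc using K1(2) [of s] s C by (intro mult_left_mono) auto
      finally show ?thesis by (simp add: mult_ac)
    qed
    have NC: "C \<le> N * C" using C mult_right_mono [of 1 N C] by simp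
    have s3: "1 + s \<le> (1 + s) ^ 3" using s power_increasing [of 1 3 "1 + s"] by simp
    have s23: "(1 + s) ^ 2 \<le> (1 + s) ^ 3" using s by (intro power_increasing) auto
    have "norm (kerP t v s) = norm (sinh (v * of_real s)) * (1 / norm (exp (complex_of_real s) - 1)) * (norm (kap (t * of_real s)) / s)"
      using s by (simp add: kerP_def norm_mult norm_divide)
    also have "\<dots> \<le> N * C * K1 * exp (- ((1 - \<rho>) / 2) * s)"
    proof (rule gen [OF sh E])
      show "norm (kap (t * of_real s)) / s \<le> C" using k1 s by (simp add: field_simps)
      have "N * s * (1 + 1 / s) * C = N * C * (1 + s)" using s by (simp add: field_simps)
      also have "\<dots> \<le> N * C * (1 + s) ^ 3" using s3 C by (intro mult_left_mono) auto
      finally show "N * s * (1 + 1 / s) * C \<le> N * C * (1 + s) ^ 3" .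
    qed (use s C in auto)
    finally show "norm (kerP t v s) \<le> N * C * K1 * exp (- ((1 - \<rho>) / 2) * s)" .
    have "norm (kerPt t v s) = norm (sinh (v * of_real s)) * (1 / norm (exp (complex_of_real s) - 1)) * norm (kap' (t * of_real s))"
      using s by (simp add: kerPt_def norm_mult norm_divide)
    also have "\<dots> \<le> N * C * K1 * exp (- ((1 - \<rho>) / 2) * s)"
    proof (rule gen [OF sh E k2])
      have "N * s * (1 + 1 / s) * C = N * C * (1 + s)" using s by (simp add: field_simps)
      also have "\<dots> \<le> N * C * (1 + s) ^ 3" using s3 C by (intro mult_left_mono) auto
      finally show "N * s * (1 + 1 / s) * C \<le> N * C * (1 + s) ^ 3" .
    qed (use s C in auto)
    finally show "norm (kerPt t v s) \<le> N * C * K1 * exp (- ((1 - \<rho>) / 2) * s)" .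
    have "norm (kerPtn t v s) = (s * norm (cosh (v * of_real s))) * (1 / norm (exp (complex_of_real s) - 1)) * norm (kap' (t * of_real s))"
      using s by (simp add: kerPtn_def norm_mult norm_divide)
    also have "\<dots> \<le> N * C * K1 * exp (- ((1 - \<rho>) / 2) * s)"
    proof (rule gen [OF _ E k2])
      show "s * norm (cosh (v * of_real s)) \<le> s * exp (\<rho> * s)" using ch s by simp
      have "s * (1 + 1 / s) * C = C * (1 + s)" using s by (simp add: field_simps)
      also have "\<dots> \<le> N * C * (1 + s) ^ 3" using s3 C NC s by (intro mult_mono) auto
      finally show "s * (1 + 1 / s) * C \<le> N * C * (1 + s) ^ 3" .
    qed (use s C in auto)
    finally show "norm (kerPtn t v s) \<le> N * C * K1 * exp (- ((1 - \<rho>) / 2) * s)" .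
    show "norm (kerPn n t v s) \<le> N * C * K1 * exp (- ((1 - \<rho>) / 2) * s)" if n: "n \<le> 2"
    proof -
      define h where "h = norm (if even n then cosh (v * of_real s) else sinh (v * of_real s))"
      have h: "h \<le> exp (\<rho> * s)" "h \<ge> 0" using ch by (auto simp: h_def)
      have "norm (kerPn n t v s) = (s ^ n * h) * (1 / norm (exp (complex_of_real s) - 1)) * norm (kap (t * of_real s))"
        using s by (simp add: kerPn_def norm_mult norm_divide norm_power h_def)
      also have "\<dots> \<le> N * C * K1 * exp (- ((1 - \<rho>) / 2) * s)"
      proof (rule gen [OF _ E k1])
        show "s ^ n * h \<le> s ^ n * exp (\<rho> * s)" using h s by (intro mult_left_mono) auto
        have "s ^ n \<le> (1 + s) ^ n" using s by (intro power_mono) auto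
        also have "\<dots> \<le> (1 + s) ^ 2" using n s by (intro power_increasing) auto
        finally have "s ^ n \<le> (1 + s) ^ 2" .
        have "s ^ n * (1 + 1 / s) * (C * s) = C * (s ^ n * (1 + s))" using s by (simp add: field_simps)
        also have "\<dots> \<le> (N * C) * ((1 + s) ^ 2 * (1 + s))"
          using \<open>s ^ n \<le> (1 + s) ^ 2\<close> s C NC by (intro mult_mono) auto
        finally show "s ^ n * (1 + 1 / s) * (C * s) \<le> N * C * (1 + s) ^ 3"
          by (simp add: power2_eq_square power3_eq_cube)
      qed (use s C h in auto)
      finally show ?thesis .
    qed
  qed
  show ?thesis
  proof (rule that [of r "(1 - \<rho>) / 2" "N * C * K1"])
    show "Re t > 0 \<and> \<bar>Re v\<bar> < 1" if "t \<in> ball \<tau> r" "v \<in> ball \<nu> r" for t v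
      using A(3) [of t] Re_v [of v] that \<rho> by (auto simp: r_def)
  qed (use r \<rho> est in auto)
qed

lemma continuous_on_kernels:
  assumes "Re \<tau> > 0"
  shows "continuous_on {0<..} (kerP \<tau> \<nu>)" "continuous_on {0<..} (kerPn n \<tau> \<nu>)"
    "continuous_on {0<..} (kerPt \<tau> \<nu>)" "continuous_on {0<..} (kerPtn \<tau> \<nu>)"
proof -
  have nz: "exp (complex_of_real s) - 1 \<noteq> 0" if "s > 0" for s
    using exp_neq_one_Re_pos [of "of_real s"] that by simp
  have k: "continuous_on {0<..} (\<lambda>s. kap (\<tau> * of_real s))"
    unfolding kap_def using assms nz exp_neq_one_Re_pos
    by (auto intro!: continuous_intros)
  have k': "continuous_on {0<..} (\<lambda>s. kap' (\<tau> * of_real s))"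
    unfolding kap'_def using assms nz exp_neq_one_Re_pos
    by (auto intro!: continuous_intros)
  show "continuous_on {0<..} (kerP \<tau> \<nu>)"
    unfolding kerP_def [abs_def] using nz by (intro continuous_intros k) auto
  show "continuous_on {0<..} (kerPn n \<tau> \<nu>)"
    unfolding kerPn_def [abs_def] using nz by (cases "even n") (auto intro!: continuous_intros k)
  show "continuous_on {0<..} (kerPt \<tau> \<nu>)"
    unfolding kerPt_def [abs_def] using nz by (intro continuous_intros k') auto
  show "continuous_on {0<..} (kerPtn \<tau> \<nu>)"
    unfolding kerPtn_def [abs_def] using nz by (intro continuous_intros k') auto
qed

lemma kernel_derivatives:
  assumes "Re \<tau> > 0" "s > 0"
  shows "((\<lambda>v. kerP \<tau> v s) has_field_derivative kerPn 0 \<tau> \<nu> s) (at \<nu>)"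
    "((\<lambda>t. kerP t \<nu> s) has_field_derivative kerPt \<tau> \<nu> s) (at \<tau>)"
    "((\<lambda>v. kerPn n \<tau> v s) has_field_derivative kerPn (Suc n) \<tau> \<nu> s) (at \<nu>)"
    "((\<lambda>v. kerPt \<tau> v s) has_field_derivative kerPtn \<tau> \<nu> s) (at \<nu>)"
    "((\<lambda>t. kerPn 0 t \<nu> s) has_field_derivative kerPtn \<tau> \<nu> s) (at \<tau>)"
proof -
  have nz: "exp (complex_of_real s) - 1 \<noteq> 0" using exp_neq_one_Re_pos [of "of_real s"] assms by simp
  have k: "((\<lambda>t. kap (t * of_real s)) has_field_derivative kap' (\<tau> * of_real s) * of_real s) (at \<tau>)"
    by (rule DERIV_chain2 [OF has_field_derivative_kap]) (use assms in \<open>auto intro!: derivative_eq_intros\<close>)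
  show "((\<lambda>v. kerP \<tau> v s) has_field_derivative kerPn 0 \<tau> \<nu> s) (at \<nu>)"
    unfolding kerP_def kerPn_def using nz assms by (auto intro!: derivative_eq_intros)
  show "((\<lambda>v. kerPn n \<tau> v s) has_field_derivative kerPn (Suc n) \<tau> \<nu> s) (at \<nu>)"
    unfolding kerPn_def using nz assms by (cases "even n") (auto intro!: derivative_eq_intros)
  show "((\<lambda>v. kerPt \<tau> v s) has_field_derivative kerPtn \<tau> \<nu> s) (at \<nu>)"
    unfolding kerPt_def kerPtn_def using nz assms by (auto intro!: derivative_eq_intros)
  show "((\<lambda>t. kerP t \<nu> s) has_field_derivative kerPt \<tau> \<nu> s) (at \<tau>)"
    unfolding kerP_def kerPt_def using nz assms by (auto intro!: derivative_eq_intros k)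
  show "((\<lambda>t. kerPn 0 t \<nu> s) has_field_derivative kerPtn \<tau> \<nu> s) (at \<tau>)"
    unfolding kerPtn_def kerPn_def using nz assms by (auto intro!: derivative_eq_intros k)
qed

definition intP :: "complex \<Rightarrow> complex \<Rightarrow> complex" where
  "intP \<tau> \<nu> = halfline_integral (kerP \<tau> \<nu>)"

definition intPn :: "nat \<Rightarrow> complex \<Rightarrow> complex \<Rightarrow> complex" where
  "intPn n \<tau> \<nu> = halfline_integral (kerPn n \<tau> \<nu>)"

definition intPt :: "complex \<Rightarrow> complex \<Rightarrow> complex" where
  "intPt \<tau> \<nu> = halfline_integral (kerPt \<tau> \<nu>)"

definition intPtn :: "complex \<Rightarrow> complex \<Rightarrow> complex" where
  "intPtn \<tau> \<nu> = halfline_integral (kerPtn \<tau> \<nu>)"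

lemma intP_derivatives:
  assumes \<tau>: "Re \<tau> > 0" and \<nu>: "\<bar>Re \<nu>\<bar> < 1"
  shows "(intP \<tau> has_field_derivative intPn 0 \<tau> \<nu>) (at \<nu>)"
    "((\<lambda>t. intP t \<nu>) has_field_derivative intPt \<tau> \<nu>) (at \<tau>)"
    "n \<le> 1 \<Longrightarrow> (intPn n \<tau> has_field_derivative intPn (Suc n) \<tau> \<nu>) (at \<nu>)"
    "(intPt \<tau> has_field_derivative intPtn \<tau> \<nu>) (at \<nu>)"
    "((\<lambda>t. intPn 0 t \<nu>) has_field_derivative intPtn \<tau> \<nu>) (at \<tau>)"
proof -
  obtain r c K where rc: "r > 0" "c > 0"
    and Re: "\<And>t v. t \<in> ball \<tau> r \<Longrightarrow> v \<in> ball \<nu> r \<Longrightarrow> Re t > 0 \<and> \<bar>Re v\<bar> < 1"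
    and b: "\<And>t v s. t \<in> ball \<tau> r \<Longrightarrow> v \<in> ball \<nu> r \<Longrightarrow> s > 0 \<Longrightarrow> norm (kerP t v s) \<le> K * exp (- c * s)"
    "\<And>t v s n. t \<in> ball \<tau> r \<Longrightarrow> v \<in> ball \<nu> r \<Longrightarrow> s > 0 \<Longrightarrow> n \<le> 2 \<Longrightarrow> norm (kerPn n t v s) \<le> K * exp (- c * s)"
    "\<And>t v s. t \<in> ball \<tau> r \<Longrightarrow> v \<in> ball \<nu> r \<Longrightarrow> s > 0 \<Longrightarrow> norm (kerPt t v s) \<le> K * exp (- c * s)"
    "\<And>t v s. t \<in> ball \<tau> r \<Longrightarrow> v \<in> ball \<nu> r \<Longrightarrow> s > 0 \<Longrightarrow> norm (kerPtn t v s) \<le> K * exp (- c * s)"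
    by (rule kernel_bounds [OF \<tau> \<nu>]) (rule that)
  have z: "\<tau> \<in> ball \<tau> r" "\<nu> \<in> ball \<nu> r" using rc by auto
  have Ret: "Re t > 0" if "t \<in> ball \<tau> r" for t using Re [OF that z(2)] by simp
  show "(intP \<tau> has_field_derivative intPn 0 \<tau> \<nu>) (at \<nu>)"
    unfolding intP_def [abs_def] intPn_def
    by (rule has_field_derivative_halfline_integral [OF rc, where K = K and ?K0.0 = K])
       (use b z in \<open>auto intro: kernel_derivatives [OF \<tau>] continuous_on_kernels [OF \<tau>]\<close>)
  show "(intPn n \<tau> has_field_derivative intPn (Suc n) \<tau> \<nu>) (at \<nu>)" if "n \<le> 1"
    unfolding intPn_def [abs_def]
    by (rule has_field_derivative_halfline_integral [OF rc, where K = K and ?K0.0 = K])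
       (use b z that in \<open>auto intro: kernel_derivatives [OF \<tau>] continuous_on_kernels [OF \<tau>]\<close>)
  show "(intPt \<tau> has_field_derivative intPtn \<tau> \<nu>) (at \<nu>)"
    unfolding intPt_def [abs_def] intPtn_def
    by (rule has_field_derivative_halfline_integral [OF rc, where K = K and ?K0.0 = K])
       (use b z in \<open>auto intro: kernel_derivatives [OF \<tau>] continuous_on_kernels [OF \<tau>]\<close>)
  show "((\<lambda>t. intP t \<nu>) has_field_derivative intPt \<tau> \<nu>) (at \<tau>)"
    unfolding intP_def [abs_def] intPt_def
    by (rule has_field_derivative_halfline_integral [OF rc, where K = K and ?K0.0 = K])
       (use b z in \<open>auto intro: kernel_derivatives [OF Ret] continuous_on_kernels [OF Ret]\<close>)
  show "((\<lambda>t. intPn 0 t \<nu>) has_field_derivative intPtn \<tau> \<nu>) (at \<tau>)"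
    unfolding intPn_def [abs_def] intPtn_def
    by (rule has_field_derivative_halfline_integral [OF rc, where K = K and ?K0.0 = K])
       (use b z in \<open>auto intro: kernel_derivatives [OF Ret] continuous_on_kernels [OF Ret]\<close>)
qed

subsection \<open>The integral as a lattice sum\<close>

text \<open>A product majorant makes the family absolutely summable over pairs, so both orders of
  summation agree. The rest translates between \<open>infsum\<close> and
  \<open>suminf\<close>.\<close>

lemma double_series:
  fixes f :: "nat \<Rightarrow> nat \<Rightarrow> complex" and a :: "nat \<Rightarrow> real"
  assumes a: "summable a" "\<And>k. a k \<ge> 0" and le: "\<And>k m. norm (f k m) \<le> a k * a m"
  shows "summable (f k)" "summable (\<lambda>k. f k m)" "summable (\<lambda>k. \<Sum>m. f k m)" "summable (\<lambda>m. \<Sum>k. f k m)"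
    "(\<Sum>k. \<Sum>m. f k m) = (\<Sum>m. \<Sum>k. f k m)"
proof -
  have s1: "summable (\<lambda>m. norm (f k m))" for k
    by (rule summable_comparison_test' [OF summable_mult [OF a(1), of "a k"]]) (use le in auto)
  have s2: "summable (\<lambda>k. norm (f k m))" for m
    by (rule summable_comparison_test' [OF summable_mult [OF a(1), of "a m"]]) (use le in \<open>auto simp: mult.commute\<close>)
  show "summable (f k)" "summable (\<lambda>k. f k m)" using s1 s2 by (auto intro: summable_norm_cancel)
  have b1: "norm (\<Sum>m. f k m) \<le> a k * suminf a" for k
  proof -
    have "norm (\<Sum>m. f k m) \<le> (\<Sum>m. norm (f k m))" by (rule summable_norm [OF s1])
    also have "\<dots> \<le> (\<Sum>m. a k * a m)" by (intro suminf_le le s1 summable_mult a)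
    finally show ?thesis by (simp add: suminf_mult a)
  qed
  have b2: "norm (\<Sum>k. f k m) \<le> a m * suminf a" for m
  proof -
    have "norm (\<Sum>k. f k m) \<le> (\<Sum>k. norm (f k m))" by (rule summable_norm [OF s2])
    also have "\<dots> \<le> (\<Sum>k. a m * a k)"
      by (intro suminf_le s2 summable_mult a) (use le in \<open>simp add: mult.commute\<close>)
    finally show ?thesis by (simp add: suminf_mult a)
  qed
  have t1: "summable (\<lambda>k. norm (\<Sum>m. f k m))"
    by (rule summable_comparison_test' [OF summable_mult2 [OF a(1), of "suminf a"]]) (use b1 in auto)
  have t2: "summable (\<lambda>m. norm (\<Sum>k. f k m))"
    by (rule summable_comparison_test' [OF summable_mult2 [OF a(1), of "suminf a"]]) (use b2 in auto)
  show "summable (\<lambda>k. \<Sum>m. f k m)" "summable (\<lambda>m. \<Sum>k. f k m)"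
    using t1 t2 by (auto intro: summable_norm_cancel)
  have "(\<lambda>(k, m). a k * a m) summable_on (UNIV \<times> UNIV)"
  proof (rule summable_on_SigmaI [where g = "\<lambda>k. a k * suminf a"])
    show "((\<lambda>y. case (x, y) of (k, m) \<Rightarrow> a k * a m) has_sum a x * suminf a) UNIV" for x
      using a by (auto intro!: sums_nonneg_imp_has_sum sums_mult summable_sums)
    show "(\<lambda>k. a k * suminf a) summable_on UNIV"
      by (subst summable_on_UNIV_nonneg_real_iff) (use a in \<open>auto intro!: summable_mult2 suminf_nonneg mult_nonneg_nonneg\<close>)
  qed (use a in auto)
  then have "(\<lambda>x. norm (case x of (k, m) \<Rightarrow> f k m)) summable_on (UNIV \<times> UNIV)"
    by (rule Infinite_Sum.abs_summable_on_comparison_test') (use le in auto)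
  then have "(\<lambda>(k, m). f k m) summable_on (UNIV \<times> UNIV)" by (rule abs_summable_summable)
  then have "infsum (\<lambda>k. infsum (f k) UNIV) UNIV = infsum (\<lambda>m. infsum (\<lambda>k. f k m) UNIV) UNIV"
    by (rule infsum_swap_banach)
  moreover have "infsum g UNIV = suminf g" if "summable (\<lambda>n. norm (g n))" for g :: "nat \<Rightarrow> complex"
    using norm_summable_imp_has_sum [OF that] summable_norm_cancel [OF that] infsumI summable_sums by blast
  ultimately show "(\<Sum>k. \<Sum>m. f k m) = (\<Sum>m. \<Sum>k. f k m)"
    using s1 s2 t1 t2 by simp
qed

text \<open>The cube of a sum is split into one-variable factors with exponent 3/2 > 1, which gives
  the summable product majorant that \<open>double_series\<close> requires. The same splitting of a
  square would give exponent 1.\<close>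

lemma cube_ge_powr:
  assumes "x > (0::real)" "y > 0"
  shows "x powr (3/2) * y powr (3/2) \<le> (x + y) ^ 3"
proof -
  have "x * y \<le> (x + y) ^ 2" using assms by (simp add: power2_eq_square algebra_simps)
  then have "(x * y) powr (3/2) \<le> ((x + y) ^ 2) powr (3/2)" using assms by (intro powr_mono2) auto
  also have "\<dots> = (x + y) powr 3" using assms by (simp add: powr_powr powr_numeral [symmetric] del: powr_numeral)
  also have "\<dots> = (x + y) ^ 3" using assms by simp
  finally show ?thesis using assms by (simp add: powr_mult)
qed

lemma lattice_cubes:
  fixes w :: "nat \<Rightarrow> nat \<Rightarrow> complex"
  assumes p: "p > 0" and w: "\<And>k m. norm (w k m) \<ge> p * (real (Suc k) + real (Suc m))"
  shows "summable (\<lambda>m. 1 / w k m ^ 3)" "summable (\<lambda>k. 1 / w k m ^ 3)" "summable (\<lambda>k. \<Sum>m. 1 / w k m ^ 3)"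
    "summable (\<lambda>m. \<Sum>k. 1 / w k m ^ 3)"
    "(\<Sum>k. \<Sum>m. 1 / w k m ^ 3) = (\<Sum>m. \<Sum>k. 1 / w k m ^ 3)"
proof -
  define a where "a = (\<lambda>k::nat. 1 / (p * real (Suc k)) powr (3/2))"
  have "summable (\<lambda>k. real k powr (- (3/2)))" by (subst summable_real_powr_iff) auto
  then have "summable (\<lambda>k. real (Suc k) powr (- (3/2)))" by (subst summable_Suc_iff)
  then have "summable (\<lambda>k. 1 / p powr (3/2) * real (Suc k) powr (- (3/2)))" by (rule summable_mult)
  moreover have "1 / p powr (3/2) * real (Suc k) powr (- (3/2)) = a k" for k
  proof -
    have 1: "(p * real (Suc k)) powr (3/2) = p powr (3/2) * real (Suc k) powr (3/2)"
      by (rule powr_mult)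
    have 2: "real (Suc k) powr (- (3/2)) = inverse (real (Suc k) powr (3/2))" by (rule powr_minus)
    show ?thesis unfolding a_def 1 2 by (simp only: divide_inverse inverse_mult_distrib mult_1_left)
  qed
  ultimately have 1: "summable a" by (simp only:)
  have 2: "a k \<ge> 0" for k by (simp add: a_def)
  have 3: "norm (1 / w k m ^ 3) \<le> a k * a m" for k m
  proof -
    have pos: "p * real (Suc k) > 0" "p * real (Suc m) > 0" using p by auto
    have "(p * real (Suc k)) powr (3/2) * (p * real (Suc m)) powr (3/2) \<le> (p * real (Suc k) + p * real (Suc m)) ^ 3"
      by (rule cube_ge_powr [OF pos])
    also have "\<dots> \<le> norm (w k m) ^ 3" using w [of k m] pos by (intro power_mono) (auto simp: algebra_simps)
    finally have le: "(p * real (Suc k)) powr (3/2) * (p * real (Suc m)) powr (3/2) \<le> norm (w k m) ^ 3" .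
    have "0 < (p * real (Suc k)) powr (3/2) * (p * real (Suc m)) powr (3/2)"
      using pos p by (intro mult_pos_pos) (simp_all del: of_nat_Suc)
    then have "1 / norm (w k m) ^ 3 \<le> 1 / ((p * real (Suc k)) powr (3/2) * (p * real (Suc m)) powr (3/2))"
      by (rule frac_le [OF zero_le_one order_refl _ le])
    also have "\<dots> = a k * a m" by (simp add: a_def)
    finally show ?thesis by (simp add: norm_divide norm_power)
  qed
  show "summable (\<lambda>m. 1 / w k m ^ 3)" "summable (\<lambda>k. 1 / w k m ^ 3)" "summable (\<lambda>k. \<Sum>m. 1 / w k m ^ 3)"
    "summable (\<lambda>m. \<Sum>k. 1 / w k m ^ 3)"
    "(\<Sum>k. \<Sum>m. 1 / w k m ^ 3) = (\<Sum>m. \<Sum>k. 1 / w k m ^ 3)"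
    using double_series [of a "\<lambda>k m. 1 / w k m ^ 3", OF 1 2 3] by auto
qed

section \<open>Laplace transforms and termwise integration\<close>

lemma laplace_0:
  assumes "Re a > 0"
  shows "halfline_integral (\<lambda>s. exp (- (a * of_real s))) = 1 / a"
proof -
  have a: "a \<noteq> 0" using assms by auto
  define F where "F = (\<lambda>s::real. - exp (- (a * of_real s)) / a)"
  have "(LBINT s=0..\<infinity>. exp (- (a * of_real s))) = 0 - (- 1 / a)"
  proof (rule interval_integral_FTC_integrable [where F = F])
    show "(F has_vector_derivative exp (- (a * of_real s))) (at s)" for s
      unfolding F_def using a
      by (auto intro!: derivative_eq_intros has_vector_derivative_real_field)
    show "isCont (\<lambda>s. exp (- (a * of_real s))) s" for s :: real by (intro continuous_intros)
    have "set_integrable lborel {0<..} (\<lambda>s. exp (- (a * complex_of_real s)))"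
      by (rule set_integrable_exp_dominated [where c = "Re a" and K = 1]) (use assms in \<open>auto intro!: continuous_intros\<close>)
    then show "set_integrable lborel (einterval 0 \<infinity>) (\<lambda>s. exp (- (a * complex_of_real s)))"
      by (simp add: zero_ereal_def)
    have "isCont F 0" unfolding F_def using a by (intro continuous_intros) auto
    then have "(F \<longlongrightarrow> F 0) (at_right 0)"
      by (meson filterlim_at_split isCont_def)
    then have "(F \<longlongrightarrow> - 1 / a) (at_right 0)" by (simp add: F_def)
    then show "((F \<circ> real_of_ereal) \<longlongrightarrow> - 1 / a) (at_right 0)"
      using ereal_tendsto_simps1(2) [of F "- 1 / a" 0] by (simp add: zero_ereal_def)
    have "((\<lambda>s. exp (- Re a * s)) \<longlongrightarrow> 0) at_top"
      by (rule filterlim_compose [OF exp_at_bot], rule filterlim_tendsto_neg_mult_at_bot [OF tendsto_const _ filterlim_ident])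
         (use assms in simp)
    then have "((\<lambda>s. exp (- Re a * s) / norm a) \<longlongrightarrow> 0 / norm a) at_top" 
      by (intro tendsto_divide tendsto_const) (use a in auto)
    then have "((\<lambda>s. norm (F s)) \<longlongrightarrow> 0) at_top" by (simp add: F_def norm_divide)
    then have "(F \<longlongrightarrow> 0) at_top" by (rule tendsto_norm_zero_cancel)
    then show "((F \<circ> real_of_ereal) \<longlongrightarrow> 0) (at_left \<infinity>)"
      using ereal_tendsto_simps1(3) [of F 0] by simp
  qed auto
  then show ?thesis
    by (simp add: halfline_integral_def interval_lebesgue_integral_0_infty)
qed

text \<open>\<open>laplace_0\<close> is differentiated twice in a under the integral sign.\<close>

lemma laplace_power:
  assumes "Re a > 0"
  shows "halfline_integral (\<lambda>s. of_real s * exp (- (a * of_real s))) = 1 / a\<^sup>2"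
    "halfline_integral (\<lambda>s. of_real s ^ 2 * exp (- (a * of_real s))) = 2 / a ^ 3"
proof -
  have bd: "\<exists>K. \<forall>y\<in>ball a (Re a / 2). \<forall>s>0. norm (of_real s ^ n * exp (- (y * of_real s))) \<le> K * exp (- (Re a / 4) * s)"
    if ra: "Re a > 0" for n a
  proof -
    have lt: "Re a / 4 < Re a / 2" using ra by simp
    obtain K where K: "K > 0" "\<And>s. s \<ge> 0 \<Longrightarrow> (1 + s) ^ n * exp (- (Re a / 2) * s) \<le> K * exp (- (Re a / 4) * s)"
      using poly_exp_bound [OF lt, where n = n] by blast
    show ?thesis
    proof (intro exI [of _ K] ballI allI impI)
      fix y and s :: real assume y: "y \<in> ball a (Re a / 2)" and s: "s > 0"
      have "Re a / 2 \<le> Re y" using y complex_Re_le_cmod [of "a - y"] by (simp add: dist_norm)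
      then have "(Re a / 2) * s \<le> Re y * s" using s by (intro mult_right_mono) auto
      then have "exp (- (Re y * s)) \<le> exp (- (Re a / 2) * s)" by simp
      moreover have "s ^ n \<le> (1 + s) ^ n" using s by (intro power_mono) auto
      ultimately have "s ^ n * exp (- (Re y * s)) \<le> (1 + s) ^ n * exp (- (Re a / 2) * s)"
        using s by (intro mult_mono) auto
      also have "\<dots> \<le> K * exp (- (Re a / 4) * s)" using K s by simp
      finally show "norm (of_real s ^ n * exp (- (y * of_real s))) \<le> K * exp (- (Re a / 4) * s)"
        using s by (simp add: norm_mult norm_power)
    qed
  qed
  have der: "((\<lambda>a. halfline_integral (\<lambda>s. of_real s ^ n * exp (- (a * of_real s)))) has_field_derivative
      halfline_integral (\<lambda>s. - (of_real s ^ Suc n * exp (- (a * of_real s))))) (at a)" if a: "Re a > 0" for n a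
  proof -
    obtain K0 where K0: "\<forall>y\<in>ball a (Re a / 2). \<forall>s>0. norm (of_real s ^ n * exp (- (y * of_real s))) \<le> K0 * exp (- (Re a / 4) * s)"
      using bd [OF a] by blast
    obtain K where K: "\<forall>y\<in>ball a (Re a / 2). \<forall>s>0. norm (of_real s ^ Suc n * exp (- (y * of_real s))) \<le> K * exp (- (Re a / 4) * s)"
      using bd [OF a] by blast
    show ?thesis
    proof (rule has_field_derivative_halfline_integral [where r = "Re a / 2" and c = "Re a / 4" and K = K and ?K0.0 = K0])
      fix y :: complex and s :: real assume "y \<in> ball a (Re a / 2)" "s > 0"
      then show "norm (- (of_real s ^ Suc n * exp (- (y * of_real s)))) \<le> K * exp (- (Re a / 4) * s)"
        using K unfolding norm_minus_cancel by blast
    next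
      fix s :: real assume "s > 0"
      moreover have "a \<in> ball a (Re a / 2)" using a by simp
      ultimately show "norm (of_real s ^ n * exp (- (a * of_real s))) \<le> K0 * exp (- (Re a / 4) * s)"
        using K0 by blast
    qed (use a in \<open>auto intro!: derivative_eq_intros continuous_intros\<close>)
  qed
  have op: "open {a. Re a > 0}" by (rule open_halfspace_Re_gt)
  have uminus: "halfline_integral (\<lambda>s. - f s) = - halfline_integral f" for f :: "real \<Rightarrow> complex"
    unfolding halfline_integral_def by (simp add: set_lebesgue_integral_def)
  have 1: "halfline_integral (\<lambda>s. of_real s * exp (- (a * of_real s))) = 1 / a\<^sup>2" if a: "Re a > 0" for a
  proof -
    have "((\<lambda>a. 1 / a) has_field_derivative halfline_integral (\<lambda>s. - (of_real s ^ Suc 0 * exp (- (a * of_real s))))) (at a)"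
      by (rule has_field_derivative_transform_within_open [OF der [OF a, of 0] op]) (use a in \<open>auto simp: laplace_0\<close>)
    moreover have "((\<lambda>a. 1 / a) has_field_derivative - (1 / a\<^sup>2)) (at a)"
      using a by (auto intro!: derivative_eq_intros simp: power2_eq_square)
    ultimately have "halfline_integral (\<lambda>s. - (of_real s ^ Suc 0 * exp (- (a * of_real s)))) = - (1 / a\<^sup>2)"
      by (rule DERIV_unique)
    then show ?thesis by (simp add: uminus)
  qed
  show "halfline_integral (\<lambda>s. of_real s * exp (- (a * of_real s))) = 1 / a\<^sup>2" by (rule 1 [OF assms])
  have nz: "a \<noteq> 0" using assms by auto
  have "((\<lambda>a. 1 / a\<^sup>2) has_field_derivative halfline_integral (\<lambda>s. - (of_real s ^ Suc 1 * exp (- (a * of_real s))))) (at a)"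
    by (rule has_field_derivative_transform_within_open [OF der [OF assms, of 1] op]) (use assms in \<open>auto simp: 1\<close>)
  moreover have "((\<lambda>a. 1 / a\<^sup>2) has_field_derivative - (2 / a ^ 3)) (at a)"
    using nz by (auto intro!: derivative_eq_intros simp: field_simps eval_nat_numeral)
  ultimately have "halfline_integral (\<lambda>s. - (of_real s ^ Suc 1 * exp (- (a * of_real s)))) = - (2 / a ^ 3)"
    by (rule DERIV_unique)
  then show "halfline_integral (\<lambda>s. of_real s ^ 2 * exp (- (a * of_real s))) = 2 / a ^ 3"
    by (simp add: uminus power2_eq_square)
qed

text \<open>The majorant of the k-th term has integral 2 K / b^3 with b = \<open>b k\<close>, which
  is summable; hence sum and integral may be interchanged.\<close>

lemma halfline_integral_sums:
  fixes f :: "nat \<Rightarrow> real \<Rightarrow> complex"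
  assumes b: "\<And>k. b k > 0" "summable (\<lambda>k. 1 / b k ^ 3)"
    and cont: "\<And>k. continuous_on {0<..} (f k)"
    and bound: "\<And>k s. s > 0 \<Longrightarrow> norm (f k s) \<le> K * (s ^ 2 * exp (- b k * s))"
    and sums: "\<And>s. s > 0 \<Longrightarrow> (\<lambda>k. f k s) sums F s"
  shows "(\<lambda>k. halfline_integral (f k)) sums halfline_integral F"
proof -
  define g where "g = (\<lambda>k s. indicat_real {0<..} s *\<^sub>R f k s)"
  have int_sq: "set_integrable lborel {0<..} (\<lambda>s. s ^ 2 * exp (- b k * s))" for k
  proof -
    obtain K' where K': "K' > 0" "\<And>s. s \<ge> 0 \<Longrightarrow> (1 + s) ^ 2 * exp (- b k * s) \<le> K' * exp (- (b k / 2) * s)"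
      using poly_exp_bound [of "b k / 2" "b k" 2] b(1) [of k] by auto
    show ?thesis
    proof (rule set_integrable_exp_dominated [where c = "b k / 2" and K = K'])
      fix s :: real assume s: "s > 0"
      have "s ^ 2 * exp (- b k * s) \<le> (1 + s) ^ 2 * exp (- b k * s)"
        using s by (intro mult_right_mono power_mono) auto
      also have "\<dots> \<le> K' * exp (- (b k / 2) * s)" using K' s by simp
      finally show "norm (s ^ 2 * exp (- b k * s)) \<le> K' * exp (- (b k / 2) * s)" by simp
    qed (use b in \<open>auto intro!: continuous_intros\<close>)
  qed
  have val_sq: "(LINT s:{0<..}|lborel. s ^ 2 * exp (- b k * s)) = 2 / b k ^ 3" for k
  proof -
    have "complex_of_real (LINT s:{0<..}|lborel. s ^ 2 * exp (- b k * s)) =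
        halfline_integral (\<lambda>s. of_real s ^ 2 * exp (- (of_real (b k) * of_real s)))"
      unfolding halfline_integral_def
      by (subst set_integral_complex_of_real [symmetric], intro set_lebesgue_integral_cong) (auto simp: exp_of_real [symmetric])
    also have "\<dots> = complex_of_real (2 / b k ^ 3)"
      using b(1) by (subst laplace_power) auto
    finally show ?thesis by (simp only: of_real_eq_iff)
  qed
  have int: "set_integrable lborel {0<..} (f k)" for k
  proof (rule set_integrable_bound)
    show "set_integrable lborel {0<..} (\<lambda>s. K * (s ^ 2 * exp (- b k * s)))" by (intro set_integrable_mult_right int_sq)
    show "set_borel_measurable lborel {0<..} (f k)"
      using borel_measurable_continuous_on_indicator [OF _ cont [of k]] by (simp add: set_borel_measurable_def)
    show "AE s in lborel. s \<in> {0<..} \<longrightarrow> norm (f k s) \<le> norm (K * (s ^ 2 * exp (- b k * s)))"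
    proof (intro AE_I2 impI)
      fix s :: real assume "s \<in> {0<..}"
      then have "norm (f k s) \<le> K * (s ^ 2 * exp (- b k * s))" by (intro bound) auto
      also have "\<dots> \<le> norm (K * (s ^ 2 * exp (- b k * s)))" by simp
      finally show "norm (f k s) \<le> norm (K * (s ^ 2 * exp (- b k * s)))" .
    qed
  qed
  have "(\<lambda>k. integral\<^sup>L lborel (g k)) sums (LINT s|lborel. (\<Sum>k. g k s))"
  proof (rule sums_integral)
    show "integrable lborel (g k)" for k using int [of k] by (simp add: g_def set_integrable_def)
    show "AE s in lborel. summable (\<lambda>k. norm (g k s))"
    proof (intro AE_I2)
      fix s :: real
      show "summable (\<lambda>k. norm (g k s))"
      proof (cases "s > 0")
        case True
        show ?thesis
        proof (rule summable_comparison_test' [OF summable_mult [OF b(2), of "\<bar>K\<bar> * 27 / s"]])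
          fix k
          \<comment> \<open>From (1 + x / 3)^3 \<le> exp x with x = b s one gets x^3 exp (- x) \<le>
            27, hence for fixed s a pointwise majorant of order 1 / b^3.\<close>
          have "(b k * s / 3) ^ 3 \<le> (1 + b k * s / 3) ^ 3" using b(1) [of k] True by (intro power_mono) auto
          also have "\<dots> \<le> exp (b k * s / 3) ^ 3"
            using b(1) [of k] True exp_ge_add_one_self [of "b k * s / 3"] by (intro power_mono) (auto simp: add_nonneg_nonneg)
          also have "\<dots> = exp (b k * s)" by (simp add: exp_of_nat_mult [symmetric])
          finally have "b k ^ 3 * s ^ 3 * exp (- b k * s) \<le> 27 * (exp (b k * s) * exp (- b k * s))"
            by (simp add: power_mult_distrib power_divide)
          then have "b k ^ 3 * s ^ 3 * exp (- b k * s) \<le> 27" by (simp add: exp_add [symmetric])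
          then have "s ^ 2 * exp (- b k * s) \<le> 27 / (b k ^ 3 * s)"
            using True b(1) [of k] by (simp add: field_simps power2_eq_square power3_eq_cube)
          then have "\<bar>K\<bar> * (s ^ 2 * exp (- b k * s)) \<le> \<bar>K\<bar> * (27 / (b k ^ 3 * s))" by (intro mult_left_mono) auto
          moreover have "norm (f k s) \<le> \<bar>K\<bar> * (s ^ 2 * exp (- b k * s))"
            using bound [OF True, of k] by (rule order_trans) (intro mult_right_mono, auto)
          ultimately show "norm (norm (g k s)) \<le> \<bar>K\<bar> * 27 / s * (1 / b k ^ 3)"
            using True by (simp add: g_def field_simps)
        qed
      qed (simp add: g_def)
    qed
    show "summable (\<lambda>k. LINT s|lborel. norm (g k s))"
    proof (rule summable_comparison_test' [OF summable_mult [OF b(2), of "\<bar>K\<bar> * 2"]])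
      fix k
      have "(LINT s|lborel. norm (g k s)) \<le> (LINT s|lborel. indicat_real {0<..} s *\<^sub>R (\<bar>K\<bar> * (s ^ 2 * exp (- b k * s))))"
      proof (rule integral_mono)
        show "integrable lborel (\<lambda>s. norm (g k s))"
          using int [of k] unfolding g_def set_integrable_def by (rule integrable_norm)
        show "integrable lborel (\<lambda>s. indicat_real {0<..} s *\<^sub>R (\<bar>K\<bar> * (s ^ 2 * exp (- b k * s))))"
          using set_integrable_mult_right [OF int_sq [of k], of "\<bar>K\<bar>"] by (simp add: set_integrable_def)
        fix s :: real
        show "norm (g k s) \<le> indicat_real {0<..} s *\<^sub>R (\<bar>K\<bar> * (s ^ 2 * exp (- b k * s)))"
        proof (cases "s > 0")
          case True
          then show ?thesis
            using bound [OF True, of k] by (simp add: g_def) (erule order_trans, intro mult_right_mono, auto)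
        qed (simp add: g_def)
      qed
      also have "\<dots> = \<bar>K\<bar> * 2 * (1 / b k ^ 3)"
        using val_sq [of k] set_integral_mult_right [of lborel "{0<..}" "\<bar>K\<bar>" "\<lambda>s. s ^ 2 * exp (- b k * s)"]
        unfolding set_lebesgue_integral_def by simp
      finally show "norm (LINT s|lborel. norm (g k s)) \<le> \<bar>K\<bar> * 2 * (1 / b k ^ 3)" by simp
    qed
  qed
  moreover have "(LINT s|lborel. (\<Sum>k. g k s)) = halfline_integral F"
    unfolding halfline_integral_def set_lebesgue_integral_def
  proof (rule Bochner_Integration.integral_cong [OF refl])
    fix s :: real
    show "(\<Sum>k. g k s) = indicat_real {0<..} s *\<^sub>R F s"
      using sums [of s] by (cases "s > 0") (auto simp: g_def sums_iff)
  qed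
  ultimately show ?thesis by (simp add: g_def [abs_def] halfline_integral_def set_lebesgue_integral_def)
qed

lemma geometric_exp_sums:
  assumes "Re u > 0"
  shows "(\<lambda>k. exp (- (of_nat (Suc k) * u))) sums (1 / (exp u - 1))"
proof -
  have "norm (exp (- u)) < 1" using assms by simp
  then have "(\<lambda>k. exp (- u) * exp (- u) ^ k) sums (exp (- u) * (1 / (1 - exp (- u))))"
    by (intro sums_mult geometric_sums)
  moreover have "exp (- u) * exp (- u) ^ k = exp (- (of_nat (Suc k) * u))" for k
    by (simp add: exp_of_nat_mult [symmetric] exp_add [symmetric] algebra_simps)
  moreover have "exp (- u) * (1 / (1 - exp (- u))) = 1 / (exp u - 1)"
    using exp_neq_one_Re_pos [OF assms] by (simp add: exp_minus field_simps)
  ultimately show ?thesis by simp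
qed

lemma summable_inverse_cube_linear:
  assumes "x > -1" "y > (0::real)"
  shows "summable (\<lambda>k. 1 / (x + 1 + real k * y) ^ 3)"
proof -
  define z where "z = (x + 1) / y"
  have z: "z > 0" using assms by (simp add: z_def)
  have "summable (\<lambda>k. inverse ((z + of_nat k) ^ 3))" using z by (intro Polygamma_converges') auto
  then have "summable (\<lambda>k. (1 / y ^ 3) * inverse ((z + of_nat k) ^ 3))" by (rule summable_mult)
  moreover have "(1 / y ^ 3) * inverse ((z + of_nat k) ^ 3) = 1 / (x + 1 + real k * y) ^ 3" for k
  proof -
    have "x + 1 + real k * y = y * (z + real k)" using assms by (simp add: z_def field_simps)
    then show ?thesis by (simp add: power_mult_distrib divide_inverse)
  qed
  ultimately show ?thesis by (simp only:)
qed

text \<open>As \<open>kap u = 1 + 2 / (exp u - 1) - 2 / u\<close>, the geometric expansion of the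
  middle term gives one Laplace integral for each k \<ge> 1, and the other two terms are
  explicit.\<close>

lemma laplace_kap:
  assumes a: "Re a > 0" and \<tau>: "Re \<tau> > 0"
  shows "halfline_integral (\<lambda>s. of_real s ^ 2 * exp (- (a * of_real s)) * kap (\<tau> * of_real s)) =
     2 / a ^ 3 + 4 * (\<Sum>k. 1 / (a + of_nat (Suc k) * \<tau>) ^ 3) - 2 / (\<tau> * a\<^sup>2)"
proof -
  obtain A r where A: "A \<ge> 1" "r > 0"
    "\<And>t. t \<in> ball \<tau> r \<Longrightarrow> Re t > 0 \<and> norm t \<le> A * Re t \<and> norm t \<le> 2 * norm \<tau>"
    by (rule sector_neighbourhood [OF \<tau>]) (rule that)
  then have A\<tau>: "norm \<tau> \<le> A * Re \<tau>" by (meson centre_in_ball)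
  have kb: "norm (kap (\<tau> * of_real s)) \<le> 4 + 3 * A" if "s > 0" for s
    by (rule kap_sector_bounds [OF A(1)]) (use that \<tau> A\<tau> in \<open>auto simp: norm_mult\<close>)
  define E where "E = (\<lambda>n (s::real). of_real s ^ n * exp (- (a * of_real s)))"
  have lt: "Re a / 2 < Re a" using a by simp
  obtain K where K: "K > 0" "\<And>s. s \<ge> 0 \<Longrightarrow> (1 + s) ^ 2 * exp (- Re a * s) \<le> K * exp (- (Re a / 2) * s)"
    using poly_exp_bound [OF lt, where n = 2] by blast
  have nE: "norm (E n s) \<le> K * exp (- (Re a / 2) * s)" if "s > 0" "n \<le> 2" for n s
  proof -
    have "norm (E n s) = s ^ n * exp (- Re a * s)" using that by (simp add: E_def norm_mult norm_power)
    also have "s ^ n \<le> (1 + s) ^ n" using that by (intro power_mono) auto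
    also have "(1 + s) ^ n \<le> (1 + s) ^ 2" using that by (intro power_increasing) auto
    also have "(1 + s) ^ 2 * exp (- Re a * s) \<le> K * exp (- (Re a / 2) * s)" using K that by simp
    finally show ?thesis by simp
  qed
  have cE: "continuous_on {0<..} (E n)" for n unfolding E_def by (intro continuous_intros)
  have iE: "set_integrable lborel {0<..} (E n)" if "n \<le> 2" for n
    by (rule set_integrable_exp_dominated [OF cE, where c = "Re a / 2" and K = K]) (use a nE that in auto)
  have ck: "continuous_on {0<..} (\<lambda>s. kap (\<tau> * of_real s))"
    unfolding kap_def using \<tau> exp_neq_one_Re_pos by (auto intro!: continuous_intros)
  have iEk: "set_integrable lborel {0<..} (\<lambda>s. E 2 s * kap (\<tau> * of_real s))"
  proof (rule set_integrable_exp_dominated [where c = "Re a / 2" and K = "K * (4 + 3 * A)"])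
    fix s :: real assume s: "s > 0"
    have "norm (E 2 s * kap (\<tau> * of_real s)) \<le> (K * exp (- (Re a / 2) * s)) * (4 + 3 * A)"
      unfolding norm_mult by (intro mult_mono nE kb) (use s K in auto)
    then show "norm (E 2 s * kap (\<tau> * of_real s)) \<le> K * (4 + 3 * A) * exp (- (Re a / 2) * s)" by (simp add: mult_ac)
  qed (use a in \<open>auto intro!: continuous_on_mult cE ck\<close>)
  \<comment> \<open>\<open>F\<close> isolates the middle term of \<open>kap\<close>. The 1 / s in
    the last term lowers s^2 to s, hence \<open>E 1\<close>.\<close>
  define F where "F = (\<lambda>s. E 2 s * kap (\<tau> * of_real s) - E 2 s + 2 / \<tau> * E 1 s)"
  have "(\<lambda>k. halfline_integral (\<lambda>s. 2 * (of_real s ^ 2 * exp (- ((a + of_nat (Suc k) * \<tau>) * of_real s))))) sums halfline_integral F"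
  proof (rule halfline_integral_sums [where b = "\<lambda>k. Re a + real (Suc k) * Re \<tau>" and K = 2])
    show "0 < Re a + real (Suc k) * Re \<tau>" for k using a \<tau> by (intro add_pos_pos mult_pos_pos) auto
    have "summable (\<lambda>k. 1 / ((Re a + Re \<tau> - 1) + 1 + real k * Re \<tau>) ^ 3)"
      using a \<tau> by (intro summable_inverse_cube_linear) auto
    then show "summable (\<lambda>k. 1 / (Re a + real (Suc k) * Re \<tau>) ^ 3)" by (simp add: algebra_simps)
    fix s :: real assume s: "s > 0"
    show "norm (2 * (of_real s ^ 2 * exp (- ((a + of_nat (Suc k) * \<tau>) * of_real s)))) \<le>
        2 * (s ^ 2 * exp (- (Re a + real (Suc k) * Re \<tau>) * s))" for k
      using s by (simp add: norm_mult norm_power algebra_simps)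
    have "(\<lambda>k. 2 * E 2 s * exp (- (of_nat (Suc k) * (\<tau> * of_real s)))) sums (2 * E 2 s * (1 / (exp (\<tau> * of_real s) - 1)))"
      using s \<tau> by (intro sums_mult geometric_exp_sums) auto
    moreover have "2 * E 2 s * exp (- (of_nat (Suc k) * (\<tau> * of_real s))) =
        2 * (of_real s ^ 2 * exp (- ((a + of_nat (Suc k) * \<tau>) * of_real s)))" for k
      by (simp add: E_def exp_add [symmetric] algebra_simps)
    moreover have "2 * E 2 s * (1 / (exp (\<tau> * of_real s) - 1)) = F s"
    proof -
      have nz: "exp (\<tau> * of_real s) - 1 \<noteq> 0" "\<tau> \<noteq> 0" "s \<noteq> 0" using s \<tau> exp_neq_one_Re_pos [of "\<tau> * of_real s"] by auto
      have "E 2 s = of_real s * E 1 s" by (simp add: E_def power2_eq_square)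
      then show ?thesis using nz by (simp add: F_def kap_def field_simps)
    qed
    ultimately show "(\<lambda>k. 2 * (of_real s ^ 2 * exp (- ((a + of_nat (Suc k) * \<tau>) * of_real s)))) sums F s" by (simp only:)
  qed (intro continuous_intros)
  moreover have "halfline_integral (\<lambda>s. 2 * (of_real s ^ 2 * exp (- ((a + of_nat (Suc k) * \<tau>) * of_real s)))) =
      4 * (1 / (a + of_nat (Suc k) * \<tau>) ^ 3)" for k
  proof -
    have "Re (a + of_nat (Suc k) * \<tau>) > 0" using a \<tau> by (simp add: add_pos_nonneg)
    from laplace_power(2) [OF this] show ?thesis by (simp add: halfline_integral_def)
  qed
  ultimately have S: "(\<lambda>k. 4 * (1 / (a + of_nat (Suc k) * \<tau>) ^ 3)) sums halfline_integral F" by simp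
  then have "(\<lambda>k. (1/4) * (4 * (1 / (a + of_nat (Suc k) * \<tau>) ^ 3))) sums ((1/4) * halfline_integral F)" by (rule sums_mult)
  then have "halfline_integral F = 4 * (\<Sum>k. 1 / (a + of_nat (Suc k) * \<tau>) ^ 3)"
    by (auto simp: sums_iff mult.commute)
  moreover have "halfline_integral F = halfline_integral (\<lambda>s. E 2 s * kap (\<tau> * of_real s)) - halfline_integral (E 2) + 2 / \<tau> * halfline_integral (E 1)"
    unfolding halfline_integral_def F_def
    using iE [of 1] iE [of 2] iEk by (simp add: set_integral_add set_integral_diff del: times_divide_eq_left)
  moreover have "halfline_integral (E 2) = 2 / a ^ 3" "halfline_integral (E 1) = 1 / a\<^sup>2"
    using laplace_power [OF a] by (simp_all add: E_def)
  ultimately show ?thesis by (simp add: E_def field_simps)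
qed

text \<open>Expanding 1 / (exp s - 1) into exp (- m s) with m \<ge> 1, and cosh into two
  exponentials, leaves Laplace integrals with a = m - \<nu> and a = m + \<nu>. \<open>C\<close> is
  half the value in \<open>laplace_kap\<close>, the half coming from cosh.\<close>

lemma intPn_2_eq:
  assumes \<tau>: "Re \<tau> > 0" and \<nu>: "\<bar>Re \<nu>\<bar> < 1"
  defines "C \<equiv> (\<lambda>a. 1 / a ^ 3 + 2 * (\<Sum>k. 1 / (a + of_nat (Suc k) * \<tau>) ^ 3) - 1 / (\<tau> * a\<^sup>2))"
  shows "(\<lambda>m. C (of_nat (Suc m) - \<nu>) + C (of_nat (Suc m) + \<nu>)) sums intPn 2 \<tau> \<nu>"
proof -
  obtain A r where A: "A \<ge> 1" "r > 0"
    "\<And>t. t \<in> ball \<tau> r \<Longrightarrow> Re t > 0 \<and> norm t \<le> A * Re t \<and> norm t \<le> 2 * norm \<tau>"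
    by (rule sector_neighbourhood [OF \<tau>]) (rule that)
  then have A\<tau>: "norm \<tau> \<le> A * Re \<tau>" by (meson centre_in_ball)
  have kb: "norm (kap (\<tau> * of_real s)) \<le> 4 + 3 * A" if "s > 0" for s
    by (rule kap_sector_bounds [OF A(1)]) (use that \<tau> A\<tau> in \<open>auto simp: norm_mult\<close>)
  have ck: "continuous_on {0<..} (\<lambda>s. kap (\<tau> * of_real s))"
    unfolding kap_def using \<tau> exp_neq_one_Re_pos by (auto intro!: continuous_intros)
  define G where "G = (\<lambda>a (s::real). of_real s ^ 2 * exp (- (a * of_real s)) * kap (\<tau> * of_real s))"
  have nG: "norm (G a s) \<le> (4 + 3 * A) * (s ^ 2 * exp (- b * s))" if "b \<le> Re a" "s > 0" for a b s
  proof -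
    have "norm (G a s) = (s ^ 2 * exp (- (Re a * s))) * norm (kap (\<tau> * of_real s))"
      using that by (simp add: G_def norm_mult norm_power)
    also have "\<dots> \<le> (s ^ 2 * exp (- b * s)) * (4 + 3 * A)"
      using that kb by (intro mult_mono) auto
    finally show ?thesis by (simp add: mult.commute)
  qed
  have cG: "continuous_on {0<..} (G a)" for a unfolding G_def by (intro continuous_intros ck)
  have iG: "set_integrable lborel {0<..} (G a)" if a: "Re a > 0" for a
  proof -
    have lt: "Re a / 2 < Re a" using a by simp
    obtain K where K: "K > 0" "\<And>s. s \<ge> 0 \<Longrightarrow> (1 + s) ^ 2 * exp (- Re a * s) \<le> K * exp (- (Re a / 2) * s)"
      using poly_exp_bound [OF lt, where n = 2] by blast
    show ?thesis
    proof (rule set_integrable_exp_dominated [OF cG, where c = "Re a / 2" and K = "(4 + 3 * A) * K"])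
      fix s :: real assume s: "s > 0"
      have "norm (G a s) \<le> (4 + 3 * A) * (s ^ 2 * exp (- Re a * s))" by (rule nG) (use s in auto)
      also have "\<dots> \<le> (4 + 3 * A) * ((1 + s) ^ 2 * exp (- Re a * s))"
        using s A by (intro mult_left_mono mult_right_mono power_mono) auto
      also have "\<dots> \<le> (4 + 3 * A) * (K * exp (- (Re a / 2) * s))" using s A K by (intro mult_left_mono) auto
      finally show "norm (G a s) \<le> (4 + 3 * A) * K * exp (- (Re a / 2) * s)" by simp
    qed (use a in auto)
  qed
  define f where "f = (\<lambda>m s. 1/2 * (G (of_nat (Suc m) - \<nu>) s + G (of_nat (Suc m) + \<nu>) s))"
  have Re: "Re (of_nat (Suc m) - \<nu>) \<ge> real (Suc m) - \<bar>Re \<nu>\<bar>" "Re (of_nat (Suc m) + \<nu>) \<ge> real (Suc m) - \<bar>Re \<nu>\<bar>"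
      "real (Suc m) - \<bar>Re \<nu>\<bar> > 0" for m
    using \<nu> by auto
  have "(\<lambda>m. halfline_integral (f m)) sums halfline_integral (kerPn 2 \<tau> \<nu>)"
  proof (rule halfline_integral_sums [where b = "\<lambda>m. real (Suc m) - \<bar>Re \<nu>\<bar>" and K = "4 + 3 * A"])
    show "real (Suc m) - \<bar>Re \<nu>\<bar> > 0" for m by (rule Re)
    have "summable (\<lambda>k. 1 / (- \<bar>Re \<nu>\<bar> + 1 + real k * 1) ^ 3)"
      using \<nu> by (intro summable_inverse_cube_linear) auto
    then show "summable (\<lambda>m. 1 / (real (Suc m) - \<bar>Re \<nu>\<bar>) ^ 3)" by (simp add: algebra_simps)
    show "continuous_on {0<..} (f m)" for m unfolding f_def by (intro continuous_intros cG)
    fix s :: real assume s: "s > 0"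
    show "norm (f m s) \<le> (4 + 3 * A) * (s ^ 2 * exp (- (real (Suc m) - \<bar>Re \<nu>\<bar>) * s))" for m
    proof -
      have "norm (f m s) \<le> 1/2 * (norm (G (of_nat (Suc m) - \<nu>) s) + norm (G (of_nat (Suc m) + \<nu>) s))"
        unfolding f_def norm_mult by (intro mult_mono norm_triangle_ineq) auto
      also have "\<dots> \<le> (4 + 3 * A) * (s ^ 2 * exp (- (real (Suc m) - \<bar>Re \<nu>\<bar>) * s))"
        using nG [OF Re(1) s, of m] nG [OF Re(2) s, of m] by simp
      finally show ?thesis .
    qed
    have "(\<lambda>m. of_real s ^ 2 * cosh (\<nu> * of_real s) * kap (\<tau> * of_real s) * exp (- (of_nat (Suc m) * of_real s))) sums
       (of_real s ^ 2 * cosh (\<nu> * of_real s) * kap (\<tau> * of_real s) * (1 / (exp (of_real s) - 1)))"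
      using s by (intro sums_mult geometric_exp_sums) auto
    moreover have "of_real s ^ 2 * cosh (\<nu> * of_real s) * kap (\<tau> * of_real s) * exp (- (of_nat (Suc m) * of_real s)) = f m s" for m
      unfolding f_def G_def cosh_def
      by (simp add: exp_add [symmetric] ring_distribs scaleR_conv_of_real mult_ac) (simp add: exp_add algebra_simps exp_diff exp_minus divide_inverse)
    ultimately show "(\<lambda>m. f m s) sums kerPn 2 \<tau> \<nu> s" by (simp add: kerPn_def mult_ac)
  qed
  moreover have "halfline_integral (f m) = C (of_nat (Suc m) - \<nu>) + C (of_nat (Suc m) + \<nu>)" for m
  proof -
    have pos: "Re (of_nat (Suc m) - \<nu>) > 0" "Re (of_nat (Suc m) + \<nu>) > 0" using Re [of m] by linarith+
    have "halfline_integral (f m) = 1/2 * (halfline_integral (G (of_nat (Suc m) - \<nu>)) + halfline_integral (G (of_nat (Suc m) + \<nu>)))"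
      unfolding f_def halfline_integral_def using iG [OF pos(1)] iG [OF pos(2)]
      by (simp add: set_integral_add del: of_nat_Suc)
    also have "\<dots> = C (of_nat (Suc m) - \<nu>) + C (of_nat (Suc m) + \<nu>)"
      unfolding G_def laplace_kap [OF pos(1) \<tau>] laplace_kap [OF pos(2) \<tau>] C_def by (simp add: field_simps)
    finally show ?thesis .
  qed
  ultimately show ?thesis by (simp add: intPn_def)
qed

subsection \<open>Polygamma functions and Lambert series as lattice sums\<close>

lemma not_Ints_imp_not_nonpos_Ints:
  fixes u :: complex
  assumes "u \<notin> \<int>" shows "u \<notin> \<int>\<^sub>\<le>\<^sub>0" "1 - u \<notin> \<int>\<^sub>\<le>\<^sub>0"
  using assms by (auto dest!: nonpos_Ints_Int)

text \<open>Logarithmic differentiation of Gamma u * Gamma (1 - u) = pi / sin (pi u).\<close>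

lemma Digamma_reflection:
  fixes u :: complex
  assumes u: "u \<notin> \<int>"
  shows "Digamma (1 - u) - Digamma u = of_real pi * cos (of_real pi * u) / sin (of_real pi * u)"
proof -
  note nn = not_Ints_imp_not_nonpos_Ints [OF u]
  have s: "sin (of_real pi * u) \<noteq> 0"
  proof
    assume "sin (of_real pi * u) = 0"
    then obtain n :: int where "of_real pi * u = of_real (of_int n * pi)" unfolding sin_eq_0 by auto
    then have "u = of_int n" by simp
    then show False using u by simp
  qed
  have G: "Gamma u \<noteq> 0" "Gamma (1 - u) \<noteq> 0" using nn by (auto simp: Gamma_eq_zero_iff)
  have "((\<lambda>u. Gamma u * Gamma (1 - u)) has_field_derivative
      (Gamma u * Digamma u) * Gamma (1 - u) + (- (Gamma (1 - u) * Digamma (1 - u))) * Gamma u) (at u)"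
    using nn by (auto intro!: derivative_eq_intros)
  moreover have "((\<lambda>u. Gamma u * Gamma (1 - u)) has_field_derivative
      - (of_real pi * (of_real pi * cos (of_real pi * u))) / (sin (of_real pi * u) * sin (of_real pi * u))) (at u)"
    unfolding Gamma_reflection_complex using s by (auto intro!: derivative_eq_intros)
  ultimately have eq: "(Gamma u * Digamma u) * Gamma (1 - u) + (- (Gamma (1 - u) * Digamma (1 - u))) * Gamma u =
      - (of_real pi * (of_real pi * cos (of_real pi * u))) / (sin (of_real pi * u) * sin (of_real pi * u))"
    by (rule DERIV_unique)
  have "(Gamma u * Gamma (1 - u)) * (Digamma (1 - u) - Digamma u) =
      - ((Gamma u * Digamma u) * Gamma (1 - u) + (- (Gamma (1 - u) * Digamma (1 - u))) * Gamma u)"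
    by (simp add: algebra_simps)
  also have "\<dots> = (Gamma u * Gamma (1 - u)) * (of_real pi * cos (of_real pi * u) / sin (of_real pi * u))"
    unfolding eq Gamma_reflection_complex by simp
  finally show ?thesis using G by (simp only: mult_cancel_left mult_eq_0_iff simp_thms)
qed

text \<open>Both sides equal - 1/2 + (i / 2) cot (pi u). The digamma form leads by differentiation
  to partial fractions over the integers.\<close>

lemma lam0_Digamma:
  assumes u: "u \<notin> \<int>"
  shows "lam0 u = - 1/2 + \<i> / (2 * of_real pi) * (Digamma (1 - u) - Digamma u)"
proof -
  have ne: "qexp u \<noteq> 1" using u by (simp add: qexp_eq_1_iff)
  define E where "E = exp (\<i> * (of_real pi * u))"
  have eq: "2 * of_real pi * \<i> * u = \<i> * (of_real pi * u) + \<i> * (of_real pi * u)" by (simp add: algebra_simps)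
  have E: "E \<noteq> 0" "qexp u = E * E"
    unfolding E_def qexp_def eq exp_add by simp_all
  have s: "sin (of_real pi * u) = (E - 1 / E) / (2 * \<i>)" and c: "cos (of_real pi * u) = (E + 1 / E) / 2"
    unfolding sin_exp_eq cos_exp_eq E_def by (simp_all add: exp_minus inverse_eq_divide)
  have ne': "E * E - 1 \<noteq> 0" "1 - E * E \<noteq> 0" using ne E by auto
  have "cos (of_real pi * u) / sin (of_real pi * u) = \<i> * (E * E + 1) / (E * E - 1)"
    unfolding s c using E ne' by (simp add: field_simps)
  then have "Digamma (1 - u) - Digamma u = of_real pi * (\<i> * (E * E + 1) / (E * E - 1))"
    using Digamma_reflection [OF u] by (metis times_divide_eq_right)
  then have "\<i> / (2 * of_real pi) * (Digamma (1 - u) - Digamma u) =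
      \<i> / (2 * of_real pi) * (of_real pi * (\<i> * (E * E + 1) / (E * E - 1)))" by (simp only:)
  also have "\<dots> = - (E * E + 1) / (2 * (E * E - 1))"
    using ne' by (simp add: divide_simps)
  finally have "\<i> / (2 * of_real pi) * (Digamma (1 - u) - Digamma u) = - (E * E + 1) / (2 * (E * E - 1))" .
  then have "- 1/2 + \<i> / (2 * of_real pi) * (Digamma (1 - u) - Digamma u) = - (E * E) / (E * E - 1)"
    using ne' by (simp add: field_simps)
  also have "\<dots> = lam0 u" using ne' by (simp add: lam0_def E field_simps)
  finally show ?thesis by simp
qed

lemma lam_Polygamma:
  assumes u: "u \<notin> \<int>"
  shows "lam1 u = - \<i> / (2 * of_real pi) * (Polygamma 1 (1 - u) + Polygamma 1 u)"
    "lam2 u = \<i> / (2 * of_real pi) * (Polygamma 2 (1 - u) - Polygamma 2 u)"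
proof -
  have op: "open (- \<int> :: complex set)" by (simp add: open_Compl closed_Ints)
  have 1: "lam1 u = - \<i> / (2 * of_real pi) * (Polygamma 1 (1 - u) + Polygamma 1 u)" if u: "u \<notin> \<int>" for u
  proof (rule DERIV_unique)
    show "(lam0 has_field_derivative lam1 u) (at u)"
      using u by (intro has_field_derivative_lam0) (simp add: qexp_eq_1_iff)
    have "((\<lambda>u. - 1/2 + \<i> / (2 * of_real pi) * (Digamma (1 - u) - Digamma u)) has_field_derivative
       - \<i> / (2 * of_real pi) * (Polygamma 1 (1 - u) + Polygamma 1 u)) (at u)"
      using not_Ints_imp_not_nonpos_Ints [OF u] by (auto intro!: derivative_eq_intros simp: algebra_simps)
    then show "(lam0 has_field_derivative - \<i> / (2 * of_real pi) * (Polygamma 1 (1 - u) + Polygamma 1 u)) (at u)"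
      by (rule has_field_derivative_transform_within_open [OF _ op]) (use u lam0_Digamma in auto)
  qed
  show "lam1 u = - \<i> / (2 * of_real pi) * (Polygamma 1 (1 - u) + Polygamma 1 u)" by (rule 1 [OF u])
  show "lam2 u = \<i> / (2 * of_real pi) * (Polygamma 2 (1 - u) - Polygamma 2 u)"
  proof (rule DERIV_unique)
    show "(lam1 has_field_derivative lam2 u) (at u)"
      using u by (intro has_field_derivative_lam1) (simp add: qexp_eq_1_iff)
    have "((\<lambda>u. - \<i> / (2 * of_real pi) * (Polygamma 1 (1 - u) + Polygamma 1 u)) has_field_derivative
       \<i> / (2 * of_real pi) * (Polygamma 2 (1 - u) - Polygamma 2 u)) (at u)"
      using not_Ints_imp_not_nonpos_Ints [OF u]
      by (auto intro!: derivative_eq_intros simp: algebra_simps numeral_2_eq_2)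
    then show "(lam1 has_field_derivative \<i> / (2 * of_real pi) * (Polygamma 2 (1 - u) - Polygamma 2 u)) (at u)"
      by (rule has_field_derivative_transform_within_open [OF _ op]) (use u 1 in auto)
  qed
qed

lemma Polygamma_sums:
  fixes z :: complex
  assumes "z \<noteq> 0"
  shows "(\<lambda>k. 1 / (z + of_nat k)\<^sup>2) sums Polygamma 1 z" "(\<lambda>k. 1 / (z + of_nat k) ^ 3) sums (- Polygamma 2 z / 2)"
proof -
  have "summable (\<lambda>k. inverse ((z + of_nat k)\<^sup>2))" "summable (\<lambda>k. inverse ((z + of_nat k) ^ 3))"
    using assms by (auto intro: Polygamma_converges')
  then show "(\<lambda>k. 1 / (z + of_nat k)\<^sup>2) sums Polygamma 1 z" "(\<lambda>k. 1 / (z + of_nat k) ^ 3) sums (- Polygamma 2 z / 2)"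
    by (simp_all add: Polygamma_def numeral_2_eq_2 numeral_3_eq_3 inverse_eq_divide summable_sums)
qed

definition lattice_sum :: "nat \<Rightarrow> complex \<Rightarrow> complex \<Rightarrow> complex" where
  "lattice_sum n u \<omega> = (\<Sum>k. 1 / (u + of_nat (Suc k) * \<omega>) ^ n)"

text \<open>Partial fractions of the derivatives of the cotangent: the polygamma function at u
  collects the poles 0, -1, -2, ... and the one at 1 - u the poles 1, 2, ... The pole at 0 is split
  off, so that both remaining halves start at index 1.\<close>

lemma lam_lattice:
  assumes u: "u \<notin> \<int>"
  shows "lam1 u = - \<i> / (2 * of_real pi) * (1 / u\<^sup>2 + lattice_sum 2 u 1 + lattice_sum 2 u (-1))"
    "lam2 u = \<i> / of_real pi * (1 / u ^ 3 + lattice_sum 3 u 1 + lattice_sum 3 u (-1))"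
    "summable (\<lambda>k. 1 / (u + of_nat (Suc k))\<^sup>2)" "summable (\<lambda>k. 1 / (u - of_nat (Suc k))\<^sup>2)"
    "summable (\<lambda>k. 1 / (u + of_nat (Suc k)) ^ 3)" "summable (\<lambda>k. 1 / (u - of_nat (Suc k)) ^ 3)"
proof -
  have nz: "u \<noteq> 0" "1 - u \<noteq> 0" using u by auto
  have a2: "(\<lambda>k. 1 / (u + of_nat (Suc k))\<^sup>2) sums (Polygamma 1 u - 1 / u\<^sup>2)"
    using Polygamma_sums(1) [OF nz(1)] by (subst sums_Suc_iff) simp
  have a3: "(\<lambda>k. 1 / (u + of_nat (Suc k)) ^ 3) sums (- Polygamma 2 u / 2 - 1 / u ^ 3)"
    using Polygamma_sums(2) [OF nz(1)] by (subst sums_Suc_iff) simp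
  have neg3: "(- z) ^ 3 = - (z ^ 3)" for z :: complex by simp
  have "1 - u + of_nat k = - (u - of_nat (Suc k))" for k by simp
  then have eq: "(1 - u + of_nat k)\<^sup>2 = (u - of_nat (Suc k))\<^sup>2" "(1 - u + of_nat k) ^ 3 = - ((u - of_nat (Suc k)) ^ 3)" for k
    by (simp_all only: power2_minus neg3)
  have b2: "(\<lambda>k. 1 / (u - of_nat (Suc k))\<^sup>2) sums Polygamma 1 (1 - u)"
    using Polygamma_sums(1) [OF nz(2)] by (simp only: eq)
  have "(\<lambda>k. 1 / - ((u - of_nat (Suc k)) ^ 3)) sums (- Polygamma 2 (1 - u) / 2)"
    using Polygamma_sums(2) [OF nz(2)] by (simp only: eq)
  from sums_minus [OF this] have b3: "(\<lambda>k. 1 / (u - of_nat (Suc k)) ^ 3) sums (Polygamma 2 (1 - u) / 2)" by simp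
  show "summable (\<lambda>k. 1 / (u + of_nat (Suc k))\<^sup>2)" "summable (\<lambda>k. 1 / (u - of_nat (Suc k))\<^sup>2)"
    "summable (\<lambda>k. 1 / (u + of_nat (Suc k)) ^ 3)" "summable (\<lambda>k. 1 / (u - of_nat (Suc k)) ^ 3)"
    using a2 a3 b2 b3 by (auto dest: sums_summable)
  have l: "lattice_sum 2 u 1 = Polygamma 1 u - 1 / u\<^sup>2" "lattice_sum 3 u 1 = - Polygamma 2 u / 2 - 1 / u ^ 3"
    "lattice_sum 2 u (-1) = Polygamma 1 (1 - u)" "lattice_sum 3 u (-1) = Polygamma 2 (1 - u) / 2"
    using a2 a3 b2 b3 by (simp_all add: lattice_sum_def sums_iff del: of_nat_Suc)
  show "lam1 u = - \<i> / (2 * of_real pi) * (1 / u\<^sup>2 + lattice_sum 2 u 1 + lattice_sum 2 u (-1))"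
    "lam2 u = \<i> / of_real pi * (1 / u ^ 3 + lattice_sum 3 u 1 + lattice_sum 3 u (-1))"
    unfolding l lam_Polygamma [OF u] by (simp_all add: field_simps)
qed

subsection \<open>The first identity up to a linear function\<close>

text \<open>|Re \<nu>| < 1 lets the integral over s converge; Im \<nu> > 0 puts qexp \<nu> into the
  unit disc, where the principal logarithm and the dilogarithm series are the right
  branches.\<close>

definition strip_domain :: "complex set" where
  "strip_domain = {\<nu>. \<bar>Re \<nu>\<bar> < 1 \<and> Im \<nu> > 0}"

definition lsum :: "(nat \<Rightarrow> complex) \<Rightarrow> (complex \<Rightarrow> complex) \<Rightarrow> complex \<Rightarrow> complex \<Rightarrow> complex" where
  "lsum w g u \<omega> = (\<Sum>k. w k * g (u + of_nat (Suc k) * \<omega>))"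

text \<open>This is 2 pi i times the difference of the two sides of the first identity, with
  \<open>intPn 0\<close> for the \<nu>-derivative of P. The term \<open>lam0 \<nu>\<close> is half
  of the missing k = 0 term of the series and has the sign of the series; on the other side of the
  identity it therefore carries a minus.\<close>

definition F1 :: "complex \<Rightarrow> complex \<Rightarrow> complex" where
  "F1 \<tau> \<nu> = 2 * of_real pi * \<i> * lsum (\<lambda>_. 1) lam0 \<nu> \<tau> - Ln (1 - qexp \<nu>) / \<tau> + of_real pi * \<i> * lam0 \<nu>
     - 2 * of_real pi * \<i> / \<tau> * lsum (\<lambda>_. 1) lam0 (\<nu> / \<tau>) (- 1 / \<tau>)
     - (Digamma (\<nu> / \<tau> + 1) - Ln (\<nu> / \<tau>)) / \<tau> + 1 / (2 * \<nu>) + intPn 0 \<tau> \<nu>"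

text \<open>The case that needs Re \<tau> > 0 is the dual series. A pole would be \<nu> = m + j
  \<tau> with m \<ge> 1; Im \<nu> > 0 forces j > 0, and then Re \<nu> > 1.\<close>

lemma strip_domain_nonpole:
  assumes "Re \<tau> > 0" "Im \<tau> > 0" "\<nu> \<in> strip_domain"
  shows "qexp \<nu> \<noteq> 1" "qexp (\<nu> + of_nat (Suc k) * \<tau>) \<noteq> 1" "qexp (\<nu> / \<tau> + of_nat (Suc m) * (- 1 / \<tau>)) \<noteq> 1"
    "\<nu> / \<tau> \<notin> \<real>\<^sub>\<le>\<^sub>0" "\<nu> / \<tau> + 1 \<notin> \<int>\<^sub>\<le>\<^sub>0" "\<nu> \<noteq> 0" "1 - qexp \<nu> \<notin> \<real>\<^sub>\<le>\<^sub>0" "\<tau> \<noteq> 0"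
proof -
  have Im: "Im \<nu> > 0" "\<bar>Re \<nu>\<bar> < 1" using assms by (auto simp: strip_domain_def)
  have nI: "u \<notin> \<int>" if "Im u > 0" for u :: complex using that by (auto elim!: Ints_cases)
  show t: "\<tau> \<noteq> 0" "\<nu> \<noteq> 0" using assms Im by auto
  show "qexp \<nu> \<noteq> 1" using nI [OF Im(1)] by (simp add: qexp_eq_1_iff)
  have "Im (\<nu> + of_nat (Suc k) * \<tau>) > 0" using Im assms by (simp add: add_pos_nonneg)
  then show "qexp (\<nu> + of_nat (Suc k) * \<tau>) \<noteq> 1" using nI by (simp add: qexp_eq_1_iff)
  show "qexp (\<nu> / \<tau> + of_nat (Suc m) * (- 1 / \<tau>)) \<noteq> 1"
  proof
    assume "qexp (\<nu> / \<tau> + of_nat (Suc m) * (- 1 / \<tau>)) = 1"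
    then obtain j where "\<nu> / \<tau> + of_nat (Suc m) * (- 1 / \<tau>) = of_int j" by (auto simp: qexp_eq_1_iff elim: Ints_cases)
    then have "\<nu> = of_nat (Suc m) + of_int j * \<tau>" using t by (simp add: field_simps)
    then have eq: "Im \<nu> = of_int j * Im \<tau>" "Re \<nu> = real (Suc m) + of_int j * Re \<tau>" by (simp_all del: of_nat_Suc)
    have "of_int j > (0::real)" using Im(1) assms unfolding eq(1) by (simp add: zero_less_mult_iff)
    then have "of_int j * Re \<tau> > 0" using assms by simp
    then show False using eq(2) Im(2) by simp
  qed
  show nr: "\<nu> / \<tau> \<notin> \<real>\<^sub>\<le>\<^sub>0"
  proof
    assume "\<nu> / \<tau> \<in> \<real>\<^sub>\<le>\<^sub>0"
    then obtain r where r: "r \<le> 0" "\<nu> / \<tau> = of_real r" by (auto elim: nonpos_Reals_cases)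
    then have "\<nu> = of_real r * \<tau>" using t by (simp add: field_simps)
    then have "Im \<nu> = r * Im \<tau>" by simp
    then show False using r Im assms mult_nonpos_nonneg [of r "Im \<tau>"] by simp
  qed
  show "\<nu> / \<tau> + 1 \<notin> \<int>\<^sub>\<le>\<^sub>0"
  proof
    assume "\<nu> / \<tau> + 1 \<in> \<int>\<^sub>\<le>\<^sub>0"
    then obtain n where "\<nu> / \<tau> + 1 = - of_nat n" by (auto elim!: nonpos_Ints_cases')
    then have "\<nu> / \<tau> = of_real (- real n - 1)" by (simp add: algebra_simps)
    then have "\<nu> / \<tau> \<in> \<real>\<^sub>\<le>\<^sub>0" by (simp only: nonpos_Reals_of_real_iff)
    then show False using nr by simp
  qed
  have "norm (qexp \<nu>) < 1" using Im by (simp add: norm_qexp)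
  then have "Re (1 - qexp \<nu>) > 0" using complex_Re_le_cmod [of "qexp \<nu>"] by simp
  then show "1 - qexp \<nu> \<notin> \<real>\<^sub>\<le>\<^sub>0" by (auto simp: complex_nonpos_Reals_iff)
qed

lemma open_strip_domain: "open strip_domain" and convex_strip_domain: "convex strip_domain"
proof -
  have eq: "strip_domain = {\<nu>. Re \<nu> < 1} \<inter> {\<nu>. Re \<nu> > -1} \<inter> {\<nu>. Im \<nu> > 0}"
    by (auto simp: strip_domain_def abs_less_iff)
  show "open strip_domain" unfolding eq
    by (intro open_Int open_halfspace_Re_lt open_halfspace_Re_gt open_halfspace_Im_gt)
  show "convex strip_domain" unfolding eq
    by (intro convex_Int convex_halfspace_Re_lt convex_halfspace_Re_gt convex_halfspace_Im_gt)
qed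

lemma lsum_strip_derivatives:
  assumes \<tau>: "Re \<tau> > 0" "Im \<tau> > 0" and \<nu>: "\<nu> \<in> strip_domain"
    and g: "\<And>u. qexp u \<noteq> 1 \<Longrightarrow> (g has_field_derivative g' u) (at u)"
    and bd: "\<And>u. norm (qexp u) \<le> 1/2 \<Longrightarrow> norm (g u) \<le> C * norm (qexp u)"
    and w: "\<And>k. norm (w k) \<le> real (Suc k)"
  shows "((\<lambda>\<nu>. lsum w g \<nu> \<tau>) has_field_derivative lsum w g' \<nu> \<tau>) (at \<nu>)"
    "((\<lambda>\<nu>. lsum w g (\<nu> / \<tau>) (- 1 / \<tau>)) has_field_derivative lsum w g' (\<nu> / \<tau>) (- 1 / \<tau>) / \<tau>) (at \<nu>)"
    "summable (\<lambda>k. w k * g' (\<nu> + of_nat (Suc k) * \<tau>))"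
    "summable (\<lambda>k. w k * g' (\<nu> / \<tau> + of_nat (Suc k) * (- 1 / \<tau>)))"
proof -
  note np = strip_domain_nonpole [OF \<tau>]
  have t: "\<tau> \<noteq> 0" using \<tau> by auto
  have Im': "Im (- 1 / \<tau>) > 0" using \<tau> by (simp add: Im_divide sum_power2_gt_zero_iff)
  have A: "summable (\<lambda>k. w k * (g' (\<nu> + of_nat (Suc k) * \<tau>) * (1 + of_nat (Suc k) * 0)))"
    "((\<lambda>z. \<Sum>k. w k * g (z + of_nat (Suc k) * \<tau>)) has_field_derivative
          (\<Sum>k. w k * (g' (\<nu> + of_nat (Suc k) * \<tau>) * (1 + of_nat (Suc k) * 0)))) (at \<nu>)"
    using lambert_series_derivative [where S = strip_domain and a = "\<lambda>_. \<tau>" and a' = "\<lambda>_. 0" and b = "\<lambda>z. z" and b' = "\<lambda>_. 1"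
        and g = g and g' = g' and w = w and C = C, OF open_strip_domain _ _ _ _ g bd w \<nu>] \<tau> np(2)
    by auto
  then show "((\<lambda>\<nu>. lsum w g \<nu> \<tau>) has_field_derivative lsum w g' \<nu> \<tau>) (at \<nu>)"
    "summable (\<lambda>k. w k * g' (\<nu> + of_nat (Suc k) * \<tau>))"
    by (simp_all add: lsum_def [abs_def] del: of_nat_Suc)
  have B: "summable (\<lambda>k. w k * (g' (\<nu> / \<tau> + of_nat (Suc k) * (- 1 / \<tau>)) * (1 / \<tau> + of_nat (Suc k) * 0)))"
    "((\<lambda>z. \<Sum>k. w k * g (z / \<tau> + of_nat (Suc k) * (- 1 / \<tau>))) has_field_derivative
          (\<Sum>k. w k * (g' (\<nu> / \<tau> + of_nat (Suc k) * (- 1 / \<tau>)) * (1 / \<tau> + of_nat (Suc k) * 0)))) (at \<nu>)"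
    using lambert_series_derivative(2,3) [where S = strip_domain and a = "\<lambda>_. - 1 / \<tau>" and a' = "\<lambda>_. 0" and b = "\<lambda>z. z / \<tau>" and b' = "\<lambda>_. 1 / \<tau>"
        and g = g and g' = g' and w = w and C = C, OF open_strip_domain DERIV_const DERIV_cdivide [OF DERIV_ident] Im' _ g bd w \<nu>] np(3)
    by auto
  have eq: "w k * (g' (\<nu> / \<tau> + of_nat (Suc k) * (- 1 / \<tau>)) * (1 / \<tau> + of_nat (Suc k) * 0)) =
      (w k * g' (\<nu> / \<tau> + of_nat (Suc k) * (- 1 / \<tau>))) / \<tau>" for k by simp
  from B(1) have "summable (\<lambda>k. (w k * g' (\<nu> / \<tau> + of_nat (Suc k) * (- 1 / \<tau>))) / \<tau> * \<tau>)"
    unfolding eq by (rule summable_mult2)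
  then show s: "summable (\<lambda>k. w k * g' (\<nu> / \<tau> + of_nat (Suc k) * (- 1 / \<tau>)))" using t by simp
  show "((\<lambda>\<nu>. lsum w g (\<nu> / \<tau>) (- 1 / \<tau>)) has_field_derivative lsum w g' (\<nu> / \<tau>) (- 1 / \<tau>) / \<tau>) (at \<nu>)"
    using B(2) unfolding eq lsum_def suminf_divide [OF s] .
qed

definition F1' :: "complex \<Rightarrow> complex \<Rightarrow> complex" where
  "F1' \<tau> \<nu> = 2 * of_real pi * \<i> * lsum (\<lambda>_. 1) lam1 \<nu> \<tau> + 2 * of_real pi * \<i> * lam0 \<nu> / \<tau> + of_real pi * \<i> * lam1 \<nu>
     - 2 * of_real pi * \<i> / \<tau> * (lsum (\<lambda>_. 1) lam1 (\<nu> / \<tau>) (- 1 / \<tau>) / \<tau>)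
     - (Polygamma 1 (\<nu> / \<tau> + 1) / \<tau> - 1 / \<nu>) / \<tau> - 1 / (2 * \<nu>\<^sup>2) + intPn 1 \<tau> \<nu>"

lemma has_field_derivative_Ln_one_minus_qexp:
  assumes "1 - qexp \<nu> \<notin> \<real>\<^sub>\<le>\<^sub>0"
  shows "((\<lambda>\<nu>. Ln (1 - qexp \<nu>)) has_field_derivative - (2 * of_real pi * \<i> * lam0 \<nu>)) (at \<nu>)"
  using assms by (auto intro!: derivative_eq_intros simp: lam0_def divide_inverse)

lemma F1_derivatives:
  assumes \<tau>: "Re \<tau> > 0" "Im \<tau> > 0" and \<nu>: "\<nu> \<in> strip_domain"
  shows "(F1 \<tau> has_field_derivative F1' \<tau> \<nu>) (at \<nu>)"
    "(F1' \<tau> has_field_derivative 2 * of_real pi * \<i> * lsum (\<lambda>_. 1) lam2 \<nu> \<tau> + 2 * of_real pi * \<i> * lam1 \<nu> / \<tau>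
       + of_real pi * \<i> * lam2 \<nu> - 2 * of_real pi * \<i> / \<tau> * (lsum (\<lambda>_. 1) lam2 (\<nu> / \<tau>) (- 1 / \<tau>) / \<tau> / \<tau>)
       - (Polygamma 2 (\<nu> / \<tau> + 1) / \<tau> / \<tau> + 1 / \<nu>\<^sup>2) / \<tau> + 1 / \<nu> ^ 3 + intPn 2 \<tau> \<nu>) (at \<nu>)"
proof -
  note np = strip_domain_nonpole [OF \<tau> \<nu>]
  have Re: "\<bar>Re \<nu>\<bar> < 1" using \<nu> by (simp add: strip_domain_def)
  have w: "norm (1 :: complex) \<le> real (Suc k)" for k by simp
  note l0 = lsum_strip_derivatives [where w = "\<lambda>_. 1", OF \<tau> \<nu> has_field_derivative_lam0 norm_lam0_le w]
  note l1 = lsum_strip_derivatives [where w = "\<lambda>_. 1", OF \<tau> \<nu> has_field_derivative_lam1 norm_lam1_le w]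
  have P: "((\<lambda>\<nu>. Polygamma n (\<nu> / \<tau> + 1)) has_field_derivative Polygamma (Suc n) (\<nu> / \<tau> + 1) / \<tau>) (at \<nu>)" for n
    using np by (auto intro!: derivative_eq_intros)
  have L: "((\<lambda>\<nu>. Ln (\<nu> / \<tau>)) has_field_derivative 1 / \<nu>) (at \<nu>)"
    using np by (auto intro!: derivative_eq_intros)
  have i: "((\<lambda>\<nu>. 1 / (2 * \<nu>)) has_field_derivative - 1 / (2 * \<nu>\<^sup>2)) (at \<nu>)"
    using np by (auto intro!: derivative_eq_intros simp: power2_eq_square)
  have i1: "((\<lambda>\<nu>. 1 / \<nu>) has_field_derivative - 1 / \<nu>\<^sup>2) (at \<nu>)"
    using np by (auto intro!: derivative_eq_intros simp: power2_eq_square)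
  have i2: "((\<lambda>\<nu>. 1 / (2 * \<nu>\<^sup>2)) has_field_derivative - 1 / \<nu> ^ 3) (at \<nu>)"
    using np by (auto intro!: derivative_eq_intros simp: power2_eq_square power3_eq_cube)
  have "(F1 \<tau> has_field_derivative 2 * of_real pi * \<i> * lsum (\<lambda>_. 1) lam1 \<nu> \<tau> - - (2 * of_real pi * \<i> * lam0 \<nu>) / \<tau>
      + of_real pi * \<i> * lam1 \<nu> - 2 * of_real pi * \<i> / \<tau> * (lsum (\<lambda>_. 1) lam1 (\<nu> / \<tau>) (- 1 / \<tau>) / \<tau>)
      - (Polygamma (Suc 0) (\<nu> / \<tau> + 1) / \<tau> - 1 / \<nu>) / \<tau> + - 1 / (2 * \<nu>\<^sup>2) + intPn (Suc 0) \<tau> \<nu>) (at \<nu>)"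
    unfolding F1_def [abs_def]
    by (intro DERIV_add DERIV_diff DERIV_cmult DERIV_cdivide P L i l0 has_field_derivative_Ln_one_minus_qexp
        has_field_derivative_lam0 intP_derivatives np \<tau> Re) simp_all
  then show "(F1 \<tau> has_field_derivative F1' \<tau> \<nu>) (at \<nu>)" by (simp add: F1'_def)
  have "(F1' \<tau> has_field_derivative 2 * of_real pi * \<i> * lsum (\<lambda>_. 1) lam2 \<nu> \<tau> + 2 * of_real pi * \<i> * lam1 \<nu> / \<tau>
       + of_real pi * \<i> * lam2 \<nu> - 2 * of_real pi * \<i> / \<tau> * (lsum (\<lambda>_. 1) lam2 (\<nu> / \<tau>) (- 1 / \<tau>) / \<tau> / \<tau>)
       - (Polygamma (Suc 1) (\<nu> / \<tau> + 1) / \<tau> / \<tau> - - 1 / \<nu>\<^sup>2) / \<tau> - - 1 / \<nu> ^ 3 + intPn (Suc 1) \<tau> \<nu>) (at \<nu>)"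
    unfolding F1'_def [abs_def]
    by (intro DERIV_add DERIV_diff DERIV_cmult DERIV_cdivide P L i1 i2 l1 
        has_field_derivative_lam0 has_field_derivative_lam1 intP_derivatives np \<tau> Re) simp_all
  then show "(F1' \<tau> has_field_derivative 2 * of_real pi * \<i> * lsum (\<lambda>_. 1) lam2 \<nu> \<tau> + 2 * of_real pi * \<i> * lam1 \<nu> / \<tau>
       + of_real pi * \<i> * lam2 \<nu> - 2 * of_real pi * \<i> / \<tau> * (lsum (\<lambda>_. 1) lam2 (\<nu> / \<tau>) (- 1 / \<tau>) / \<tau> / \<tau>)
       - (Polygamma 2 (\<nu> / \<tau> + 1) / \<tau> / \<tau> + 1 / \<nu>\<^sup>2) / \<tau> + 1 / \<nu> ^ 3 + intPn 2 \<tau> \<nu>) (at \<nu>)"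
    by (simp add: numeral_2_eq_2)
qed

text \<open>Homogeneity of degree -3 carries expansions over the integers to expansions over
  multiples of \<tau>.\<close>

lemma lattice_sum_scale:
  assumes "\<tau> \<noteq> 0" "summable (\<lambda>k. 1 / (u / \<tau> + of_nat (Suc k) * \<omega>) ^ 3)"
  shows "lattice_sum 3 (u / \<tau>) \<omega> = \<tau> ^ 3 * lattice_sum 3 u (\<omega> * \<tau>)"
proof -
  have eq: "1 / (u / \<tau> + of_nat (Suc k) * \<omega>) ^ 3 = \<tau> ^ 3 * (1 / (u + of_nat (Suc k) * (\<omega> * \<tau>)) ^ 3)" for k
  proof -
    have "u / \<tau> + of_nat (Suc k) * \<omega> = (u + of_nat (Suc k) * (\<omega> * \<tau>)) / \<tau>"
      using assms(1) by (simp add: add_divide_distrib)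
    then show ?thesis by (simp only: power_divide) simp
  qed
  have "summable (\<lambda>k. \<tau> ^ 3 * (1 / (u + of_nat (Suc k) * (\<omega> * \<tau>)) ^ 3))" using assms(2) unfolding eq .
  then have "summable (\<lambda>k. 1 / \<tau> ^ 3 * (\<tau> ^ 3 * (1 / (u + of_nat (Suc k) * (\<omega> * \<tau>)) ^ 3)))" by (rule summable_mult)
  then have s: "summable (\<lambda>k. 1 / (u + of_nat (Suc k) * (\<omega> * \<tau>)) ^ 3)" using assms(1) by simp
  show ?thesis unfolding lattice_sum_def eq by (rule suminf_mult [OF s])
qed

lemma lattice_sum_unit:
  "lattice_sum n u 1 = (\<Sum>k. 1 / (u + of_nat (Suc k)) ^ n)"
  "lattice_sum n u (-1) = (\<Sum>k. 1 / (u - of_nat (Suc k)) ^ n)"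
  by (simp_all only: lattice_sum_def mult_minus_right mult_1_right add_uminus_conv_diff)

text \<open>Up to constants the Lambert series contributes the quadrants \<open>XP\<close> and
  \<open>XM\<close>, its dual \<open>XM\<close> and \<open>XE\<close>, and the integral
  \<open>XE\<close> and \<open>XP\<close>, in different orders of summation. Of the boundary rows,
  \<open>A\<close> cancels against the polygamma term, and the sums over the integers cancel among
  \<open>lam1 \<nu>\<close>, \<open>lam2 \<nu>\<close>, the dual series and the integral.\<close>

lemma F1_second_derivative:
  assumes \<tau>: "Re \<tau> > 0" "Im \<tau> > 0" and \<nu>: "\<nu> \<in> strip_domain"
  shows "(F1' \<tau> has_field_derivative 0) (at \<nu>)"
proof -
  note np = strip_domain_nonpole [OF \<tau> \<nu>]
  have Re: "\<bar>Re \<nu>\<bar> < 1" and Im: "Im \<nu> > 0" using \<nu> by (auto simp: strip_domain_def)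
  have w1: "norm (1 :: complex) \<le> real (Suc k)" for k by simp
  note l1 = lsum_strip_derivatives [where w = "\<lambda>_. 1", OF \<tau> \<nu> has_field_derivative_lam1 norm_lam1_le w1]
  define gp where "gp = (\<lambda>k m. 1 / (\<nu> + of_nat (Suc k) * \<tau> + of_nat (Suc m)) ^ 3)"
  define gm where "gm = (\<lambda>k m. 1 / (\<nu> + of_nat (Suc k) * \<tau> - of_nat (Suc m)) ^ 3)"
  define ge where "ge = (\<lambda>k m. 1 / (of_nat (Suc m) - \<nu> + of_nat (Suc k) * \<tau>) ^ 3)"
  \<comment> \<open>For \<open>gp\<close> and \<open>ge\<close> the real part alone bounds the norm
    from below, as Re \<tau> > 0 and |Re \<nu>| < 1 make both indices contribute positively.\<close>
  define p where "p = min (Re \<tau>) (1 - \<bar>Re \<nu>\<bar>)"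
  have p: "p > 0" "p \<le> Re \<tau>" "p \<le> 1 - \<bar>Re \<nu>\<bar>" using \<tau> Re by (auto simp: p_def)
  have pxy: "p * (x + y) \<le> x * Re \<tau> + y - \<bar>Re \<nu>\<bar>" if "x \<ge> 0" "y \<ge> 1" for x y :: real
  proof -
    have "x * p \<le> x * Re \<tau>" using p that by (intro mult_left_mono) auto
    moreover have "y * p \<le> y * (1 - \<bar>Re \<nu>\<bar>)" using p that by (intro mult_left_mono) auto
    moreover have "\<bar>Re \<nu>\<bar> * 1 \<le> \<bar>Re \<nu>\<bar> * y" using that by (intro mult_left_mono) auto
    ultimately show ?thesis by (simp add: algebra_simps)
  qed
  have pk: "p * (real (Suc k) + real (Suc m)) \<le> real (Suc k) * Re \<tau> + real (Suc m) - \<bar>Re \<nu>\<bar>" for k m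
    by (rule pxy) simp_all
  have wp: "norm (\<nu> + of_nat (Suc k) * \<tau> + of_nat (Suc m)) \<ge> p * (real (Suc k) + real (Suc m))" for k m
    using complex_Re_le_cmod [of "\<nu> + of_nat (Suc k) * \<tau> + of_nat (Suc m)"] pk [of k m]
    by (simp del: of_nat_Suc)
  have we: "norm (of_nat (Suc m) - \<nu> + of_nat (Suc k) * \<tau>) \<ge> p * (real (Suc k) + real (Suc m))" for k m
    using complex_Re_le_cmod [of "of_nat (Suc m) - \<nu> + of_nat (Suc k) * \<tau>"] pk [of k m]
    by (simp del: of_nat_Suc)
  \<comment> \<open>For \<open>gm\<close> the real parts of k \<tau> and - m have opposite signs.
    The linear form M Im z - Re z replaces the real part: it is at least k on k \<tau>, nonnegative
    at \<nu>, equal to m at - m, and at most (M + 1) norm z.\<close>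
  define M where "M = (Re \<tau> + 1) / Im \<tau> + 1 / Im \<nu>"
  have M: "M > 0" "M * Im \<tau> - Re \<tau> \<ge> 1" "M * Im \<nu> - Re \<nu> \<ge> 0"
  proof -
    show "M > 0" using \<tau> Im by (auto simp: M_def intro!: add_pos_pos divide_pos_pos)
    have "M * Im \<tau> = Re \<tau> + 1 + Im \<tau> / Im \<nu>" "M * Im \<nu> = 1 + (Re \<tau> + 1) * Im \<nu> / Im \<tau>"
      using \<tau> Im by (auto simp: M_def field_simps)
    moreover have "Im \<tau> / Im \<nu> \<ge> 0" "(Re \<tau> + 1) * Im \<nu> / Im \<tau> \<ge> 0" using \<tau> Im by auto
    ultimately show "M * Im \<tau> - Re \<tau> \<ge> 1" "M * Im \<nu> - Re \<nu> \<ge> 0" using Re by linarith+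
  qed
  have wm: "norm (\<nu> + of_nat (Suc k) * \<tau> - of_nat (Suc m)) \<ge> 1 / (M + 1) * (real (Suc k) + real (Suc m))" for k m
  proof -
    define z where "z = \<nu> + of_nat (Suc k) * \<tau> - of_nat (Suc m)"
    define Y where "Y = real (Suc k) * (M * Im \<tau> - Re \<tau>)"
    have "real (Suc k) * 1 \<le> Y" unfolding Y_def using M by (intro mult_left_mono) auto
    then have "real (Suc k) + real (Suc m) \<le> (M * Im \<nu> - Re \<nu>) + Y + real (Suc m)"
      using add_mono [OF M(3), of "real (Suc k)" Y] by (simp del: of_nat_Suc)
    also have "\<dots> = M * Im z - Re z"
      by (simp add: z_def Y_def algebra_simps del: of_nat_Suc)
    also have "\<dots> \<le> M * norm z + norm z"
    proof (rule order_trans [OF diff_left_mono])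
      show "M * Im z - (- norm z) \<le> M * norm z + norm z"
        using M abs_Im_le_cmod [of z] by simp
    qed (use abs_Re_le_cmod [of z] in auto)
    finally show ?thesis using M by (simp add: z_def field_simps del: of_nat_Suc)
  qed
  note sp0 = lattice_cubes [where w = "\<lambda>k m. \<nu> + of_nat (Suc k) * \<tau> + of_nat (Suc m)", OF p(1) wp]
  have sp: "summable (gp k)" "\<And>m. summable (\<lambda>k. gp k m)" "summable (\<lambda>k. \<Sum>m. gp k m)" "summable (\<lambda>m. \<Sum>k. gp k m)"
      "(\<Sum>k. \<Sum>m. gp k m) = (\<Sum>m. \<Sum>k. gp k m)" for k
    unfolding gp_def by (rule sp0)+
  note se0 = lattice_cubes [where w = "\<lambda>k m. of_nat (Suc m) - \<nu> + of_nat (Suc k) * \<tau>", OF p(1) we]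
  have se: "summable (ge k)" "\<And>m. summable (\<lambda>k. ge k m)" "summable (\<lambda>k. \<Sum>m. ge k m)" "summable (\<lambda>m. \<Sum>k. ge k m)"
      "(\<Sum>k. \<Sum>m. ge k m) = (\<Sum>m. \<Sum>k. ge k m)" for k
    unfolding ge_def by (rule se0)+
  have M1: "1 / (M + 1) > 0" using M by simp
  note sm0 = lattice_cubes [where w = "\<lambda>k m. \<nu> + of_nat (Suc k) * \<tau> - of_nat (Suc m)", OF M1 wm]
  have sm: "summable (gm k)" "\<And>m. summable (\<lambda>k. gm k m)" "summable (\<lambda>k. \<Sum>m. gm k m)" "summable (\<lambda>m. \<Sum>k. gm k m)"
      "(\<Sum>k. \<Sum>m. gm k m) = (\<Sum>m. \<Sum>k. gm k m)" for k
    unfolding gm_def by (rule sm0)+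
  have nI: "u \<notin> \<int>" if "qexp u \<noteq> 1" for u using that by (simp add: qexp_eq_1_iff)
  define A where "A = lattice_sum 3 \<nu> \<tau>"
  define XP where "XP = (\<Sum>m. \<Sum>k. gp k m)"
  define XM where "XM = (\<Sum>m. \<Sum>k. gm k m)"
  define XE where "XE = (\<Sum>m. \<Sum>k. ge k m)"
  define S3p where "S3p = lattice_sum 3 \<nu> 1"
  define S3m where "S3m = lattice_sum 3 \<nu> (-1)"
  define S2p where "S2p = lattice_sum 2 \<nu> 1"
  define S2m where "S2m = lattice_sum 2 \<nu> (-1)"
  note lat = lam_lattice [OF nI [OF np(1)]]

  \<comment> \<open>The polygamma term is the row m = 0, with its poles at \<nu> = - k \<tau> for k
    \<ge> 1.\<close>
  have digamma: "Polygamma 2 (\<nu> / \<tau> + 1) = - 2 * \<tau> ^ 3 * A"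
    and sA: "summable (\<lambda>k. 1 / (\<nu> + of_nat (Suc k) * \<tau>) ^ 3)"
  proof -
    have "\<nu> / \<tau> + 1 \<noteq> 0" using np(5) by auto
    then have S: "(\<lambda>k. 1 / (\<nu> / \<tau> + 1 + of_nat k) ^ 3) sums (- Polygamma 2 (\<nu> / \<tau> + 1) / 2)" by (rule Polygamma_sums)
    have eq: "1 / (\<nu> / \<tau> + 1 + of_nat k) ^ 3 = \<tau> ^ 3 * (1 / (\<nu> + of_nat (Suc k) * \<tau>) ^ 3)" for k
    proof -
      have "\<nu> / \<tau> + 1 + of_nat k = (\<nu> + of_nat (Suc k) * \<tau>) / \<tau>" using np(8) by (simp add: field_simps)
      then show ?thesis by (simp only: power_divide) simp
    qed
    from S have S': "(\<lambda>k. \<tau> ^ 3 * (1 / (\<nu> + of_nat (Suc k) * \<tau>) ^ 3)) sums (- Polygamma 2 (\<nu> / \<tau> + 1) / 2)" unfolding eq .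
    from sums_mult [OF S', of "1 / \<tau> ^ 3"]
    have S'': "(\<lambda>k. 1 / (\<nu> + of_nat (Suc k) * \<tau>) ^ 3) sums (1 / \<tau> ^ 3 * (- Polygamma 2 (\<nu> / \<tau> + 1) / 2))"
      using np(8) by simp
    then show "summable (\<lambda>k. 1 / (\<nu> + of_nat (Suc k) * \<tau>) ^ 3)" by (rule sums_summable)
    have "A = 1 / \<tau> ^ 3 * (- Polygamma 2 (\<nu> / \<tau> + 1) / 2)"
      using S'' unfolding A_def lattice_sum_def by (rule sums_unique [symmetric])
    then show "Polygamma 2 (\<nu> / \<tau> + 1) = - 2 * \<tau> ^ 3 * A" using np(8) by simp
  qed

  \<comment> \<open>Here m is the inner index; \<open>sp(5)\<close> and \<open>sm(5)\<close> bring
    the sums into the order in which \<open>XP\<close> and \<open>XM\<close> are defined.\<close>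
  have T1: "lsum (\<lambda>_. 1) lam2 \<nu> \<tau> = \<i> / of_real pi * (A + XP + XM)"
  proof -
    have "lam2 (\<nu> + of_nat (Suc k) * \<tau>) = \<i> / of_real pi * (1 / (\<nu> + of_nat (Suc k) * \<tau>) ^ 3 + (\<Sum>m. gp k m) + (\<Sum>m. gm k m))" for k
      using lam_lattice(2) [OF nI [OF np(2) [of k]]] by (simp add: lattice_sum_def gp_def gm_def del: of_nat_Suc)
    moreover have "(\<lambda>k. \<i> / of_real pi * (1 / (\<nu> + of_nat (Suc k) * \<tau>) ^ 3 + (\<Sum>m. gp k m) + (\<Sum>m. gm k m))) sums
        (\<i> / of_real pi * (A + XP + XM))"
      unfolding A_def lattice_sum_def XP_def XM_def sp(5) [symmetric] sm(5) [symmetric]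
      by (intro sums_mult sums_add summable_sums sA sp(3) sm(3))
    ultimately show ?thesis by (simp add: lsum_def sums_iff del: of_nat_Suc)
  qed

  have odd: "1 / (- z) ^ 3 = - (1 / z ^ 3)" for z :: complex by simp
  \<comment> \<open>After multiplication by \<tau> the points (\<nu> - m) / \<tau> + j become \<nu>
    - m + j \<tau>. Those with j < 0 are the negatives of the points of \<open>ge\<close>, whence
    the sign of \<open>XE\<close>.\<close>
  have T4: "lsum (\<lambda>_. 1) lam2 (\<nu> / \<tau>) (- 1 / \<tau>) = \<i> / of_real pi * \<tau> ^ 3 * (S3m + XM - XE)"
  proof -
    have "lam2 (\<nu> / \<tau> + of_nat (Suc m) * (- 1 / \<tau>)) =
        \<i> / of_real pi * \<tau> ^ 3 * (1 / (\<nu> - of_nat (Suc m)) ^ 3 + (\<Sum>k. gm k m) + (- (\<Sum>k. ge k m)))" for m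
    proof -
      have e: "\<nu> / \<tau> + of_nat (Suc m) * (- 1 / \<tau>) = (\<nu> - of_nat (Suc m)) / \<tau>" using np(8) by (simp add: field_simps)
      have n: "(\<nu> - of_nat (Suc m)) / \<tau> \<notin> \<int>" using nI [OF np(3) [of m]] unfolding e .
      note L = lam_lattice [OF n]
      have 1: "lattice_sum 3 ((\<nu> - of_nat (Suc m)) / \<tau>) 1 = \<tau> ^ 3 * lattice_sum 3 (\<nu> - of_nat (Suc m)) (1 * \<tau>)"
        by (rule lattice_sum_scale [OF np(8)]) (simp only: mult_minus_right mult_1_right add_uminus_conv_diff L)
      have 2: "lattice_sum 3 ((\<nu> - of_nat (Suc m)) / \<tau>) (-1) = \<tau> ^ 3 * lattice_sum 3 (\<nu> - of_nat (Suc m)) (-1 * \<tau>)"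
        by (rule lattice_sum_scale [OF np(8)]) (simp only: mult_minus_right mult_1_right add_uminus_conv_diff L)
      have 3: "lattice_sum 3 (\<nu> - of_nat (Suc m)) (1 * \<tau>) = (\<Sum>k. gm k m)"
        by (simp add: lattice_sum_def gm_def algebra_simps)
      have 4: "lattice_sum 3 (\<nu> - of_nat (Suc m)) (-1 * \<tau>) = - (\<Sum>k. ge k m)"
      proof -
        have "1 / (\<nu> - of_nat (Suc m) + of_nat (Suc k) * (-1 * \<tau>)) ^ 3 = - ge k m" for k
          unfolding ge_def odd [symmetric] by (simp add: algebra_simps)
        then show ?thesis unfolding lattice_sum_def by (simp only: suminf_minus [OF se(2)])
      qed
      have 5: "1 / ((\<nu> - of_nat (Suc m)) / \<tau>) ^ 3 = \<tau> ^ 3 * (1 / (\<nu> - of_nat (Suc m)) ^ 3)"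
        by (simp only: power_divide) simp
      show ?thesis unfolding e L(2) 1 2 3 4 5 by (simp add: algebra_simps)
    qed
    moreover have "(\<lambda>m. \<i> / of_real pi * \<tau> ^ 3 * (1 / (\<nu> - of_nat (Suc m)) ^ 3 + (\<Sum>k. gm k m) + (- (\<Sum>k. ge k m)))) sums
        (\<i> / of_real pi * \<tau> ^ 3 * ((\<Sum>m. 1 / (\<nu> - of_nat (Suc m)) ^ 3) + XM + - XE))"
      unfolding XM_def XE_def by (intro sums_mult sums_add sums_minus summable_sums lat sm(4) se(4))
    moreover have "S3m = (\<Sum>m. 1 / (\<nu> - of_nat (Suc m)) ^ 3)" by (simp only: S3m_def lattice_sum_unit)
    ultimately show ?thesis by (simp add: lsum_def sums_iff del: of_nat_Suc)
  qed

  have T7: "intPn 2 \<tau> \<nu> = - S3m + S3p + 2 * XE + 2 * XP - (S2m + S2p) / \<tau>"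
  proof -
    define h where "h = (\<lambda>m. (- (1 / (\<nu> - of_nat (Suc m)) ^ 3) + 1 / (\<nu> + of_nat (Suc m)) ^ 3 + 2 * (\<Sum>k. ge k m) + 2 * (\<Sum>k. gp k m))
         - (1 / (\<nu> - of_nat (Suc m))\<^sup>2 + 1 / (\<nu> + of_nat (Suc m))\<^sup>2) / \<tau>)"
    have "h sums ((- (\<Sum>m. 1 / (\<nu> - of_nat (Suc m)) ^ 3) + (\<Sum>m. 1 / (\<nu> + of_nat (Suc m)) ^ 3) + 2 * XE + 2 * XP)
        - ((\<Sum>m. 1 / (\<nu> - of_nat (Suc m))\<^sup>2) + (\<Sum>m. 1 / (\<nu> + of_nat (Suc m))\<^sup>2)) / \<tau>)"
      unfolding h_def XE_def XP_def
      by (intro sums_add sums_diff sums_minus sums_mult sums_divide summable_sums lat se(4) sp(4))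
    then have 1: "h sums (- S3m + S3p + 2 * XE + 2 * XP - (S2m + S2p) / \<tau>)"
      by (simp only: S3m_def S3p_def S2m_def S2p_def lattice_sum_unit)
    have "1 / (of_nat (Suc m) - \<nu>) ^ 3 + 2 * (\<Sum>k. 1 / (of_nat (Suc m) - \<nu> + of_nat (Suc k) * \<tau>) ^ 3) - 1 / (\<tau> * (of_nat (Suc m) - \<nu>)\<^sup>2)
       + (1 / (of_nat (Suc m) + \<nu>) ^ 3 + 2 * (\<Sum>k. 1 / (of_nat (Suc m) + \<nu> + of_nat (Suc k) * \<tau>) ^ 3) - 1 / (\<tau> * (of_nat (Suc m) + \<nu>)\<^sup>2)) = h m" for m
    proof -
      have a: "1 / (of_nat (Suc m) - \<nu>) ^ 3 = - (1 / (\<nu> - of_nat (Suc m)) ^ 3)" unfolding odd [symmetric] by simp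
      have b: "(of_nat (Suc m) - \<nu>)\<^sup>2 = (\<nu> - of_nat (Suc m))\<^sup>2" by (rule power2_commute)
      have c: "(\<Sum>k. 1 / (of_nat (Suc m) + \<nu> + of_nat (Suc k) * \<tau>) ^ 3) = (\<Sum>k. gp k m)"
        by (simp add: gp_def add_ac)
      have d: "(\<Sum>k. 1 / (of_nat (Suc m) - \<nu> + of_nat (Suc k) * \<tau>) ^ 3) = (\<Sum>k. ge k m)"
        by (simp add: ge_def)
      have e: "of_nat (Suc m) + \<nu> = \<nu> + of_nat (Suc m)" by simp
      show ?thesis unfolding a b c d unfolding e h_def using np(8)
        by (simp add: add_divide_distrib divide_divide_eq_left mult.commute del: of_nat_Suc)
    qed
    then have "h sums intPn 2 \<tau> \<nu>" using intPn_2_eq [OF \<tau>(1) Re] by (simp only:)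
    then show ?thesis using 1 by (rule sums_unique2)
  qed

  have "2 * of_real pi * \<i> * lsum (\<lambda>_. 1) lam2 \<nu> \<tau> + 2 * of_real pi * \<i> * lam1 \<nu> / \<tau>
       + of_real pi * \<i> * lam2 \<nu> - 2 * of_real pi * \<i> / \<tau> * (lsum (\<lambda>_. 1) lam2 (\<nu> / \<tau>) (- 1 / \<tau>) / \<tau> / \<tau>)
       - (Polygamma 2 (\<nu> / \<tau> + 1) / \<tau> / \<tau> + 1 / \<nu>\<^sup>2) / \<tau> + 1 / \<nu> ^ 3 + intPn 2 \<tau> \<nu> = 0"
  proof -
    have ii: "\<i> * (\<i> * z) = - z" for z by (metis i_squared mult.assoc mult_minus1)
    have q1: "2 * of_real pi * \<i> * lsum (\<lambda>_. 1) lam2 \<nu> \<tau> = - 2 * (A + XP + XM)"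
      unfolding T1 by (simp add: field_simps ii)
    have q2: "2 * of_real pi * \<i> * lam1 \<nu> / \<tau> = (1 / \<nu>\<^sup>2 + S2p + S2m) / \<tau>"
      unfolding lat(1) S2p_def [symmetric] S2m_def [symmetric] by (simp add: ii)
    have q3: "of_real pi * \<i> * lam2 \<nu> = - (1 / \<nu> ^ 3 + S3p + S3m)"
      unfolding lat(2) S3p_def [symmetric] S3m_def [symmetric] by (simp add: ii)
    have q4: "2 * of_real pi * \<i> / \<tau> * (lsum (\<lambda>_. 1) lam2 (\<nu> / \<tau>) (- 1 / \<tau>) / \<tau> / \<tau>) = - 2 * (S3m + XM - XE)"
      unfolding T4 using np(8) by (simp add: power3_eq_cube field_simps ii)
    have q5: "(Polygamma 2 (\<nu> / \<tau> + 1) / \<tau> / \<tau> + 1 / \<nu>\<^sup>2) / \<tau> = - 2 * A + 1 / \<nu>\<^sup>2 / \<tau>"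
      unfolding digamma using np(8) by (simp add: power3_eq_cube add_divide_distrib diff_divide_distrib)
    show ?thesis unfolding q1 q2 q3 q4 q5 T7 by (simp add: add_divide_distrib)
  qed
  then show ?thesis using F1_derivatives(2) [OF \<tau> \<nu>] by simp
qed

subsection \<open>Limits along the imaginary axis\<close>

text \<open>Riemann-Lebesgue: a shift by \<open>pi / y\<close> changes the sign of \<open>cis (y * s)\<close>.\<close>

lemma riemann_lebesgue:
  fixes f :: "real \<Rightarrow> complex" and Y :: "nat \<Rightarrow> real"
  assumes cont: "continuous_on {0<..} f" and c: "c > 0"
    and bound: "\<And>s. s > 0 \<Longrightarrow> norm (f s) \<le> K * exp (- c * s)"
    and Y: "\<And>n. Y n \<noteq> 0" "(\<lambda>n. 1 / Y n) \<longlonglongrightarrow> 0"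
  shows "(\<lambda>n. halfline_integral (\<lambda>s. f s * cis (Y n * s))) \<longlonglongrightarrow> 0"
proof -
  define g where "g = (\<lambda>s. indicat_real {0<..} s *\<^sub>R f s)"
  have K: "K \<ge> 0"
  proof -
    have "0 \<le> norm (f 1)" by simp
    also have "\<dots> \<le> K * exp (- c * 1)" by (rule bound) simp
    finally show ?thesis by (simp add: zero_le_mult_iff)
  qed
  have gb: "norm (g s) \<le> K * exp (- c * s)" if "s > 0" for s using bound [OF that] that by (simp add: g_def)
  have g0: "g s = 0" if "s \<le> 0" for s using that by (simp add: g_def)
  have mg [measurable]: "g \<in> borel_measurable borel"
    using borel_measurable_continuous_on_indicator [OF _ cont] by (simp add: g_def [abs_def])
  have mc [measurable]: "(\<lambda>s. cis (y * s)) \<in> borel_measurable borel" for y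
    by (intro borel_measurable_continuous_onI continuous_intros)
  \<comment> \<open>A majorant for the difference of g and its shift by at most 1: the shift costs
    the factor exp c and may move the support down to -1, and the factor 2 accounts for the two
    summands.\<close>
  define w where "w = (\<lambda>s. indicat_real {0<..} s *\<^sub>R (2 * K * exp c * exp (- c * s)) + indicat_real {-1..0} s *\<^sub>R (2 * K * exp c))"
  have "set_integrable lborel {0<..} (\<lambda>s. 2 * K * exp c * exp (- c * s))"
    by (rule set_integrable_exp_dominated [OF _ c, where K = "2 * K * exp c"])
       (use K in \<open>auto intro!: continuous_intros simp: abs_mult\<close>)
  then have iw: "integrable lborel w"
    unfolding w_def set_integrable_def by (intro Bochner_Integration.integrable_add) auto
  have sb: "norm (g (s + h)) \<le> w s / 2" if h: "\<bar>h\<bar> \<le> 1" for s h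
  proof (cases "s + h > 0")
    case True
    have "norm (g (s + h)) \<le> K * exp (- c * (s + h))" by (rule gb [OF True])
    also have "\<dots> \<le> w s / 2"
    proof (cases "s > 0")
      case True
      have "- c * (s + h) \<le> c + (- c * s)" using c h mult_left_mono [of "- h" 1 c] by (simp add: algebra_simps)
      then have "exp (- c * (s + h)) \<le> exp (c + (- c * s))" by (rule exp_le_cancel_iff [THEN iffD2])
      then have "exp (- c * (s + h)) \<le> exp c * exp (- c * s)" by (simp only: exp_add)
      then have "K * exp (- c * (s + h)) \<le> K * (exp c * exp (- c * s))"
        by (rule mult_left_mono [OF _ K])
      then show ?thesis using True by (simp add: w_def)
    next
      case False
      have "exp (- c * (s + h)) \<le> exp c"
        using c \<open>s + h > 0\<close> by (simp add: less_imp_le order_trans [of _ 0])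
      then show ?thesis using False \<open>s + h > 0\<close> h K by (auto simp: w_def intro: mult_left_mono)
    qed
    finally show ?thesis .
  next
    case False
    then show ?thesis using K by (simp add: g0 w_def)
  qed
  have ig: "integrable lborel g"
    using set_integrable_exp_dominated [OF cont c bound] by (simp add: set_integrable_def g_def)
  have shift: "2 * halfline_integral (\<lambda>s. f s * cis (y * s)) = (LINT s|lborel. (g s - g (s + pi / y)) * cis (y * s))" if y: "y \<noteq> 0" for y
  proof -
    have i1: "integrable lborel (\<lambda>s. g s * cis (y * s))"
      by (rule Bochner_Integration.integrable_bound [OF ig]) (auto simp: norm_mult)
    have i2: "integrable lborel (\<lambda>s. g (s + pi / y) * cis (y * s))"
    proof (rule Bochner_Integration.integrable_bound)
      show "integrable lborel (\<lambda>s. g (pi / y + 1 * s))"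
        by (rule lborel_integrable_real_affine [OF ig]) simp
    qed (auto simp: norm_mult add.commute)
    have e1: "halfline_integral (\<lambda>s. f s * cis (y * s)) = (LINT s|lborel. g s * cis (y * s))"
      by (simp add: halfline_integral_def set_lebesgue_integral_def g_def)
    also have "\<dots> = (LINT s|lborel. g (pi / y + 1 * s) * cis (y * (pi / y + 1 * s)))"
      by (subst lborel_integral_real_affine [where c = 1 and t = "pi / y"]) simp_all
    also have "\<dots> = (LINT s|lborel. - (g (s + pi / y) * cis (y * s)))"
    proof (rule Bochner_Integration.integral_cong [OF refl])
      fix s :: real
      have "y * (pi / y + 1 * s) = pi + y * s" using y by (simp add: field_simps)
      then show "g (pi / y + 1 * s) * cis (y * (pi / y + 1 * s)) = - (g (s + pi / y) * cis (y * s))"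
        by (simp add: cis_mult [symmetric] add.commute)
    qed
    finally have e2: "halfline_integral (\<lambda>s. f s * cis (y * s)) = - (LINT s|lborel. g (s + pi / y) * cis (y * s))"
      by simp
    have "2 * halfline_integral (\<lambda>s. f s * cis (y * s)) = halfline_integral (\<lambda>s. f s * cis (y * s)) + halfline_integral (\<lambda>s. f s * cis (y * s))" by simp
    also have "\<dots> = (LINT s|lborel. g s * cis (y * s)) - (LINT s|lborel. g (s + pi / y) * cis (y * s))"
      by (subst e1, subst e2) simp
    also have "\<dots> = (LINT s|lborel. (g s - g (s + pi / y)) * cis (y * s))"
      using i1 i2 by (simp add: left_diff_distrib)
    finally show ?thesis .
  qed
  have h0: "(\<lambda>n. pi / Y n) \<longlonglongrightarrow> 0" using tendsto_mult_left [OF Y(2), of pi] by simp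
  then have "eventually (\<lambda>n. norm (pi / Y n) < 1) sequentially" by (auto simp: tendsto_iff dist_norm)
  then obtain N where N: "\<And>n. n \<ge> N \<Longrightarrow> norm (pi / Y n) < 1" by (auto simp: eventually_sequentially)
  have "(\<lambda>n. LINT s|lborel. (g s - g (s + pi / Y (n + N))) * cis (Y (n + N) * s)) \<longlonglongrightarrow> (LINT s|(lborel :: real measure). (0 :: complex))"
  proof (rule integral_dominated_convergence [OF _ _ iw])
    show "AE s in lborel. (\<lambda>n. (g s - g (s + pi / Y (n + N))) * cis (Y (n + N) * s)) \<longlonglongrightarrow> 0"
    \<comment> \<open>The cut-off function g can be discontinuous at 0 only, which is a null
      set.\<close>
    proof (rule AE_mp [OF AE_lborel_singleton [of 0]], intro AE_I2 impI)
      fix s :: real assume s: "s \<noteq> 0"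
      have "isCont g s"
      proof (cases "s > 0")
        case True
        then have "isCont f s" using cont by (simp add: continuous_on_eq_continuous_at)
        moreover have "eventually (\<lambda>x. x \<in> {0<..}) (nhds s)" using True by (intro eventually_nhds_in_open) auto
        then have "eventually (\<lambda>x. g x = f x) (nhds s)" by eventually_elim (simp add: g_def)
        ultimately show ?thesis by (simp add: isCont_cong)
      next
        case False
        then have "eventually (\<lambda>x. x \<in> {..<0}) (nhds s)" using s by (intro eventually_nhds_in_open) auto
        then have "eventually (\<lambda>x. g x = 0) (nhds s)" by eventually_elim (simp add: g_def)
        then show ?thesis by (simp add: isCont_cong)
      qed
      have "(\<lambda>n. s + pi / Y (n + N)) \<longlonglongrightarrow> s + 0"
        by (intro tendsto_add tendsto_const LIMSEQ_ignore_initial_segment [OF h0])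
      then have "(\<lambda>n. g (s + pi / Y (n + N))) \<longlonglongrightarrow> g s"
        using isCont_tendsto_compose [OF \<open>isCont g s\<close>] by simp
      then have "(\<lambda>n. g s - g (s + pi / Y (n + N))) \<longlonglongrightarrow> g s - g s" by (intro tendsto_diff tendsto_const)
      then have "(\<lambda>n. norm (g s - g (s + pi / Y (n + N)))) \<longlonglongrightarrow> 0" by (simp add: tendsto_norm_zero)
      then have "(\<lambda>n. norm ((g s - g (s + pi / Y (n + N))) * cis (Y (n + N) * s))) \<longlonglongrightarrow> 0"
        by (simp add: norm_mult)
      then show "(\<lambda>n. (g s - g (s + pi / Y (n + N))) * cis (Y (n + N) * s)) \<longlonglongrightarrow> 0"
        by (rule tendsto_norm_zero_cancel)
    qed
    show "AE s in lborel. norm ((g s - g (s + pi / Y (n + N))) * cis (Y (n + N) * s)) \<le> w s" for n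
    proof (intro AE_I2)
      fix s :: real
      have "norm ((g s - g (s + pi / Y (n + N))) * cis (Y (n + N) * s)) \<le> norm (g s) + norm (g (s + pi / Y (n + N)))"
        by (simp add: norm_mult norm_triangle_ineq4)
      also have "\<dots> \<le> w s / 2 + w s / 2"
        using sb [of 0 s] sb [of "pi / Y (n + N)" s] N [of "n + N"] by (intro add_mono) auto
      finally show "norm ((g s - g (s + pi / Y (n + N))) * cis (Y (n + N) * s)) \<le> w s" by simp
    qed
  qed measurable
  then have "(\<lambda>n. 2 * halfline_integral (\<lambda>s. f s * cis (Y (n + N) * s))) \<longlonglongrightarrow> 0"
    using shift [OF Y(1)] by simp
  then have "(\<lambda>n. 1/2 * (2 * halfline_integral (\<lambda>s. f s * cis (Y (n + N) * s)))) \<longlonglongrightarrow> 1/2 * 0"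
    by (rule tendsto_mult_left)
  then have "(\<lambda>n. halfline_integral (\<lambda>s. f s * cis (Y (n + N) * s))) \<longlonglongrightarrow> 0" by simp
  then show ?thesis by (rule LIMSEQ_offset)
qed

lemma riemann_lebesgue_cosh_sinh:
  fixes f :: "real \<Rightarrow> complex"
  assumes cont: "continuous_on {0<..} f" and c: "c > 0"
    and bound: "\<And>s. s > 0 \<Longrightarrow> norm (f s) \<le> K * exp (- c * s)"
  shows "(\<lambda>n. halfline_integral (\<lambda>s. f s * cosh (\<i> * of_nat (Suc n) * of_real s))) \<longlonglongrightarrow> 0"
    "(\<lambda>n. halfline_integral (\<lambda>s. f s * sinh (\<i> * of_nat (Suc n) * of_real s))) \<longlonglongrightarrow> 0"
proof -
  have lim: "(\<lambda>n. 1 / real (Suc n)) \<longlonglongrightarrow> 0" by (rule LIMSEQ_Suc [OF lim_1_over_n])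
  have p: "(\<lambda>n. halfline_integral (\<lambda>s. f s * cis (real (Suc n) * s))) \<longlonglongrightarrow> 0"
    by (rule riemann_lebesgue [OF cont c bound _ lim]) auto
  have m: "(\<lambda>n. halfline_integral (\<lambda>s. f s * cis (- real (Suc n) * s))) \<longlonglongrightarrow> 0"
  proof (rule riemann_lebesgue [OF cont c bound, where Y = "\<lambda>n. - real (Suc n)"])
    show "(\<lambda>n. 1 / - real (Suc n)) \<longlonglongrightarrow> 0" using tendsto_minus [OF lim] by (simp del: of_nat_Suc)
  qed auto
  have i: "set_integrable lborel {0<..} (\<lambda>s. f s * cis (y * s))" for y
    by (rule set_integrable_exp_dominated [OF _ c, where K = K])
       (use cont bound in \<open>auto intro!: continuous_intros simp: norm_mult\<close>)
  have ch: "f s * cosh (\<i> * of_nat (Suc n) * of_real s) = 1/2 * (f s * cis (real (Suc n) * s) + f s * cis (- real (Suc n) * s))"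
    and sh: "f s * sinh (\<i> * of_nat (Suc n) * of_real s) = 1/2 * (f s * cis (real (Suc n) * s) - f s * cis (- real (Suc n) * s))" for n s
    by (simp_all add: cosh_def sinh_def cis_conv_exp scaleR_conv_of_real algebra_simps)
  have e: "halfline_integral (\<lambda>s. f s * cosh (\<i> * of_nat (Suc n) * of_real s)) =
      1/2 * (halfline_integral (\<lambda>s. f s * cis (real (Suc n) * s)) + halfline_integral (\<lambda>s. f s * cis (- real (Suc n) * s)))"
     "halfline_integral (\<lambda>s. f s * sinh (\<i> * of_nat (Suc n) * of_real s)) =
      1/2 * (halfline_integral (\<lambda>s. f s * cis (real (Suc n) * s)) - halfline_integral (\<lambda>s. f s * cis (- real (Suc n) * s)))" for n
    unfolding ch sh halfline_integral_def
    by (simp_all only: set_integral_mult_right set_integral_add(2) [OF i i] set_integral_diff(2) [OF i i])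
  show "(\<lambda>n. halfline_integral (\<lambda>s. f s * cosh (\<i> * of_nat (Suc n) * of_real s))) \<longlonglongrightarrow> 0"
    unfolding e(1) using tendsto_mult_left [OF tendsto_add [OF p m], of "1/2"] by (simp only: add_0_left mult_zero_right)
  show "(\<lambda>n. halfline_integral (\<lambda>s. f s * sinh (\<i> * of_nat (Suc n) * of_real s))) \<longlonglongrightarrow> 0"
    unfolding e(2) using tendsto_mult_left [OF tendsto_diff [OF p m], of "1/2"] by (simp only: diff_self mult_zero_right)
qed

text \<open>This is the error of the trapezoidal rule for the integral of 1 / z from w to w + 1. As
  a function of the length t of the interval it has derivative t^2 / (2 w (w + t)^2), and norm (w +
  t) \<ge> norm w.\<close>

lemma trapezoid_inverse_bound:
  fixes w :: complex
  assumes w: "Re w > 0"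
  shows "norm ((1 / w + 1 / (w + 1)) / 2 - (Ln (w + 1) - Ln w)) \<le> 1 / (2 * norm w ^ 3)"
proof -
  define h where "h = (\<lambda>t. t * (1 / w + 1 / (w + t)) / 2 - (Ln (w + t) - Ln w))"
  define h' where "h' = (\<lambda>t. t\<^sup>2 / (2 * w * (w + t)\<^sup>2))"
  have "norm (h 1 - h 0) \<le> 1 / (2 * norm w ^ 3) * norm (1 - 0 :: complex)"
  proof (rule field_differentiable_bound [of "closed_segment 0 1" h h'])
    fix t :: complex assume "t \<in> closed_segment 0 1"
    then obtain x where x: "0 \<le> x" "x \<le> 1" "t = of_real x" by (auto simp: in_segment scaleR_conv_of_real)
    have Re: "Re (w + t) > 0" using w x by simp
    have nR: "w + t \<notin> \<real>\<^sub>\<le>\<^sub>0" using Re by (auto simp: complex_nonpos_Reals_iff)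
    then have nz: "w + t \<noteq> 0" "w \<noteq> 0" "w + t \<notin> \<real>\<^sub>\<le>\<^sub>0" using w by auto
    have d1: "((\<lambda>t. 1 / (w + t)) has_field_derivative - 1 / (w + t)\<^sup>2) (at t within closed_segment 0 1)"
      using nz by (auto intro!: derivative_eq_intros simp: power2_eq_square)
    have d2: "((\<lambda>t. Ln (w + t)) has_field_derivative 1 / (w + t)) (at t within closed_segment 0 1)"
      using nz by (auto intro!: derivative_eq_intros simp: inverse_eq_divide)
    have "(h has_field_derivative (1 * (1 / w + 1 / (w + t)) + (0 + - 1 / (w + t)\<^sup>2) * t) / 2 - (1 / (w + t) - 0)) (at t within closed_segment 0 1)"
      unfolding h_def by (intro DERIV_diff DERIV_cdivide DERIV_mult DERIV_add DERIV_ident DERIV_const d1 d2)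
    also have "(1 * (1 / w + 1 / (w + t)) + (0 + - 1 / (w + t)\<^sup>2) * t) / 2 - (1 / (w + t) - 0) = h' t"
    proof -
      define v where "v = w + t"
      have t: "t = v - w" by (simp add: v_def)
      have "v \<noteq> 0" using nz by (simp add: v_def)
      then have "(1 * (1 / w + 1 / v) + (0 + - 1 / v\<^sup>2) * (v - w)) / 2 - (1 / v - 0) = (v - w)\<^sup>2 / (2 * w * v\<^sup>2)"
        using nz(2) by (simp add: field_simps power2_eq_square)
      then show ?thesis by (simp add: h'_def v_def)
    qed
    finally show "(h has_field_derivative h' t) (at t within closed_segment 0 1)" .
    have "norm w \<le> norm (w + t)"
    proof (rule power2_le_imp_le)
      have "(Re w)\<^sup>2 \<le> (Re w + x)\<^sup>2" using w x by (intro power_mono) auto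
      then show "(norm w)\<^sup>2 \<le> (norm (w + t))\<^sup>2" using x by (simp add: cmod_power2)
    qed simp
    have "norm (h' t) = x\<^sup>2 / (2 * norm w * norm (w + t) ^ 2)"
      using x by (simp add: h'_def norm_divide norm_mult norm_power)
    also have "\<dots> \<le> 1 / (2 * norm w * norm w ^ 2)"
    proof (rule frac_le)
      show "x\<^sup>2 \<le> 1" using x by (simp add: power_le_one)
      show "2 * norm w * norm w ^ 2 \<le> 2 * norm w * norm (w + t) ^ 2"
        using \<open>norm w \<le> norm (w + t)\<close> by (intro mult_left_mono power_mono) auto
      show "0 < 2 * norm w * norm w ^ 2" using nz by simp
    qed simp
    also have "\<dots> = 1 / (2 * norm w ^ 3)" by (simp add: power2_eq_square power3_eq_cube)
    finally show "norm (h' t) \<le> 1 / (2 * norm w ^ 3)" .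
  qed auto
  moreover have "h 1 - h 0 = (1 / w + 1 / (w + 1)) / 2 - (Ln (w + 1) - Ln w)" by (simp add: h_def)
  ultimately show ?thesis by simp
qed

text \<open>The trapezoidal errors over the unit steps from z, z + 1, ... add up to Ln z + 1 / (2 z)
  - Digamma (z + 1), and their bounds telescope. Quadratic decay is needed for the second identity,
  where the digamma term is multiplied by \<nu>.\<close>

lemma Digamma_asymptotic_bound:
  fixes z :: complex
  assumes z: "Re z > 0" "norm z > 1"
  shows "norm (Digamma (z + 1) - Ln z - 1 / (2 * z)) \<le> 1 / (norm z * (norm z - 1))"
proof -
  define R where "R = norm z"
  have R: "R > 1" using z by (simp add: R_def)
  define g where "g = (\<lambda>k. (1 / (z + of_nat k) + 1 / (z + of_nat (Suc k))) / 2 - (Ln (z + of_nat (Suc k)) - Ln (z + of_nat k)))"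
  have nz: "z \<noteq> 0" using z by auto
  have gb: "norm (g k) \<le> 1 / R * (1 / (R + real k - 1) - 1 / (R + real (Suc k) - 1))" for k
  proof -
    have Re: "Re (z + of_nat k) > 0" using z by simp
    have "norm (g k) \<le> 1 / (2 * norm (z + of_nat k) ^ 3)"
      using trapezoid_inverse_bound [OF Re] by (simp add: g_def add_ac)
    also have "\<dots> \<le> 1 / (R * (R + real k) ^ 2)"
    proof (rule frac_le)
      \<comment> \<open>As Re z > 0, norm (z + k)^2 \<ge> R^2 + k^2 \<ge> (R + k)^2 / 2; this uses
        up the factor 2 of the preceding bound.\<close>
      have sq: "(norm (z + of_nat k))\<^sup>2 \<ge> R\<^sup>2 + (real k)\<^sup>2"
        using z by (simp add: R_def cmod_power2 power2_sum)
      have "R\<^sup>2 \<le> (norm (z + of_nat k))\<^sup>2" using sq by (rule order_trans [rotated]) simp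
      then have n1: "R \<le> norm (z + of_nat k)" by (rule power2_le_imp_le) simp
      have "(R + real k)\<^sup>2 \<le> 2 * (R\<^sup>2 + (real k)\<^sup>2)"
        using sum_squares_ge_zero [of "R - real k" 0] by (simp add: power2_eq_square algebra_simps)
      then have "R * (R + real k)\<^sup>2 \<le> norm (z + of_nat k) * (2 * (norm (z + of_nat k))\<^sup>2)"
        using n1 sq R by (intro mult_mono) auto
      then show "R * (R + real k)\<^sup>2 \<le> 2 * norm (z + of_nat k) ^ 3" by (simp add: power2_eq_square power3_eq_cube)
      show "0 < R * (R + real k)\<^sup>2" using R by (intro mult_pos_pos zero_less_power) auto
    qed auto
    also have "\<dots> = 1 / R * (1 / (R + real k) ^ 2)" by simp
    also have "\<dots> \<le> 1 / R * (1 / (R + real k - 1) - 1 / (R + real (Suc k) - 1))"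
    proof (rule mult_left_mono)
      define x where "x = R + real k"
      have x: "x > 1" using R by (simp add: x_def)
      have "1 / x ^ 2 \<le> 1 / ((x - 1) * x)" using x by (intro frac_le) (auto simp: power2_eq_square)
      also have "\<dots> = 1 / (x - 1) - 1 / x" using x by (simp add: field_simps)
      finally show "1 / (R + real k) ^ 2 \<le> 1 / (R + real k - 1) - 1 / (R + real (Suc k) - 1)" by (simp add: x_def add_ac)
    qed (use R in simp)
    finally show ?thesis .
  qed
  define a where "a = (\<lambda>k. inverse (z + of_nat k))"
  define L where "L = (\<lambda>k. Ln (z + of_nat k))"
  have ga: "g k = (a k + a (Suc k)) / 2 - (L (Suc k) - L k)" for k
    by (simp add: g_def a_def L_def inverse_eq_divide)
  have s0: "(\<Sum>k<m. g k) = (\<Sum>k<m. a k) - a 0 / 2 + a m / 2 - (L m - L 0)" for m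
  proof (induction m)
    case (Suc m)
    have "(\<Sum>k<Suc m. g k) = (\<Sum>k<m. a k) - a 0 / 2 + a m / 2 - (L m - L 0) + g m" using Suc by simp
    also have "g m = (a m + a (Suc m)) / 2 - (L (Suc m) - L m)" by (rule ga)
    finally have F: "(\<Sum>k<Suc m. g k) = (\<Sum>k<m. a k) - a 0 / 2 + a m / 2 - (L m - L 0)
      + ((a m + a (Suc m)) / 2 - (L (Suc m) - L m))" .
    have R: "(\<Sum>k<Suc m. a k) = (\<Sum>k<m. a k) + a m" by simp
    show ?case unfolding F R by (simp add: field_simps)
  qed simp
  have am: "a m / 2 = 1 / (2 * (z + of_nat m))" for m
    by (simp only: a_def inverse_eq_divide divide_divide_eq_left mult.commute)
  have sum_g: "(\<Sum>k<m. g k) = (\<Sum>k<m. inverse (z + of_nat k)) - 1 / (2 * z) + 1 / (2 * (z + of_nat m)) - (Ln (z + of_nat m) - Ln z)" for m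
    unfolding s0 am by (simp add: a_def L_def)
  have lim: "(\<lambda>m. \<Sum>k<m. g k) \<longlonglongrightarrow> - (Digamma (z + 1) - Ln z - 1 / (2 * z))"
  proof -
    have l1: "(\<lambda>m. of_real (ln (real m)) - (\<Sum>k<m. inverse (z + of_nat k))) \<longlonglongrightarrow> Digamma z"
      by (rule Digamma_LIMSEQ [OF nz])
    have l2: "(\<lambda>m. 1 / (z + of_nat m)) \<longlonglongrightarrow> 0"
      by (rule tendsto_divide_0 [OF tendsto_const tendsto_add_filterlim_at_infinity [OF tendsto_const tendsto_of_nat]])
    have l3: "(\<lambda>m. Ln (z + of_nat m) - of_real (ln (real m))) \<longlonglongrightarrow> 0"
    proof -
      have "(\<lambda>m. 1 + z * (1 / of_nat m)) \<longlonglongrightarrow> 1 + z * 0"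
        by (intro tendsto_add tendsto_mult tendsto_const lim_1_over_n)
      then have "(\<lambda>m. Ln (1 + z * (1 / of_nat m))) \<longlonglongrightarrow> Ln 1"
        by (intro tendsto_Ln) (auto simp: complex_nonpos_Reals_iff)
      moreover have "eventually (\<lambda>m. Ln (1 + z * (1 / of_nat m)) = Ln (z + of_nat m) - of_real (ln (real m))) sequentially"
        using eventually_gt_at_top [of 0]
      proof eventually_elim
        case (elim m)
        have "1 + z * (1 / of_nat m) = (z + of_nat m) / of_real (real m)" using elim by (simp add: field_simps)
        moreover have "Ln ((z + of_nat m) / of_real (real m)) = Ln (z + of_nat m) - of_real (ln (real m))"
        proof -
          have "z + of_nat m \<noteq> 0" using z by (auto simp: complex_eq_iff)
          moreover have "real m > 0" using elim by simp
          ultimately show ?thesis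
            using Ln_divide_of_real [of "real m" "z + of_nat m"] Ln_of_real [of "real m"] by (metis of_real_of_nat_eq)
        qed
        ultimately show ?case by (simp only:)
      qed
      ultimately show ?thesis using Lim_transform_eventually by fastforce
    qed
    have "(\<lambda>m. - (of_real (ln (real m)) - (\<Sum>k<m. inverse (z + of_nat k))) - 1 / (2 * z) + 1 / 2 * (1 / (z + of_nat m))
         - (Ln (z + of_nat m) - of_real (ln (real m))) + Ln z)
        \<longlonglongrightarrow> - Digamma z - 1 / (2 * z) + 1 / 2 * 0 - 0 + Ln z"
      by (intro tendsto_intros l1 l2 l3)
    moreover have "- (of_real (ln (real m)) - (\<Sum>k<m. inverse (z + of_nat k))) - 1 / (2 * z) + 1 / 2 * (1 / (z + of_nat m))
         - (Ln (z + of_nat m) - of_real (ln (real m))) + Ln z = (\<Sum>k<m. g k)" for m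
      unfolding sum_g by simp
    moreover have "- Digamma z - 1 / (2 * z) + 1 / 2 * 0 - 0 + Ln z = - (Digamma (z + 1) - Ln z - 1 / (2 * z))"
    proof -
      have "1 / z = 1 / (2 * z) + 1 / (2 * z)" by (simp add: field_simps)
      then have d: "Digamma (z + 1) = Digamma z + (1 / (2 * z) + 1 / (2 * z))" by (simp only: Digamma_plus1 [OF nz])
      show ?thesis unfolding d by simp
    qed
    ultimately show ?thesis by (simp only:)
  qed
  have "norm (\<Sum>k<m. g k) \<le> 1 / (R * (R - 1))" for m
  proof -
    have T: "(\<Sum>k<m. 1 / (R + real k - 1) - 1 / (R + real (Suc k) - 1)) = 1 / (R + real 0 - 1) - 1 / (R + real m - 1)"
      by (rule sum_lessThan_telescope')
    have "norm (\<Sum>k<m. g k) \<le> (\<Sum>k<m. 1 / R * (1 / (R + real k - 1) - 1 / (R + real (Suc k) - 1)))"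
      by (rule sum_norm_le) (rule gb)
    also have "\<dots> = 1 / R * (1 / (R - 1) - 1 / (R + real m - 1))"
      unfolding sum_distrib_left [symmetric] T by simp
    also have "\<dots> \<le> 1 / R * (1 / (R - 1))" using R by (intro mult_left_mono) auto
    finally show ?thesis by simp
  qed
  then have "norm (- (Digamma (z + 1) - Ln z - 1 / (2 * z))) \<le> 1 / (R * (R - 1))"
    by (intro tendsto_upperbound [OF tendsto_norm [OF lim]]) auto
  then show ?thesis unfolding norm_minus_cancel R_def .
qed

section \<open>The dilogarithm, and the limits of the single terms\<close>

lemma dilog_series_derivative:
  assumes x: "norm x < 1"
  shows "x \<noteq> 0 \<Longrightarrow> (dilog_series has_field_derivative - Ln (1 - x) / x) (at x)" "isCont dilog_series 0" "dilog_series 0 = 0"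
proof -
  \<comment> \<open>The coefficient at n = 0 is 1 / 0 = 0, so the series from 0 has the same sum as
    \<open>dilog_series\<close>, which starts at exponent 1.\<close>
  define c :: "nat \<Rightarrow> complex" where "c = (\<lambda>n. 1 / of_nat (n\<^sup>2))"
  have sm: "summable (\<lambda>n. c n * 1 ^ n)"
  proof -
    have "summable (\<lambda>n. norm (c n))"
      using inverse_power_summable [of 2, where 'a = real] by (simp add: c_def norm_divide norm_power inverse_eq_divide)
    then show ?thesis by (simp add: summable_norm_cancel)
  qed
  have S: "dilog_series y = (\<Sum>n. c n * y ^ n)" if "norm y < 1" for y
  proof -
    have "summable (\<lambda>n. c n * y ^ n)" by (rule powser_inside [OF sm]) (use that in simp)
    from suminf_split_head [OF this] show ?thesis
      by (simp add: dilog_series_def c_def)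
  qed
  have der: "(dilog_series has_field_derivative (\<Sum>n. diffs c n * y ^ n)) (at y)" if y: "norm y < 1" for y
  proof (rule has_field_derivative_transform_within_open [OF termdiffs_strong [OF sm]])
    show "open (ball (0::complex) 1)" by simp
  qed (use y S in auto)
  have dc: "diffs c n = 1 / of_nat (Suc n)" for n
    by (simp add: diffs_def c_def power2_eq_square del: of_nat_Suc)
  show "isCont dilog_series 0" using der [of 0] by (auto intro: DERIV_isCont)
  show "dilog_series 0 = 0" by (simp add: dilog_series_def)
  assume x0: "x \<noteq> 0"
  have "(\<lambda>n. - ((- (- x)) ^ n) / of_nat n) sums Ln (1 + - x)" by (rule Ln_series') (use x in simp)
  from sums_minus [OF this] have "(\<lambda>n. x ^ n / of_nat n) sums (- Ln (1 - x))" by simp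
  then have "(\<lambda>n. x ^ Suc n / of_nat (Suc n)) sums (- Ln (1 - x))" by (subst sums_Suc_iff) simp
  then have "(\<lambda>n. (1 / x) * (x ^ Suc n / of_nat (Suc n))) sums ((1 / x) * - Ln (1 - x))" by (rule sums_mult)
  moreover have "(1 / x) * (x ^ Suc n / of_nat (Suc n)) = diffs c n * x ^ n" for n using x0 by (simp add: dc)
  ultimately have "(\<Sum>n. diffs c n * x ^ n) = - Ln (1 - x) / x" by (simp add: sums_iff)
  then show "(dilog_series has_field_derivative - Ln (1 - x) / x) (at x)" using der [OF x] by simp
qed

lemma has_field_derivative_dilog_qexp:
  assumes "Im \<nu> > 0"
  shows "((\<lambda>\<nu>. dilog_series (qexp \<nu>)) has_field_derivative - (2 * of_real pi * \<i>) * Ln (1 - qexp \<nu>)) (at \<nu>)"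
proof -
  have n: "norm (qexp \<nu>) < 1" using assms by (simp add: norm_qexp)
  have "((\<lambda>\<nu>. dilog_series (qexp \<nu>)) has_field_derivative (- Ln (1 - qexp \<nu>) / qexp \<nu>) * (2 * of_real pi * \<i> * 1 * qexp \<nu>)) (at \<nu>)"
    by (rule DERIV_chain2 [OF dilog_series_derivative(1) [OF n] has_field_derivative_qexp [OF DERIV_ident]]) simp
  then show ?thesis by (simp add: mult_ac)
qed

text \<open>Every term carries the factor \<open>qexp u\<close>, so the constant depends on the
  weights and on \<omega> only.\<close>

lemma norm_lsum_lam0_le:
  assumes \<omega>: "Im \<omega> > 0" and w: "\<And>k. norm (w k) \<le> real (Suc k)"
  obtains C where "C \<ge> 0" "\<And>u. norm (qexp u) \<le> 1/2 \<Longrightarrow> norm (lsum w lam0 u \<omega>) \<le> C * norm (qexp u)"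
proof -
  define r where "r = norm (qexp \<omega>)"
  have r: "0 < r" "r < 1" using \<omega> by (auto simp: r_def norm_qexp)
  have s: "summable (\<lambda>k. real (Suc k) * r ^ k)" using sums_summable [OF geometric_deriv_sums [of r]] r by simp
  define C where "C = 2 * (\<Sum>k. real (Suc k) * r ^ k)"
  show ?thesis
  proof (rule that [of C])
    show "C \<ge> 0" unfolding C_def using r by (intro mult_nonneg_nonneg suminf_nonneg s) auto
    fix u assume u: "norm (qexp u) \<le> 1/2"
    have le: "norm (w k * lam0 (u + of_nat (Suc k) * \<omega>)) \<le> 2 * norm (qexp u) * (real (Suc k) * r ^ k)" for k
    proof -
      have eq: "norm (qexp (u + of_nat (Suc k) * \<omega>)) = norm (qexp u) * r ^ Suc k"
        by (simp only: qexp_add qexp_of_nat_mult norm_mult norm_power r_def)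
      have "r ^ Suc k \<le> r ^ k" using r by (simp add: mult_left_le_one_le)
      moreover have "r ^ k \<le> 1" using r by (simp add: power_le_one)
      ultimately have le1: "norm (qexp (u + of_nat (Suc k) * \<omega>)) \<le> norm (qexp u) * r ^ k" "norm (qexp u) * r ^ k \<le> norm (qexp u) * 1"
        unfolding eq by (auto intro!: mult_left_mono)
      then have "norm (lam0 (u + of_nat (Suc k) * \<omega>)) \<le> 2 * norm (qexp (u + of_nat (Suc k) * \<omega>))"
        using u by (intro norm_lam0_le) linarith
      also have "\<dots> \<le> 2 * (norm (qexp u) * r ^ k)" using le1 by simp
      finally have "norm (w k) * norm (lam0 (u + of_nat (Suc k) * \<omega>)) \<le> real (Suc k) * (2 * (norm (qexp u) * r ^ k))"
        using w by (intro mult_mono) auto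
      then show ?thesis by (simp add: norm_mult mult_ac del: of_nat_Suc)
    qed
    have s': "summable (\<lambda>k. 2 * norm (qexp u) * (real (Suc k) * r ^ k))" by (rule summable_mult [OF s])
    have "norm (lsum w lam0 u \<omega>) \<le> (\<Sum>k. norm (w k * lam0 (u + of_nat (Suc k) * \<omega>)))"
      unfolding lsum_def by (rule summable_norm, rule summable_comparison_test' [OF s']) (use le in auto)
    also have "\<dots> \<le> (\<Sum>k. 2 * norm (qexp u) * (real (Suc k) * r ^ k))"
      by (intro suminf_le le s' summable_comparison_test' [OF s']) (use le in auto)
    also have "\<dots> = C * norm (qexp u)" by (subst suminf_mult [OF s]) (simp add: C_def)
    finally show "norm (lsum w lam0 u \<omega>) \<le> C * norm (qexp u)" .
  qed
qed

lemma qexp_ray_tendsto_0: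
  assumes "Im c > 0"
  shows "(\<lambda>n. of_nat (Suc n) * qexp (of_nat (Suc n) * c)) \<longlonglongrightarrow> 0"
proof -
  define r where "r = norm (qexp c)"
  have r: "norm r < 1" using assms by (simp add: r_def norm_qexp)
  have "(\<lambda>n. of_nat n * r ^ n) \<longlonglongrightarrow> 0" using powser_times_n_limit_0 [OF r] by simp
  then have "(\<lambda>n. of_nat (Suc n) * r ^ Suc n) \<longlonglongrightarrow> 0" by (rule LIMSEQ_Suc)
  moreover have "norm (of_nat (Suc n) * qexp (of_nat (Suc n) * c)) = of_nat (Suc n) * r ^ Suc n" for n
    by (simp only: norm_mult norm_of_nat qexp_of_nat_mult norm_power r_def)
  ultimately have "(\<lambda>n. norm (of_nat (Suc n) * qexp (of_nat (Suc n) * c))) \<longlonglongrightarrow> 0" by (simp only:)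
  then show ?thesis by (rule tendsto_norm_zero_cancel)
qed

text \<open>The version with the factor n is for the term of the second identity in which \<nu>
  multiplies the dual series.\<close>

lemma lsum_ray_tendsto_0:
  assumes c: "Im c > 0" and \<omega>: "Im \<omega> > 0" and w: "\<And>k. norm (w k) \<le> real (Suc k)"
  shows "(\<lambda>n. of_nat (Suc n) * lsum w lam0 (of_nat (Suc n) * c) \<omega>) \<longlonglongrightarrow> 0"
    "(\<lambda>n. lsum w lam0 (of_nat (Suc n) * c) \<omega>) \<longlonglongrightarrow> 0"
proof -
  obtain C where C: "C \<ge> 0" "\<And>u. norm (qexp u) \<le> 1/2 \<Longrightarrow> norm (lsum w lam0 u \<omega>) \<le> C * norm (qexp u)"
    using norm_lsum_lam0_le [where w = w, OF \<omega> w] by blast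
  note q = qexp_ray_tendsto_0 [OF c]
  have q': "(\<lambda>n. C * norm (of_nat (Suc n) * qexp (of_nat (Suc n) * c))) \<longlonglongrightarrow> C * 0"
    by (intro tendsto_mult tendsto_const tendsto_norm_zero q)
  have ev: "eventually (\<lambda>n. norm (of_nat (Suc n) * qexp (of_nat (Suc n) * c)) < 1/2) sequentially"
    using order_tendstoD(2) [OF tendsto_norm_zero [OF q], of "1/2"] by simp
  have ge: "norm x \<le> norm (of_nat (Suc n) * x)" for x :: complex and n
  proof -
    have "1 * norm x \<le> real (Suc n) * norm x" by (intro mult_right_mono) auto
    then show ?thesis by (simp only: norm_mult norm_of_nat mult_1_left)
  qed
  have b: "eventually (\<lambda>n. norm (of_nat (Suc n) * lsum w lam0 (of_nat (Suc n) * c) \<omega>) \<le> C * norm (of_nat (Suc n) * qexp (of_nat (Suc n) * c))) sequentially"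
    using ev
  proof eventually_elim
    case (elim n)
    have "norm (qexp (of_nat (Suc n) * c)) \<le> 1/2" using ge [of "qexp (of_nat (Suc n) * c)" n] elim by linarith
    then have "norm (lsum w lam0 (of_nat (Suc n) * c) \<omega>) \<le> C * norm (qexp (of_nat (Suc n) * c))" by (rule C(2))
    then have "real (Suc n) * norm (lsum w lam0 (of_nat (Suc n) * c) \<omega>) \<le> real (Suc n) * (C * norm (qexp (of_nat (Suc n) * c)))"
      by (intro mult_left_mono) auto
    then show ?case by (simp only: norm_mult norm_of_nat mult_ac)
  qed
  show 1: "(\<lambda>n. of_nat (Suc n) * lsum w lam0 (of_nat (Suc n) * c) \<omega>) \<longlonglongrightarrow> 0"
    using q' by (intro Lim_null_comparison [OF b]) simp
  show "(\<lambda>n. lsum w lam0 (of_nat (Suc n) * c) \<omega>) \<longlonglongrightarrow> 0"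
    by (rule Lim_null_comparison [OF _ tendsto_norm_zero [OF 1]]) (use ge in auto)
qed

text \<open>The first limit reflects the summand 1 / (2 z) of the asymptotic expansion and cancels -
  1 / (2 \<tau>) in \<open>F2\<close>; the second is the one for \<open>F1\<close>.\<close>

lemma Digamma_ray_limit:
  assumes c: "Re c > 0"
  shows "(\<lambda>n. of_nat (Suc n) * c * (Digamma (of_nat (Suc n) * c + 1) - Ln (of_nat (Suc n) * c))) \<longlonglongrightarrow> 1/2"
    "(\<lambda>n. Digamma (of_nat (Suc n) * c + 1) - Ln (of_nat (Suc n) * c)) \<longlonglongrightarrow> 0"
proof -
  define z where "z = (\<lambda>n. of_nat (Suc n) * c)"
  have c0: "c \<noteq> 0" using c by auto
  have Rez: "Re (z n) > 0" for n using c by (simp add: z_def)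
  have nz: "filterlim (\<lambda>n. norm (z n)) at_top sequentially"
  proof -
    have "filterlim (\<lambda>n. norm c * real (Suc n)) at_top sequentially"
      by (rule filterlim_tendsto_pos_mult_at_top [OF tendsto_const _ filterlim_compose [OF filterlim_real_sequentially filterlim_Suc]])
         (use c0 in simp)
    then show ?thesis by (simp add: z_def norm_mult mult.commute del: of_nat_Suc)
  qed
  define d where "d = (\<lambda>n. Digamma (z n + 1) - Ln (z n))"
  have b: "eventually (\<lambda>n. norm (z n * d n - 1/2) \<le> 1 / (norm (z n) - 1)) sequentially"
  proof -
    have "eventually (\<lambda>n. norm (z n) > 1) sequentially" using nz by (simp add: filterlim_at_top_dense)
    then show ?thesis
    proof eventually_elim
      case (elim n)
      have "z n \<noteq> 0" using Rez [of n] by auto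
      then have "z n * d n - 1/2 = z n * (Digamma (z n + 1) - Ln (z n) - 1 / (2 * z n))" by (simp add: d_def field_simps)
      then have "norm (z n * d n - 1/2) = norm (z n) * norm (Digamma (z n + 1) - Ln (z n) - 1 / (2 * z n))" by (simp only: norm_mult)
      also have "\<dots> \<le> norm (z n) * (1 / (norm (z n) * (norm (z n) - 1)))"
        by (intro mult_left_mono Digamma_asymptotic_bound Rez elim) auto
      also have "\<dots> = 1 / (norm (z n) - 1)" using \<open>z n \<noteq> 0\<close> by simp
      finally show ?case .
    qed
  qed
  have "filterlim (\<lambda>n. - 1 + norm (z n)) at_top sequentially"
    by (rule filterlim_tendsto_add_at_top [OF tendsto_const nz])
  then have "(\<lambda>n. inverse (- 1 + norm (z n))) \<longlonglongrightarrow> 0" by (rule tendsto_inverse_0_at_top)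
  then have "(\<lambda>n. 1 / (norm (z n) - 1)) \<longlonglongrightarrow> 0" by (simp add: inverse_eq_divide)
  then have "(\<lambda>n. z n * d n - 1/2) \<longlonglongrightarrow> 0" by (rule Lim_null_comparison [OF b])
  then have 1: "(\<lambda>n. z n * d n) \<longlonglongrightarrow> 1/2" by (rule LIM_zero_cancel)
  then show "(\<lambda>n. of_nat (Suc n) * c * (Digamma (of_nat (Suc n) * c + 1) - Ln (of_nat (Suc n) * c))) \<longlonglongrightarrow> 1/2"
    unfolding d_def z_def .
  have "filterlim z at_infinity sequentially" using nz by (rule filterlim_norm_at_top_imp_at_infinity)
  then have "(\<lambda>n. (z n * d n) / z n) \<longlonglongrightarrow> 0" by (rule tendsto_divide_0 [OF 1])
  moreover have "(z n * d n) / z n = d n" for n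
  proof -
    have "z n \<noteq> 0" using Rez [of n] by (metis less_irrefl zero_complex.sel(1))
    then show ?thesis by simp
  qed
  ultimately have "d \<longlonglongrightarrow> 0" by (simp only:)
  then show "(\<lambda>n. Digamma (of_nat (Suc n) * c + 1) - Ln (of_nat (Suc n) * c)) \<longlonglongrightarrow> 0"
    unfolding d_def z_def .
qed

lemma imaginary_ray:
  fixes \<tau> :: complex
  assumes \<tau>: "Re \<tau> > 0" "Im \<tau> > 0"
  shows "\<i> * of_nat (Suc n) \<in> strip_domain" "\<i> * of_nat (Suc n) / \<tau> = of_nat (Suc n) * (\<i> / \<tau>)"
    "Re (\<i> / \<tau>) > 0" "Im (\<i> / \<tau>) > 0" "Im (- 1 / \<tau>) > 0" "\<i> * of_nat (Suc n) = of_nat (Suc n) * \<i>"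
  using \<tau> by (auto simp: strip_domain_def Re_divide Im_divide sum_power2_gt_zero_iff)

lemma tendsto_const_over_Suc: "(\<lambda>n. c / (of_nat (Suc n) * d)) \<longlonglongrightarrow> (0 :: complex)"
proof -
  have "(\<lambda>n. (c / d) * (1 / of_nat (Suc n))) \<longlonglongrightarrow> (c / d) * 0"
    by (intro tendsto_mult tendsto_const LIMSEQ_Suc [OF lim_1_over_n])
  then show ?thesis by (simp add: field_simps)
qed

lemma qexp_ii_tendsto_0: "(\<lambda>n. qexp (of_nat (Suc n) * \<i>)) \<longlonglongrightarrow> 0"
proof (rule Lim_null_comparison [OF _ tendsto_norm_zero [OF qexp_ray_tendsto_0 [of \<i>]]])
  show "eventually (\<lambda>n. norm (qexp (of_nat (Suc n) * \<i>)) \<le> norm (of_nat (Suc n) * qexp (of_nat (Suc n) * \<i>))) sequentially"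
  proof (intro always_eventually allI)
    fix n
    have "1 * norm (qexp (of_nat (Suc n) * \<i>)) \<le> real (Suc n) * norm (qexp (of_nat (Suc n) * \<i>))"
      by (intro mult_right_mono) auto
    then show "norm (qexp (of_nat (Suc n) * \<i>)) \<le> norm (of_nat (Suc n) * qexp (of_nat (Suc n) * \<i>))"
      by (simp only: norm_mult norm_of_nat mult_1_left)
  qed
qed simp

lemma kerPn_0_bound:
  assumes \<tau>: "Re \<tau> > 0"
  obtains c K where "c > 0" "\<And>s. s > 0 \<Longrightarrow> norm (kerPn 0 \<tau> 0 s) \<le> K * exp (- c * s)"
proof -
  obtain r c K where "r > 0" "c > 0"
    "\<And>t v. t \<in> ball \<tau> r \<Longrightarrow> v \<in> ball 0 r \<Longrightarrow> Re t > 0 \<and> \<bar>Re v\<bar> < 1"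
    "\<And>t v s. t \<in> ball \<tau> r \<Longrightarrow> v \<in> ball 0 r \<Longrightarrow> s > 0 \<Longrightarrow> norm (kerP t v s) \<le> K * exp (- c * s)"
    "\<And>t v s n. t \<in> ball \<tau> r \<Longrightarrow> v \<in> ball 0 r \<Longrightarrow> s > 0 \<Longrightarrow> n \<le> 2 \<Longrightarrow> norm (kerPn n t v s) \<le> K * exp (- c * s)"
    "\<And>t v s. t \<in> ball \<tau> r \<Longrightarrow> v \<in> ball 0 r \<Longrightarrow> s > 0 \<Longrightarrow> norm (kerPt t v s) \<le> K * exp (- c * s)"
    "\<And>t v s. t \<in> ball \<tau> r \<Longrightarrow> v \<in> ball 0 r \<Longrightarrow> s > 0 \<Longrightarrow> norm (kerPtn t v s) \<le> K * exp (- c * s)"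
    by (rule kernel_bounds [OF \<tau>, of 0]) (simp, rule that)
  then show ?thesis by (intro that [of c K]) auto
qed

text \<open>At \<nu> = i y the kernel is its value at \<nu> = 0 times cos (y s), so only the
  oscillating factor depends on y.\<close>

lemma intPn_0_ray_tendsto_0:
  assumes \<tau>: "Re \<tau> > 0"
  shows "(\<lambda>n. intPn 0 \<tau> (\<i> * of_nat (Suc n))) \<longlonglongrightarrow> 0"
proof -
  obtain c K where c: "c > 0" "\<And>s. s > 0 \<Longrightarrow> norm (kerPn 0 \<tau> 0 s) \<le> K * exp (- c * s)"
    by (rule kerPn_0_bound [OF \<tau>]) (rule that)
  have "(\<lambda>n. halfline_integral (\<lambda>s. kerPn 0 \<tau> 0 s * cosh (\<i> * of_nat (Suc n) * of_real s))) \<longlonglongrightarrow> 0"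
    by (rule riemann_lebesgue_cosh_sinh(1) [OF continuous_on_kernels(2) [OF \<tau>] c])
  moreover have "kerPn 0 \<tau> 0 s * cosh (\<i> * of_nat (Suc n) * of_real s) = kerPn 0 \<tau> (\<i> * of_nat (Suc n)) s" for n s
    by (simp add: kerPn_def)
  ultimately show ?thesis by (simp add: intPn_def [abs_def])
qed

lemma F1_eq_0:
  assumes \<tau>: "Re \<tau> > 0" "Im \<tau> > 0" and \<nu>: "\<nu> \<in> strip_domain"
  shows "F1 \<tau> \<nu> = 0"
proof -
  have w: "norm (1 :: complex) \<le> real (Suc k)" for k by simp
  note ray = imaginary_ray [OF \<tau>]
  obtain B where B: "\<And>v. v \<in> strip_domain \<Longrightarrow> F1' \<tau> v = B"
    using has_field_derivative_zero_constant [OF convex_strip_domain, of "F1' \<tau>"] F1_second_derivative [OF \<tau>]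
    by (metis has_field_derivative_at_within)
  have "((\<lambda>v. F1 \<tau> v - B * v) has_field_derivative 0) (at v within strip_domain)" if "v \<in> strip_domain" for v
    using DERIV_diff [OF F1_derivatives(1) [OF \<tau> that] DERIV_cmult [OF DERIV_ident, of B v UNIV]] B [OF that]
    by (simp add: has_field_derivative_at_within)
  then obtain A where A: "\<And>v. v \<in> strip_domain \<Longrightarrow> F1 \<tau> v - B * v = A"
    using has_field_derivative_zero_constant [OF convex_strip_domain, of "\<lambda>v. F1 \<tau> v - B * v"] by metis
  have lim: "(\<lambda>n. F1 \<tau> (\<i> * of_nat (Suc n))) \<longlonglongrightarrow> 0"
  proof -
    have t1: "(\<lambda>n. lsum (\<lambda>_. 1) lam0 (\<i> * of_nat (Suc n)) \<tau>) \<longlonglongrightarrow> 0"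
      unfolding ray(6) by (rule lsum_ray_tendsto_0(2) [OF _ \<tau>(2) w]) simp
    have t2: "(\<lambda>n. Ln (1 - qexp (\<i> * of_nat (Suc n)))) \<longlonglongrightarrow> Ln (1 - 0)"
      unfolding ray(6) by (intro tendsto_Ln tendsto_diff tendsto_const qexp_ii_tendsto_0) auto
    have t3: "(\<lambda>n. lam0 (\<i> * of_nat (Suc n))) \<longlonglongrightarrow> 0 / (1 - 0)"
      unfolding ray(6) lam0_def by (intro tendsto_divide tendsto_diff tendsto_const qexp_ii_tendsto_0) auto
    have t4: "(\<lambda>n. lsum (\<lambda>_. 1) lam0 (\<i> * of_nat (Suc n) / \<tau>) (- 1 / \<tau>)) \<longlonglongrightarrow> 0"
      unfolding ray(2) by (rule lsum_ray_tendsto_0(2) [OF ray(4) ray(5) w])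
    have t5: "(\<lambda>n. Digamma (\<i> * of_nat (Suc n) / \<tau> + 1) - Ln (\<i> * of_nat (Suc n) / \<tau>)) \<longlonglongrightarrow> 0"
      unfolding ray(2) by (rule Digamma_ray_limit(2) [OF ray(3)])
    have "(\<lambda>n. 1 / (of_nat (Suc n) * (2 * \<i>))) \<longlonglongrightarrow> 0" by (rule tendsto_const_over_Suc)
    moreover have "of_nat (Suc n) * (2 * \<i>) = 2 * (\<i> * of_nat (Suc n))" for n by (simp add: algebra_simps)
    ultimately have t6: "(\<lambda>n. 1 / (2 * (\<i> * of_nat (Suc n)))) \<longlonglongrightarrow> 0" by (simp only:)
    have "(\<lambda>n. F1 \<tau> (\<i> * of_nat (Suc n))) \<longlonglongrightarrow> 2 * of_real pi * \<i> * 0 - Ln (1 - 0) / \<tau> + of_real pi * \<i> * (0 / (1 - 0))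
       - 2 * of_real pi * \<i> / \<tau> * 0 - 0 / \<tau> + 0 + 0"
      unfolding F1_def using \<tau>
      by (intro tendsto_add tendsto_diff tendsto_mult tendsto_divide [OF _ tendsto_const] tendsto_const t1 t2 t3 t4 t5 t6 intPn_0_ray_tendsto_0) auto
    then show ?thesis by simp
  qed
  have "(\<lambda>n. A + B * (\<i> * of_nat (Suc n))) \<longlonglongrightarrow> 0"
    using lim A [OF ray(1)] by (simp add: diff_eq_eq del: of_nat_Suc)
  then have L: "(\<lambda>n. A + B * \<i> * of_nat (Suc n)) \<longlonglongrightarrow> 0" by (simp only: mult.assoc)
  \<comment> \<open>On the ray F1 equals A + B i n and tends to 0. Division by n removes A and gives
    B = 0, after which A = 0.\<close>
  have "(\<lambda>n. (A + B * \<i> * of_nat (Suc n)) * (1 / of_nat (Suc n)) - A * (1 / of_nat (Suc n))) \<longlonglongrightarrow> 0 * 0 - A * 0"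
    by (intro tendsto_intros L LIMSEQ_Suc [OF lim_1_over_n])
  moreover have "(A + B * \<i> * of_nat (Suc n)) * (1 / of_nat (Suc n)) - A * (1 / of_nat (Suc n)) = B * \<i>" for n
    by (simp add: field_simps del: of_nat_Suc)
  ultimately have "(\<lambda>n::nat. B * \<i>) \<longlonglongrightarrow> 0 * 0 - A * 0" by (simp only:)
  then have "B * \<i> = 0" by (simp add: LIMSEQ_const_iff)
  then have B0: "B = 0" by simp
  then have "(\<lambda>n::nat. A) \<longlonglongrightarrow> 0" using L by simp
  then have "A = 0" by (simp add: LIMSEQ_const_iff)
  then show ?thesis using A [OF \<nu>] B0 by simp
qed

subsection \<open>The second identity on the strip\<close>

text \<open>This is 2 pi i times the difference of the two sides of the second identity, with
  \<open>intPt\<close> for the \<tau>-derivative of P. The summand - 1 / (2 \<tau>) is what \<nu>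
  times \<tau> / (2 \<nu>) leaves.\<close>

definition F2 :: "complex \<Rightarrow> complex \<Rightarrow> complex" where
  "F2 \<tau> \<nu> = 2 * of_real pi * \<i> * lsum (\<lambda>k. of_nat (Suc k)) lam0 \<nu> \<tau> - of_real pi * \<i> / 12
     + \<i> / (2 * of_real pi * \<tau>\<^sup>2) * dilog_series (qexp \<nu>)
     + 2 * of_real pi * \<i> / \<tau>\<^sup>2 * (\<nu> * lsum (\<lambda>_. 1) lam0 (\<nu> / \<tau>) (- 1 / \<tau>) - lsum (\<lambda>k. of_nat (Suc k)) lam0 (\<nu> / \<tau>) (- 1 / \<tau>))
     + \<nu> * (Digamma (\<nu> / \<tau> + 1) - Ln (\<nu> / \<tau>)) / \<tau>\<^sup>2 - 1 / (2 * \<tau>) + intPt \<tau> \<nu>"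

text \<open>\<open>F1 t \<nu>\<close> vanishes for all t in the open quadrant, hence so does its
  \<tau>-derivative, and this is the \<nu>-derivative of \<open>F2\<close>. For the integrals that
  is the symmetry of mixed derivatives: both are \<open>intPtn\<close>.\<close>

lemma F2_derivative:
  assumes \<tau>: "Re \<tau> > 0" "Im \<tau> > 0" and \<nu>: "\<nu> \<in> strip_domain"
  shows "(F2 \<tau> has_field_derivative 0) (at \<nu>)"
proof -
  note np = strip_domain_nonpole [OF \<tau> \<nu>]
  have Re: "\<bar>Re \<nu>\<bar> < 1" and Im: "Im \<nu> > 0" using \<nu> by (auto simp: strip_domain_def)
  have w1: "norm (1 :: complex) \<le> real (Suc k)" for k by simp
  have wS: "norm (of_nat (Suc k) :: complex) \<le> real (Suc k)" for k by (simp only: norm_of_nat order_refl)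
  note l1 = lsum_strip_derivatives [where w = "\<lambda>_. 1", OF \<tau> \<nu> has_field_derivative_lam0 norm_lam0_le w1]
  note lS = lsum_strip_derivatives [where w = "\<lambda>k. of_nat (Suc k)", OF \<tau> \<nu> has_field_derivative_lam0 norm_lam0_le wS]
  define A where "A = lsum (\<lambda>k. of_nat (Suc k)) lam1 \<nu> \<tau>"
  define B0 where "B0 = lsum (\<lambda>_. 1) lam0 (\<nu> / \<tau>) (- 1 / \<tau>)"
  define B1 where "B1 = lsum (\<lambda>_. 1) lam1 (\<nu> / \<tau>) (- 1 / \<tau>)"
  define B2 where "B2 = lsum (\<lambda>k. of_nat (Suc k)) lam1 (\<nu> / \<tau>) (- 1 / \<tau>)"
  define L where "L = Ln (1 - qexp \<nu>)"
  define G where "G = Digamma (\<nu> / \<tau> + 1) - Ln (\<nu> / \<tau>)"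
  define G1 where "G1 = Polygamma 1 (\<nu> / \<tau> + 1)"
  define T where "T = intPtn \<tau> \<nu>"

  define S where "S = {t. Re t > 0 \<and> Im t > 0}"
  have opS: "open S"
    unfolding S_def Collect_conj_eq by (intro open_Int open_halfspace_Re_gt open_halfspace_Im_gt)
  have tS: "\<tau> \<in> S" using \<tau> by (simp add: S_def)
  have npS: "\<And>t k. t \<in> S \<Longrightarrow> qexp (\<nu> + of_nat (Suc k) * t) \<noteq> 1" "\<And>t k. t \<in> S \<Longrightarrow> qexp (\<nu> / t + of_nat (Suc k) * (- 1 / t)) \<noteq> 1"
    "\<And>t. t \<in> S \<Longrightarrow> t \<noteq> 0" "\<And>t. t \<in> S \<Longrightarrow> Im (- 1 / t) > 0"
    using strip_domain_nonpole [OF _ _ \<nu>] imaginary_ray(5) by (auto simp: S_def)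
  have dA: "((\<lambda>t. lsum (\<lambda>_. 1) lam0 \<nu> t) has_field_derivative A) (at \<tau>)"
  proof -
    have "((\<lambda>t. \<Sum>k. 1 * lam0 (\<nu> + of_nat (Suc k) * t)) has_field_derivative
          (\<Sum>k. 1 * (lam1 (\<nu> + of_nat (Suc k) * \<tau>) * (0 + of_nat (Suc k) * 1)))) (at \<tau>)"
      by (rule lambert_series_derivative(3) [where S = S and a = "\<lambda>t. t" and a' = "\<lambda>_. 1" and b = "\<lambda>_. \<nu>" and b' = "\<lambda>_. 0"
          and w = "\<lambda>_. 1" and g = lam0 and g' = lam1, OF opS DERIV_ident DERIV_const _ npS(1) has_field_derivative_lam0 norm_lam0_le w1 tS])
         (simp add: S_def)
    then show ?thesis unfolding A_def lsum_def by (simp only: mult_1_left mult_1_right add_0_left mult.commute)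
  qed
  \<comment> \<open>Both \<nu> / t and - 1 / t depend on t. Differentiating the second brings down
    the weight k + 1, which is how a series of the type of L2 enters.\<close>
  have dB: "((\<lambda>t. lsum (\<lambda>_. 1) lam0 (\<nu> / t) (- 1 / t)) has_field_derivative - \<nu> / \<tau>\<^sup>2 * B1 + B2 / \<tau>\<^sup>2) (at \<tau>)"
  proof -
    have d1: "((\<lambda>t. \<nu> / t) has_field_derivative - \<nu> / t\<^sup>2) (at t)" "((\<lambda>t. - 1 / t) has_field_derivative 1 / t\<^sup>2) (at t)" if "t \<in> S" for t
      using npS(3) [OF that] by (auto intro!: derivative_eq_intros simp: power2_eq_square)
    have "((\<lambda>t. \<Sum>k. 1 * lam0 (\<nu> / t + of_nat (Suc k) * (- 1 / t))) has_field_derivative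
          (\<Sum>k. 1 * (lam1 (\<nu> / \<tau> + of_nat (Suc k) * (- 1 / \<tau>)) * (- \<nu> / \<tau>\<^sup>2 + of_nat (Suc k) * (1 / \<tau>\<^sup>2))))) (at \<tau>)"
      by (rule lambert_series_derivative(3) [where S = S and a = "\<lambda>t. - 1 / t" and a' = "\<lambda>t. 1 / t\<^sup>2" and b = "\<lambda>t. \<nu> / t" and b' = "\<lambda>t. - \<nu> / t\<^sup>2"
          and w = "\<lambda>_. 1" and g = lam0 and g' = lam1, OF opS d1(2) d1(1) npS(4) npS(2) has_field_derivative_lam0 norm_lam0_le w1 tS])
    moreover have "1 * (lam1 (\<nu> / \<tau> + of_nat (Suc k) * (- 1 / \<tau>)) * (- \<nu> / \<tau>\<^sup>2 + of_nat (Suc k) * (1 / \<tau>\<^sup>2))) =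
       - \<nu> / \<tau>\<^sup>2 * (1 * lam1 (\<nu> / \<tau> + of_nat (Suc k) * (- 1 / \<tau>))) + (of_nat (Suc k) * lam1 (\<nu> / \<tau> + of_nat (Suc k) * (- 1 / \<tau>))) / \<tau>\<^sup>2" for k
      by (simp only: distrib_left mult_1_left times_divide_eq_left times_divide_eq_right mult_1_right mult.commute)
    moreover have "(\<lambda>k. - \<nu> / \<tau>\<^sup>2 * (1 * lam1 (\<nu> / \<tau> + of_nat (Suc k) * (- 1 / \<tau>))) + (of_nat (Suc k) * lam1 (\<nu> / \<tau> + of_nat (Suc k) * (- 1 / \<tau>))) / \<tau>\<^sup>2)
        sums (- \<nu> / \<tau>\<^sup>2 * B1 + B2 / \<tau>\<^sup>2)"
      unfolding B1_def B2_def lsum_def by (intro sums_add sums_mult sums_divide summable_sums l1(4) lS(4))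
    ultimately show ?thesis unfolding lsum_def by (simp only: sums_iff mult_1_left)
  qed
  have dG: "((\<lambda>t. Digamma (\<nu> / t + 1) - Ln (\<nu> / t)) has_field_derivative G1 * (- \<nu> / \<tau>\<^sup>2) + 1 / \<tau>) (at \<tau>)"
  proof -
    have d: "((\<lambda>t. \<nu> / t + 1) has_field_derivative - \<nu> / \<tau>\<^sup>2) (at \<tau>)" "((\<lambda>t. \<nu> / t) has_field_derivative - \<nu> / \<tau>\<^sup>2) (at \<tau>)"
      using np(8) by (auto intro!: derivative_eq_intros simp: power2_eq_square)
    have "((\<lambda>t. Digamma (\<nu> / t + 1) - Ln (\<nu> / t)) has_field_derivative Polygamma (Suc 0) (\<nu> / \<tau> + 1) * (- \<nu> / \<tau>\<^sup>2) - inverse (\<nu> / \<tau>) * (- \<nu> / \<tau>\<^sup>2)) (at \<tau>)"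
      by (intro DERIV_diff DERIV_chain2 [OF has_field_derivative_Polygamma d(1)] DERIV_chain2 [OF has_field_derivative_Ln d(2)] np)
    moreover have "inverse (\<nu> / \<tau>) * (- \<nu> / \<tau>\<^sup>2) = - 1 / \<tau>" using np by (simp add: field_simps power2_eq_square)
    ultimately show ?thesis by (simp add: G1_def)
  qed
  have dF1: "((\<lambda>t. F1 t \<nu>) has_field_derivative
     2 * of_real pi * \<i> * A - - L / \<tau>\<^sup>2 + 0
     - (- 2 * of_real pi * \<i> / \<tau>\<^sup>2 * B0 + (- \<nu> / \<tau>\<^sup>2 * B1 + B2 / \<tau>\<^sup>2) * (2 * of_real pi * \<i> / \<tau>))
     - (- 1 / \<tau>\<^sup>2 * G + (G1 * (- \<nu> / \<tau>\<^sup>2) + 1 / \<tau>) * (1 / \<tau>)) + 0 + T) (at \<tau>)"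
  proof -
    have d: "((\<lambda>t. c / t) has_field_derivative - c / \<tau>\<^sup>2) (at \<tau>)" for c
      using np(8) by (auto intro!: derivative_eq_intros simp: power2_eq_square)
    have eq: "F1 t \<nu> = 2 * of_real pi * \<i> * lsum (\<lambda>_. 1) lam0 \<nu> t - Ln (1 - qexp \<nu>) / t + of_real pi * \<i> * lam0 \<nu>
     - (2 * of_real pi * \<i> / t) * lsum (\<lambda>_. 1) lam0 (\<nu> / t) (- 1 / t)
     - (1 / t) * (Digamma (\<nu> / t + 1) - Ln (\<nu> / t)) + 1 / (2 * \<nu>) + intPn 0 t \<nu>" for t
      by (simp add: F1_def)
    have d2: "((\<lambda>t. 2 * of_real pi * \<i> / t) has_field_derivative - 2 * of_real pi * \<i> / \<tau>\<^sup>2) (at \<tau>)"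
      using d [of "2 * of_real pi * \<i>"] by simp
    show ?thesis unfolding eq L_def B0_def G_def T_def
      by (intro DERIV_add DERIV_diff DERIV_cmult DERIV_const DERIV_mult dA dB dG d d2 intP_derivatives \<tau> Re)
  qed
  have "((\<lambda>t. F1 t \<nu>) has_field_derivative 0) (at \<tau>)"
    by (rule has_field_derivative_transform_within_open [OF DERIV_const opS tS])
       (use F1_eq_0 [OF _ _ \<nu>] in \<open>auto simp: S_def\<close>)
  \<comment> \<open>\<open>E\<close> says that the expression computed for the \<tau>-derivative of
    \<open>F1\<close> is 0; below, the \<nu>-derivative of \<open>F2\<close> is brought to the same
    expression.\<close>
  note E = DERIV_unique [OF dF1 this]
  have P: "((\<lambda>v. Digamma (v / \<tau> + 1) - Ln (v / \<tau>)) has_field_derivative G1 / \<tau> - 1 / \<nu>) (at \<nu>)"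
    using np by (auto intro!: derivative_eq_intros simp: G1_def)
  have "(F2 \<tau> has_field_derivative 2 * of_real pi * \<i> * A - 0
     + \<i> / (2 * of_real pi * \<tau>\<^sup>2) * (- (2 * of_real pi * \<i>) * L)
     + 2 * of_real pi * \<i> / \<tau>\<^sup>2 * ((1 * B0 + (B1 / \<tau>) * \<nu>) - B2 / \<tau>)
     + (1 * G + (G1 / \<tau> - 1 / \<nu>) * \<nu>) / \<tau>\<^sup>2 - 0 + T) (at \<nu>)"
    unfolding F2_def [abs_def] A_def B0_def B1_def B2_def L_def G_def T_def
    by (intro DERIV_add DERIV_diff DERIV_cmult DERIV_cdivide DERIV_const DERIV_mult DERIV_ident lS l1 P [unfolded G_def]
        has_field_derivative_dilog_qexp Im intP_derivatives \<tau> Re)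
  also have "2 * of_real pi * \<i> * A - 0
     + \<i> / (2 * of_real pi * \<tau>\<^sup>2) * (- (2 * of_real pi * \<i>) * L)
     + 2 * of_real pi * \<i> / \<tau>\<^sup>2 * ((1 * B0 + (B1 / \<tau>) * \<nu>) - B2 / \<tau>)
     + (1 * G + (G1 / \<tau> - 1 / \<nu>) * \<nu>) / \<tau>\<^sup>2 - 0 + T =
     2 * of_real pi * \<i> * A - - L / \<tau>\<^sup>2 + 0
     - (- 2 * of_real pi * \<i> / \<tau>\<^sup>2 * B0 + (- \<nu> / \<tau>\<^sup>2 * B1 + B2 / \<tau>\<^sup>2) * (2 * of_real pi * \<i> / \<tau>))
     - (- 1 / \<tau>\<^sup>2 * G + (G1 * (- \<nu> / \<tau>\<^sup>2) + 1 / \<tau>) * (1 / \<tau>)) + 0 + T"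
  proof -
    have ii: "\<i> * (\<i> * z) = - z" for z by (metis i_squared mult.assoc mult_minus1)
    have "\<i> / (2 * of_real pi * \<tau>\<^sup>2) * (- (2 * of_real pi * \<i>) * L) = L / \<tau>\<^sup>2"
      using np(8) by (simp add: field_simps ii)
    moreover have "(1 * G + (G1 / \<tau> - 1 / \<nu>) * \<nu>) / \<tau>\<^sup>2 = G / \<tau>\<^sup>2 + G1 * \<nu> / \<tau> ^ 3 - 1 / \<tau>\<^sup>2"
      using np(6,8) by (simp add: field_simps power2_eq_square power3_eq_cube)
    ultimately show ?thesis
      using np(8) by (simp add: field_simps power2_eq_square power3_eq_cube)
  qed
  finally show ?thesis unfolding E .
qed

text \<open>With a real y in place of n + 1 the integral is i arctan y: it vanishes at y = 0, and
  its y-derivative is i times the Laplace transform 1 / (1 + y^2) of the cosine.\<close>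

lemma sinh_exp_integral_ray:
  "(\<lambda>n. halfline_integral (\<lambda>s. exp (- of_real s) / of_real s * sinh (\<i> * of_nat (Suc n) * of_real s))) \<longlonglongrightarrow> \<i> * of_real (pi / 2)"
proof -
  define k where "k = (\<lambda>z (s::real). sinh (z * of_real s) * (exp (- complex_of_real s) / of_real s))"
  define k' where "k' = (\<lambda>z (s::real). cosh (z * of_real s) * exp (- complex_of_real s))"
  have e1: "norm (exp (- complex_of_real s)) = exp (- s)" for s :: real by simp
  have d: "((\<lambda>z. halfline_integral (k z)) has_field_derivative halfline_integral (k' z)) (at z)" if z: "Re z = 0" for z
  proof (rule has_field_derivative_halfline_integral [where r = "1/2" and c = "1/2" and K = 1 and ?K0.0 = "norm z"])
    fix y :: complex and s :: real assume y: "y \<in> ball z (1/2)" and s: "s > 0"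
    show "((\<lambda>y. k y s) has_field_derivative k' y s) (at y)"
      unfolding k_def k'_def using s by (auto intro!: derivative_eq_intros)
    have "\<bar>Re y\<bar> \<le> 1/2" using y z abs_Re_le_cmod [of "z - y"] by (simp add: dist_norm)
    then have "\<bar>Re (y * of_real s)\<bar> \<le> 1/2 * s" using s by (simp add: abs_mult)
    then have "exp \<bar>Re (y * of_real s)\<bar> \<le> exp (1/2 * s)" by simp
    then have "norm (cosh (y * of_real s)) \<le> exp (1/2 * s)" using norm_cosh_le [of "y * of_real s"] by linarith
    then have "norm (k' y s) \<le> exp (1/2 * s) * exp (- s)" unfolding k'_def norm_mult e1 by (intro mult_right_mono) auto
    also have "\<dots> = 1 * exp (- (1/2) * s)" by (simp add: exp_add [symmetric])
    finally show "norm (k' y s) \<le> 1 * exp (- (1/2) * s)" .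
  next
    fix s :: real assume s: "s > 0"
    have "norm (sinh (z * of_real s)) \<le> norm z * s"
      using norm_sinh_le [of "z * of_real s"] z s by (simp add: norm_mult)
    then have "norm (k z s) \<le> (norm z * s) * (exp (- s) / s)"
      unfolding k_def norm_mult norm_divide e1 using s by (intro mult_mono) auto
    also have "\<dots> = norm z * exp (- s)" using s by simp
    also have "\<dots> \<le> norm z * exp (- (1/2) * s)" using s by (intro mult_left_mono) auto
    finally show "norm (k z s) \<le> norm z * exp (- (1/2) * s)" .
  qed (auto simp: k_def k'_def intro!: continuous_intros)
  have val: "halfline_integral (k' (\<i> * of_real y)) = of_real (1 / (1 + y\<^sup>2))" for y
  proof -
    have i: "set_integrable lborel {0<..} (\<lambda>s. exp (- (a * complex_of_real s)))" if "Re a = 1" for a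
      by (rule set_integrable_exp_dominated [where c = 1 and K = 1]) (use that in \<open>auto intro!: continuous_intros\<close>)
    have eq: "k' (\<i> * of_real y) = (\<lambda>s. 1/2 * (exp (- ((1 - \<i> * of_real y) * of_real s)) + exp (- ((1 + \<i> * of_real y) * of_real s))))"
    proof
      fix s :: real
      have a: "- ((1 - \<i> * of_real y) * of_real s) = - of_real s + \<i> * of_real y * of_real s"
        and b: "- ((1 + \<i> * of_real y) * of_real s) = - of_real s + - (\<i> * of_real y * of_real s)"
        by (simp_all add: algebra_simps)
      show "k' (\<i> * of_real y) s = 1/2 * (exp (- ((1 - \<i> * of_real y) * of_real s)) + exp (- ((1 + \<i> * of_real y) * of_real s)))"
        unfolding a b exp_add k'_def cosh_def by (simp add: scaleR_conv_of_real algebra_simps)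
    qed
    have "halfline_integral (k' (\<i> * of_real y)) =
       1/2 * (halfline_integral (\<lambda>s. exp (- ((1 - \<i> * of_real y) * of_real s))) + halfline_integral (\<lambda>s. exp (- ((1 + \<i> * of_real y) * of_real s))))"
      unfolding eq halfline_integral_def
      by (simp only: set_integral_mult_right) (subst set_integral_add(2), auto intro!: i)
    also have "\<dots> = 1/2 * (1 / (1 - \<i> * of_real y) + 1 / (1 + \<i> * of_real y))" by (simp add: laplace_0)
    also have "\<dots> = of_real (1 / (1 + y\<^sup>2))"
    proof -
      have "(1 - \<i> * of_real y) * (1 + \<i> * of_real y) = of_real (1 + y\<^sup>2)" by (simp add: algebra_simps power2_eq_square)
      moreover have "1 - \<i> * of_real y \<noteq> 0" "1 + \<i> * of_real y \<noteq> 0" by (auto simp: complex_eq_iff)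
      ultimately have "1 / (1 - \<i> * of_real y) + 1 / (1 + \<i> * of_real y) = 2 / of_real (1 + y\<^sup>2)"
        by (simp add: add_divide_eq_iff divide_add_eq_iff)
      then show ?thesis by simp
    qed
    finally show ?thesis .
  qed
  define \<phi> where "\<phi> = (\<lambda>y. halfline_integral (k (\<i> * of_real y)) - \<i> * of_real (arctan y))"
  have "(\<phi> has_vector_derivative 0) (at y)" for y :: real
  proof -
    have "((\<lambda>z. halfline_integral (k (\<i> * z))) has_field_derivative halfline_integral (k' (\<i> * of_real y)) * \<i>) (at (of_real y))"
      by (rule DERIV_chain2 [OF d]) (auto intro!: derivative_eq_intros)
    then have "((\<lambda>y. halfline_integral (k (\<i> * of_real y))) has_vector_derivative halfline_integral (k' (\<i> * of_real y)) * \<i>) (at y)"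
      by (rule has_vector_derivative_real_field)
    moreover have "((\<lambda>y. \<i> * of_real (arctan y)) has_vector_derivative \<i> * of_real (inverse (1 + y\<^sup>2))) (at y)"
      by (intro has_vector_derivative_mult_right has_vector_derivative_of_real)
         (simp add: has_real_derivative_iff_has_vector_derivative [symmetric] DERIV_arctan)
    ultimately have "(\<phi> has_vector_derivative (halfline_integral (k' (\<i> * of_real y)) * \<i> - \<i> * of_real (inverse (1 + y\<^sup>2)))) (at y)"
      unfolding \<phi>_def by (rule has_vector_derivative_diff)
    then show ?thesis unfolding val by (simp add: inverse_eq_divide)
  qed
  then obtain c where c: "\<And>y. \<phi> y = c"
    using has_vector_derivative_zero_constant [of UNIV \<phi>] by auto
  have "\<phi> 0 = 0" by (simp add: \<phi>_def k_def halfline_integral_def)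
  then have "halfline_integral (k (\<i> * of_real y)) = \<i> * of_real (arctan y)" for y using c [of 0] c [of y] by (simp add: \<phi>_def)
  from this [of "real (Suc n)" for n] have eq: "halfline_integral (\<lambda>s. exp (- of_real s) / of_real s * sinh (\<i> * of_nat (Suc n) * of_real s)) = \<i> * of_real (arctan (real (Suc n)))" for n
    by (simp add: k_def mult.commute del: of_nat_Suc)
  have "(\<lambda>n. arctan (real (Suc n))) \<longlonglongrightarrow> pi / 2"
    by (rule filterlim_compose [OF tendsto_arctan_at_top filterlim_compose [OF filterlim_real_sequentially filterlim_Suc]])
  then show ?thesis unfolding eq by (intro tendsto_intros)
qed

text \<open>The amplitude of the kernel behaves like 1 / (6 s) at 0, so Riemann-Lebesgue does not
  apply to it directly. After subtraction of exp (- s) / (6 s) it does, and the subtracted part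
  contributes 1/6 of i pi / 2; divided by 2 pi i this is the 1/24 of the theorem.\<close>

lemma intPt_ray_limit:
  assumes \<tau>: "Re \<tau> > 0"
  shows "(\<lambda>n. intPt \<tau> (\<i> * of_nat (Suc n))) \<longlonglongrightarrow> of_real pi * \<i> / 12"
proof -
  obtain A r where A: "A \<ge> 1" "r > 0"
    "\<And>t. t \<in> ball \<tau> r \<Longrightarrow> Re t > 0 \<and> norm t \<le> A * Re t \<and> norm t \<le> 2 * norm \<tau>"
    by (rule sector_neighbourhood [OF \<tau>]) (rule that)
  then have A\<tau>: "norm \<tau> \<le> A * Re \<tau>" by (meson centre_in_ball)
  define C where "C = 8 * A * (4 + 12 * A) * norm \<tau>"
  have C: "C \<ge> 0" using A by (simp add: C_def)
  define w where "w = (\<lambda>s. kap' (\<tau> * of_real s) / (exp (of_real s) - 1) - 1/6 * (exp (- complex_of_real s) / of_real s))"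
  have nz: "exp (complex_of_real s) - 1 \<noteq> 0" if "s > 0" for s
    using exp_neq_one_Re_pos [of "of_real s"] that by simp
  have ck: "continuous_on {0<..} (\<lambda>s. kap' (\<tau> * of_real s))"
    unfolding kap'_def using \<tau> nz exp_neq_one_Re_pos by (auto intro!: continuous_intros)
  have cw: "continuous_on {0<..} w" unfolding w_def using nz by (intro continuous_intros ck) auto
  have half: "(0::real) < 1" "(1/2::real) < 1" by auto
  obtain K :: real where K: "K > 0" "\<And>s :: real. s \<ge> 0 \<Longrightarrow> (1 + s) ^ 1 * exp (- 1 * s) \<le> K * exp (- (1/2) * s)"
    by (rule poly_exp_bound [OF half(2), where n = 1]) (rule that)
  have bw: "norm (w s) \<le> (C + 1) * K * exp (- (1/2) * s)" if s: "s > 0" for s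
  proof -
    have k: "norm (kap' (\<tau> * of_real s) - 1/6) \<le> C * s"
    proof -
      have "norm (kap' (\<tau> * of_real s) - 1/6) \<le> 8 * A * (4 + 12 * A) * norm (\<tau> * of_real s)"
        by (rule kap'_sector_bounds [OF A(1)]) (use s \<tau> A\<tau> in \<open>auto simp: norm_mult\<close>)
      then show ?thesis using s by (simp add: C_def norm_mult)
    qed
    have E: "1 / (exp s - 1) \<le> (1 + 1 / s) * exp (- s)" by (rule inverse_exp_minus_one_le [OF s])
    have E2: "exp (- s) / s \<le> 1 / (exp s - 1)"
    proof -
      have "1 - s \<le> exp (- s)" using exp_ge_add_one_self [of "- s"] by simp
      then have "exp (- s) * (exp s - 1) \<le> s" by (simp add: right_diff_distrib exp_add [symmetric])
      then show ?thesis using s by (simp add: field_simps)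
    qed
    \<comment> \<open>The poles of 1 / (exp s - 1) and of its model exp (- s) / s cancel, and the
      difference lies between 0 and exp (- s).\<close>
    define D where "D = 1 / (exp s - 1) - exp (- s) / s"
    have D: "0 \<le> D" "D \<le> exp (- s)" using E E2 by (auto simp: D_def algebra_simps)
    have "w s = (kap' (\<tau> * of_real s) - 1/6) / (exp (of_real s) - 1) + 1/6 * of_real D"
      by (simp add: w_def D_def diff_divide_distrib exp_of_real [symmetric] algebra_simps)
    then have "norm (w s) \<le> norm ((kap' (\<tau> * of_real s) - 1/6) / (exp (of_real s) - 1)) + norm (1/6 * complex_of_real D)"
      by (simp only: norm_triangle_ineq)
    also have "\<dots> = norm (kap' (\<tau> * of_real s) - 1/6) * (1 / (exp s - 1)) + D / 6"
      using D norm_exp_of_real_minus_one [OF s] by (simp add: norm_divide norm_mult)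
    also have "\<dots> \<le> (C * s) * ((1 + 1 / s) * exp (- s)) + exp (- s)"
      using k E D C s by (intro add_mono mult_mono) auto
    also have "\<dots> = C * ((1 + s) * exp (- s)) + exp (- s)" using s by (simp add: field_simps)
    also have "\<dots> \<le> C * ((1 + s) * exp (- s)) + (1 + s) * exp (- s)" using s by simp
    also have "\<dots> = (C + 1) * ((1 + s) * exp (- s))" by (simp add: algebra_simps)
    also have "\<dots> \<le> (C + 1) * (K * exp (- (1/2) * s))" using K(2) [of s] s C by (intro mult_left_mono) auto
    finally show ?thesis by simp
  qed
  have L1: "(\<lambda>n. halfline_integral (\<lambda>s. w s * sinh (\<i> * of_nat (Suc n) * of_real s))) \<longlonglongrightarrow> 0"
    by (rule riemann_lebesgue_cosh_sinh(2) [OF cw _ bw]) auto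
  have L2: "(\<lambda>n. 1/6 * halfline_integral (\<lambda>s. exp (- of_real s) / of_real s * sinh (\<i> * of_nat (Suc n) * of_real s)))
     \<longlonglongrightarrow> 1/6 * (\<i> * of_real (pi / 2))"
    by (intro tendsto_mult tendsto_const sinh_exp_integral_ray)
  have sh: "norm (sinh (\<i> * of_nat (Suc n) * of_real s)) \<le> 1" for n s
    using norm_sinh_le1 [of "\<i> * of_nat (Suc n) * of_real s"] by simp
  have i1: "set_integrable lborel {0<..} (\<lambda>s. w s * sinh (\<i> * of_nat (Suc n) * of_real s))" for n
  proof (rule set_integrable_exp_dominated [where c = "1/2" and K = "(C + 1) * K"])
    fix s :: real assume s: "s > 0"
    have "norm (w s * sinh (\<i> * of_nat (Suc n) * of_real s)) \<le> ((C + 1) * K * exp (- (1/2) * s)) * 1"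
      unfolding norm_mult [of "w s"] using bw [OF s] sh C K by (intro mult_mono) auto
    then show "norm (w s * sinh (\<i> * of_nat (Suc n) * of_real s)) \<le> (C + 1) * K * exp (- (1/2) * s)" by simp
  qed (auto intro!: continuous_intros cw)
  have i2: "set_integrable lborel {0<..} (\<lambda>s. exp (- complex_of_real s) / of_real s * sinh (\<i> * of_nat (Suc n) * of_real s))" for n
  proof (rule set_integrable_exp_dominated [where c = 1 and K = "real (Suc n)"])
    fix s :: real assume s: "s > 0"
    have "norm (sinh (\<i> * of_nat (Suc n) * of_real s)) \<le> norm (\<i> * of_nat (Suc n) * of_real s) * exp \<bar>Re (\<i> * of_nat (Suc n) * of_real s)\<bar>"
      by (rule norm_sinh_le)
    also have "\<dots> = real (Suc n) * s" using s unfolding norm_mult norm_of_nat by simp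
    finally have "norm (exp (- complex_of_real s) / of_real s) * norm (sinh (\<i> * of_nat (Suc n) * of_real s)) \<le> (exp (- s) / s) * (real (Suc n) * s)"
      using s by (intro mult_mono) (auto simp: norm_divide)
    also have "\<dots> = real (Suc n) * exp (- 1 * s)" using s by simp
    finally show "norm (exp (- complex_of_real s) / of_real s * sinh (\<i> * of_nat (Suc n) * of_real s)) \<le> real (Suc n) * exp (- 1 * s)"
      by (simp only: norm_mult)
  qed (auto intro!: continuous_intros)
  have eq: "intPt \<tau> (\<i> * of_nat (Suc n)) = halfline_integral (\<lambda>s. w s * sinh (\<i> * of_nat (Suc n) * of_real s)) +
      1/6 * halfline_integral (\<lambda>s. exp (- of_real s) / of_real s * sinh (\<i> * of_nat (Suc n) * of_real s))" for n
  proof -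
    have "intPt \<tau> (\<i> * of_nat (Suc n)) = halfline_integral (\<lambda>s. w s * sinh (\<i> * of_nat (Suc n) * of_real s) +
      1/6 * (exp (- of_real s) / of_real s * sinh (\<i> * of_nat (Suc n) * of_real s)))"
      unfolding intPt_def
    proof (rule halfline_integral_cong)
      fix s :: real
      define x where "x = sinh (\<i> * of_nat (Suc n) * of_real s)"
      show "kerPt \<tau> (\<i> * of_nat (Suc n)) s = w s * sinh (\<i> * of_nat (Suc n) * of_real s) + 1/6 * (exp (- of_real s) / of_real s * sinh (\<i> * of_nat (Suc n) * of_real s))"
        unfolding kerPt_def w_def x_def [symmetric] by (simp add: algebra_simps)
    qed
    also have "\<dots> = halfline_integral (\<lambda>s. w s * sinh (\<i> * of_nat (Suc n) * of_real s)) +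
      halfline_integral (\<lambda>s. 1/6 * (exp (- of_real s) / of_real s * sinh (\<i> * of_nat (Suc n) * of_real s)))"
      unfolding halfline_integral_def by (rule set_integral_add(2) [OF i1 set_integrable_mult_right [OF i2]])
    finally show ?thesis unfolding halfline_integral_def by (simp only: set_integral_mult_right)
  qed
  show ?thesis unfolding eq using tendsto_add [OF L1 L2] by (simp add: mult.commute)
qed

text \<open>Along the ray only the integral and the digamma term have nonzero limits; they cancel -
  pi i / 12 and - 1 / (2 \<tau>).\<close>

lemma F2_eq_0:
  assumes \<tau>: "Re \<tau> > 0" "Im \<tau> > 0" and \<nu>: "\<nu> \<in> strip_domain"
  shows "F2 \<tau> \<nu> = 0"
proof -
  have w1: "norm (1 :: complex) \<le> real (Suc k)" for k by simp
  have wS: "norm (of_nat (Suc k) :: complex) \<le> real (Suc k)" for k by (simp only: norm_of_nat order_refl)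
  note ray = imaginary_ray [OF \<tau>]
  obtain A where A: "\<And>v. v \<in> strip_domain \<Longrightarrow> F2 \<tau> v = A"
    using has_field_derivative_zero_constant [OF convex_strip_domain, of "F2 \<tau>"] F2_derivative [OF \<tau>]
    by (metis has_field_derivative_at_within)
  have t0: "\<tau> \<noteq> 0" using \<tau> by auto
  have t1: "(\<lambda>n. lsum (\<lambda>k. of_nat (Suc k)) lam0 (\<i> * of_nat (Suc n)) \<tau>) \<longlonglongrightarrow> 0"
    unfolding ray(6) by (rule lsum_ray_tendsto_0(2) [OF _ \<tau>(2) wS]) simp
  have t2: "(\<lambda>n. dilog_series (qexp (\<i> * of_nat (Suc n)))) \<longlonglongrightarrow> 0"
    unfolding ray(6) using isCont_tendsto_compose [OF dilog_series_derivative(2) qexp_ii_tendsto_0, of 0]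
    by (simp add: dilog_series_derivative(3) [of 0] del: of_nat_Suc)
  have e: "\<i> * of_nat (Suc n) * x = \<i> * (of_nat (Suc n) * x)" for n x by (rule mult.assoc)
  have t3: "(\<lambda>n. \<i> * of_nat (Suc n) * lsum (\<lambda>_. 1) lam0 (\<i> * of_nat (Suc n) / \<tau>) (- 1 / \<tau>)) \<longlonglongrightarrow> \<i> * 0"
    unfolding ray(2) e by (intro tendsto_mult tendsto_const lsum_ray_tendsto_0(1) [OF ray(4) ray(5) w1])
  have t4: "(\<lambda>n. lsum (\<lambda>k. of_nat (Suc k)) lam0 (\<i> * of_nat (Suc n) / \<tau>) (- 1 / \<tau>)) \<longlonglongrightarrow> 0"
    unfolding ray(2) by (rule lsum_ray_tendsto_0(2) [OF ray(4) ray(5) wS])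
  have t5: "(\<lambda>n. \<i> * of_nat (Suc n) * (Digamma (\<i> * of_nat (Suc n) / \<tau> + 1) - Ln (\<i> * of_nat (Suc n) / \<tau>))) \<longlonglongrightarrow> \<tau> * (1/2)"
  proof -
    have "\<i> * of_nat (Suc n) * x = \<tau> * (of_nat (Suc n) * (\<i> / \<tau>) * x)" for n x using t0 by (simp add: field_simps)
    then show ?thesis unfolding ray(2) by (simp only:) (intro tendsto_mult tendsto_const Digamma_ray_limit(1) [OF ray(3)])
  qed
  have "(\<lambda>n. F2 \<tau> (\<i> * of_nat (Suc n))) \<longlonglongrightarrow> 2 * of_real pi * \<i> * 0 - of_real pi * \<i> / 12 + \<i> / (2 * of_real pi * \<tau>\<^sup>2) * 0
     + 2 * of_real pi * \<i> / \<tau>\<^sup>2 * (\<i> * 0 - 0) + \<tau> * (1/2) / \<tau>\<^sup>2 - 1 / (2 * \<tau>) + of_real pi * \<i> / 12"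
    unfolding F2_def using t0
    by (intro tendsto_add tendsto_diff tendsto_mult [OF tendsto_const] tendsto_divide [OF _ tendsto_const] tendsto_const t1 t2 t3 t4 t5 intPt_ray_limit \<tau>) auto
  moreover have "2 * of_real pi * \<i> * 0 - of_real pi * \<i> / 12 + \<i> / (2 * of_real pi * \<tau>\<^sup>2) * 0
     + 2 * of_real pi * \<i> / \<tau>\<^sup>2 * (\<i> * 0 - 0) + \<tau> * (1/2) / \<tau>\<^sup>2 - 1 / (2 * \<tau>) + of_real pi * \<i> / 12 = 0"
    using t0 by (simp add: power2_eq_square)
  ultimately have "(\<lambda>n. F2 \<tau> (\<i> * of_nat (Suc n))) \<longlonglongrightarrow> 0" by (simp only:)
  then have "(\<lambda>n::nat. A) \<longlonglongrightarrow> 0" using A [OF ray(1)] by (simp only:)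
  then show ?thesis using A [OF \<nu>] by (simp add: LIMSEQ_const_iff)
qed

subsection \<open>Rotating the ray\<close>

text \<open>On t = - i \<tau> s the exponent i t / \<tau> is just s, sin becomes - i sinh and cot
  becomes i coth; the factors - i and i multiply to 1.\<close>

lemma P_integrand_eq_kerP:
  assumes \<tau>: "Re \<tau> > 0" and s: "s > 0"
  shows "P_integrand \<tau> \<nu> (- \<i> * \<tau> * of_real s) * (- \<i> * \<tau>) = kerP \<tau> \<nu> s"
proof -
  define t where "t = - \<i> * \<tau> * of_real s"
  define u where "u = \<tau> * of_real s"
  define E where "E = exp (u / 2)"
  have t0: "\<tau> \<noteq> 0" "t \<noteq> 0" "u \<noteq> 0" using \<tau> s by (auto simp: t_def u_def)
  have E: "E \<noteq> 0" "exp u = E * E" by (simp_all add: E_def exp_add [symmetric])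
  have nz: "E * E - 1 \<noteq> 0" using exp_neq_one_Re_pos [of u] \<tau> s by (simp add: E(2) [symmetric] u_def)
  have a1: "\<nu> / \<tau> * t = - \<i> * (\<nu> * of_real s)" using t0 by (simp add: t_def field_simps)
  have it: "\<i> * (- \<i> * z) = z" for z by simp
  have s1: "sin (\<nu> / \<tau> * t) = - \<i> * sinh (\<nu> * of_real s)"
    unfolding a1 sin_exp_eq it sinh_def by (simp add: scaleR_conv_of_real field_simps)
  have a2: "exp (\<i> * t / \<tau>) = exp (of_real s)" using t0 by (simp add: t_def field_simps)
  have a3: "t / 2 = - \<i> * (u / 2)" by (simp add: t_def u_def)
  have "sin (t / 2) = (E - 1 / E) / (2 * \<i>)" "cos (t / 2) = (E + 1 / E) / 2"
    unfolding a3 sin_exp_eq cos_exp_eq it E_def by (simp_all add: exp_minus inverse_eq_divide)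
  then have "cot (t / 2) = ((E + 1 / E) / 2) / ((E - 1 / E) / (2 * \<i>))" by (simp only: cot_def)
  also have "\<dots> = \<i> * ((E * E + 1) / (E * E - 1))" using E nz by (simp add: field_simps)
  finally have c1: "cot (t / 2) = \<i> * ((exp u + 1) / (exp u - 1))" by (simp add: E)
  have c2: "2 / t = \<i> * (2 / u)" using t0 by (simp add: t_def u_def field_simps)
  have k: "cot (t / 2) - 2 / t = \<i> * kap u" unfolding c1 c2 kap_def by (simp add: right_diff_distrib)
  have tt: "(- \<i> * \<tau>) / t = 1 / of_real s" using t0 s by (simp add: t_def field_simps)
  have "P_integrand \<tau> \<nu> t * (- \<i> * \<tau>) = sin (\<nu> / \<tau> * t) / (exp (\<i> * t / \<tau>) - 1) * (cot (t / 2) - 2 / t) * ((- \<i> * \<tau>) / t)"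
    by (simp add: P_integrand_def)
  also have "\<dots> = kerP \<tau> \<nu> s"
  proof -
    have g: "- \<i> * x / y * (\<i> * k) * z = x / y * k * z" for x y k z :: complex
    proof -
      have "- \<i> * x / y * (\<i> * k) * z = (- \<i> * \<i>) * (x / y * k * z)"
        by (simp only: divide_inverse mult_ac)
      then show ?thesis by simp
    qed
    show ?thesis unfolding s1 a2 k tt g by (simp add: kerP_def u_def)
  qed
  finally show ?thesis by (simp add: t_def)
qed

text \<open>The direction of - i \<tau> is Arg \<tau> - pi / 2, which for \<tau> in the open
  quadrant lies in (- pi / 2, 0). For this direction the condition of \<open>P_ray_domain\<close> is
  exactly |Re \<nu>| < 1.\<close>

lemma P_ray_eq_intP:
  assumes \<tau>: "Re \<tau> > 0" "Im \<tau> > 0" and \<nu>: "\<bar>Re \<nu>\<bar> < 1"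
  shows "\<exists>d\<in>{-pi<..<0}. (\<tau>, \<nu>) \<in> P_ray_domain d \<and> P_ray d \<tau> \<nu> = intP \<tau> \<nu>"
proof -
  define d where "d = Arg \<tau> - pi / 2"
  have t0: "\<tau> \<noteq> 0" using \<tau> by auto
  define R where "R = norm \<tau>"
  have R: "R > 0" using t0 by (simp add: R_def)
  have "0 < Arg \<tau>" using \<tau> Arg_less_0 [of \<tau>] Arg_eq_0 [of \<tau>] by (auto simp: complex_is_Real_iff less_le)
  moreover have "Arg \<tau> < pi / 2" using Re_Ln_pos_lt [OF t0] \<tau> t0 by (simp add: Arg_def abs_less_iff)
  ultimately have d: "d \<in> {-pi<..<0}" by (auto simp: d_def)
  have "\<tau> = of_real R * cis (Arg \<tau>)" using rcis_cmod_Arg [of \<tau>] by (simp add: R_def rcis_def)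
  then have c: "cis d = - \<i> * \<tau> / of_real R"
  proof -
    have "cis d = cis (Arg \<tau>) * cis (- (pi / 2))" by (simp only: d_def cis_mult diff_conv_add_uminus)
    also have "cis (- (pi / 2)) = - \<i>" by (simp add: complex_eq_iff)
    also have "cis (Arg \<tau>) = \<tau> / of_real R" using \<open>\<tau> = of_real R * cis (Arg \<tau>)\<close> R by (metis nonzero_mult_div_cancel_left of_real_eq_0_iff less_irrefl)
    finally show ?thesis by simp
  qed
  have dom: "(\<tau>, \<nu>) \<in> P_ray_domain d"
  proof -
    have "\<nu> * cis d / \<tau> = - \<i> * \<nu> / of_real R" "cis d / \<tau> = - \<i> / of_real R" using t0 by (simp_all add: c)
    then show ?thesis using \<nu> R by (simp add: P_ray_domain_def divide_strict_right_mono)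
  qed
  have "P_ray d \<tau> \<nu> = (LINT r|lborel. indicat_real {0<..} r *\<^sub>R (P_integrand \<tau> \<nu> (of_real r * cis d) * cis d))"
    by (simp only: P_ray_def set_lebesgue_integral_def)
  also have "\<dots> = \<bar>R\<bar> *\<^sub>R (LINT s|lborel. indicat_real {0<..} (0 + R * s) *\<^sub>R (P_integrand \<tau> \<nu> (of_real (0 + R * s) * cis d) * cis d))"
    by (rule lborel_integral_real_affine) (use R in simp)
  also have "\<dots> = (LINT s|lborel. \<bar>R\<bar> *\<^sub>R (indicat_real {0<..} (0 + R * s) *\<^sub>R (P_integrand \<tau> \<nu> (of_real (0 + R * s) * cis d) * cis d)))"
    unfolding scaleR_conv_of_real [of "\<bar>R\<bar>"] by (rule integral_mult_right_zero [symmetric])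
  also have "\<dots> = (LINT s|lborel. indicat_real {0<..} s *\<^sub>R kerP \<tau> \<nu> s)"
  proof (rule Bochner_Integration.integral_cong [OF refl])
    fix s :: real
    show "\<bar>R\<bar> *\<^sub>R (indicat_real {0<..} (0 + R * s) *\<^sub>R (P_integrand \<tau> \<nu> (of_real (0 + R * s) * cis d) * cis d)) = indicat_real {0<..} s *\<^sub>R kerP \<tau> \<nu> s"
    proof (cases "s > 0")
      case True
      have e: "of_real (0 + R * s) * cis d = - \<i> * \<tau> * of_real s" using R by (simp add: c)
      have "\<bar>R\<bar> *\<^sub>R (P_integrand \<tau> \<nu> (- \<i> * \<tau> * of_real s) * cis d) = P_integrand \<tau> \<nu> (- \<i> * \<tau> * of_real s) * (- \<i> * \<tau>)"
        using R by (simp add: c scaleR_conv_of_real)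
      then show ?thesis unfolding e using True R P_integrand_eq_kerP [OF \<tau>(1) True, of \<nu>] by simp
    next
      case False
      then have "\<not> R * s > 0" using R by (simp add: zero_less_mult_iff)
      then show ?thesis using False by simp
    qed
  qed
  also have "\<dots> = intP \<tau> \<nu>" by (simp add: intP_def halfline_integral_def set_lebesgue_integral_def)
  finally show ?thesis using d dom by blast
qed

subsection \<open>Joint analyticity along complex lines\<close>

lemma holomorphic2_on_line:
  assumes P: "holomorphic2_on P D" and z: "z + (\<zeta> * a, \<zeta> * b) \<in> D"
  shows "(\<lambda>\<zeta>. P (z + (\<zeta> * a, \<zeta> * b))) field_differentiable (at \<zeta>)"
proof -
  obtain \<alpha> \<beta> where d: "(P has_derivative (\<lambda>(h, k). \<alpha> * h + \<beta> * k)) (at (z + (\<zeta> * a, \<zeta> * b)))"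
    using P z unfolding holomorphic2_on_def by blast
  have l: "((\<lambda>\<zeta>. z + (\<zeta> * a, \<zeta> * b)) has_derivative (\<lambda>h. (h * a, h * b))) (at \<zeta>)"
    by (auto intro!: derivative_eq_intros)
  have "((\<lambda>\<zeta>. P (z + (\<zeta> * a, \<zeta> * b))) has_derivative (\<lambda>h. (\<lambda>(h, k). \<alpha> * h + \<beta> * k) (h * a, h * b))) (at \<zeta>)"
    by (rule has_derivative_compose [OF l d])
  then have "((\<lambda>\<zeta>. P (z + (\<zeta> * a, \<zeta> * b))) has_field_derivative (\<alpha> * a + \<beta> * b)) (at \<zeta>)"
    unfolding has_field_derivative_def by (rule has_derivative_eq_rhs) (auto simp: algebra_simps)
  then show ?thesis unfolding field_differentiable_def by blast
qed

lemma holomorphic2_on_imp_continuous_on: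
  assumes P: "holomorphic2_on P D" shows "continuous_on D P"
proof (rule continuous_at_imp_continuous_on, rule ballI)
  fix z assume "z \<in> D"
  then obtain a b where "(P has_derivative (\<lambda>(h, k). a * h + b * k)) (at z)"
    using P unfolding holomorphic2_on_def by blast
  then show "isCont P z" by (rule has_derivative_continuous)
qed

text \<open>Taylor's remainder of second order, with Cauchy's estimate on discs of radius r / 2. The
  bound depends on \<phi> only through M, which makes convergence of the difference quotients
  uniform.\<close>

lemma difference_quotient_bound:
  fixes \<phi> :: "complex \<Rightarrow> complex"
  assumes r: "r > 0" and hol: "\<phi> holomorphic_on cball 0 r" and M: "\<And>x. x \<in> cball 0 r \<Longrightarrow> norm (\<phi> x) \<le> M"
    and x: "norm x \<le> r / 2"
  shows "norm (\<phi> x - \<phi> 0 - x * deriv \<phi> 0) \<le> (2 * M / (r / 2) ^ 2) * norm x ^ 2"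
proof -
  define f where "f = (\<lambda>i::nat. (deriv ^^ i) \<phi>)"
  have hb: "\<phi> holomorphic_on ball 0 r" by (rule holomorphic_on_subset [OF hol]) auto
  have "norm (f 0 x - (\<Sum>i\<le>1. f i 0 * (x - 0) ^ i / fact i)) \<le> (2 * M / (r / 2) ^ 2) * norm (x - 0) ^ Suc 1 / fact 1"
  proof (rule complex_Taylor [of "cball 0 (r / 2)"])
    fix i and y :: complex assume y: "y \<in> cball 0 (r / 2)"
    then have yb: "y \<in> ball 0 r" using r by auto
    show "(f i has_field_derivative f (Suc i) y) (at y within cball 0 (r / 2))"
      using holomorphic_derivI [OF holomorphic_higher_deriv [OF hb open_ball] open_ball yb]
      by (simp add: f_def has_field_derivative_at_within)
  next
    fix y :: complex assume y: "y \<in> cball 0 (r / 2)"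
    have sub: "cball y (r / 2) \<subseteq> cball 0 r"
    proof
      fix w assume "w \<in> cball y (r / 2)"
      then show "w \<in> cball 0 r" using y dist_triangle [of 0 w y] by auto
    qed
    have "norm ((deriv ^^ 2) \<phi> y) \<le> fact 2 * M / (r / 2) ^ 2"
    proof (rule Cauchy_inequality)
      show "\<phi> holomorphic_on ball y (r / 2)" using sub by (intro holomorphic_on_subset [OF hol]) auto
      show "continuous_on (cball y (r / 2)) \<phi>"
        by (intro holomorphic_on_imp_continuous_on holomorphic_on_subset [OF hol] sub)
      fix w assume "norm (y - w) = r / 2"
      then have "w \<in> cball y (r / 2)" by (simp add: dist_norm)
      then show "norm (\<phi> w) \<le> M" using sub M by blast
    qed (use r in simp)
    then show "norm (f (Suc 1) y) \<le> 2 * M / (r / 2) ^ 2" by (simp add: f_def numeral_2_eq_2)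
  qed (use x r in auto)
  then show ?thesis by (simp add: f_def mult.commute power2_eq_square algebra_simps)
qed

text \<open>The partial derivatives are locally uniform limits of difference quotients, which are
  holomorphic along complex lines.\<close>

lemma holomorphic_partial_derivative_on_line:
  assumes P: "holomorphic2_on P D" and D: "open D" and S: "open S"
    and line: "\<And>\<zeta>. \<zeta> \<in> S \<Longrightarrow> z + (\<zeta> * a, \<zeta> * b) \<in> D"
  shows "(\<lambda>\<zeta>. deriv (\<lambda>\<eta>. P (z + (\<zeta> * a, \<zeta> * b) + (\<eta> * c, \<eta> * d))) 0) holomorphic_on S"
proof -
  define l where "l = (\<lambda>\<zeta>. z + (\<zeta> * a, \<zeta> * b))"
  define g where "g = (\<lambda>\<zeta>. deriv (\<lambda>\<eta>. P (l \<zeta> + (\<eta> * c, \<eta> * d))) 0)"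
  have "g field_differentiable (at \<zeta>0)" if \<zeta>0: "\<zeta>0 \<in> S" for \<zeta>0
  proof -
    obtain \<rho> where \<rho>: "\<rho> > 0" "cball (l \<zeta>0) \<rho> \<subseteq> D"
      using D line [OF \<zeta>0] open_contains_cball unfolding l_def by blast
    have cP: "compact (P ` cball (l \<zeta>0) \<rho>)"
      by (intro compact_continuous_image continuous_on_subset [OF holomorphic2_on_imp_continuous_on [OF P]] \<rho>) auto
    obtain M where M: "\<And>y. y \<in> cball (l \<zeta>0) \<rho> \<Longrightarrow> norm (P y) \<le> M"
      using compact_imp_bounded [OF cP] unfolding bounded_iff by blast
    define N where "N = norm (a, b) + norm (c, d) + 1"
    have N: "N > 0" "norm (a, b) \<le> N" "norm (c, d) \<le> N" by (auto simp: N_def intro: add_nonneg_pos)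
    \<comment> \<open>As \<open>r * N + r * N = \<rho>\<close>, a displacement by r along the line
      and one by r in the direction (c, d) together stay in the compact ball on which P is
      bounded.\<close>
    define r where "r = \<rho> / (2 * N)"
    have r: "r > 0" using \<rho> N by (simp add: r_def)
    have scale: "norm (t * x, t * y) = norm t * norm (x, y)" for t x y :: complex
      by (simp add: norm_Pair norm_mult power_mult_distrib distrib_left [symmetric] real_sqrt_mult)
    have incl: "l \<zeta> + (\<eta> * c, \<eta> * d) \<in> cball (l \<zeta>0) \<rho>" if "norm (\<zeta> - \<zeta>0) \<le> r" "norm \<eta> \<le> r" for \<zeta> \<eta>
    proof -
      have "l \<zeta> + (\<eta> * c, \<eta> * d) - l \<zeta>0 = ((\<zeta> - \<zeta>0) * a, (\<zeta> - \<zeta>0) * b) + (\<eta> * c, \<eta> * d)"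
        by (simp add: l_def algebra_simps)
      then have "norm (l \<zeta> + (\<eta> * c, \<eta> * d) - l \<zeta>0) \<le> norm (\<zeta> - \<zeta>0) * norm (a, b) + norm \<eta> * norm (c, d)"
        using norm_triangle_ineq [of "((\<zeta> - \<zeta>0) * a, (\<zeta> - \<zeta>0) * b)" "(\<eta> * c, \<eta> * d)"] by (simp only: scale)
      also have "\<dots> \<le> r * N + r * N" using that N r by (intro add_mono mult_mono) auto
      also have "\<dots> = \<rho>" using N by (simp add: r_def)
      finally show ?thesis by (simp add: dist_norm norm_minus_commute)
    qed
    \<comment> \<open>The increments r / (n + 2) are at most r / 2, as the Taylor bound requires,
      already for n = 0.\<close>
    define f where "f = (\<lambda>n \<zeta>. (P (l \<zeta> + (of_real (r / (real n + 2)) * c, of_real (r / (real n + 2)) * d)) - P (l \<zeta>)) / of_real (r / (real n + 2)))"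
    have neps: "norm (complex_of_real (r / (real n + 2))) = r / (real n + 2)" for n
      unfolding norm_of_real using r by (intro abs_of_nonneg) simp
    have small: "norm (complex_of_real (r / (real n + 2))) \<le> r / 2" for n
      unfolding neps using r by (intro divide_left_mono) auto
    have "g holomorphic_on ball \<zeta>0 r"
    proof (rule holomorphic_uniform_sequence [where f = f])
      show "f n holomorphic_on ball \<zeta>0 r" for n
      proof -
        define \<epsilon> where "\<epsilon> = complex_of_real (r / (real n + 2))"
        have "norm \<epsilon> > 0" unfolding \<epsilon>_def neps using r by simp
        then have \<epsilon>: "norm \<epsilon> \<le> r" "\<epsilon> \<noteq> 0" using small [of n] r unfolding \<epsilon>_def by auto
        have 1: "(\<lambda>\<zeta>. P ((z + (\<epsilon> * c, \<epsilon> * d)) + (\<zeta> * a, \<zeta> * b))) field_differentiable (at x)" if "x \<in> ball \<zeta>0 r" for x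
        proof (rule holomorphic2_on_line [OF P])
          show "(z + (\<epsilon> * c, \<epsilon> * d)) + (x * a, x * b) \<in> D"
            using incl [of x \<epsilon>] that \<epsilon> \<rho> by (auto simp: l_def dist_norm norm_minus_commute add_ac)
        qed
        have 2: "(\<lambda>\<zeta>. P (z + (\<zeta> * a, \<zeta> * b))) field_differentiable (at x)" if "x \<in> ball \<zeta>0 r" for x
        proof (rule holomorphic2_on_line [OF P])
          show "z + (x * a, x * b) \<in> D"
            using incl [of x 0] that r \<rho> by (auto simp: l_def dist_norm norm_minus_commute zero_prod_def [symmetric])
        qed
        have "(\<lambda>\<zeta>. (P ((z + (\<epsilon> * c, \<epsilon> * d)) + (\<zeta> * a, \<zeta> * b)) - P (z + (\<zeta> * a, \<zeta> * b))) / \<epsilon>) holomorphic_on ball \<zeta>0 r"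
        proof (intro holomorphic_intros)
          show "(\<lambda>\<zeta>. P ((z + (\<epsilon> * c, \<epsilon> * d)) + (\<zeta> * a, \<zeta> * b))) holomorphic_on ball \<zeta>0 r"
            "(\<lambda>\<zeta>. P (z + (\<zeta> * a, \<zeta> * b))) holomorphic_on ball \<zeta>0 r"
            unfolding holomorphic_on_def using 1 2 by (auto intro: field_differentiable_at_within)
        qed (use \<epsilon> in auto)
        moreover have "f n = (\<lambda>\<zeta>. (P ((z + (\<epsilon> * c, \<epsilon> * d)) + (\<zeta> * a, \<zeta> * b)) - P (z + (\<zeta> * a, \<zeta> * b))) / \<epsilon>)"
          unfolding f_def l_def \<epsilon>_def by (simp add: add_ac)
        ultimately show ?thesis by simp
      qed
      fix x assume x: "x \<in> ball \<zeta>0 r"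
      then obtain \<delta> where \<delta>: "\<delta> > 0" "cball x \<delta> \<subseteq> ball \<zeta>0 r" using open_contains_cball open_ball by blast
      define B where "B = 2 * M / (r / 2) ^ 2"
      have est: "norm (f n y - g y) \<le> \<bar>B\<bar> * r * (1 / real (Suc n))" if y: "y \<in> cball x \<delta>" for n y
      proof -
        define \<epsilon> where "\<epsilon> = complex_of_real (r / (real n + 2))"
        have "norm \<epsilon> > 0" unfolding \<epsilon>_def neps using r by simp
        then have \<epsilon>: "norm \<epsilon> \<le> r / 2" "\<epsilon> \<noteq> 0" using small [of n] unfolding \<epsilon>_def by auto
        have yr: "norm (y - \<zeta>0) \<le> r" using y \<delta> by (auto simp: dist_norm norm_minus_commute subset_iff)
        define \<phi> where "\<phi> = (\<lambda>\<eta>. P (l y + (\<eta> * c, \<eta> * d)))"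
        have "\<phi> holomorphic_on cball 0 r"
          unfolding holomorphic_on_def \<phi>_def
        proof
          fix \<eta> :: complex assume "\<eta> \<in> cball 0 r"
          then have "l y + (\<eta> * c, \<eta> * d) \<in> D" using incl [OF yr, of \<eta>] \<rho> by auto
          then show "(\<lambda>\<eta>. P (l y + (\<eta> * c, \<eta> * d))) field_differentiable (at \<eta> within cball 0 r)"
            by (rule field_differentiable_at_within [OF holomorphic2_on_line [OF P]])
        qed
        then have "norm (\<phi> \<epsilon> - \<phi> 0 - \<epsilon> * deriv \<phi> 0) \<le> B * norm \<epsilon> ^ 2"
          unfolding B_def by (rule difference_quotient_bound [OF r _ _ \<epsilon>(1)]) (use incl yr M in \<open>auto simp: \<phi>_def\<close>)
        moreover have "\<phi> \<epsilon> - \<phi> 0 - \<epsilon> * deriv \<phi> 0 = \<epsilon> * (f n y - g y)"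
        proof -
          have "\<phi> 0 = P (l y)" by (simp add: \<phi>_def zero_prod_def [symmetric])
          then have "f n y = (\<phi> \<epsilon> - \<phi> 0) / \<epsilon>" by (simp only: f_def \<phi>_def \<epsilon>_def)
          moreover have "g y = deriv \<phi> 0" by (simp only: g_def \<phi>_def)
          moreover have "\<epsilon> * (X / \<epsilon>) = X" for X using \<epsilon>(2) by simp
          ultimately show ?thesis by (simp only: right_diff_distrib [of \<epsilon> "_ / _"])
        qed
        ultimately have "norm \<epsilon> * norm (f n y - g y) \<le> norm \<epsilon> * (B * norm \<epsilon>)"
          by (simp add: norm_mult power2_eq_square mult_ac)
        then have "norm (f n y - g y) \<le> B * norm \<epsilon>" using \<epsilon>(2) by (simp add: mult_le_cancel_left)
        also have "\<dots> \<le> \<bar>B\<bar> * (r * (1 / real (Suc n)))"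
        proof (rule mult_mono)
          have "r / (real n + 2) \<le> r / real (Suc n)" using r by (intro divide_left_mono) auto
          then show "norm \<epsilon> \<le> r * (1 / real (Suc n))" unfolding \<epsilon>_def neps by simp
        qed auto
        finally show ?thesis by simp
      qed
      have "(\<lambda>n. \<bar>B\<bar> * r * (1 / real (Suc n))) \<longlonglongrightarrow> \<bar>B\<bar> * r * 0"
        by (intro tendsto_mult tendsto_const LIMSEQ_Suc [OF lim_1_over_n])
      then have lim: "(\<lambda>n. \<bar>B\<bar> * r * (1 / real (Suc n))) \<longlonglongrightarrow> 0" by simp
      have "uniform_limit (cball x \<delta>) f g sequentially"
      proof (rule uniform_limitI)
        fix e :: real assume "e > 0"
        with lim have "eventually (\<lambda>n. \<bar>B\<bar> * r * (1 / real (Suc n)) < e) sequentially" by (rule order_tendstoD(2))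
        then show "eventually (\<lambda>n. \<forall>y\<in>cball x \<delta>. dist (f n y) (g y) < e) sequentially"
        proof eventually_elim
          case (elim n)
          show ?case
          proof
            fix y assume y: "y \<in> cball x \<delta>"
            show "dist (f n y) (g y) < e" unfolding dist_norm by (rule le_less_trans [OF est [OF y] elim])
          qed
        qed
      qed
      then show "\<exists>d>0. cball x d \<subseteq> ball \<zeta>0 r \<and> uniform_limit (cball x d) f g sequentially" using \<delta> by blast
    qed auto
    then show ?thesis using r by (intro holomorphic_on_imp_differentiable_at [of g "ball \<zeta>0 r"]) auto
  qed
  then show ?thesis unfolding holomorphic_on_def g_def l_def by (blast intro: field_differentiable_at_within)
qed

text \<open>Any two points off the exceptional set lie on a complex line which meets that set in a
  countable set only, so the one-variable identity theorem applies in every ball.\<close>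

lemma identity_theorem_along_lines:
  fixes G :: "complex \<times> complex \<Rightarrow> complex" and \<Omega> N W :: "(complex \<times> complex) set"
  assumes \<Omega>: "open \<Omega>" "connected \<Omega>"
    and hol: "\<And>z a b S. open S \<Longrightarrow> (\<And>\<zeta>. \<zeta> \<in> S \<Longrightarrow> z + (\<zeta> * a, \<zeta> * b) \<in> \<Omega> - N) \<Longrightarrow>
        (\<lambda>\<zeta>. G (z + (\<zeta> * a, \<zeta> * b))) holomorphic_on S"
    and count: "\<And>z a b. z \<in> \<Omega> - N \<Longrightarrow> countable {\<zeta>. z + (\<zeta> * a, \<zeta> * b) \<in> N}"
    and opN: "open (\<Omega> - N)"
    and dense: "\<And>V. open V \<Longrightarrow> V \<subseteq> \<Omega> \<Longrightarrow> V \<noteq> {} \<Longrightarrow> V - N \<noteq> {}"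
    and W: "open W" "W \<subseteq> \<Omega>" "W \<noteq> {}" "\<And>z. z \<in> W - N \<Longrightarrow> G z = 0"
    and z: "z \<in> \<Omega> - N"
  shows "G z = 0"
proof -
  have ball_step: "G y = 0"
    if B: "ball p \<epsilon> \<subseteq> \<Omega>" and V: "open V" "V \<subseteq> ball p \<epsilon>" "V \<noteq> {}" "\<And>z. z \<in> V - N \<Longrightarrow> G z = 0"
      and y: "y \<in> ball p \<epsilon> - N" for p \<epsilon> V y
  proof -
    have V\<Omega>: "V \<subseteq> \<Omega>" using V(2) B by (rule order_trans)
    obtain w where w: "w \<in> V" "w \<notin> N" using dense [OF V(1) V\<Omega> V(3)] by blast
    define a where "a = fst y - fst w"
    define b where "b = snd y - snd w"
    define l where "l = (\<lambda>\<zeta>::complex. w + (\<zeta> * a, \<zeta> * b))"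
    have cl: "continuous_on UNIV l" unfolding l_def by (intro continuous_intros)
    define S where "S = l -` ball p \<epsilon>"
    have opS: "open S" unfolding S_def by (rule open_vimage [OF open_ball cl])
    have "convex S"
    proof (rule convexI)
      fix x x' :: complex and u v :: real
      assume xx: "x \<in> S" "x' \<in> S" "0 \<le> u" "0 \<le> v" "u + v = 1"
      have "w = u *\<^sub>R w + v *\<^sub>R w" using xx by (simp add: scaleR_left_distrib [symmetric])
      then have "l (u *\<^sub>R x + v *\<^sub>R x') = u *\<^sub>R l x + v *\<^sub>R l x'"
        unfolding l_def by (simp add: scaleR_right_distrib algebra_simps scaleR_Pair prod_eq_iff)
      then show "u *\<^sub>R x + v *\<^sub>R x' \<in> S"
        using xx convexD [OF convex_ball [of p \<epsilon>], of "l x" "l x'" u v] by (simp add: S_def)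
    qed
    then have conS: "connected S" by (rule convex_connected)
    define T where "T = S \<inter> l -` N"
    have w\<Omega>: "w \<in> \<Omega> - N" using w V\<Omega> by blast
    have "countable {\<zeta>. l \<zeta> \<in> N}" unfolding l_def by (rule count [OF w\<Omega>])
    then have cT: "countable T" by (rule countable_subset [rotated]) (auto simp: T_def)
    have eqS: "S - T = S \<inter> l -` (\<Omega> - N)" using B by (auto simp: S_def T_def)
    have opST: "open (S - T)" unfolding eqS by (intro open_Int opS open_vimage [OF opN cl])
    have conST: "connected (S - T)" by (intro connected_open_diff_countable) (use opS conS cT in auto)
    have 0: "l 0 = w" "l 1 = y" by (simp_all add: l_def a_def b_def zero_prod_def [symmetric] prod_eq_iff)
    have y1: "1 \<in> S - T" using y by (auto simp: S_def T_def 0)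
    have opV: "open ((S - T) \<inter> l -` V)" by (intro open_Int opST open_vimage [OF V(1) cl])
    have "0 \<in> (S - T) \<inter> l -` V" using w V by (auto simp: S_def T_def 0)
    then have neV: "(S - T) \<inter> l -` V \<noteq> {}" by blast
    have "G (l 1) = 0"
    proof (rule analytic_continuation_open [where f = "\<lambda>\<zeta>. G (l \<zeta>)" and g = "\<lambda>_. 0" and z = 1, OF opV opST neV conST])
      show "(\<lambda>\<zeta>. G (l \<zeta>)) holomorphic_on S - T"
        unfolding l_def by (rule hol [OF opST]) (use eqS in \<open>auto simp: l_def\<close>)
      fix x assume "x \<in> (S - T) \<inter> l -` V"
      then show "G (l x) = 0" using V(4) by (auto simp: T_def)
    qed (use y1 in auto)
    then show ?thesis by (simp add: 0)
  qed
  \<comment> \<open>X is open by construction and closed in \<Omega> by \<open>ball_step\<close>,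
    applied to a ball around a limit point.\<close>
  define X where "X = {p \<in> \<Omega>. \<exists>\<epsilon>>0. \<forall>y\<in>ball p \<epsilon> \<inter> \<Omega> - N. G y = 0}"
  have "openin (top_of_set \<Omega>) X"
  proof -
    have "open X"
    proof (subst open_subopen, intro ballI)
      fix p assume "p \<in> X"
      then obtain \<epsilon> where \<epsilon>: "\<epsilon> > 0" "p \<in> \<Omega>" "\<forall>y\<in>ball p \<epsilon> \<inter> \<Omega> - N. G y = 0" by (auto simp: X_def)
      have "q \<in> X" if q: "q \<in> ball p \<epsilon> \<inter> \<Omega>" for q
      proof -
        obtain \<delta> where "\<delta> > 0" "ball q \<delta> \<subseteq> ball p \<epsilon> \<inter> \<Omega>"
          using q \<Omega>(1) open_Int [OF open_ball \<Omega>(1)] open_contains_ball by blast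
        then show ?thesis using q \<epsilon>(3) by (auto simp: X_def)
      qed
      then show "\<exists>T. open T \<and> p \<in> T \<and> T \<subseteq> X"
        using \<epsilon> \<Omega>(1) by (intro exI [of _ "ball p \<epsilon> \<inter> \<Omega>"]) auto
    qed
    then show ?thesis by (auto simp: X_def intro: open_subset)
  qed
  moreover have "closedin (top_of_set \<Omega>) X"
  proof (subst closedin_limpt, intro conjI allI impI)
    show "X \<subseteq> \<Omega>" by (auto simp: X_def)
    fix p assume p: "p islimpt X \<and> p \<in> \<Omega>"
    then obtain \<epsilon> where \<epsilon>: "\<epsilon> > 0" "ball p \<epsilon> \<subseteq> \<Omega>" using \<Omega>(1) open_contains_ball by blast
    then obtain q where q: "q \<in> X" "q \<in> ball p \<epsilon>"
      using p by (metis islimpt_approachable mem_ball dist_commute)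
    then obtain \<delta> where \<delta>: "\<delta> > 0" "\<forall>y\<in>ball q \<delta> \<inter> \<Omega> - N. G y = 0" by (auto simp: X_def)
    have "G y = 0" if "y \<in> ball p \<epsilon> - N" for y
    proof (rule ball_step [OF \<epsilon>(2) _ _ _ _ that])
      show "open (ball p \<epsilon> \<inter> ball q \<delta>)" by auto
      show "ball p \<epsilon> \<inter> ball q \<delta> \<noteq> {}" using q \<delta> by (metis IntI centre_in_ball empty_iff)
      show "G z = 0" if "z \<in> ball p \<epsilon> \<inter> ball q \<delta> - N" for z using \<delta>(2) that \<epsilon>(2) by auto
    qed auto
    then show "p \<in> X" using p \<epsilon> by (auto simp: X_def)
  qed
  moreover have "X \<noteq> {}"
  proof -
    obtain p where p: "p \<in> W" using W by blast
    then obtain \<epsilon> where "\<epsilon> > 0" "ball p \<epsilon> \<subseteq> W" using W(1) open_contains_ball by blast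
    then have "p \<in> X" using p W by (auto simp: X_def intro!: exI [of _ \<epsilon>])
    then show ?thesis by blast
  qed
  ultimately have "X = \<Omega>" using \<Omega>(2) unfolding connected_clopen by blast
  then obtain \<epsilon> where "\<epsilon> > 0" "\<forall>y\<in>ball z \<epsilon> \<inter> \<Omega> - N. G y = 0" using z by (auto simp: X_def)
  then show ?thesis using z by auto
qed

subsection \<open>The branches of the logarithm and the dilogarithm\<close>

lemma nu_domain_iff: "\<nu> \<in> nu_domain \<longleftrightarrow> Im \<nu> \<noteq> 0 \<or> \<bar>Re \<nu>\<bar> < 1"
proof -
  have "\<nu> \<in> complex_of_real ` ({..-1} \<union> {1..}) \<longleftrightarrow> Im \<nu> = 0 \<and> (Re \<nu> \<le> -1 \<or> Re \<nu> \<ge> 1)"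
    by (auto simp: image_iff complex_eq_iff)
  then show ?thesis unfolding nu_domain_def by auto
qed

lemma open_nu_domain: "open nu_domain"
proof -
  have "nu_domain = {\<nu>. Im \<nu> \<noteq> 0} \<union> {\<nu>. \<bar>Re \<nu>\<bar> < 1}" by (auto simp: nu_domain_iff)
  also have "open \<dots>" by (intro open_Un open_Collect_neq open_Collect_less continuous_intros)
  finally show ?thesis .
qed

lemma nu_domain_scale:
  assumes "\<nu> \<in> nu_domain" "0 \<le> t" "t \<le> 1"
  shows "of_real t * \<nu> \<in> nu_domain"
proof (cases "t = 0 \<or> Im \<nu> = 0")
  case True
  have "t * \<bar>Re \<nu>\<bar> < 1" if "\<bar>Re \<nu>\<bar> < 1"
    using mult_mono [of t 1 "\<bar>Re \<nu>\<bar>" "\<bar>Re \<nu>\<bar>"] assms that by simp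
  then show ?thesis using True assms by (auto simp: nu_domain_iff abs_mult)
next
  case False
  then show ?thesis by (simp add: nu_domain_iff)
qed

lemma starlike_nu_domain: "starlike nu_domain"
  unfolding starlike_def
proof (intro bexI [of _ 0] ballI subsetI)
  fix \<nu> x assume "\<nu> \<in> nu_domain" "x \<in> closed_segment 0 \<nu>"
  then show "x \<in> nu_domain" using nu_domain_scale by (auto simp: in_segment scaleR_conv_of_real)
qed (simp add: nu_domain_iff)

lemma convex_upper_half_plane: "convex {u. Im u > 0}"
  and open_upper_half_plane: "open {u. Im u > 0}"
  by (rule convex_halfspace_Im_gt, rule open_halfspace_Im_gt)

lemma upper_half_plane_facts:
  assumes "Im u > 0"
  shows "u \<noteq> 0" "u \<notin> \<real>\<^sub>\<le>\<^sub>0" "1 - qexp u \<notin> \<real>\<^sub>\<le>\<^sub>0" "1 - qexp u \<noteq> 0" "u \<in> nu_domain"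
proof -
  have "norm (qexp u) < 1" using assms by (simp add: norm_qexp)
  then have "Re (1 - qexp u) > 0" using complex_Re_le_cmod [of "qexp u"] by simp
  then show "1 - qexp u \<notin> \<real>\<^sub>\<le>\<^sub>0" by (auto simp: complex_nonpos_Reals_iff)
  then show "1 - qexp u \<noteq> 0" by auto
qed (use assms in \<open>auto simp: complex_nonpos_Reals_iff nu_domain_iff\<close>)

text \<open>Dividing out the zero at 0 leaves (1 - qexp u) / u without zeros on the starlike
  \<open>nu_domain\<close>, hence with a holomorphic logarithm there. All branching of log (1 - qexp
  u) is thereby moved into log u.\<close>

lemma log_quotient_exists:
  obtains h where "h holomorphic_on nu_domain" "\<And>u. Im u > 0 \<Longrightarrow> h u = Ln (1 - qexp u) - Ln u"
proof -
  define f where "f = (\<lambda>u. 1 - qexp u)"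
  define g where "g = (\<lambda>u. if u = 0 then deriv f 0 else (f u - f 0) / (u - 0))"
  have df: "(f has_field_derivative - (2 * of_real pi * \<i> * qexp u)) (at u)" for u
    unfolding f_def by (auto intro!: derivative_eq_intros)
  have f0: "f 0 = 0" by (simp add: f_def qexp_def)
  have "f holomorphic_on nu_domain"
    unfolding holomorphic_on_def field_differentiable_def using df by (blast intro: has_field_derivative_at_within)
  then have holg: "g holomorphic_on nu_domain" unfolding g_def by (rule pole_lemma_open [OF _ open_nu_domain])
  have "g u \<noteq> 0" if u: "u \<in> nu_domain" for u
  proof (cases "u = 0")
    case True
    have "deriv f 0 = - (2 * of_real pi * \<i> * qexp 0)" by (rule DERIV_imp_deriv [OF df])
    then show ?thesis using True by (simp add: g_def)
  next
    case False
    have "qexp u \<noteq> 1"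
    proof
      assume "qexp u = 1"
      then obtain j where j: "u = of_int j" by (auto simp: qexp_eq_1_iff elim: Ints_cases)
      then have "j \<noteq> 0" using False by auto
      then show False using u j by (simp add: nu_domain_iff)
    qed
    then show ?thesis using False f0 by (simp add: g_def f_def)
  qed
  then obtain h0 where h0: "h0 holomorphic_on nu_domain" "\<And>u. u \<in> nu_domain \<Longrightarrow> g u = exp (h0 u)"
    using contractible_imp_holomorphic_log [OF holg starlike_imp_contractible [OF starlike_nu_domain]] by metis
  \<comment> \<open>On the upper half-plane both logarithms have the same exponential, so their
    difference \<open>k\<close> is constant; adding it adjusts \<open>h0\<close> to the principal
    branches.\<close>
  define k where "k = (\<lambda>u. Ln (1 - qexp u) - Ln u - h0 u)"
  have ek: "exp (k u) = 1" if u: "Im u > 0" for u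
  proof -
    note U = upper_half_plane_facts [OF u]
    have "exp (h0 u) = (1 - qexp u) / u" using h0(2) [OF U(5)] U f0 by (simp add: g_def f_def)
    then show ?thesis using U by (simp add: k_def exp_diff)
  qed
  have "(k has_field_derivative 0) (at u within {u. Im u > 0})" if u: "u \<in> {u. Im u > 0}" for u
  proof -
    have u': "Im u > 0" using u by simp
    note U = upper_half_plane_facts [OF u']
    have "(h0 has_field_derivative deriv h0 u) (at u)" by (rule holomorphic_derivI [OF h0(1) open_nu_domain U(5)])
    then have dk: "(k has_field_derivative (- (2 * of_real pi * \<i> * lam0 u) - 1 / u - deriv h0 u)) (at u)" (is "(k has_field_derivative ?d) _")
      unfolding k_def using U
      by (intro DERIV_diff has_field_derivative_Ln_one_minus_qexp) (auto intro!: derivative_eq_intros simp: inverse_eq_divide)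
    have "((\<lambda>u. exp (k u)) has_field_derivative exp (k u) * ?d) (at u)"
      by (rule DERIV_chain2 [OF DERIV_exp dk])
    moreover have "((\<lambda>u. exp (k u)) has_field_derivative 0) (at u)"
      by (rule has_field_derivative_transform_within_open [OF DERIV_const open_upper_half_plane u]) (simp add: ek)
    ultimately have "exp (k u) * ?d = 0" by (rule DERIV_unique)
    then have "?d = 0" by simp
    then show ?thesis using dk by (simp only: has_field_derivative_at_within)
  qed
  then obtain c where c: "\<And>u. u \<in> {u. Im u > 0} \<Longrightarrow> k u = c"
    using has_field_derivative_zero_constant [OF convex_upper_half_plane, of k] by metis
  show ?thesis
  proof (rule that [of "\<lambda>u. h0 u + c"])
    show "(\<lambda>u. h0 u + c) holomorphic_on nu_domain" by (intro holomorphic_intros h0)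
    show "h0 u + c = Ln (1 - qexp u) - Ln u" if "Im u > 0" for u using c [of u] that by (simp add: k_def algebra_simps)
  qed
qed

text \<open>The dilogarithm of qexp u has derivative - 2 pi i log (1 - qexp u). A primitive of
  \<open>h\<close> and the primitive u Ln u - u of Ln therefore give it up to a constant, which the
  series on the upper half-plane fixes.\<close>

lemma dilog_primitive_exists:
  assumes h: "h holomorphic_on nu_domain" "\<And>u. Im u > 0 \<Longrightarrow> h u = Ln (1 - qexp u) - Ln u"
  obtains h1 where "\<And>u. u \<in> nu_domain \<Longrightarrow> (h1 has_field_derivative h u) (at u)"
    "\<And>u. Im u > 0 \<Longrightarrow> dilog_series (qexp u) = - (2 * of_real pi * \<i>) * (h1 u + u * Ln u - u)"
proof -
  have "\<exists>p. \<forall>u\<in>nu_domain. (p has_field_derivative h u) (at u)"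
    by (rule holomorphic_starlike_primitive [OF holomorphic_on_imp_continuous_on [OF h(1)] starlike_nu_domain open_nu_domain finite.emptyI])
       (use h(1) open_nu_domain in \<open>auto intro: holomorphic_on_imp_differentiable_at\<close>)
  then obtain p where p: "\<And>u. u \<in> nu_domain \<Longrightarrow> (p has_field_derivative h u) (at u)" by blast
  define c where "c = 2 * complex_of_real pi * \<i>"
  have c0: "c \<noteq> 0" by (simp add: c_def)
  define k where "k = (\<lambda>u. dilog_series (qexp u) + c * (p u + u * Ln u - u))"
  have "(k has_field_derivative 0) (at u within {u. Im u > 0})" if u: "u \<in> {u. Im u > 0}" for u
  proof -
    have u': "Im u > 0" using u by simp
    note U = upper_half_plane_facts [OF u']
    have L: "(Ln has_field_derivative 1 / u) (at u)" using U by (auto intro!: derivative_eq_intros simp: inverse_eq_divide)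
    have "(k has_field_derivative (- c * Ln (1 - qexp u) + c * (h u + (1 * Ln u + 1 / u * u) - 1))) (at u)"
      unfolding k_def c_def
      by (intro DERIV_add DERIV_cmult DERIV_diff DERIV_mult DERIV_ident L p U has_field_derivative_dilog_qexp u')
    moreover have "- c * Ln (1 - qexp u) + c * (h u + (1 * Ln u + 1 / u * u) - 1) = 0"
      using h(2) [OF u'] U by (simp add: algebra_simps)
    ultimately show ?thesis by (simp only: has_field_derivative_at_within)
  qed
  then obtain k0 where k0: "\<And>u. u \<in> {u. Im u > 0} \<Longrightarrow> k u = k0"
    using has_field_derivative_zero_constant [OF convex_upper_half_plane, of k] by metis
  show ?thesis
  proof (rule that [of "\<lambda>u. p u - k0 / c"])
    show "((\<lambda>u. p u - k0 / c) has_field_derivative h u) (at u)" if "u \<in> nu_domain" for u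
      using DERIV_diff [OF p [OF that] DERIV_const] by simp
    show "dilog_series (qexp u) = - (2 * of_real pi * \<i>) * (p u - k0 / c + u * Ln u - u)" if "Im u > 0" for u
    proof -
      have "dilog_series (qexp u) = k0 - c * (p u + u * Ln u - u)" using k0 [of u] that by (simp add: k_def algebra_simps)
      also have "\<dots> = - c * (p u - k0 / c + u * Ln u - u)" using c0 by (simp add: field_simps)
      finally show ?thesis by (simp only: c_def)
    qed
  qed
qed

text \<open>\<open>continuation\<close> is a choice: one exhibited continuation f shows that the
  choice succeeds, and the identity theorem that it yields f.\<close>

lemma continuation_eq:
  assumes "open S" "S \<noteq> {}" "S \<subseteq> D" "open D" "connected D"
    and f: "f holomorphic_on D" "\<And>u. u \<in> S \<Longrightarrow> f u = g u" and x: "x \<in> D"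
  shows "continuation g S D x = f x"
proof -
  have c: "(continuation g S D) holomorphic_on D \<and> (\<forall>u\<in>S. continuation g S D u = g u)"
    unfolding continuation_def by (rule someI [of _ f]) (use f in auto)
  show ?thesis
    by (rule analytic_continuation_open [where f = "continuation g S D" and g = f and z = x, OF assms(1,4,2,5,3)])
       (use c f x in auto)
qed

lemma open_slit_domain: "\<tau> \<noteq> 0 \<Longrightarrow> open (slit_domain \<tau>)"
proof -
  assume "\<tau> \<noteq> 0"
  have "slit_domain \<tau> = nu_domain \<inter> (\<lambda>\<nu>. \<nu> / \<tau>) -` (- \<real>\<^sub>\<le>\<^sub>0)" by (auto simp: slit_domain_def)
  also have "open \<dots>"
    using \<open>\<tau> \<noteq> 0\<close> by (intro open_Int open_nu_domain open_vimage open_Compl closed_nonpos_Reals_complex continuous_intros) auto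
  finally show ?thesis .
qed

text \<open>The origin lies on the slit and cannot serve as a centre. Instead, the unit disc without
  the slit is connected, and scaling a point towards 0 keeps it in the domain until it enters this
  disc.\<close>

lemma connected_slit_domain:
  assumes "\<tau> \<noteq> 0" shows "connected (slit_domain \<tau>)"
proof -
  \<comment> \<open>Multiplication by \<tau> takes the disc of radius R without the nonpositive
    reals to the unit disc without the slit.\<close>
  define R where "R = 1 / norm \<tau>"
  have R: "R > 0" using assms by (simp add: R_def)
  define B where "B = {w :: complex. norm w < R \<and> w \<notin> \<real>\<^sub>\<le>\<^sub>0}"
  have "starlike B"
    unfolding starlike_def
  proof (intro bexI [of _ "complex_of_real (R / 2)"] ballI subsetI)
    fix w x assume w: "w \<in> B" and x: "x \<in> closed_segment (complex_of_real (R / 2)) w"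
    have "closed_segment (complex_of_real (R / 2)) w \<subseteq> ball 0 R"
      by (rule closed_segment_subset) (use w R in \<open>auto simp: B_def\<close>)
    then have n: "norm x < R" using x by auto
    obtain t where t: "0 \<le> t" "t \<le> 1" "x = (1 - t) *\<^sub>R complex_of_real (R / 2) + t *\<^sub>R w"
      using x by (auto simp: in_segment)
    have "x \<notin> \<real>\<^sub>\<le>\<^sub>0"
    proof
      assume "x \<in> \<real>\<^sub>\<le>\<^sub>0"
      then have x0: "Re x \<le> 0" "Im x = 0" by (auto simp: complex_nonpos_Reals_iff)
      have Re: "Re x = (1 - t) * (R / 2) + t * Re w" and Im: "Im x = t * Im w" by (simp_all add: t)
      have "t \<noteq> 0" using Re x0 R by auto
      then have "Im w = 0" using Im x0 by simp
      then have "Re w > 0" using w by (auto simp: B_def complex_nonpos_Reals_iff)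
      then have "t * Re w > 0" using t \<open>t \<noteq> 0\<close> by simp
      moreover have "(1 - t) * (R / 2) \<ge> 0" using t R by simp
      ultimately show False using Re x0 by linarith
    qed
    then show "x \<in> B" using n by (simp add: B_def)
  qed (use R in \<open>auto simp: B_def complex_nonpos_Reals_iff\<close>)
  then have "connected B" by (rule starlike_imp_connected)
  define K where "K = (\<lambda>w. \<tau> * w) ` B"
  have cK: "connected K" unfolding K_def by (intro connected_continuous_image continuous_intros \<open>connected B\<close>)
  have memK: "x \<in> K" if "norm x < 1" "x / \<tau> \<notin> \<real>\<^sub>\<le>\<^sub>0" for x
  proof -
    have "x = \<tau> * (x / \<tau>)" using assms by simp
    moreover have "x / \<tau> \<in> B" using that assms by (simp add: B_def R_def norm_divide divide_strict_right_mono)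
    ultimately show ?thesis unfolding K_def by blast
  qed
  have Ksub: "K \<subseteq> slit_domain \<tau>"
  proof
    fix x assume "x \<in> K"
    then obtain w where w: "x = \<tau> * w" "w \<in> B" by (auto simp: K_def)
    have "norm x < 1" using w assms by (simp add: B_def R_def norm_mult field_simps)
    then have "\<bar>Re x\<bar> < 1" using abs_Re_le_cmod [of x] by linarith
    then show "x \<in> slit_domain \<tau>" using w assms by (simp add: slit_domain_def nu_domain_iff B_def)
  qed
  have Kne: "K \<noteq> {}"
  proof -
    have "complex_of_real (R / 2) \<in> B" using R by (simp add: B_def complex_nonpos_Reals_iff)
    then show ?thesis by (auto simp: K_def)
  qed
  define seg where "seg = (\<lambda>\<nu>::complex. (\<lambda>t. of_real t * \<nu>) ` {0<..1::real})"
  have slit_scale: "of_real t * \<nu> \<in> slit_domain \<tau>" if "\<nu> \<in> slit_domain \<tau>" "0 < t" "t \<le> 1" for t \<nu>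
  proof -
    have n: "\<nu> / \<tau> \<notin> \<real>\<^sub>\<le>\<^sub>0" "\<nu> \<in> nu_domain" using that by (simp_all add: slit_domain_def)
    have "of_real t * (\<nu> / \<tau>) \<notin> \<real>\<^sub>\<le>\<^sub>0"
      using n(1) \<open>0 < t\<close> unfolding complex_nonpos_Reals_iff by (simp add: mult_le_0_iff del: times_divide_eq_right)
    then show ?thesis
      using nu_domain_scale [OF n(2), of t] that by (simp add: slit_domain_def)
  qed
  have "connected (K \<union> seg \<nu>)" if \<nu>: "\<nu> \<in> slit_domain \<tau>" for \<nu>
  proof (rule connected_Un [OF cK])
    show "connected (seg \<nu>)" unfolding seg_def by (intro connected_continuous_image continuous_intros) auto
    define t where "t = 1 / (norm \<nu> + 1)"
    have t: "0 < t" "t \<le> 1" by (auto simp: t_def add_nonneg_pos)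
    have "norm \<nu> + 1 > 0" by (simp add: add_nonneg_pos)
    then have "t * norm \<nu> < 1" by (simp add: t_def field_simps)
    then have "norm (of_real t * \<nu>) < 1" using t by (simp add: norm_mult)
    moreover have "of_real t * \<nu> / \<tau> \<notin> \<real>\<^sub>\<le>\<^sub>0" using slit_scale [OF \<nu> t] by (simp add: slit_domain_def)
    ultimately have "of_real t * \<nu> \<in> K" by (rule memK)
    moreover have "of_real t * \<nu> \<in> seg \<nu>" using t by (auto simp: seg_def)
    ultimately show "K \<inter> seg \<nu> \<noteq> {}" by blast
  qed
  then have "connected (\<Union>((\<lambda>\<nu>. K \<union> seg \<nu>) ` slit_domain \<tau>))"
    by (intro connected_Union) (use Kne in auto)
  moreover have "\<Union>((\<lambda>\<nu>. K \<union> seg \<nu>) ` slit_domain \<tau>) = slit_domain \<tau>"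
  proof
    show "\<Union>((\<lambda>\<nu>. K \<union> seg \<nu>) ` slit_domain \<tau>) \<subseteq> slit_domain \<tau>"
      using Ksub slit_scale by (auto simp: seg_def)
    show "slit_domain \<tau> \<subseteq> \<Union>((\<lambda>\<nu>. K \<union> seg \<nu>) ` slit_domain \<tau>)"
    proof
      fix \<nu> assume "\<nu> \<in> slit_domain \<tau>"
      moreover have "\<nu> \<in> seg \<nu>" unfolding seg_def by (rule image_eqI [of _ _ 1]) auto
      ultimately show "\<nu> \<in> \<Union>((\<lambda>\<nu>. K \<union> seg \<nu>) ` slit_domain \<tau>)" by blast
    qed
  qed
  ultimately show ?thesis by simp
qed

text \<open>Both arguments lie in (0, pi), so their difference is a principal value.\<close>

lemma Ln_divide_upper_half_plane:
  assumes "Im u > 0" "Im \<tau> > 0"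
  shows "Ln (u / \<tau>) = Ln u - Ln \<tau>"
proof -
  have nz: "u \<noteq> 0" "\<tau> \<noteq> 0" using assms by auto
  have "0 < Im (Ln u)" "Im (Ln u) < pi" "0 < Im (Ln \<tau>)" "Im (Ln \<tau>) < pi"
    using assms nz Im_Ln_pos_lt_imp [of u] Im_Ln_pos_lt_imp [of \<tau>] by auto
  moreover have "exp (Ln u - Ln \<tau>) = u / \<tau>" using nz by (simp add: exp_diff)
  ultimately show ?thesis using Ln_exp [of "Ln u - Ln \<tau>"] by simp
qed

lemma upper_half_plane_subset_slit_domain:
  assumes "Im \<tau> > 0"
  shows "{u. Im u > 0} \<subseteq> slit_domain \<tau>"
proof
  fix u assume "u \<in> {u. Im u > 0}"
  then have u: "Im u > 0" by simp
  have "u / \<tau> \<notin> \<real>\<^sub>\<le>\<^sub>0"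
  proof
    assume "u / \<tau> \<in> \<real>\<^sub>\<le>\<^sub>0"
    then obtain r where r: "r \<le> 0" "u / \<tau> = of_real r" by (auto elim: nonpos_Reals_cases)
    moreover have "\<tau> \<noteq> 0" using assms by auto
    ultimately have "u = of_real r * \<tau>" by (simp add: divide_eq_eq)
    then have "Im u = r * Im \<tau>" by simp
    then show False using r u assms mult_nonpos_nonneg [of r "Im \<tau>"] by simp
  qed
  then show "u \<in> slit_domain \<tau>" using u by (simp add: slit_domain_def nu_domain_iff)
qed

text \<open>Ln (\<nu> / \<tau>) + Ln \<tau> is the logarithm of \<nu> cut along \<nu> / \<tau> \<le>
  0: holomorphic on \<open>slit_domain \<tau>\<close> and equal to Ln \<nu> on the upper half-plane.
  Added to \<open>h\<close> it gives the required continuation.\<close>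

lemma log_one_minus_e_eq:
  assumes \<tau>: "Im \<tau> > 0" and h: "h holomorphic_on nu_domain" "\<And>u. Im u > 0 \<Longrightarrow> h u = Ln (1 - qexp u) - Ln u"
    and \<nu>: "\<nu> \<in> slit_domain \<tau>"
  shows "log_one_minus_e \<tau> \<nu> = h \<nu> + Ln (\<nu> / \<tau>) + Ln \<tau>"
proof -
  have t0: "\<tau> \<noteq> 0" using \<tau> by auto
  have ne: "{u. Im u > 0} \<noteq> {}" by (auto intro: exI [of _ \<i>])
  show ?thesis unfolding log_one_minus_e_def qexp_def [symmetric]
  proof (rule continuation_eq [OF open_upper_half_plane ne upper_half_plane_subset_slit_domain [OF \<tau>]
      open_slit_domain [OF t0] connected_slit_domain [OF t0] _ _ \<nu>])
    show "(\<lambda>\<nu>. h \<nu> + Ln (\<nu> / \<tau>) + Ln \<tau>) holomorphic_on slit_domain \<tau>"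
      using t0 by (intro holomorphic_intros holomorphic_on_subset [OF h(1)]) (auto simp: slit_domain_def)
    fix u assume "u \<in> {u. Im u > 0}"
    then show "h u + Ln (u / \<tau>) + Ln \<tau> = Ln (1 - qexp u)"
      using h(2) [of u] Ln_divide_upper_half_plane [of u \<tau>] \<tau> by simp
  qed
qed

lemma dilog_e_eq:
  assumes \<tau>: "Im \<tau> > 0" and h: "\<And>u. u \<in> nu_domain \<Longrightarrow> (h1 has_field_derivative h u) (at u)"
    "\<And>u. Im u > 0 \<Longrightarrow> dilog_series (qexp u) = - (2 * of_real pi * \<i>) * (h1 u + u * Ln u - u)"
    and \<nu>: "\<nu> \<in> slit_domain \<tau>"
  shows "dilog_e \<tau> \<nu> = - (2 * of_real pi * \<i>) * (h1 \<nu> + \<nu> * (Ln (\<nu> / \<tau>) + Ln \<tau>) - \<nu>)"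
proof -
  have t0: "\<tau> \<noteq> 0" using \<tau> by auto
  have ne: "{u. Im u > 0} \<noteq> {}" by (auto intro: exI [of _ \<i>])
  have h1: "h1 holomorphic_on nu_domain"
    unfolding holomorphic_on_def field_differentiable_def using h(1) by (blast intro: has_field_derivative_at_within)
  show ?thesis unfolding dilog_e_def qexp_def [symmetric]
  proof (rule continuation_eq [OF open_upper_half_plane ne upper_half_plane_subset_slit_domain [OF \<tau>]
      open_slit_domain [OF t0] connected_slit_domain [OF t0] _ _ \<nu>])
    show "(\<lambda>\<nu>. - (2 * of_real pi * \<i>) * (h1 \<nu> + \<nu> * (Ln (\<nu> / \<tau>) + Ln \<tau>) - \<nu>)) holomorphic_on slit_domain \<tau>"
      using t0 by (intro holomorphic_intros holomorphic_on_subset [OF h1]) (auto simp: slit_domain_def)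
    fix u assume "u \<in> {u. Im u > 0}"
    then show "- (2 * of_real pi * \<i>) * (h1 u + u * (Ln (u / \<tau>) + Ln \<tau>) - u) = dilog_series (qexp u)"
      using h(2) [of u] Ln_divide_upper_half_plane [of u \<tau>] \<tau> by simp
  qed
qed

subsection \<open>Connectedness over the upper half-plane\<close>

lemma open_P_ray_domain: "open (P_ray_domain d)"
proof -
  define S :: "(complex \<times> complex) set" where "S = {z. fst z \<noteq> 0}"
  define f where "f = (\<lambda>z::complex \<times> complex. - Im (cis d / fst z) - \<bar>Im (snd z * cis d / fst z)\<bar>)"
  have opS: "open S" unfolding S_def by (intro open_Collect_neq continuous_intros)
  have "continuous_on S f" unfolding f_def by (intro continuous_intros) (auto simp: S_def)
  then have "open (S \<inter> f -` {0<..})" by (intro continuous_open_preimage opS) auto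
  \<comment> \<open>Points with \<tau> = 0 fail the strict inequality, because division by 0 makes
    both of its sides 0.\<close>
  moreover have "S \<inter> f -` {0<..} = P_ray_domain d" by (auto simp: S_def f_def P_ray_domain_def)
  ultimately show ?thesis by simp
qed

text \<open>The inequality is homogeneous under positive scaling, so any w in the lower half-plane
  can stand for its direction.\<close>

lemma in_P_ray_domain:
  assumes "Im w < 0" "\<bar>Im (\<nu> * w / \<tau>)\<bar> < - Im (w / \<tau>)"
  obtains d where "d \<in> {-pi<..<0}" "(\<tau>, \<nu>) \<in> P_ray_domain d"
proof (rule that [of "Arg w"])
  have w: "w \<noteq> 0" using assms by auto
  define r where "r = norm w"
  have r: "r > 0" using w by (simp add: r_def)
  show "Arg w \<in> {-pi<..<0}" using assms(1) Arg_less_0 [of w] mpi_less_Arg [of w] by auto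
  have c: "cis (Arg w) = w / of_real r" using cis_Arg [OF w] by (simp add: sgn_eq r_def)
  have "\<nu> * (w / of_real r) / \<tau> = (\<nu> * w / \<tau>) / of_real r" "(w / of_real r) / \<tau> = (w / \<tau>) / of_real r" by simp_all
  then show "(\<tau>, \<nu>) \<in> P_ray_domain (Arg w)"
    using divide_strict_right_mono [OF assms(2) r] r unfolding P_ray_domain_def c
    by (simp only: Im_divide_of_real mem_Collect_eq case_prod_conv) simp
qed

lemma real_point_in_P_ray_domain:
  assumes "Im \<tau> = 0" "\<tau> \<notin> \<real>\<^sub>\<le>\<^sub>0" "\<nu> \<in> nu_domain"
  obtains d where "d \<in> {-pi<..<0}" "(\<tau>, \<nu>) \<in> P_ray_domain d"
proof -
  define t where "t = Re \<tau>"
  have t: "t > 0" "\<tau> = of_real t" using assms by (auto simp: t_def complex_nonpos_Reals_iff complex_eq_iff)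
  \<comment> \<open>If \<nu> is not real, the one of cnj \<nu> and - cnj \<nu> in the lower
    half-plane makes \<nu> w real. If \<nu> is real, w = - i turns the condition into |Re \<nu>| <
    1, which \<open>nu_domain\<close> provides.\<close>
  define w where "w = (if Im \<nu> = 0 then - \<i> else if Im \<nu> > 0 then cnj \<nu> else - cnj \<nu>)"
  have w: "Im w < 0" by (auto simp: w_def)
  have lt: "\<bar>Im (\<nu> * w)\<bar> < - Im w" using assms(3) by (auto simp: w_def nu_domain_iff algebra_simps)
  have "\<bar>Im (\<nu> * w / \<tau>)\<bar> < - Im (w / \<tau>)"
    using divide_strict_right_mono [OF lt t(1)] t(1) unfolding t(2) Im_divide_of_real by simp
  from in_P_ray_domain [OF w this] show ?thesis using that by blast
qed

definition upper_ray_domain :: "(complex \<times> complex) set" where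
  "upper_ray_domain = (\<Union>d\<in>{-pi<..<0}. P_ray_domain d) \<inter> {z. Im (fst z) > 0}"

text \<open>Each fibre over \<tau> is starlike about \<nu> = 0, because the left side of the
  defining inequality scales with \<nu>; the centres form a copy of the upper half-plane.\<close>

lemma connected_upper_ray_domain: "connected upper_ray_domain"
proof -
  define H :: "(complex \<times> complex) set" where "H = {\<tau>. Im \<tau> > 0} \<times> {0}"
  have cH: "connected H" unfolding H_def
    by (intro connected_Times convex_connected [OF convex_upper_half_plane]) auto
  have Hsub: "H \<subseteq> upper_ray_domain"
  proof
    fix z assume "z \<in> H"
    then obtain \<tau> where \<tau>: "z = (\<tau>, 0)" "Im \<tau> > 0" by (auto simp: H_def)
    \<comment> \<open>Chosen so that u and u \<tau> both have imaginary part -1; then w = u \<tau>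
      is an admissible direction for \<nu> = 0.\<close>
    define u where "u = Complex ((Re \<tau> - 1) / Im \<tau>) (-1)"
    have 1: "Im (u * \<tau>) < 0" using \<tau> by (simp add: u_def)
    have t0: "\<tau> \<noteq> 0" using \<tau> by auto
    have 2: "\<bar>Im (0 * (u * \<tau>) / \<tau>)\<bar> < - Im (u * \<tau> / \<tau>)" using t0 by (simp add: u_def)
    obtain d where "d \<in> {-pi<..<0}" "(\<tau>, 0) \<in> P_ray_domain d" by (rule in_P_ray_domain [OF 1 2])
    then show "z \<in> upper_ray_domain" using \<tau> by (auto simp: upper_ray_domain_def)
  qed
  define seg where "seg = (\<lambda>z::complex \<times> complex. (\<lambda>t. (fst z, of_real t * snd z)) ` {0..1::real})"
  have seg_sub: "seg z \<subseteq> upper_ray_domain" if z: "z \<in> upper_ray_domain" for z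
  proof
    fix y assume "y \<in> seg z"
    then obtain t where t: "0 \<le> t" "t \<le> 1" "y = (fst z, of_real t * snd z)" by (auto simp: seg_def)
    obtain d where d: "d \<in> {-pi<..<0}" "z \<in> P_ray_domain d" "Im (fst z) > 0" using z by (auto simp: upper_ray_domain_def)
    have "of_real t * snd z * cis d / fst z = of_real t * (snd z * cis d / fst z)" by simp
    moreover have "Im (of_real t * x) = t * Im x" for x by simp
    ultimately have "\<bar>Im (of_real t * snd z * cis d / fst z)\<bar> = t * \<bar>Im (snd z * cis d / fst z)\<bar>"
      using t by (simp only: abs_mult abs_of_nonneg)
    also have "\<dots> \<le> 1 * \<bar>Im (snd z * cis d / fst z)\<bar>" using t by (intro mult_right_mono) auto
    also have "\<dots> < - Im (cis d / fst z)" using d(2) by (auto simp: P_ray_domain_def)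
    finally have "y \<in> P_ray_domain d" using t by (simp add: P_ray_domain_def)
    then show "y \<in> upper_ray_domain" using d t by (auto simp: upper_ray_domain_def)
  qed
  have "connected (H \<union> seg z)" if z: "z \<in> upper_ray_domain" for z
  proof (rule connected_Un [OF cH])
    show "connected (seg z)" unfolding seg_def by (intro connected_continuous_image continuous_intros) auto
    have "(fst z, 0) \<in> seg z" unfolding seg_def by (rule image_eqI [of _ _ 0]) auto
    moreover have "(fst z, 0) \<in> H" using z by (auto simp: H_def upper_ray_domain_def)
    ultimately show "H \<inter> seg z \<noteq> {}" by blast
  qed
  then have "connected (\<Union>((\<lambda>z. H \<union> seg z) ` upper_ray_domain))"
  proof (intro connected_Union)
    have "(\<i>, 0) \<in> H" by (simp add: H_def)
    then show "\<Inter>((\<lambda>z. H \<union> seg z) ` upper_ray_domain) \<noteq> {}" by blast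
  qed auto
  moreover have "\<Union>((\<lambda>z. H \<union> seg z) ` upper_ray_domain) = upper_ray_domain"
  proof
    show "\<Union>((\<lambda>z. H \<union> seg z) ` upper_ray_domain) \<subseteq> upper_ray_domain" using Hsub seg_sub by blast
    show "upper_ray_domain \<subseteq> \<Union>((\<lambda>z. H \<union> seg z) ` upper_ray_domain)"
    proof
      fix z assume "z \<in> upper_ray_domain"
      moreover have "z \<in> seg z" unfolding seg_def by (rule image_eqI [of _ _ 1]) auto
      ultimately show "z \<in> \<Union>((\<lambda>z. H \<union> seg z) ` upper_ray_domain)" by blast
    qed
  qed
  ultimately show ?thesis by simp
qed

text \<open>A component of the part of \<open>D\<close> over the upper half-plane cannot avoid the ray domains:
  its boundary points in \<open>D\<close> have \<open>\<tau> > 0\<close>, and there all admissible \<open>\<nu>\<close> lie in a ray domain.\<close>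

lemma connected_upper_part:
  assumes P: "P_continuation D P"
  shows "connected (D \<inter> {z. Im (fst z) > 0})"
proof -
  define Dp where "Dp = D \<inter> {z. Im (fst z) > 0}"
  have D: "open D" "connected D" "D \<subseteq> (- \<real>\<^sub>\<le>\<^sub>0) \<times> nu_domain" "\<And>d. d \<in> {-pi<..<0} \<Longrightarrow> P_ray_domain d \<subseteq> D"
    using P by (auto simp: P_continuation_def)
  have op: "open {z :: complex \<times> complex. Im (fst z) > 0}" "open {z :: complex \<times> complex. Im (fst z) < 0}"
    by (intro open_Collect_less continuous_intros)+
  have opDp: "open Dp" unfolding Dp_def by (intro open_Int D op)
  have Usub: "upper_ray_domain \<subseteq> Dp" using D(4) unfolding upper_ray_domain_def Dp_def by blast
  have False if A: "open A" and B: "open B" and AB: "Dp \<subseteq> A \<union> B" "A \<inter> B \<inter> Dp = {}" "B \<inter> Dp \<noteq> {}"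
    and UA: "upper_ray_domain \<subseteq> A" for A B
  proof -
    define B' where "B' = Dp \<inter> B"
    define R where "R = (\<Union>d\<in>{-pi<..<0}. P_ray_domain d)"
    have opB': "open B'" unfolding B'_def by (intro open_Int opDp B)
    \<comment> \<open>\<open>B'\<close> and \<open>C\<close> would split the connected
      \<open>D\<close>: points with real \<tau> lie in \<open>R\<close>, so \<open>C\<close>
      contains all of \<open>D\<close> outside \<open>B'\<close>, and \<open>R\<close> misses
      \<open>B'\<close> because the upper ray domain lies in \<open>A\<close>.\<close>
    define C where "C = (Dp \<inter> A) \<union> (D \<inter> {z. Im (fst z) < 0}) \<union> R"
    have opC: "open C" unfolding C_def R_def
      by (intro open_Un open_Int opDp A D op open_UN ballI open_P_ray_domain)
    have "D \<subseteq> B' \<union> C"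
    proof
      fix z assume z: "z \<in> D"
      consider "Im (fst z) > 0" | "Im (fst z) < 0" | "Im (fst z) = 0" by linarith
      then show "z \<in> B' \<union> C"
      proof cases
        case 1
        then have "z \<in> Dp" using z by (simp add: Dp_def)
        then show ?thesis using AB(1) by (auto simp: B'_def C_def)
      next
        case 2 then show ?thesis using z by (simp add: C_def)
      next
        case 3
        have "fst z \<notin> \<real>\<^sub>\<le>\<^sub>0" "snd z \<in> nu_domain" using D(3) z by auto
        from real_point_in_P_ray_domain [OF 3 this] obtain d where "d \<in> {-pi<..<0}" "(fst z, snd z) \<in> P_ray_domain d" by blast
        then have "z \<in> R" unfolding R_def by auto
        then show ?thesis by (simp add: C_def)
      qed
    qed
    moreover have "B' \<inter> C \<inter> D = {}"
    proof -
      have "z \<notin> C" if z: "z \<in> B'" for z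
      proof -
        have zz: "z \<in> Dp" "z \<in> B" "Im (fst z) > 0" using z by (auto simp: B'_def Dp_def)
        then have "z \<notin> A" using AB(2) by blast
        moreover have "z \<notin> R"
        proof
          assume "z \<in> R"
          then have "z \<in> upper_ray_domain" using zz by (simp add: R_def upper_ray_domain_def)
          then show False using UA \<open>z \<notin> A\<close> by blast
        qed
        ultimately show ?thesis using zz by (simp add: C_def)
      qed
      then show ?thesis by blast
    qed
    moreover have "B' \<inter> D \<noteq> {}" using AB(3) by (auto simp: B'_def Dp_def)
    moreover have "C \<inter> D \<noteq> {}"
    proof -
      obtain d where "d \<in> {-pi<..<0}" "(1, 0) \<in> P_ray_domain d"
        by (rule real_point_in_P_ray_domain [of 1 0]) (auto simp: nu_domain_iff)
      then have "(1, 0) \<in> C \<inter> D" using D(4) by (auto simp: C_def R_def)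
      then show ?thesis by blast
    qed
    ultimately show False using D(2) opB' opC unfolding connected_def by blast
  qed
  then have key: "\<And>A B. open A \<Longrightarrow> open B \<Longrightarrow> Dp \<subseteq> A \<union> B \<Longrightarrow> A \<inter> B \<inter> Dp = {} \<Longrightarrow> B \<inter> Dp \<noteq> {} \<Longrightarrow> \<not> upper_ray_domain \<subseteq> A"
    by blast
  have "connected Dp"
    unfolding connected_def
  proof (intro notI, elim exE conjE)
    fix A B assume AB: "open A" "open B" "Dp \<subseteq> A \<union> B" "A \<inter> B \<inter> Dp = {}" "A \<inter> Dp \<noteq> {}" "B \<inter> Dp \<noteq> {}"
    have "upper_ray_domain \<subseteq> A \<or> upper_ray_domain \<subseteq> B"
    proof (rule ccontr)
      assume "\<not> ?thesis"
      then have "A \<inter> upper_ray_domain \<noteq> {}" "B \<inter> upper_ray_domain \<noteq> {}" using AB Usub by blast+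
      then show False using connected_upper_ray_domain AB Usub unfolding connected_def by blast
    qed
    then show False using key [of A B] key [of B A] AB by blast
  qed
  then show ?thesis by (simp add: Dp_def)
qed

subsection \<open>Continuation of both identities\<close>

text \<open>Besides \<nu> = 0 these are the poles of both Lambert series. The poles \<nu> = - k
  \<tau> of the digamma term are among them, and those of \<open>lam0 \<nu>\<close> other than 0 lie
  outside \<open>nu_domain\<close>.\<close>

definition pole_set :: "(complex \<times> complex) set" where
  "pole_set = {z. snd z = 0 \<or> (\<exists>k. qexp (snd z + of_nat (Suc k) * fst z) = 1) \<or>
     (\<exists>m. qexp (snd z / fst z + of_nat (Suc m) * (- 1 / fst z)) = 1)}"

lemma open_complement_pole_set:
  assumes S: "open S" and Im: "\<And>z. z \<in> S \<Longrightarrow> Im (fst z) > 0"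
  shows "open (S - pole_set)"
proof -
  have nz: "fst z \<noteq> 0" if "z \<in> S" for z using Im [OF that] by auto
  have "open {z \<in> S. \<forall>k. qexp (snd z + of_nat (Suc k) * fst z) \<noteq> 1}"
    by (rule open_lambert_domain [OF S _ _ Im]) (auto intro!: continuous_intros)
  moreover have "open {z \<in> S. \<forall>k. qexp (snd z / fst z + of_nat (Suc k) * (- 1 / fst z)) \<noteq> 1}"
  proof (rule open_lambert_domain [OF S])
    show "0 < Im (- 1 / fst z)" if "z \<in> S" for z
      using Im [OF that] by (simp add: Im_divide sum_power2_gt_zero_iff)
  qed (use nz in \<open>auto intro!: continuous_intros\<close>)
  moreover have "open {z :: complex \<times> complex. snd z \<noteq> 0}" by (intro open_Collect_neq continuous_intros)
  ultimately have "open ({z \<in> S. \<forall>k. qexp (snd z + of_nat (Suc k) * fst z) \<noteq> 1} \<inter>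
      {z \<in> S. \<forall>k. qexp (snd z / fst z + of_nat (Suc k) * (- 1 / fst z)) \<noteq> 1} \<inter> {z. snd z \<noteq> 0})" by blast
  moreover have "({z \<in> S. \<forall>k. qexp (snd z + of_nat (Suc k) * fst z) \<noteq> 1} \<inter>
      {z \<in> S. \<forall>k. qexp (snd z / fst z + of_nat (Suc k) * (- 1 / fst z)) \<noteq> 1} \<inter> {z. snd z \<noteq> 0}) = S - pole_set"
    unfolding pole_set_def by blast
  ultimately show ?thesis by simp
qed

text \<open>Off \<tau> = 0 the set is a countable union of zero sets of affine functions. At \<tau>
  = 0 the convention on division makes the last argument of \<open>qexp\<close> zero, so every such
  point belongs to the set.\<close>

lemma pole_set_cases:
  assumes "z \<in> pole_set"
  shows "fst z = 0 \<or> snd z = 0 \<or> (\<exists>k j. snd z + of_nat (Suc k) * fst z - of_int j = 0) \<or>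
    (\<exists>m j. snd z - of_nat (Suc m) - of_int j * fst z = 0)"
proof (cases "fst z = 0")
  case False
  consider "snd z = 0" | k where "qexp (snd z + of_nat (Suc k) * fst z) = 1"
    | m where "qexp (snd z / fst z + of_nat (Suc m) * (- 1 / fst z)) = 1"
    using assms by (auto simp: pole_set_def)
  then show ?thesis
  proof cases
    case 2
    then obtain j where "snd z + of_nat (Suc k) * fst z = of_int j" by (auto simp: qexp_eq_1_iff elim: Ints_cases)
    then have "snd z + of_nat (Suc k) * fst z - of_int j = 0" by (simp only: diff_self)
    then show ?thesis by blast
  next
    case 3
    then obtain j where "snd z / fst z + of_nat (Suc m) * (- 1 / fst z) = of_int j" by (auto simp: qexp_eq_1_iff elim: Ints_cases)
    then have "snd z - of_nat (Suc m) - of_int j * fst z = 0" using False by (simp add: field_simps)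
    then show ?thesis by blast
  qed auto
qed auto

lemma not_pole_set:
  assumes "z \<notin> pole_set" "fst z \<noteq> 0"
  shows "snd z \<noteq> 0" "snd z + of_nat (Suc k) * fst z - of_int j \<noteq> 0" "snd z - of_nat (Suc m) - of_int j * fst z \<noteq> 0"
proof -
  show "snd z \<noteq> 0" using assms by (auto simp: pole_set_def)
  show "snd z + of_nat (Suc k) * fst z - of_int j \<noteq> 0"
  proof
    assume "snd z + of_nat (Suc k) * fst z - of_int j = 0"
    then have "snd z + of_nat (Suc k) * fst z = of_int j" by (simp only: right_minus_eq)
    then have "qexp (snd z + of_nat (Suc k) * fst z) = 1" unfolding qexp_eq_1_iff by (simp only: Ints_of_int)
    then show False using assms(1) unfolding pole_set_def by blast
  qed
  show "snd z - of_nat (Suc m) - of_int j * fst z \<noteq> 0"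
  proof
    assume "snd z - of_nat (Suc m) - of_int j * fst z = 0"
    then have "snd z / fst z + of_nat (Suc m) * (- 1 / fst z) = of_int j" using assms(2) by (simp add: field_simps)
    then have "qexp (snd z / fst z + of_nat (Suc m) * (- 1 / fst z)) = 1" unfolding qexp_eq_1_iff by (simp only: Ints_of_int)
    then show False using assms(1) unfolding pole_set_def by blast
  qed
qed

lemma countable_affine_zero: "c \<noteq> 0 \<Longrightarrow> countable {\<zeta> :: complex. c + \<zeta> * d = 0}"
proof -
  assume c: "c \<noteq> 0"
  have "{\<zeta>. c + \<zeta> * d = 0} \<subseteq> {- c / d}"
  proof
    fix \<zeta> assume z: "\<zeta> \<in> {\<zeta>. c + \<zeta> * d = 0}"
    then have "d \<noteq> 0" using c by auto
    moreover have "\<zeta> * d = - c" using z by (simp add: add_eq_0_iff2 add.commute)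
    ultimately show "\<zeta> \<in> {- c / d}" by (simp add: field_simps)
  qed
  then show ?thesis by (rule countable_subset) simp
qed

text \<open>Each of the countably many affine functions is nonzero at z and so has at most one zero
  on a line through z.\<close>

lemma countable_line_pole_set:
  assumes z: "z \<notin> pole_set" "fst z \<noteq> 0"
  shows "countable {\<zeta>. z + (\<zeta> * a, \<zeta> * b) \<in> pole_set}"
proof -
  note np = not_pole_set [OF z]
  define X where "X = {\<zeta>. fst z + \<zeta> * a = 0} \<union> {\<zeta>. snd z + \<zeta> * b = 0} \<union>
    (\<Union>k. \<Union>j. {\<zeta>. (snd z + of_nat (Suc k) * fst z - of_int j) + \<zeta> * (b + of_nat (Suc k) * a) = 0}) \<union>
    (\<Union>m. \<Union>j. {\<zeta>. (snd z - of_nat (Suc m) - of_int j * fst z) + \<zeta> * (b - of_int j * a) = 0})"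
  have "countable X" unfolding X_def
    using np z(2) by (intro countable_Un countable_UN) (auto simp del: of_nat_Suc intro!: countable_affine_zero)
  moreover have "{\<zeta>. z + (\<zeta> * a, \<zeta> * b) \<in> pole_set} \<subseteq> X"
  proof
    fix \<zeta> assume "\<zeta> \<in> {\<zeta>. z + (\<zeta> * a, \<zeta> * b) \<in> pole_set}"
    then have "z + (\<zeta> * a, \<zeta> * b) \<in> pole_set" by simp
    from pole_set_cases [OF this] consider "fst z + \<zeta> * a = 0" | "snd z + \<zeta> * b = 0"
      | k j where "(snd z + \<zeta> * b) + of_nat (Suc k) * (fst z + \<zeta> * a) - of_int j = 0"
      | m j where "(snd z + \<zeta> * b) - of_nat (Suc m) - of_int j * (fst z + \<zeta> * a) = 0" by auto
    then show "\<zeta> \<in> X"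
    proof cases
      case (3 k j)
      have "(snd z + of_nat (Suc k) * fst z - of_int j) + \<zeta> * (b + of_nat (Suc k) * a) =
        (snd z + \<zeta> * b) + of_nat (Suc k) * (fst z + \<zeta> * a) - of_int j" by (simp add: algebra_simps)
      then have "(snd z + of_nat (Suc k) * fst z - of_int j) + \<zeta> * (b + of_nat (Suc k) * a) = 0" using 3 by (simp only:)
      then show ?thesis unfolding X_def by blast
    next
      case (4 m j)
      have "(snd z - of_nat (Suc m) - of_int j * fst z) + \<zeta> * (b - of_int j * a) =
        (snd z + \<zeta> * b) - of_nat (Suc m) - of_int j * (fst z + \<zeta> * a)" by (simp add: algebra_simps)
      then have "(snd z - of_nat (Suc m) - of_int j * fst z) + \<zeta> * (b - of_int j * a) = 0" using 4 by (simp only:)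
      then show ?thesis unfolding X_def by blast
    qed (auto simp: X_def)
  qed
  ultimately show ?thesis by (rule countable_subset [rotated])
qed

text \<open>For fixed \<tau> only countably many \<nu> are excluded, while discs are
  uncountable.\<close>

lemma dense_complement_pole_set:
  assumes V: "open V" "V \<noteq> {}" "\<And>z. z \<in> V \<Longrightarrow> fst z \<noteq> 0"
  shows "V - pole_set \<noteq> {}"
proof
  assume *: "V - pole_set = {}"
  obtain \<tau> \<nu> where z: "(\<tau>, \<nu>) \<in> V" using V(2) by auto
  have t0: "\<tau> \<noteq> 0" using V(3) [OF z] by simp
  obtain A B where AB: "open A" "open B" "(\<tau>, \<nu>) \<in> A \<times> B" "A \<times> B \<subseteq> V"
    by (rule open_prod_elim [OF V(1) z]) (rule that)
  define X where "X = {0} \<union> (\<Union>k. \<Union>j. {of_int j - of_nat (Suc k) * \<tau>}) \<union> (\<Union>m. \<Union>j. {of_nat (Suc m) + of_int j * \<tau>})"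
  have "countable X" unfolding X_def by (intro countable_Un countable_UN) auto
  moreover have "B \<subseteq> X"
  proof
    fix v assume "v \<in> B"
    then have "(\<tau>, v) \<in> pole_set" using AB * by blast
    from pole_set_cases [OF this] t0 consider "v = 0" | k j where "v + of_nat (Suc k) * \<tau> - of_int j = 0"
      | m j where "v - of_nat (Suc m) - of_int j * \<tau> = 0" by auto
    then show "v \<in> X"
    proof cases
      case (2 k j)
      then have "v = of_int j - of_nat (Suc k) * \<tau>" by (simp add: algebra_simps)
      then show ?thesis unfolding X_def by blast
    next
      case (3 m j)
      then have "v = of_nat (Suc m) + of_int j * \<tau>" by (simp add: algebra_simps)
      then show ?thesis unfolding X_def by blast
    qed (simp add: X_def)
  qed
  ultimately have "countable B" by (rule countable_subset [rotated])
  moreover obtain r where "r > 0" "ball \<nu> r \<subseteq> B" using AB open_contains_ball by blast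
  ultimately show False using uncountable_ball [of r \<nu>] countable_subset by blast
qed

lemma holomorphic_on_lsum:
  assumes S: "open S" and a: "a holomorphic_on S" and b: "b holomorphic_on S"
    and Im: "\<And>z. z \<in> S \<Longrightarrow> Im (a z) > 0"
    and np: "\<And>z k. z \<in> S \<Longrightarrow> qexp (b z + of_nat (Suc k) * a z) \<noteq> 1"
    and w: "\<And>k. norm (w k) \<le> real (Suc k)"
  shows "(\<lambda>z. lsum w lam0 (b z) (a z)) holomorphic_on S"
  unfolding holomorphic_on_def field_differentiable_def
proof
  fix z assume z: "z \<in> S"
  have "((\<lambda>z. \<Sum>k. w k * lam0 (b z + of_nat (Suc k) * a z)) has_field_derivative
          (\<Sum>k. w k * (lam1 (b z + of_nat (Suc k) * a z) * (deriv b z + of_nat (Suc k) * deriv a z)))) (at z)"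
    by (rule lambert_series_derivative(3) [where a' = "deriv a" and b' = "deriv b" and g = lam0 and g' = lam1,
          OF S holomorphic_derivI [OF a S] holomorphic_derivI [OF b S] Im np has_field_derivative_lam0 norm_lam0_le w z])
  then show "\<exists>f'. ((\<lambda>z. lsum w lam0 (b z) (a z)) has_field_derivative f') (at z within S)"
    unfolding lsum_def by (blast intro: has_field_derivative_at_within)
qed

lemma deriv_shift_0: "deriv (\<lambda>\<eta>. f (z + \<eta>)) 0 = deriv f (z :: complex)"
  unfolding deriv_def using DERIV_shift [of f _ 0 z] by (simp add: add.commute)

text \<open>\<open>F1\<close> with Ln (1 - qexp \<nu>) - Ln (\<nu> / \<tau>) replaced by h \<nu> +
  Ln \<tau>, so that no cut along \<nu> / \<tau> \<le> 0 remains. The derivative of P has the form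
  used in \<open>holomorphic_partial_derivative_on_line\<close>.\<close>

definition G1 :: "(complex \<Rightarrow> complex) \<Rightarrow> (complex \<times> complex \<Rightarrow> complex) \<Rightarrow> complex \<times> complex \<Rightarrow> complex" where
  "G1 h P z = 2 * of_real pi * \<i> * lsum (\<lambda>_. 1) lam0 (snd z) (fst z) - (h (snd z) + Ln (fst z)) / fst z
     + of_real pi * \<i> * lam0 (snd z)
     - 2 * of_real pi * \<i> / fst z * lsum (\<lambda>_. 1) lam0 (snd z / fst z) (- 1 / fst z)
     - Digamma (snd z / fst z + 1) / fst z + 1 / (2 * snd z) + deriv (\<lambda>\<eta>. P (z + (\<eta> * 0, \<eta> * 1))) 0"

text \<open>The summand \<nu> Ln \<nu> of the dilogarithm and - \<nu> Ln (\<nu> / \<tau>) combine to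
  \<nu> Ln \<tau>, which again removes the cut.\<close>

definition G2 :: "(complex \<Rightarrow> complex) \<Rightarrow> (complex \<times> complex \<Rightarrow> complex) \<Rightarrow> complex \<times> complex \<Rightarrow> complex" where
  "G2 h1 P z = 2 * of_real pi * \<i> * lsum (\<lambda>k. of_nat (Suc k)) lam0 (snd z) (fst z) - of_real pi * \<i> / 12
     + (h1 (snd z) - snd z + snd z * Ln (fst z)) / (fst z)\<^sup>2
     + 2 * of_real pi * \<i> / (fst z)\<^sup>2 * (snd z * lsum (\<lambda>_. 1) lam0 (snd z / fst z) (- 1 / fst z)
         - lsum (\<lambda>k. of_nat (Suc k)) lam0 (snd z / fst z) (- 1 / fst z))
     + snd z * Digamma (snd z / fst z + 1) / (fst z)\<^sup>2 - 1 / (2 * fst z) + deriv (\<lambda>\<eta>. P (z + (\<eta> * 1, \<eta> * 0))) 0"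

lemma Digamma_argument_ok:
  assumes "z \<notin> pole_set" "fst z \<noteq> 0"
  shows "snd z / fst z + 1 \<notin> \<int>\<^sub>\<le>\<^sub>0"
proof
  assume "snd z / fst z + 1 \<in> \<int>\<^sub>\<le>\<^sub>0"
  then obtain n where "snd z / fst z + 1 = - of_nat n" by (auto elim!: nonpos_Ints_cases')
  then have "snd z / fst z = - of_nat (Suc n)" by (simp add: algebra_simps eq_neg_iff_add_eq_0)
  then have "snd z = - of_nat (Suc n) * fst z" using assms(2) by (metis nonzero_mult_div_cancel_right times_divide_eq_left nonzero_eq_divide_eq)
  then have "snd z + of_nat (Suc n) * fst z - of_int 0 = 0" by (simp add: algebra_simps)
  then show False using not_pole_set(2) [OF assms] by blast
qed

lemma nu_domain_qexp: "\<nu> \<in> nu_domain \<Longrightarrow> \<nu> \<noteq> 0 \<Longrightarrow> qexp \<nu> \<noteq> 1"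
  by (auto simp: qexp_eq_1_iff nu_domain_iff elim!: Ints_cases)

lemma G_holomorphic_on_line:
  assumes P: "holomorphic2_on P D" "open D" "D \<subseteq> (- \<real>\<^sub>\<le>\<^sub>0) \<times> nu_domain"
    and h: "h holomorphic_on nu_domain" "h1 holomorphic_on nu_domain"
    and S: "open S" and line: "\<And>\<zeta>. \<zeta> \<in> S \<Longrightarrow> z + (\<zeta> * a, \<zeta> * b) \<in> D \<inter> {z. Im (fst z) > 0} - pole_set"
  shows "(\<lambda>\<zeta>. G1 h P (z + (\<zeta> * a, \<zeta> * b))) holomorphic_on S"
    "(\<lambda>\<zeta>. G2 h1 P (z + (\<zeta> * a, \<zeta> * b))) holomorphic_on S"
proof -
  define l where "l = (\<lambda>\<zeta>. z + (\<zeta> * a, \<zeta> * b))"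
  define t where "t = (\<lambda>\<zeta>. fst (l \<zeta>))"
  define v where "v = (\<lambda>\<zeta>. snd (l \<zeta>))"
  have ht: "t holomorphic_on S" and hv: "v holomorphic_on S"
    unfolding t_def v_def l_def by (auto intro!: holomorphic_intros)
  have Im: "Im (t \<zeta>) > 0" and nv: "v \<zeta> \<in> nu_domain" and nt: "t \<zeta> \<notin> \<real>\<^sub>\<le>\<^sub>0" and t0: "t \<zeta> \<noteq> 0" and npl: "l \<zeta> \<notin> pole_set"
    and lD: "l \<zeta> \<in> D" if "\<zeta> \<in> S" for \<zeta>
  proof -
    have "l \<zeta> \<in> D \<inter> {z. Im (fst z) > 0} - pole_set" using line [OF that] by (simp only: l_def)
    then show "Im (t \<zeta>) > 0" "v \<zeta> \<in> nu_domain" "t \<zeta> \<notin> \<real>\<^sub>\<le>\<^sub>0" "l \<zeta> \<notin> pole_set" "l \<zeta> \<in> D"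
      using P(3) by (auto simp: t_def v_def)
    then show "t \<zeta> \<noteq> 0" by auto
  qed
  have v0: "v \<zeta> \<noteq> 0" and np1: "qexp (v \<zeta> + of_nat (Suc k) * t \<zeta>) \<noteq> 1"
    and np2: "qexp (v \<zeta> / t \<zeta> + of_nat (Suc k) * (- 1 / t \<zeta>)) \<noteq> 1" if "\<zeta> \<in> S" for \<zeta> k
    using npl [OF that] unfolding pole_set_def t_def v_def by blast+
  have q: "1 - qexp (v \<zeta>) \<noteq> 0" if "\<zeta> \<in> S" for \<zeta> using nu_domain_qexp [OF nv [OF that] v0 [OF that]] by simp
  have dg: "v \<zeta> / t \<zeta> + 1 \<notin> \<int>\<^sub>\<le>\<^sub>0" if "\<zeta> \<in> S" for \<zeta>
    using Digamma_argument_ok [OF npl [OF that]] t0 [OF that] by (simp add: t_def v_def)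
  have w1: "norm (1 :: complex) \<le> real (Suc k)" for k by simp
  have wS: "norm (of_nat (Suc k) :: complex) \<le> real (Suc k)" for k by (simp only: norm_of_nat order_refl)
  have Im2: "Im (- 1 / t \<zeta>) > 0" if "\<zeta> \<in> S" for \<zeta>
    using Im [OF that] by (simp add: Im_divide sum_power2_gt_zero_iff)
  have A: "(\<lambda>\<zeta>. lsum w lam0 (v \<zeta>) (t \<zeta>)) holomorphic_on S"
    and B: "(\<lambda>\<zeta>. lsum w lam0 (v \<zeta> / t \<zeta>) (- 1 / t \<zeta>)) holomorphic_on S"
    if w: "\<And>k. norm (w k) \<le> real (Suc k)" for w
  proof -
    show "(\<lambda>\<zeta>. lsum w lam0 (v \<zeta>) (t \<zeta>)) holomorphic_on S"
      by (rule holomorphic_on_lsum [OF S ht hv Im np1 w])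
    have 1: "(\<lambda>\<zeta>. - 1 / t \<zeta>) holomorphic_on S" "(\<lambda>\<zeta>. v \<zeta> / t \<zeta>) holomorphic_on S"
      using t0 by (auto intro!: holomorphic_intros ht hv)
    show "(\<lambda>\<zeta>. lsum w lam0 (v \<zeta> / t \<zeta>) (- 1 / t \<zeta>)) holomorphic_on S"
      by (rule holomorphic_on_lsum [OF S 1(1) 1(2) Im2 np2 w])
  qed
  have hh: "(\<lambda>\<zeta>. f (v \<zeta>)) holomorphic_on S" if "f holomorphic_on nu_domain" for f
    using holomorphic_on_compose_gen [OF hv that] nv by (auto simp: o_def)
  have hL: "(\<lambda>\<zeta>. Ln (t \<zeta>)) holomorphic_on S" using nt by (intro holomorphic_intros ht) auto
  have hl: "(\<lambda>\<zeta>. lam0 (v \<zeta>)) holomorphic_on S"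
    unfolding lam0_def qexp_def using q by (intro holomorphic_intros hv) (auto simp: qexp_def)
  have hD: "(\<lambda>\<zeta>. Digamma (v \<zeta> / t \<zeta> + 1)) holomorphic_on S"
  proof -
    have "(\<lambda>\<zeta>. v \<zeta> / t \<zeta> + 1) holomorphic_on S" using t0 by (intro holomorphic_intros ht hv) auto
    from holomorphic_on_compose_gen [OF this holomorphic_on_Polygamma [of "- \<int>\<^sub>\<le>\<^sub>0" 0]]
    show ?thesis using dg by (auto simp: o_def)
  qed
  have hP: "(\<lambda>\<zeta>. deriv (\<lambda>\<eta>. P (l \<zeta> + (\<eta> * c, \<eta> * d))) 0) holomorphic_on S" for c d
    unfolding l_def by (rule holomorphic_partial_derivative_on_line [OF P(1,2) S]) (use lD in \<open>simp add: l_def\<close>)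
  have "(\<lambda>\<zeta>. G1 h P (l \<zeta>)) holomorphic_on S"
    unfolding G1_def
    unfolding t_def [THEN fun_cong, symmetric] v_def [THEN fun_cong, symmetric]
    using t0 v0 by (intro holomorphic_intros A [OF w1] B [OF w1] hh h hL hl hD hP ht hv) auto
  moreover have "(\<lambda>\<zeta>. G2 h1 P (l \<zeta>)) holomorphic_on S"
    unfolding G2_def
    unfolding t_def [THEN fun_cong, symmetric] v_def [THEN fun_cong, symmetric]
    using t0 v0 by (intro holomorphic_intros A [OF wS] B [OF w1] B [OF wS] hh h hL hl hD hP ht hv) auto
  ultimately show "(\<lambda>\<zeta>. G1 h P (z + (\<zeta> * a, \<zeta> * b))) holomorphic_on S"
    "(\<lambda>\<zeta>. G2 h1 P (z + (\<zeta> * a, \<zeta> * b))) holomorphic_on S" by (simp_all only: l_def)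
qed

text \<open>On the product of the open quadrant and the strip P is \<open>intP\<close>; as this
  product is open, the partial derivatives agree as well.\<close>

lemma G_eq_0_seed:
  assumes P: "P_continuation D P"
    and h: "\<And>u. Im u > 0 \<Longrightarrow> h u = Ln (1 - qexp u) - Ln u"
    and h1: "\<And>u. Im u > 0 \<Longrightarrow> dilog_series (qexp u) = - (2 * of_real pi * \<i>) * (h1 u + u * Ln u - u)"
    and \<tau>: "Re \<tau> > 0" "Im \<tau> > 0" and \<nu>: "\<nu> \<in> strip_domain"
  shows "(\<tau>, \<nu>) \<in> D" "G1 h P (\<tau>, \<nu>) = 0" "G2 h1 P (\<tau>, \<nu>) = 0"
proof -
  have Re: "\<bar>Re \<nu>\<bar> < 1" and Im: "Im \<nu> > 0" using \<nu> by (auto simp: strip_domain_def)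
  have t0: "\<tau> \<noteq> 0" using \<tau> by auto
  have Peq: "(t, v) \<in> D \<and> P (t, v) = intP t v" if t: "Re t > 0" "Im t > 0" and v: "\<bar>Re v\<bar> < 1" for t v
  proof -
    obtain d where d: "d \<in> {-pi<..<0}" "(t, v) \<in> P_ray_domain d" "P_ray d t v = intP t v"
      using P_ray_eq_intP [OF t v] by blast
    have "P_ray_domain d \<subseteq> D" "\<forall>(\<tau>, \<nu>)\<in>P_ray_domain d. P (\<tau>, \<nu>) = P_ray d \<tau> \<nu>"
      using P d(1) unfolding P_continuation_def by blast+
    then show ?thesis using d by auto
  qed
  then show "(\<tau>, \<nu>) \<in> D" using \<tau> Re by blast
  have d1: "deriv (\<lambda>\<eta>. P ((\<tau>, \<nu>) + (\<eta> * 0, \<eta> * 1))) 0 = intPn 0 \<tau> \<nu>"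
  proof -
    have "((\<lambda>w. P (\<tau>, w)) has_field_derivative intPn 0 \<tau> \<nu>) (at \<nu>)"
      by (rule has_field_derivative_transform_within_open [OF intP_derivatives(1) [OF \<tau>(1) Re] open_strip_domain \<nu>])
         (use Peq \<tau> in \<open>auto simp: strip_domain_def\<close>)
    then have "deriv (\<lambda>w. P (\<tau>, w)) \<nu> = intPn 0 \<tau> \<nu>" by (rule DERIV_imp_deriv)
    then show ?thesis using deriv_shift_0 [of "\<lambda>w. P (\<tau>, w)" \<nu>] by simp
  qed
  have d2: "deriv (\<lambda>\<eta>. P ((\<tau>, \<nu>) + (\<eta> * 1, \<eta> * 0))) 0 = intPt \<tau> \<nu>"
  proof -
    define S where "S = {t. Re t > 0 \<and> Im t > 0}"
    have opS: "open S"
      unfolding S_def Collect_conj_eq by (intro open_Int open_halfspace_Re_gt open_halfspace_Im_gt)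
    have tS: "\<tau> \<in> S" using \<tau> by (simp add: S_def)
    have "((\<lambda>t. P (t, \<nu>)) has_field_derivative intPt \<tau> \<nu>) (at \<tau>)"
      by (rule has_field_derivative_transform_within_open [OF intP_derivatives(2) [OF \<tau>(1) Re] opS tS])
         (use Peq Re in \<open>auto simp: S_def\<close>)
    then have "deriv (\<lambda>t. P (t, \<nu>)) \<tau> = intPt \<tau> \<nu>" by (rule DERIV_imp_deriv)
    then show ?thesis using deriv_shift_0 [of "\<lambda>t. P (t, \<nu>)" \<tau>] by simp
  qed
  have L: "Ln (\<nu> / \<tau>) = Ln \<nu> - Ln \<tau>" by (rule Ln_divide_upper_half_plane [OF Im \<tau>(2)])
  have "G1 h P (\<tau>, \<nu>) = F1 \<tau> \<nu>"
    unfolding G1_def d1 fst_conv snd_conv h [OF Im] F1_def L by (simp add: diff_divide_distrib add_divide_distrib)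
  then show "G1 h P (\<tau>, \<nu>) = 0" using F1_eq_0 [OF \<tau> \<nu>] by simp
  have D: "\<i> / (2 * of_real pi * \<tau>\<^sup>2) * dilog_series (qexp \<nu>) = (h1 \<nu> + \<nu> * Ln \<nu> - \<nu>) / \<tau>\<^sup>2"
  proof -
    have c: "\<i> / (2 * of_real pi * \<tau>\<^sup>2) * (- (2 * of_real pi * \<i>) * x) = x / \<tau>\<^sup>2" for x
    proof -
      have "\<i> / (2 * of_real pi * \<tau>\<^sup>2) * (- (2 * of_real pi * \<i>) * x) = - (\<i> * \<i>) * ((2 * of_real pi) / (2 * of_real pi)) * (x / \<tau>\<^sup>2)"
        by (simp only: divide_inverse inverse_mult_distrib mult_minus_left mult_minus_right mult_ac)
      then show ?thesis by simp
    qed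
    show ?thesis unfolding h1 [OF Im] c ..
  qed
  have "G2 h1 P (\<tau>, \<nu>) = F2 \<tau> \<nu>"
    unfolding G2_def d2 fst_conv snd_conv F2_def D L
    by (simp add: diff_divide_distrib add_divide_distrib right_diff_distrib)
  then show "G2 h1 P (\<tau>, \<nu>) = 0" using F2_eq_0 [OF \<tau> \<nu>] by simp
qed

lemma G_eq_0:
  assumes P: "P_continuation D P"
    and h: "h holomorphic_on nu_domain" "\<And>u. Im u > 0 \<Longrightarrow> h u = Ln (1 - qexp u) - Ln u"
    and h1: "h1 holomorphic_on nu_domain" "\<And>u. Im u > 0 \<Longrightarrow> dilog_series (qexp u) = - (2 * of_real pi * \<i>) * (h1 u + u * Ln u - u)"
    and z: "z \<in> D \<inter> {z. Im (fst z) > 0} - pole_set"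
  shows "G1 h P z = 0" "G2 h1 P z = 0"
proof -
  define \<Omega> where "\<Omega> = D \<inter> {z. Im (fst z) > 0}"
  have D: "open D" "D \<subseteq> (- \<real>\<^sub>\<le>\<^sub>0) \<times> nu_domain" "holomorphic2_on P D"
    using P by (auto simp: P_continuation_def)
  have op\<Omega>: "open \<Omega>" unfolding \<Omega>_def by (intro open_Int D open_Collect_less continuous_intros)
  have con\<Omega>: "connected \<Omega>" unfolding \<Omega>_def by (rule connected_upper_part [OF P])
  have Im: "Im (fst z) > 0" if "z \<in> \<Omega>" for z using that by (simp add: \<Omega>_def)
  have f0: "fst z \<noteq> 0" if "z \<in> \<Omega>" for z using Im [OF that] by auto
  have opN: "open (\<Omega> - pole_set)" by (rule open_complement_pole_set [OF op\<Omega> Im])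
  have count: "countable {\<zeta>. z + (\<zeta> * a, \<zeta> * b) \<in> pole_set}" if "z \<in> \<Omega> - pole_set" for z a b
    using that f0 by (intro countable_line_pole_set) auto
  have dense: "V - pole_set \<noteq> {}" if "open V" "V \<subseteq> \<Omega>" "V \<noteq> {}" for V
    using that f0 by (intro dense_complement_pole_set) auto
  define S where "S = {t. Re t > 0 \<and> Im t > 0}"
  have opS: "open S"
    unfolding S_def Collect_conj_eq by (intro open_Int open_halfspace_Re_gt open_halfspace_Im_gt)
  define W where "W = S \<times> strip_domain"
  have opW: "open W" unfolding W_def by (intro open_Times opS open_strip_domain)
  note seed = G_eq_0_seed [OF P h(2) h1(2)]
  have W\<Omega>: "W \<subseteq> \<Omega>" using seed(1) by (auto simp: W_def S_def \<Omega>_def)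
  have neW: "W \<noteq> {}"
  proof -
    have "(1 + \<i>, \<i>) \<in> W" by (simp add: W_def S_def strip_domain_def)
    then show ?thesis by blast
  qed
  have z': "z \<in> \<Omega> - pole_set" using z by (simp add: \<Omega>_def)
  note hol = G_holomorphic_on_line [OF D(3) D(1) D(2) h(1) h1(1), folded \<Omega>_def]
  show "G1 h P z = 0"
    by (rule identity_theorem_along_lines [where G = "G1 h P" and \<Omega> = \<Omega> and N = pole_set and W = W,
          OF op\<Omega> con\<Omega> hol(1) count opN dense opW W\<Omega> neW _ z'])
       (use seed(2) in \<open>auto simp: W_def S_def\<close>)
  show "G2 h1 P z = 0"
    by (rule identity_theorem_along_lines [where G = "G2 h1 P" and \<Omega> = \<Omega> and N = pole_set and W = W,
          OF op\<Omega> con\<Omega> hol(2) count opN dense opW W\<Omega> neW _ z'])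
       (use seed(3) in \<open>auto simp: W_def S_def\<close>)
qed

text \<open>The branches \<open>log_one_minus_e\<close> and \<open>dilog_e\<close> bring back Ln
  (\<nu> / \<tau>), which the explicit - Ln (\<nu> / \<tau>) of each identity removes; what is left
  is \<open>G1\<close> = 0 and \<open>G2\<close> = 0 divided by 2 pi i. The half term
  \<open>lam0 \<nu> / 2\<close> has the minus sign that \<open>G1\<close> forces.\<close>

theorem theorem3p3:
  fixes \<tau> \<nu> \<tau>' \<nu>' :: complex
    and D :: "(complex \<times> complex) set" and P :: "complex \<times> complex \<Rightarrow> complex"
  assumes "Im \<tau> > 0"
    and "\<nu> \<in> nu_domain"
    and "\<nu> / \<tau> \<notin> \<real>\<^sub>\<le>\<^sub>0"
    and \<tau>'_def: "\<tau>' = - 1 / \<tau>"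
    and \<nu>'_def: "\<nu>' = \<nu> / \<tau>"
    and "L_denominators_nonzero \<tau> (\<nu> + \<tau>)"
    and "L_denominators_nonzero \<tau>' (\<nu>' + \<tau>')"
    and "P_continuation D P"
    and "(\<tau>, \<nu>) \<in> D"
  shows "L1 \<tau> (\<nu> + \<tau>) =
           log_one_minus_e \<tau> \<nu> / (2 * of_real pi * \<tau> * \<i>)
           - exp (2 * of_real pi * \<i> * \<nu>) / (2 * (1 - exp (2 * of_real pi * \<i> * \<nu>)))
           + 1 / \<tau> * L1 \<tau>' (\<nu>' + \<tau>')
           + 1 / (2 * of_real pi * \<tau> * \<i>) *
             (deriv Gamma (\<nu> / \<tau> + 1) / Gamma (\<nu> / \<tau> + 1) - Ln (\<nu> / \<tau>) - \<tau> / (2 * \<nu>)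
              - \<tau> * deriv (\<lambda>w. P (\<tau>, w)) \<nu>)
       \<and> L2 \<tau> (\<nu> + \<tau>) =
           1 / 24 - dilog_e \<tau> \<nu> / (4 * (of_real pi)\<^sup>2 * \<tau>\<^sup>2)
           - \<nu> / \<tau>\<^sup>2 * L1 \<tau>' (\<nu>' + \<tau>')
           + 1 / \<tau>\<^sup>2 * L2 \<tau>' (\<nu>' + \<tau>')
           - \<nu> / (2 * of_real pi * \<i> * \<tau>\<^sup>2) *
             (deriv Gamma (\<nu> / \<tau> + 1) / Gamma (\<nu> / \<tau> + 1) - Ln (\<nu> / \<tau>) - \<tau> / (2 * \<nu>)
              + \<tau>\<^sup>2 / \<nu> * deriv (\<lambda>t. P (t, \<nu>)) \<tau>)"
proof -
  have t0: "\<tau> \<noteq> 0" and v0: "\<nu> \<noteq> 0" using assms(1,3) by auto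
  \<comment> \<open>The conditions on the denominators exclude the poles of the two series, and
    \<nu> \<noteq> 0 holds because 0 is a nonpositive real.\<close>
  have np: "(\<tau>, \<nu>) \<notin> pole_set"
    using assms(6,7) v0 unfolding \<tau>'_def \<nu>'_def L_denominators_nonzero_iff pole_set_def by simp
  have z: "(\<tau>, \<nu>) \<in> D \<inter> {z. Im (fst z) > 0} - pole_set" using assms(1,9) np by simp
  have \<nu>: "\<nu> \<in> slit_domain \<tau>" using assms(2,3) by (simp add: slit_domain_def)
  obtain h where h: "h holomorphic_on nu_domain" "\<And>u. Im u > 0 \<Longrightarrow> h u = Ln (1 - qexp u) - Ln u"
    by (rule log_quotient_exists) (rule that)
  obtain h1 where h1: "\<And>u. u \<in> nu_domain \<Longrightarrow> (h1 has_field_derivative h u) (at u)"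
    "\<And>u. Im u > 0 \<Longrightarrow> dilog_series (qexp u) = - (2 * of_real pi * \<i>) * (h1 u + u * Ln u - u)"
    using dilog_primitive_exists [OF h] by blast
  have hol1: "h1 holomorphic_on nu_domain"
    unfolding holomorphic_on_def field_differentiable_def using h1(1) by (blast intro: has_field_derivative_at_within)
  note G = G_eq_0 [OF assms(8) h hol1 h1(2) z]
  have dig: "deriv Gamma (\<nu> / \<tau> + 1) / Gamma (\<nu> / \<tau> + 1) = Digamma (\<nu> / \<tau> + 1)"
  proof -
    have n: "\<nu> / \<tau> + 1 \<notin> \<int>\<^sub>\<le>\<^sub>0" using Digamma_argument_ok [OF np] t0 by simp
    then have "deriv Gamma (\<nu> / \<tau> + 1) = Gamma (\<nu> / \<tau> + 1) * Digamma (\<nu> / \<tau> + 1)"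
      by (intro DERIV_imp_deriv has_field_derivative_Gamma)
    then show ?thesis using n by (simp add: Gamma_eq_zero_iff)
  qed
  define A1 where "A1 = lsum (\<lambda>_. 1) lam0 \<nu> \<tau>"
  define A2 where "A2 = lsum (\<lambda>k. of_nat (Suc k)) lam0 \<nu> \<tau>"
  define B1 where "B1 = lsum (\<lambda>_. 1) lam0 (\<nu> / \<tau>) (- 1 / \<tau>)"
  define B2 where "B2 = lsum (\<lambda>k. of_nat (Suc k)) lam0 (\<nu> / \<tau>) (- 1 / \<tau>)"
  have LL: "L1 \<tau> (\<nu> + \<tau>) = A1" "L2 \<tau> (\<nu> + \<tau>) = A2" "L1 \<tau>' (\<nu>' + \<tau>') = B1" "L2 \<tau>' (\<nu>' + \<tau>') = B2"
    unfolding L1_shift L2_shift A1_def A2_def B1_def B2_def lsum_def \<tau>'_def \<nu>'_def by simp_all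
  define \<psi> where "\<psi> = Digamma (\<nu> / \<tau> + 1)"
  define L where "L = Ln (\<nu> / \<tau>)"
  define PN where "PN = deriv (\<lambda>w. P (\<tau>, w)) \<nu>"
  define PT where "PT = deriv (\<lambda>t. P (t, \<nu>)) \<tau>"
  define c where "c = 2 * complex_of_real pi * \<i>"
  have c0: "c \<noteq> 0" by (simp add: c_def)
  have p0: "of_real pi \<noteq> (0 :: complex)" by simp
  have dN: "deriv (\<lambda>\<eta>. P ((\<tau>, \<nu>) + (\<eta> * 0, \<eta> * 1))) 0 = PN"
    using deriv_shift_0 [of "\<lambda>w. P (\<tau>, w)" \<nu>] by (simp add: PN_def)
  have dT: "deriv (\<lambda>\<eta>. P ((\<tau>, \<nu>) + (\<eta> * 1, \<eta> * 0))) 0 = PT"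
    using deriv_shift_0 [of "\<lambda>t. P (t, \<nu>)" \<tau>] by (simp add: PT_def)
  have lg: "log_one_minus_e \<tau> \<nu> = h \<nu> + L + Ln \<tau>"
    unfolding L_def by (rule log_one_minus_e_eq [OF assms(1) h \<nu>])
  have dl: "dilog_e \<tau> \<nu> = - c * (h1 \<nu> + \<nu> * (L + Ln \<tau>) - \<nu>)"
    unfolding c_def L_def by (rule dilog_e_eq [OF assms(1) h1 \<nu>])
  have lam: "exp (2 * of_real pi * \<i> * \<nu>) / (2 * (1 - exp (2 * of_real pi * \<i> * \<nu>))) = lam0 \<nu> / 2"
    by (simp add: lam0_def qexp_def)
  have g1: "c * A1 - (h \<nu> + Ln \<tau>) / \<tau> + c / 2 * lam0 \<nu> - c / \<tau> * B1 - \<psi> / \<tau> + 1 / (2 * \<nu>) + PN = 0"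
    using G(1) unfolding G1_def dN fst_conv snd_conv by (simp add: A1_def B1_def \<psi>_def c_def)
  have g2: "c * A2 - c / 24 + (h1 \<nu> - \<nu> + \<nu> * Ln \<tau>) / \<tau>\<^sup>2 + c / \<tau>\<^sup>2 * (\<nu> * B1 - B2) + \<nu> * \<psi> / \<tau>\<^sup>2 - 1 / (2 * \<tau>) + PT = 0"
    using G(2) unfolding G2_def dT fst_conv snd_conv by (simp add: A2_def B1_def B2_def \<psi>_def c_def mult_ac)
  have c2: "4 * (of_real pi)\<^sup>2 * \<tau>\<^sup>2 = - (c * c) * \<tau>\<^sup>2" by (simp add: c_def power2_eq_square)
  have c1: "2 * of_real pi * \<tau> * \<i> = c * \<tau>" "2 * of_real pi * \<i> * \<tau>\<^sup>2 = c * \<tau>\<^sup>2" by (simp_all add: c_def)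
  have "A1 = (h \<nu> + L + Ln \<tau>) / (c * \<tau>) - lam0 \<nu> / 2 + 1 / \<tau> * B1 + 1 / (c * \<tau>) * (\<psi> - L - \<tau> / (2 * \<nu>) - \<tau> * PN)"
  proof -
    have "c * A1 = (h \<nu> + Ln \<tau>) / \<tau> - c / 2 * lam0 \<nu> + c / \<tau> * B1 + \<psi> / \<tau> - 1 / (2 * \<nu>) - PN"
      using g1 by (simp add: algebra_simps eq_neg_iff_add_eq_0)
    also have "\<dots> = c * ((h \<nu> + L + Ln \<tau>) / (c * \<tau>) - lam0 \<nu> / 2 + 1 / \<tau> * B1 + 1 / (c * \<tau>) * (\<psi> - L - \<tau> / (2 * \<nu>) - \<tau> * PN))"
      using c0 t0 v0 by (simp add: field_simps)
    finally show ?thesis using c0 by (simp only: mult_cancel_left simp_thms)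
  qed
  moreover have "A2 = 1 / 24 - (- c * (h1 \<nu> + \<nu> * (L + Ln \<tau>) - \<nu>)) / (- (c * c) * \<tau>\<^sup>2) - \<nu> / \<tau>\<^sup>2 * B1 + 1 / \<tau>\<^sup>2 * B2
      - \<nu> / (c * \<tau>\<^sup>2) * (\<psi> - L - \<tau> / (2 * \<nu>) + \<tau>\<^sup>2 / \<nu> * PT)"
  proof -
    have "c * A2 = c / 24 - (h1 \<nu> - \<nu> + \<nu> * Ln \<tau>) / \<tau>\<^sup>2 - c / \<tau>\<^sup>2 * (\<nu> * B1 - B2) - \<nu> * \<psi> / \<tau>\<^sup>2 + 1 / (2 * \<tau>) - PT"
      using g2 by (simp add: algebra_simps eq_neg_iff_add_eq_0)
    also have "\<dots> = c * (1 / 24 - (- c * (h1 \<nu> + \<nu> * (L + Ln \<tau>) - \<nu>)) / (- (c * c) * \<tau>\<^sup>2) - \<nu> / \<tau>\<^sup>2 * B1 + 1 / \<tau>\<^sup>2 * B2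
      - \<nu> / (c * \<tau>\<^sup>2) * (\<psi> - L - \<tau> / (2 * \<nu>) + \<tau>\<^sup>2 / \<nu> * PT))"
      using c0 t0 v0 by (simp add: field_simps power2_eq_square)
    finally show ?thesis using c0 by (simp only: mult_cancel_left simp_thms)
  qed
  ultimately show ?thesis
    unfolding LL lg dl lam dig c1 c2 by (simp only: \<psi>_def L_def PN_def PT_def simp_thms)
qed

end
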